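(* The reachability problem for VASS with one $\mathbb{N}$-counter and an arbitrary number of $\mathbb{Z}$-counters, with all numbers encoded in binary, is in $\mathsf{NP}$. That is: given $k\in\mathbb{N}$, a VASS $\mathcal{V}$ with $1$ $\mathbb{N}$-counter and $k$ $\mathbb{Z}$-counters, and two configurations $s,t$ of $\mathcal{V}$ (all integers written in binary), one can decide in nondeterministic polynomial time whether $s\xrightarrow{*}t$.
   Context: A VASS with $d$ $\mathbb{N}$-counters and $k$ $\mathbb{Z}$-counters consists of a finite set $Q$ of states and a finite set $T\subseteq Q\times\mathbb{Z}^{d+k}\times Q$ of transitions. A configuration is a pair $p(\mathbf{u})$ with $p\in Q$ and $\mathbf{u}\in\mathbb{N}^d\times\mathbb{Z}^k$. A transition $(p,\mathbf{v},q)$ can be fired from $p(\mathbf{u})$, leading to $q(\mathbf{u}+\mathbf{v})$, provided the first $d$ coordinates of $\mathbf{u}+\mathbf{v}$ are nonnegative (the last $k$ coordinates are unconstrained). A run is a finite sequence of configurations, each obtained from the previous one by firing a transition; $s\xrightarrow{*}t$ means there is a run from $s$ to $t$. In the reachability problem considered here, $k$ is part of the input. *)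

theory Defs
  imports Main
begin

section \<open>VASS with one N-counter (coordinate 0) and k Z-counters (coordinates 1..k)\<close>

text \<open>States are natural numbers; a VASS is given by its finite list of transitions
  (p, v, q) with v a vector of length 1+k. A configuration is (state, counter vector).\<close>

type_synonym vass = "(nat \<times> int list \<times> nat) list"
type_synonym conf = "nat \<times> int list"

definition vass_wf :: "nat \<Rightarrow> vass \<Rightarrow> bool" where
  "vass_wf k T \<longleftrightarrow> (\<forall>(p, v, q) \<in> set T. length v = Suc k)"

definition conf_wf :: "nat \<Rightarrow> conf \<Rightarrow> bool" where
  "conf_wf k c \<longleftrightarrow> length (snd c) = Suc k \<and> snd c ! 0 \<ge> 0"

definition vass_step :: "vass \<Rightarrow> conf \<Rightarrow> conf \<Rightarrow> bool" where
  "vass_step T c c' \<longleftrightarrow>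
     (\<exists>v. (fst c, v, fst c') \<in> set T \<and> snd c' = map2 (+) (snd c) v \<and> snd c' ! 0 \<ge> 0)"

definition vass_reach :: "vass \<Rightarrow> conf \<Rightarrow> conf \<Rightarrow> bool" where
  "vass_reach T = (vass_step T)\<^sup>*\<^sup>*"

text \<open>Symbols: 1 = bit 0, 2 = bit 1, 3 = minus sign, 4 = ',', 5 = ';', 6 = '#'.\<close>

fun bin :: "nat \<Rightarrow> nat list" where
  "bin n = (if n < 2 then [n + 1] else bin (n div 2) @ [n mod 2 + 1])"

definition enc_int :: "int \<Rightarrow> nat list" where
  "enc_int i = (if i < 0 then [3] else []) @ bin (nat \<bar>i\<bar>) @ [4]"

definition enc_vec :: "int list \<Rightarrow> nat list" where
  "enc_vec v = concat (map enc_int v) @ [5]"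

definition enc_trans :: "nat \<times> int list \<times> nat \<Rightarrow> nat list" where
  "enc_trans t = (case t of (p, v, q) \<Rightarrow> bin p @ [4] @ enc_vec v @ bin q @ [5])"

definition enc_conf :: "conf \<Rightarrow> nat list" where
  "enc_conf c = bin (fst c) @ [4] @ enc_vec (snd c)"

definition enc_instance :: "nat \<Rightarrow> vass \<Rightarrow> conf \<Rightarrow> conf \<Rightarrow> nat list" where
  "enc_instance k T s t =
     bin k @ [6] @ concat (map enc_trans T) @ [6] @ enc_conf s @ [6] @ enc_conf t"

definition input_alphabet :: "nat set" where
  "input_alphabet = {1..6}"

definition REACH_1N :: "nat list set" where
  "REACH_1N = {enc_instance k T s t | k T s t.
      vass_wf k T \<and> conf_wf k s \<and> conf_wf k t \<and> vass_reach T s t}"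

text \<open>Tape symbols: 0 = blank, 1..6 input symbols, 7 = separator between input
  and certificate. Moves are -1, 0, 1. The machine halts in state tm_acc.\<close>

record tm =
  tm_nstates :: nat
  tm_nsyms :: nat
  tm_start :: nat
  tm_acc :: nat
  tm_delta :: "nat \<Rightarrow> nat \<Rightarrow> nat \<times> nat \<times> int"

definition tm_wf :: "tm \<Rightarrow> bool" where
  "tm_wf M \<longleftrightarrow> tm_start M < tm_nstates M \<and> tm_acc M < tm_nstates M \<and> 8 \<le> tm_nsyms M \<and>
     (\<forall>q < tm_nstates M. \<forall>a < tm_nsyms M.
        (case tm_delta M q a of (q', a', d) \<Rightarrow>
           q' < tm_nstates M \<and> a' < tm_nsyms M \<and> d \<in> {-1, 0, 1}))"

type_synonym tm_conf = "nat \<times> (int \<Rightarrow> nat) \<times> int"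

definition tm_step :: "tm \<Rightarrow> tm_conf \<Rightarrow> tm_conf" where
  "tm_step M c = (case c of (q, tp, h) \<Rightarrow>
     if q = tm_acc M then (q, tp, h)
     else (case tm_delta M q (tp h) of (q', a', d) \<Rightarrow> (q', tp(h := a'), h + d)))"

definition tm_init :: "tm \<Rightarrow> nat list \<Rightarrow> tm_conf" where
  "tm_init M w = (tm_start M, (\<lambda>i. if 0 \<le> i \<and> i < int (length w) then w ! nat i else 0), 0)"

definition tm_accepts_within :: "tm \<Rightarrow> nat list \<Rightarrow> nat \<Rightarrow> bool" where
  "tm_accepts_within M w t \<longleftrightarrow> (\<exists>i \<le> t. fst ((tm_step M ^^ i) (tm_init M w)) = tm_acc M)"

definition enc_cert :: "bool list \<Rightarrow> nat list" where
  "enc_cert c = map (\<lambda>b. if b then 2 else 1) c"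

definition in_NP :: "nat list set \<Rightarrow> bool" where
  "in_NP L \<longleftrightarrow> (\<exists>M a d. tm_wf M \<and>
     (\<forall>w \<in> lists input_alphabet.
        w \<in> L \<longleftrightarrow> (\<exists>c. length c \<le> a * (length w + 1) ^ d \<and>
                      tm_accepts_within M (w @ [7] @ enc_cert c) (a * (length w + 1) ^ d))))"

end

(* Every run can be brought into a normal form. Short cycles are cut out of it and attached to the first
   or last visit of one of their states: cycles that do not decrease the N-counter early, the others late,
   each rotated so that the N-counter never drops below both of its end values. What remains is a skeleton
   of quadratic length. The multiplicities of the cycles solve a linear system over the natural numbers; a
   pigeonhole argument on subset sums leaves polynomially many distinct cycles, and Siegel's lemma bounds
   their multiplicities by numbers with polynomially many bits.

   So reachability is witnessed by polynomially many single steps and cycles iterated a binary number of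
   times. Iterating a cycle keeps the N-counter nonnegative as soon as its first and last iterations do.
   The witness is checked by a nondeterministic machine with FIFO queues whose programs are regular
   expressions over push and pop actions; a program becomes a finite automaton, and the certificate of the
   Turing machine lists the edges to take. Vectors are kept in two's complement, most significant bit
   first, and are added in one pass by an automaton that guesses the carries. *)

theory Submission
  imports Defs Complex_Main "HOL-Library.FuncSet" "HOL-Library.Function_Algebras"
begin

section \<open>Small solutions of linear systems over the natural numbers\<close>

text \<open>The linear system has to express that the N-counter stays nonnegative. For this every
  item of the normal form gets a further unknown, the value of the N-counter after it; a solution in
  the natural numbers then keeps the counter nonnegative between items, and inside a block the order
  of the cycles takes care of the rest. A block may carry more distinct cycles than any polynomial
  allows, which is why the number of cycles in use is reduced before their multiplicities are
  bounded. The checker executes a single iteration of each accelerated cycle, the one at the lowest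
  N-counter. All others run higher, and the Z-counters cannot block a transition, so this iteration
  vouches for them. Queues serve as registers because popping a word and pushing it back leaves a
  queue as it was. A pass over several registers is then described by the words popped and pushed,
  and its correctness reduces to word equations. The number of Z-counters can be kept in unary, as
  each configuration of the input lists its components.\<close>

lemma card_bounded_PiE:
  assumes "finite I"
  shows "card (I \<rightarrow>\<^sub>E {- int k..int k}) = (2 * k + 1) ^ card I"
proof -
  have "card {- int k..int k} = 2 * k + 1" by simp
  then show ?thesis using assms by (simp only: card_PiE prod_constant)
qed

text \<open>Pigeonhole on subset sums, for a solution of minimal support \<open>S\<close>. If
  \<open>S\<close> has more subsets than there are possible vectors of column sums, two different
  subsets have the same sum; after removing their common part, weight can be moved from one to the
  other until a coordinate vanishes. The size of the support stays on both sides of the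
  bound.\<close>

lemma few_support:
  fixes a :: "'j \<Rightarrow> 'i \<Rightarrow> int" and x :: "'j \<Rightarrow> nat"
  assumes J: "finite J" and I: "finite I" and M: "\<And>i j. j \<in> J \<Longrightarrow> i \<in> I \<Longrightarrow> \<bar>a j i\<bar> \<le> int M"
  shows "\<exists>y. (\<forall>i\<in>I. (\<Sum>j\<in>J. int (y j) * a j i) = (\<Sum>j\<in>J. int (x j) * a j i)) \<and>
    {j \<in> J. y j \<noteq> 0} \<subseteq> {j \<in> J. x j \<noteq> 0} \<and>
    2 ^ card {j \<in> J. y j \<noteq> 0} \<le> (2 * (card {j \<in> J. y j \<noteq> 0} * M) + 1) ^ card I"
proof -
  define P where "P y \<longleftrightarrow> (\<forall>i\<in>I. (\<Sum>j\<in>J. int (y j) * a j i) = (\<Sum>j\<in>J. int (x j) * a j i)) \<and>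
    {j \<in> J. y j \<noteq> 0} \<subseteq> {j \<in> J. x j \<noteq> 0}" for y :: "'j \<Rightarrow> nat"
  have "P x" by (simp add: P_def)
  then obtain y where y: "P y" and min: "\<And>z. P z \<Longrightarrow> card {j \<in> J. y j \<noteq> 0} \<le> card {j \<in> J. z j \<noteq> 0}"
    using ex_has_least_nat[of P x "\<lambda>y. card {j \<in> J. y j \<noteq> 0}"] by blast
  define S where "S = {j \<in> J. y j \<noteq> 0}"
  have finS: "finite S" using J by (simp add: S_def)
  have "2 ^ card S \<le> (2 * (card S * M) + 1) ^ card I"
  proof (rule ccontr)
    assume "\<not> ?thesis"
    then have big: "(2 * (card S * M) + 1) ^ card I < card (Pow S)" using finS by (simp add: card_Pow)
    define F where "F A = (\<lambda>i\<in>I. \<Sum>j\<in>A. a j i)" for A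
    have "F ` Pow S \<subseteq> I \<rightarrow>\<^sub>E {- int (card S * M)..int (card S * M)}"
    proof (clarsimp simp: F_def)
      fix A i assume A: "A \<subseteq> S" "i \<in> I"
      have "\<bar>\<Sum>j\<in>A. a j i\<bar> \<le> (\<Sum>j\<in>A. \<bar>a j i\<bar>)" by (rule sum_abs)
      also have "\<dots> \<le> (\<Sum>j\<in>A. int M)" using A M by (intro sum_mono) (auto simp: S_def)
      also have "\<dots> = int (card A) * int M" by simp
      also have "\<dots> \<le> int (card S) * int M" using card_mono[OF finS A(1)] by (intro mult_right_mono) auto
      finally show "- (int (card S) * int M) \<le> (\<Sum>j\<in>A. a j i) \<and> (\<Sum>j\<in>A. a j i) \<le> int (card S) * int M" by linarith
    qed
    then have "card (F ` Pow S) \<le> (2 * (card S * M) + 1) ^ card I"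
      using card_mono[of "I \<rightarrow>\<^sub>E {- int (card S * M)..int (card S * M)}"] card_bounded_PiE[OF I, of "card S * M"] I
      by (simp add: finite_PiE)
    then have "\<not> inj_on F (Pow S)" using big by (metis card_image not_less)
    then obtain A0 B0 where AB0: "A0 \<subseteq> S" "B0 \<subseteq> S" "F A0 = F B0" "A0 \<noteq> B0" by (auto simp: inj_on_def)
    \<comment> \<open>By symmetry the first of the two sets may be taken not to be contained in the
      second.\<close>
    then obtain A1 B1 where AB1: "A1 \<subseteq> S" "B1 \<subseteq> S" "F A1 = F B1" "A1 - B1 \<noteq> {}"
      by (metis Diff_eq_empty_iff subset_antisym)
    define A B where "A = A1 - B1" and "B = B1 - A1"
    have AS: "A \<subseteq> S" "B \<subseteq> S" "A \<inter> B = {}" "A \<noteq> {}" using AB1 by (auto simp: A_def B_def)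
    have finA: "finite A" "finite B" using finite_subset[OF AS(1) finS] finite_subset[OF AS(2) finS] by auto
    have eqAB: "(\<Sum>j\<in>A. a j i) = (\<Sum>j\<in>B. a j i)" if "i \<in> I" for i
    proof -
      have "(\<Sum>j\<in>A1. a j i) = (\<Sum>j\<in>B1. a j i)" using AB1(3) that by (metis F_def restrict_apply')
      moreover have "(\<Sum>j\<in>A1. a j i) = (\<Sum>j\<in>A. a j i) + (\<Sum>j\<in>A1 \<inter> B1. a j i)"
        unfolding A_def using AB1(1) finS by (subst sum.union_disjoint[symmetric]) (auto intro: finite_subset sum.cong)
      moreover have "(\<Sum>j\<in>B1. a j i) = (\<Sum>j\<in>B. a j i) + (\<Sum>j\<in>A1 \<inter> B1. a j i)"
        unfolding B_def using AB1(2) finS by (subst sum.union_disjoint[symmetric]) (auto intro: finite_subset sum.cong)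
      ultimately show ?thesis by simp
    qed
    from AS(4) obtain j1 where "j1 \<in> A" by blast
    then obtain j0 where j0: "j0 \<in> A" "\<And>j. j \<in> A \<Longrightarrow> y j0 \<le> y j"
      using ex_has_least_nat[of "\<lambda>j. j \<in> A" j1 y] by blast
    \<comment> \<open>The least multiplicity on \<open>A\<close> is the largest amount that can be
      moved to \<open>B\<close> with all multiplicities remaining natural numbers; it makes the
      entry at \<open>j0\<close> vanish.\<close>
    define z where "z j = (if j \<in> A then y j - y j0 else if j \<in> B then y j + y j0 else y j)" for j
    have zi: "int (z j) = int (y j) + int (y j0) * ((if j \<in> B then 1 else 0) - (if j \<in> A then 1 else 0))" for j
      using j0(2)[of j] AS(3) by (auto simp: z_def of_nat_diff)
    have "(\<Sum>j\<in>J. int (z j) * a j i) = (\<Sum>j\<in>J. int (y j) * a j i)" if "i \<in> I" for i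
    proof -
      have AJ: "J \<inter> A = A" "J \<inter> B = B" using AS by (auto simp: S_def)
      have "(\<Sum>j\<in>J. int (z j) * a j i) = (\<Sum>j\<in>J. int (y j) * a j i)
          + int (y j0) * ((\<Sum>j\<in>J. if j \<in> B then a j i else 0) - (\<Sum>j\<in>J. if j \<in> A then a j i else 0))"
        unfolding zi sum_subtractf[symmetric] sum_distrib_left sum.distrib[symmetric]
        by (rule sum.cong) (auto simp: algebra_simps)
      also have "(\<Sum>j\<in>J. if j \<in> B then a j i else 0) - (\<Sum>j\<in>J. if j \<in> A then a j i else 0) = 0"
        using eqAB[OF that] J AJ by (simp add: sum.inter_restrict[symmetric])
      finally show ?thesis by simp
    qed
    moreover have zS: "{j \<in> J. z j \<noteq> 0} \<subseteq> S - {j0}"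
      using AS j0 by (auto simp: z_def S_def)
    ultimately have "P z" using y by (auto simp: P_def S_def)
    then have "card S \<le> card {j \<in> J. z j \<noteq> 0}" using min by (simp add: S_def)
    also have "\<dots> \<le> card (S - {j0})" using zS finS by (intro card_mono) auto
    also have "\<dots> < card S" using finS j0(1) AS by (intro psubset_card_mono) auto
    finally show False by simp
  qed
  then show ?thesis using y unfolding P_def S_def by blast
qed

text \<open>Siegel's lemma. With fewer equations than unknowns, the vectors with entries in a large
  enough box outnumber their images, and the difference of two vectors with the same image is the
  kernel vector.\<close>

lemma small_kernel_vector:
  fixes a :: "'j \<Rightarrow> 'i \<Rightarrow> int"
  assumes J: "finite J" and R: "finite R" "card R < card J" and "M \<ge> 1"
    and M: "\<And>i j. j \<in> J \<Longrightarrow> i \<in> R \<Longrightarrow> \<bar>a j i\<bar> \<le> int M"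
  shows "\<exists>h :: 'j \<Rightarrow> int. (\<exists>j\<in>J. h j \<noteq> 0) \<and> (\<forall>i\<in>R. (\<Sum>j\<in>J. h j * a j i) = 0) \<and>
     (\<forall>j\<in>J. \<bar>h j\<bar> \<le> int ((2 * card J * M) ^ card J))"
proof -
  let ?n = "card J" let ?B = "(2 * ?n * M) ^ ?n"
  define Y where "Y = J \<rightarrow>\<^sub>E {0..int ?B}"
  define F where "F y = (\<lambda>i\<in>R. \<Sum>j\<in>J. y j * a j i)" for y :: "'j \<Rightarrow> int"
  have cY: "card Y = (?B + 1) ^ ?n"
    unfolding Y_def using J by (simp add: card_PiE prod_constant nat_add_distrib del: of_nat_power)
  have "F ` Y \<subseteq> R \<rightarrow>\<^sub>E {- int (?n * M * ?B)..int (?n * M * ?B)}"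
  proof (rule image_subsetI)
    fix y assume y: "y \<in> Y"
    have "\<bar>\<Sum>j\<in>J. y j * a j i\<bar> \<le> int (?n * M * ?B)" if i: "i \<in> R" for i
    proof -
      have "\<bar>\<Sum>j\<in>J. y j * a j i\<bar> \<le> (\<Sum>j\<in>J. \<bar>y j * a j i\<bar>)" by (rule sum_abs)
      also have "\<dots> \<le> (\<Sum>j\<in>J. int ?B * int M)"
      proof (rule sum_mono)
        fix j assume j: "j \<in> J"
        have "0 \<le> y j" "y j \<le> int ?B" using y j by (auto simp: Y_def PiE_iff)
        then show "\<bar>y j * a j i\<bar> \<le> int ?B * int M" unfolding abs_mult using M[OF j i] by (intro mult_mono) auto
      qed
      also have "\<dots> = int (?n * M * ?B)" by simp
      finally show ?thesis .
    qed
    then show "F y \<in> R \<rightarrow>\<^sub>E {- int (?n * M * ?B)..int (?n * M * ?B)}"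
      unfolding F_def by (fastforce simp del: of_nat_mult of_nat_power simp: abs_le_iff)
  qed
  then have "card (F ` Y) \<le> (2 * (?n * M * ?B) + 1) ^ card R"
    using card_mono[of "R \<rightarrow>\<^sub>E {- int (?n * M * ?B)..int (?n * M * ?B)}"] card_bounded_PiE[OF R(1), of "?n * M * ?B"] R(1)
    by (metis finite_PiE finite_atLeastAtMost_int)
  also have "\<dots> \<le> (2 * (?n * M * ?B) + 1) ^ (?n - 1)"
    using R(2) by (intro power_increasing) auto
  \<comment> \<open>The 1 is absorbed into the factor \<open>2 * ?n * M\<close>. This leaves
    \<open>?n - 1\<close> factors \<open>?B + 1\<close> against the \<open>?n\<close> in the size of
    the box, and \<open>?B\<close> is chosen so that the remaining power of
    \<open>2 * ?n * M\<close> is less than the missing factor.\<close>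
  also have "\<dots> \<le> ((2 * ?n * M) * (?B + 1)) ^ (?n - 1)"
    using R(2) \<open>M \<ge> 1\<close> by (intro power_mono) (auto simp: algebra_simps Suc_le_eq)
  also have "\<dots> = (2 * ?n * M) ^ (?n - 1) * (?B + 1) ^ (?n - 1)" by (rule power_mult_distrib)
  also have "\<dots> < (?B + 1) * (?B + 1) ^ (?n - 1)"
  proof (rule mult_strict_right_mono)
    have "(2 * ?n * M) ^ (?n - 1) \<le> ?B" using R(2) \<open>M \<ge> 1\<close> by (intro power_increasing) auto
    then show "(2 * ?n * M) ^ (?n - 1) < ?B + 1" by simp
  qed simp
  also have "\<dots> = (?B + 1) ^ ?n" using R(2) by (metis Suc_diff_1 gr_zeroI not_less_zero power_Suc)
  finally have "card (F ` Y) < card Y" using cY by simp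
  then have "\<not> inj_on F Y" using card_image by force
  then obtain y z where yz: "y \<in> Y" "z \<in> Y" "F y = F z" "y \<noteq> z" by (auto simp: inj_on_def)
  show ?thesis
  proof (intro exI[of _ "\<lambda>j. y j - z j"] conjI ballI)
    show "\<exists>j\<in>J. y j - z j \<noteq> 0" using yz unfolding Y_def by (metis PiE_ext right_minus_eq)
  next
    fix i assume i: "i \<in> R"
    have "(\<Sum>j\<in>J. y j * a j i) = (\<Sum>j\<in>J. z j * a j i)" using fun_cong[OF yz(3), of i] i by (simp add: F_def)
    then show "(\<Sum>j\<in>J. (y j - z j) * a j i) = 0" by (simp add: left_diff_distrib sum_subtractf)
  next
    fix j assume j: "j \<in> J"
    have "0 \<le> y j" "y j \<le> int ?B" "0 \<le> z j" "z j \<le> int ?B" using yz(1,2) j by (auto simp: Y_def PiE_iff)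
    then show "\<bar>y j - z j\<bar> \<le> int ?B" by linarith
  qed
qed

section \<open>Rank arguments over the rationals and small nonnegative kernel vectors\<close>

lemma sum_fun_apply: "(\<Sum>a\<in>A. f a) x = (\<Sum>a\<in>A. f a x :: 'b :: comm_monoid_add)"
  by (induction A rule: infinite_finite_induct) auto

text \<open>A nonzero kernel vector \<open>g\<close> is orthogonal to all rows but not to itself,
  because a sum of rational squares vanishes only if every square does. Hence \<open>g\<close> lies
  outside the row space, and adding it to a basis of the row space keeps independence; so the rank
  is less than \<open>card J\<close>. The equations of the basis rows imply all others.\<close>

lemma independent_rows:
  fixes a :: "'j \<Rightarrow> 'i \<Rightarrow> int" and g :: "'j \<Rightarrow> rat"
  assumes J: "finite J" and I: "finite I" and g: "j1 \<in> J" "g j1 \<noteq> 0"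
    and ker: "\<And>i. i \<in> I \<Longrightarrow> (\<Sum>j\<in>J. g j * of_int (a j i)) = 0"
  shows "\<exists>R \<subseteq> I. card R < card J \<and> (\<forall>h :: 'j \<Rightarrow> rat. (\<forall>i\<in>R. (\<Sum>j\<in>J. h j * of_int (a j i)) = 0)
     \<longrightarrow> (\<forall>i\<in>I. (\<Sum>j\<in>J. h j * of_int (a j i)) = 0))"
proof -
  interpret vs: vector_space "\<lambda>(c :: rat) (f :: 'j \<Rightarrow> rat). (\<lambda>j. c * f j)"
    by standard (auto simp: algebra_simps fun_eq_iff)
  \<comment> \<open>Vectors are set to 0 outside \<open>J\<close>, so that they all lie in the span
    of the unit vectors indexed by \<open>J\<close>.\<close>
  define row where "row i = (\<lambda>j. if j \<in> J then of_int (a j i) else 0 :: rat)" for i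
  define g' where "g' = (\<lambda>j. if j \<in> J then g j else 0)"
  \<comment> \<open>Orthogonality to \<open>h\<close> defines a subspace, so it passes from
    generators to their span. It is used for \<open>g\<close> and again for the solutions
    \<open>h\<close> of the chosen equations.\<close>
  have perp: "(\<Sum>j\<in>J. h j * v j) = 0" if "v \<in> vs.span V" "\<And>w. w \<in> V \<Longrightarrow> (\<Sum>j\<in>J. h j * w j) = 0" for h v V
  proof -
    have "vs.subspace {v. (\<Sum>j\<in>J. h j * v j) = 0}"
      by (auto simp: vs.subspace_def distrib_left sum.distrib mult.left_commute[of _ c for c] simp flip: sum_distrib_left)
    then have "vs.span V \<subseteq> {v. (\<Sum>j\<in>J. h j * v j) = 0}" using that(2) by (intro vs.span_minimal) auto
    then show ?thesis using that(1) by auto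
  qed
  obtain B where B: "B \<subseteq> row ` I" "vs.independent B" "row ` I \<subseteq> vs.span B"
    using vs.maximal_independent_subset by blast
  have finB: "finite B" using B(1) I finite_subset by blast
  have row: "(\<Sum>j\<in>J. h j * row i j) = (\<Sum>j\<in>J. h j * of_int (a j i))" for h i
    by (rule sum.cong) (auto simp: row_def)
  have g': "g' \<notin> vs.span B"
  proof
    assume "g' \<in> vs.span B"
    then have "(\<Sum>j\<in>J. g j * g' j) = 0"
    proof (rule perp)
      fix w assume "w \<in> B"
      then obtain i where "i \<in> I" "w = row i" using B(1) by blast
      then show "(\<Sum>j\<in>J. g j * w j) = 0" using ker row by simp
    qed
    then have "(\<Sum>j\<in>J. g j * g j) = 0" by (simp add: g'_def cong: sum.cong)
    then have "g j1 * g j1 = 0" using J g(1) by (subst (asm) sum_nonneg_eq_0_iff) auto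
    then show False using g by simp
  qed
  define e where "e j = (\<lambda>j'. if j' = j then 1 else 0 :: rat)" for j :: 'j
  have in_e: "v \<in> vs.span (e ` J)" if "\<And>j. j \<notin> J \<Longrightarrow> v j = 0" for v
  proof -
    have "v = (\<Sum>j\<in>J. (\<lambda>j'. v j * e j j'))"
    proof
      fix k
      have "(\<Sum>j\<in>J. v j * e j k) = (\<Sum>j\<in>J. if j = k then v k else 0)"
        by (rule sum.cong) (auto simp: e_def)
      also have "\<dots> = v k" using J that by simp
      finally show "v k = (\<Sum>j\<in>J. (\<lambda>j'. v j * e j j')) k" by (simp add: sum_fun_apply)
    qed
    also have "\<dots> \<in> vs.span (e ` J)" by (intro vs.span_sum vs.span_scale vs.span_base) auto
    finally show ?thesis .
  qed
  have "vs.independent (insert g' B)" using B(2) g' by (simp add: vs.independent_insertI)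
  moreover have "insert g' B \<subseteq> vs.span (e ` J)" using B(1) in_e by (auto simp: g'_def row_def)
  ultimately have "card (insert g' B) \<le> card (e ` J)" using vs.independent_span_bound J by blast
  moreover have "g' \<notin> B" using g' vs.span_base by blast
  ultimately have cB: "card B < card J" using finB card_image_le[OF J, of e] by simp
  obtain R where R: "R \<subseteq> I" "row ` R = B" "inj_on row R" using subset_image_inj[of B row I] B(1) by auto
  show ?thesis
  proof (intro exI[of _ R] conjI allI impI ballI)
    show "card R < card J" using cB R card_image by metis
    fix h :: "'j \<Rightarrow> rat" and i
    assume h: "\<forall>i\<in>R. (\<Sum>j\<in>J. h j * of_int (a j i)) = 0" and i: "i \<in> I"
    have "row i \<in> vs.span B" using B(3) i by auto
    then have "(\<Sum>j\<in>J. h j * row i j) = 0"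
    proof (rule perp)
      fix w assume "w \<in> B"
      then obtain i where "i \<in> R" "w = row i" using R(2) by blast
      then show "(\<Sum>j\<in>J. h j * w j) = 0" using h row by simp
    qed
    then show "(\<Sum>j\<in>J. h j * of_int (a j i)) = 0" using row by metis
  qed (fact R)
qed


text \<open>Siegel's lemma applied on the support of a nonnegative kernel vector \<open>g\<close> of
  minimal support. An integer kernel vector \<open>h\<close> on that support with some positive
  entry has no negative entry: otherwise a combination of \<open>g\<close> and \<open>h\<close>
  would be nonnegative, nonzero and of smaller support.\<close>

lemma small_circuit:
  fixes a :: "'j \<Rightarrow> 'i \<Rightarrow> int" and z :: "'j \<Rightarrow> rat"
  assumes J: "finite J" and I: "finite I" and "M \<ge> 1"
    and M: "\<And>i j. j \<in> J \<Longrightarrow> i \<in> I \<Longrightarrow> \<bar>a j i\<bar> \<le> int M"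
    and z0: "\<And>j. j \<in> J \<Longrightarrow> z j \<ge> 0" "\<exists>j\<in>J. z j \<noteq> 0"
    and ker: "\<And>i. i \<in> I \<Longrightarrow> (\<Sum>j\<in>J. z j * of_int (a j i)) = 0"
  shows "\<exists>g :: 'j \<Rightarrow> int. (\<forall>j\<in>J. 0 \<le> g j \<and> g j \<le> int ((2 * card J * M) ^ card J)) \<and> (\<exists>j\<in>J. g j \<noteq> 0) \<and>
     (\<forall>j\<in>J. g j \<noteq> 0 \<longrightarrow> z j \<noteq> 0) \<and> (\<forall>i\<in>I. (\<Sum>j\<in>J. g j * a j i) = 0)"
proof -
  define supp where "supp z = {j \<in> J. z j \<noteq> (0 :: rat)}" for z
  define P where "P z' \<longleftrightarrow> (\<forall>j\<in>J. z' j \<ge> 0) \<and> supp z' \<noteq> {} \<and> supp z' \<subseteq> supp z \<and>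
     (\<forall>i\<in>I. (\<Sum>j\<in>J. z' j * of_int (a j i)) = 0)" for z' :: "'j \<Rightarrow> rat"
  have "P z" using z0 ker by (auto simp: P_def supp_def)
  then obtain g where g: "P g" and min: "\<And>y. P y \<Longrightarrow> card (supp g) \<le> card (supp y)"
    using ex_has_least_nat[of P z "\<lambda>y. card (supp y)"] by blast
  define S where "S = supp g"
  have SJ: "S \<subseteq> J" "finite S" using J by (auto simp: S_def supp_def)
  have sumS: "(\<Sum>j\<in>J. y j * c j) = (\<Sum>j\<in>S. y j * c j)" if "\<And>j. j \<in> J - S \<Longrightarrow> y j = 0" for y c :: "'j \<Rightarrow> 'b :: comm_ring_1"
    using that SJ J by (intro sum.mono_neutral_right) auto
  obtain j1 where j1: "j1 \<in> S" "g j1 \<noteq> 0" using g by (auto simp: P_def S_def supp_def)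
  have kerS: "(\<Sum>j\<in>S. g j * of_int (a j i)) = 0" if "i \<in> I" for i
    using that g sumS[of g] by (auto simp: P_def S_def supp_def)
  from independent_rows[where a = a and g = g, OF SJ(2) I j1 kerS] obtain R where R: "R \<subseteq> I" "card R < card S"
    "\<And>h :: 'j \<Rightarrow> rat. (\<forall>i\<in>R. (\<Sum>j\<in>S. h j * of_int (a j i)) = 0) \<Longrightarrow> (\<forall>i\<in>I. (\<Sum>j\<in>S. h j * of_int (a j i)) = 0)" by blast
  have finR: "finite R" using R(1) I finite_subset by blast
  have "\<And>i j. j \<in> S \<Longrightarrow> i \<in> R \<Longrightarrow> \<bar>a j i\<bar> \<le> int M" using M R(1) SJ by auto
  from small_kernel_vector[where a = a, OF SJ(2) finR R(2) \<open>M \<ge> 1\<close> this] obtain h0 :: "'j \<Rightarrow> int" where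
    h0: "\<exists>j\<in>S. h0 j \<noteq> 0" "\<And>i. i \<in> R \<Longrightarrow> (\<Sum>j\<in>S. h0 j * a j i) = 0"
      "\<And>j. j \<in> S \<Longrightarrow> \<bar>h0 j\<bar> \<le> int ((2 * card S * M) ^ card S)" by blast
  have "\<exists>h :: 'j \<Rightarrow> int. (\<exists>j\<in>S. h j > 0) \<and> (\<forall>i\<in>R. (\<Sum>j\<in>S. h j * a j i) = 0) \<and> (\<forall>j\<in>S. \<bar>h j\<bar> \<le> int ((2 * card S * M) ^ card S))"
  proof (cases "\<exists>j\<in>S. h0 j > 0")
    case True then show ?thesis using h0 by blast
  next
    case False
    then show ?thesis using h0 by (intro exI[of _ "\<lambda>j. - h0 j"]) (force simp: sum_negf)
  qed
  then obtain h :: "'j \<Rightarrow> int" where h: "\<exists>j\<in>S. h j > 0" "\<And>i. i \<in> R \<Longrightarrow> (\<Sum>j\<in>S. h j * a j i) = 0"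
      "\<And>j. j \<in> S \<Longrightarrow> \<bar>h j\<bar> \<le> int ((2 * card S * M) ^ card S)" by blast
  have "\<forall>i\<in>R. (\<Sum>j\<in>S. (of_int (h j) :: rat) * of_int (a j i)) = 0"
    using h(2) by (metis (no_types, lifting) of_int_0 of_int_mult of_int_sum sum.cong)
  from R(3)[OF this] have hkerQ: "(\<Sum>j\<in>S. (of_int (h j) :: rat) * of_int (a j i)) = 0" if "i \<in> I" for i
    using that by blast
  have hker: "(\<Sum>j\<in>S. h j * a j i) = 0" if "i \<in> I" for i
    using hkerQ[OF that] by (metis (no_types, lifting) of_int_eq_0_iff of_int_mult of_int_sum sum.cong)
  have nonneg: "h j \<ge> 0" if j: "j \<in> S" for j
  proof (rule ccontr)
    assume neg: "\<not> h j \<ge> 0"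
    define q where "q j = g j / of_int (h j)" for j
    define T where "T = {j \<in> S. h j > 0}"
    have T: "finite T" "T \<noteq> {}" using SJ h(1) by (auto simp: T_def)
    obtain j0 where j0: "j0 \<in> T" "\<And>j. j \<in> T \<Longrightarrow> q j0 \<le> q j"
      using arg_min_if_finite(1)[OF T, of q] arg_min_least[OF T, of _ q] by blast
    have h0': "h j0 > 0" "j0 \<in> S" using j0(1) by (auto simp: T_def)
    have gpos: "g j > 0" if "j \<in> S" for j using that g by (auto simp: S_def supp_def P_def order_less_le)
    \<comment> \<open>The ratio test of linear programming: \<open>j0\<close> minimizes
      \<open>g j / h j\<close> over the positive entries of \<open>h\<close>, so this combination
      stays nonnegative and vanishes at \<open>j0\<close>.\<close>
    define y where "y j = (if j \<in> S then of_int (h j0) * g j - g j0 * of_int (h j) else 0)" for j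
    have ynn: "y j \<ge> 0" if "j \<in> J" for j
    proof (cases "j \<in> T")
      case True
      then have "q j0 \<le> q j" "h j > 0" "j \<in> S" using j0(2) by (auto simp: T_def)
      then show ?thesis using h0' by (simp add: y_def q_def field_simps)
    next
      case False
      show ?thesis
      proof (cases "j \<in> S")
        case True
        with False have "h j \<le> 0" by (simp add: T_def)
        then have "g j0 * of_int (h j) \<le> 0" using gpos[OF h0'(2)] by (simp add: mult_nonneg_nonpos)
        moreover have "of_int (h j0) * g j \<ge> 0" using gpos[OF True] h0'(1) by simp
        ultimately show ?thesis by (simp add: y_def)
      qed (simp add: y_def)
    qed
    have yker: "(\<Sum>j\<in>J. y j * of_int (a j i)) = 0" if "i \<in> I" for i
    proof -
      have "(\<Sum>j\<in>J. y j * of_int (a j i)) = (\<Sum>j\<in>S. y j * of_int (a j i))" by (rule sumS) (simp add: y_def)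
      also have "\<dots> = of_int (h j0) * (\<Sum>j\<in>S. g j * of_int (a j i)) - g j0 * (\<Sum>j\<in>S. of_int (h j) * of_int (a j i))"
        unfolding sum_distrib_left sum_subtractf[symmetric]
        by (rule sum.cong) (auto simp: y_def algebra_simps)
      finally show ?thesis using kerS[OF that] hkerQ[OF that] by simp
    qed
    have ysupp: "supp y \<subseteq> S - {j0}" by (auto simp: supp_def y_def)
    \<comment> \<open>At a coordinate with a negative entry of \<open>h\<close> both terms of
      \<open>y\<close> contribute positively, so \<open>y\<close> is not zero.\<close>
    have "g j0 * of_int (h j) < 0" using neg gpos[OF h0'(2)] by (simp add: mult_pos_neg)
    moreover have "of_int (h j0) * g j > 0" using gpos[OF j] h0'(1) by simp
    ultimately have "y j \<noteq> 0" using j by (simp add: y_def)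
    then have "supp y \<noteq> {}" using j SJ by (auto simp: supp_def)
    moreover have "supp y \<subseteq> supp z" using ysupp g by (auto simp: S_def P_def)
    ultimately have "P y" using ynn yker by (auto simp: P_def)
    then have "card S \<le> card (supp y)" using min by (simp add: S_def)
    also have "\<dots> \<le> card (S - {j0})" using ysupp SJ by (intro card_mono) auto
    also have "\<dots> < card S" using SJ h0'(2) by (intro psubset_card_mono) auto
    finally show False by simp
  qed
  have cS: "card S \<le> card J" using SJ J card_mono by blast
  have "card S \<ge> 1" using j1 SJ by (metis One_nat_def Suc_leI card_gt_0_iff empty_iff)
  then have "(2 * card S * M) ^ card S \<le> (2 * card J * M) ^ card S" "(2 * card J * M) ^ card S \<le> (2 * card J * M) ^ card J"
    using cS \<open>M \<ge> 1\<close> by (auto intro!: power_mono power_increasing mult_le_mono)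
  then have D: "int ((2 * card S * M) ^ card S) \<le> int ((2 * card J * M) ^ card J)"
    by (meson le_trans of_nat_mono)
  show ?thesis
  proof (intro exI[of _ "\<lambda>j. if j \<in> S then h j else 0"] conjI ballI impI)
    fix i assume "i \<in> I"
    have "(\<Sum>j\<in>J. (if j \<in> S then h j else 0) * a j i) = (\<Sum>j\<in>S. (if j \<in> S then h j else 0) * a j i)"
      by (rule sumS) simp
    then show "(\<Sum>j\<in>J. (if j \<in> S then h j else 0) * a j i) = 0" using hker[OF \<open>i \<in> I\<close>] by simp
  next
    fix j assume "j \<in> J"
    show "(if j \<in> S then h j else 0) \<le> int ((2 * card J * M) ^ card J)"
    proof (cases "j \<in> S")
      case True
      then show ?thesis using h(3)[OF True] D by (simp del: of_nat_power of_nat_mult)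
    qed simp
    show "0 \<le> (if j \<in> S then h j else 0)" using nonneg by simp
    assume "(if j \<in> S then h j else 0) \<noteq> 0"
    then show "z j \<noteq> 0" using g by (auto simp: S_def P_def supp_def split: if_splits)
  next
    show "\<exists>j\<in>J. (if j \<in> S then h j else 0) \<noteq> 0" using h(1) SJ by force
  qed
qed

text \<open>The largest multiple of a small circuit that fits below \<open>z\<close> is considered.
  If the factor is at least 1, the circuit itself lies below \<open>z\<close>. Otherwise subtracting
  the multiple removes a coordinate from the support and costs the entry at \<open>j0\<close> at
  most \<open>D\<close>, so the lower bound on that entry, one \<open>D\<close> per support element,
  survives the induction.\<close>

lemma large_kernel_vector_reducible:
  fixes a :: "'j \<Rightarrow> 'i \<Rightarrow> int" and z :: "'j \<Rightarrow> rat"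
  assumes J: "finite J" and I: "finite I" and "M \<ge> 1"
    and M: "\<And>i j. j \<in> J \<Longrightarrow> i \<in> I \<Longrightarrow> \<bar>a j i\<bar> \<le> int M"
    and D: "D = int ((2 * card J * M) ^ card J)"
  shows "(\<forall>j\<in>J. z j \<ge> 0) \<Longrightarrow> (\<forall>i\<in>I. (\<Sum>j\<in>J. z j * of_int (a j i)) = 0) \<Longrightarrow>
     j0 \<in> J \<Longrightarrow> z j0 > of_nat (card {j \<in> J. z j \<noteq> 0}) * of_int D \<Longrightarrow>
     \<exists>g :: 'j \<Rightarrow> int. (\<forall>j\<in>J. 0 \<le> g j \<and> g j \<le> D \<and> of_int (g j) \<le> z j) \<and> (\<exists>j\<in>J. g j \<noteq> 0) \<and>
       (\<forall>i\<in>I. (\<Sum>j\<in>J. g j * a j i) = 0)"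
proof (induction "card {j \<in> J. z j \<noteq> 0}" arbitrary: z rule: less_induct)
  case less
  have Dnn: "D \<ge> 0" by (simp add: D)
  have "z j0 > 0" using less.prems(4) Dnn by (metis le_less_trans mult_nonneg_nonneg of_int_nonneg of_nat_0_le_iff)
  then have "\<exists>j\<in>J. z j \<noteq> 0" using less.prems(3) by force
  have zn: "\<And>j. j \<in> J \<Longrightarrow> z j \<ge> 0" and zk: "\<And>i. i \<in> I \<Longrightarrow> (\<Sum>j\<in>J. z j * of_int (a j i)) = 0"
    using less.prems(1,2) by auto
  obtain g :: "'j \<Rightarrow> int" where g0: "\<forall>j\<in>J. 0 \<le> g j \<and> g j \<le> D" and g1: "\<exists>j\<in>J. g j \<noteq> 0"
     and g2: "\<forall>j\<in>J. g j \<noteq> 0 \<longrightarrow> z j \<noteq> 0" and g3: "\<forall>i\<in>I. (\<Sum>j\<in>J. g j * a j i) = 0"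
    using small_circuit[where a = a and z = z, OF J I \<open>M \<ge> 1\<close> M zn \<open>\<exists>j\<in>J. z j \<noteq> 0\<close> zk] unfolding D[symmetric] by blast
  note g = g0[rule_format] g1 g2[rule_format] g3[rule_format]
  define q where "q j = z j / of_int (g j)" for j
  define T where "T = {j \<in> J. g j \<noteq> 0}"
  have T: "finite T" "T \<noteq> {}" using J g(2) by (auto simp: T_def)
  obtain k where k: "k \<in> T" "\<And>j. j \<in> T \<Longrightarrow> q k \<le> q j"
    using arg_min_if_finite(1)[OF T, of q] arg_min_least[OF T, of _ q] by blast
  have gk: "k \<in> J" "g k > 0" "z k > 0" using k(1) g(1,3) less.prems(1) by (force simp: T_def order_less_le)+
  have le: "q k * of_int (g j) \<le> z j" if "j \<in> J" for j
  proof (cases "g j = 0")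
    case False
    then have "g j > 0" "q k \<le> q j" using k(2) that g(1)[OF that] by (auto simp: T_def)
    then show ?thesis by (simp add: q_def field_simps)
  qed (use less.prems(1) that in simp)
  show ?case
  proof (cases "q k \<ge> 1")
    case True
    have "of_int (g j) \<le> z j" if "j \<in> J" for j
    proof -
      have "1 * (of_int (g j) :: rat) \<le> q k * of_int (g j)" using True g(1)[OF that] by (intro mult_right_mono) auto
      then show ?thesis using le[OF that] by simp
    qed
    then show ?thesis using g by blast
  next
    case False
    have qpos: "q k > 0" using gk by (simp add: q_def)
    define y where "y j = z j - q k * of_int (g j)" for j
    have "{j \<in> J. y j \<noteq> 0} \<subseteq> {j \<in> J. z j \<noteq> 0} - {k}"
      using g(3) gk by (auto simp: y_def q_def)
    moreover have "k \<in> {j \<in> J. z j \<noteq> 0}" using gk by auto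
    ultimately have c: "card {j \<in> J. y j \<noteq> 0} < card {j \<in> J. z j \<noteq> 0}"
      using J by (intro psubset_card_mono) auto
    have ynn: "\<forall>j\<in>J. y j \<ge> 0" using le by (auto simp: y_def)
    have yker: "\<forall>i\<in>I. (\<Sum>j\<in>J. y j * of_int (a j i)) = 0"
    proof
      fix i assume i: "i \<in> I"
      have "(\<Sum>j\<in>J. y j * of_int (a j i)) = (\<Sum>j\<in>J. z j * of_int (a j i)) - q k * (\<Sum>j\<in>J. of_int (g j) * of_int (a j i))"
        unfolding sum_distrib_left sum_subtractf[symmetric] by (rule sum.cong) (auto simp: y_def algebra_simps)
      also have "(\<Sum>j\<in>J. of_int (g j) * of_int (a j i)) = (of_int (\<Sum>j\<in>J. g j * a j i) :: rat)" by simp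
      finally show "(\<Sum>j\<in>J. y j * of_int (a j i)) = 0" using g(4)[OF i] less.prems(2) i by simp
    qed
    have "q k * of_int (g j0) \<le> 1 * of_int D"
      using False qpos g(1)[OF less.prems(3)] by (intro mult_mono) auto
    then have "y j0 \<ge> z j0 - of_int D" by (simp add: y_def)
    moreover have "of_nat (card {j \<in> J. y j \<noteq> 0}) * of_int D \<le> (of_nat (card {j \<in> J. z j \<noteq> 0}) - 1) * (of_int D :: rat)"
    proof (rule mult_right_mono)
      have "Suc (card {j \<in> J. y j \<noteq> 0}) \<le> card {j \<in> J. z j \<noteq> 0}" using c by simp
      then have "of_nat (Suc (card {j \<in> J. y j \<noteq> 0})) \<le> (of_nat (card {j \<in> J. z j \<noteq> 0}) :: rat)" by (rule of_nat_mono)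
      then show "of_nat (card {j \<in> J. y j \<noteq> 0}) \<le> (of_nat (card {j \<in> J. z j \<noteq> 0}) - 1 :: rat)" by simp
    qed (use Dnn in simp)
    ultimately have "y j0 > of_nat (card {j \<in> J. y j \<noteq> 0}) * of_int D"
      using less.prems(4) by (simp add: algebra_simps)
    from less.hyps[OF c ynn yker less.prems(3) this] obtain g' :: "'j \<Rightarrow> int" where
      g': "\<forall>j\<in>J. 0 \<le> g' j \<and> g' j \<le> D \<and> of_int (g' j) \<le> y j" "\<exists>j\<in>J. g' j \<noteq> 0"
       "\<forall>i\<in>I. (\<Sum>j\<in>J. g' j * a j i) = 0" by blast
    have "of_int (g' j) \<le> z j" if "j \<in> J" for j
    proof -
      have "q k * of_int (g j) \<ge> 0" using qpos g(1)[OF that] by simp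
      then show ?thesis using g'(1) that by (auto simp: y_def intro: order_trans)
    qed
    then show ?thesis using g' by blast
  qed
qed

text \<open>The right-hand side becomes an extra column \<open>None\<close> that is used once. In a
  solution of least total multiplicity on a small support, a large entry would give a small kernel
  vector \<open>g\<close> below the solution. If \<open>g\<close> avoids the extra column, it can be
  subtracted; if it uses it once, it is itself a solution of smaller total. The number
  \<open>s\<close> is left implicit here and is resolved once the parameters are known.\<close>

theorem small_solution:
  fixes a :: "'j \<Rightarrow> 'i \<Rightarrow> int" and x :: "'j \<Rightarrow> nat"
  assumes J: "finite J" and I: "finite I" and "M \<ge> 1"
    and M: "\<And>i j. j \<in> J \<Longrightarrow> i \<in> I \<Longrightarrow> \<bar>a j i\<bar> \<le> int M"
    and b: "\<And>i. i \<in> I \<Longrightarrow> \<bar>b i\<bar> \<le> int M" "\<And>i. i \<in> I \<Longrightarrow> (\<Sum>j\<in>J. int (x j) * a j i) = b i"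
  shows "\<exists>y s. (\<forall>i\<in>I. (\<Sum>j\<in>J. int (y j) * a j i) = b i) \<and> {j \<in> J. y j \<noteq> 0} \<subseteq> {j \<in> J. x j \<noteq> 0} \<and>
    card {j \<in> J. y j \<noteq> 0} \<le> s \<and> 2 ^ s \<le> (2 * (s * M) + 1) ^ card I \<and>
    (\<forall>j\<in>J. y j \<le> (s + 1) * (2 * (s + 1) * M) ^ (s + 1))"
proof -
  obtain u where u: "\<And>i. i \<in> I \<Longrightarrow> (\<Sum>j\<in>J. int (u j) * a j i) = b i" "{j \<in> J. u j \<noteq> 0} \<subseteq> {j \<in> J. x j \<noteq> 0}"
    "2 ^ card {j \<in> J. u j \<noteq> 0} \<le> (2 * (card {j \<in> J. u j \<noteq> 0} * M) + 1) ^ card I"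
    using few_support[where a = a and x = x, OF J I M] b(2) by auto
  define S where "S = {j \<in> J. u j \<noteq> 0}"
  define s where "s = card S"
  have SJ: "S \<subseteq> J" "finite S" using J by (auto simp: S_def)
  define P where "P y \<longleftrightarrow> (\<forall>i\<in>I. (\<Sum>j\<in>S. int (y j) * a j i) = b i)" for y
  have "(\<Sum>j\<in>S. int (u j) * a j i) = (\<Sum>j\<in>J. int (u j) * a j i)" for i
    using J by (intro sum.mono_neutral_left) (auto simp: S_def)
  then have "P u" unfolding P_def using u(1) by simp
  then obtain y where y: "P y" and min: "\<And>z. P z \<Longrightarrow> sum y S \<le> sum z S"
    using ex_has_least_nat[of P u "\<lambda>y. sum y S"] by blast
  define J' where "J' = insert None (Some ` S)"
  define a' where "a' j i = (case j of None \<Rightarrow> - b i | Some j \<Rightarrow> a j i)" for j i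
  define z where "z j = (case j of None \<Rightarrow> 1 | Some j \<Rightarrow> (of_nat (y j) :: rat))" for j
  have sumJ': "(\<Sum>j\<in>J'. f j) = f None + (\<Sum>j\<in>S. f (Some j))" for f :: "'j option \<Rightarrow> 'b :: comm_monoid_add"
    unfolding J'_def using SJ by (subst sum.insert) (auto simp: sum.reindex)
  have cJ': "card J' = s + 1" unfolding J'_def s_def using SJ by (subst card_insert_disjoint) (auto simp: card_image)
  let ?D = "int ((2 * (s + 1) * M) ^ (s + 1))"
  have bound: "y j \<le> (s + 1) * (2 * (s + 1) * M) ^ (s + 1)" if j: "j \<in> S" for j
  proof (rule ccontr)
    assume "\<not> ?thesis"
    then have "int (y j) > int (s + 1) * ?D" unfolding of_nat_mult[symmetric] by (simp only: of_nat_less_iff not_le)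
    then have big: "(of_nat (y j) :: rat) > of_nat (s + 1) * of_int ?D"
      by (metis of_int_less_iff of_int_mult of_int_of_nat_eq)
    have "\<exists>g :: 'j option \<Rightarrow> int. (\<forall>j\<in>J'. 0 \<le> g j \<and> g j \<le> ?D \<and> of_int (g j) \<le> z j) \<and> (\<exists>j\<in>J'. g j \<noteq> 0) \<and>
       (\<forall>i\<in>I. (\<Sum>j\<in>J'. g j * a' j i) = 0)"
    proof (rule large_kernel_vector_reducible[where ?j0.0 = "Some j" and a = a' and z = z and M = M])
      show "finite J'" using SJ by (simp add: J'_def)
      show "?D = int ((2 * card J' * M) ^ card J')" by (simp add: cJ')
      show "\<bar>a' j i\<bar> \<le> int M" if "j \<in> J'" "i \<in> I" for i j
        using that M b(1) SJ by (auto simp: a'_def J'_def split: option.splits)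
      show "\<forall>j\<in>J'. z j \<ge> 0" by (simp add: z_def split: option.splits)
      show "\<forall>i\<in>I. (\<Sum>j\<in>J'. z j * of_int (a' j i)) = 0"
      proof
        fix i assume i: "i \<in> I"
        have "(\<Sum>j\<in>S. (of_nat (y j) :: rat) * of_int (a j i)) = of_int (\<Sum>j\<in>S. int (y j) * a j i)" by simp
        also have "\<dots> = of_int (b i)" using y i by (simp add: P_def)
        finally show "(\<Sum>j\<in>J'. z j * of_int (a' j i)) = 0" by (simp add: sumJ' z_def a'_def)
      qed
      show "Some j \<in> J'" using j by (simp add: J'_def)
      have "card {j \<in> J'. z j \<noteq> 0} \<le> s + 1" unfolding cJ'[symmetric] using SJ by (intro card_mono) (auto simp: J'_def)
      then have "of_nat (card {j \<in> J'. z j \<noteq> 0}) * of_int ?D \<le> of_nat (s + 1) * (of_int ?D :: rat)"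
        by (intro mult_right_mono of_nat_mono) auto
      then show "z (Some j) > of_nat (card {j \<in> J'. z j \<noteq> 0}) * of_int ?D" using big by (simp add: z_def)
    qed fact+
    then obtain g :: "'j option \<Rightarrow> int" where g: "\<And>j. j \<in> J' \<Longrightarrow> 0 \<le> g j \<and> g j \<le> ?D \<and> of_int (g j) \<le> z j"
      "\<exists>j\<in>J'. g j \<noteq> 0" "\<And>i. i \<in> I \<Longrightarrow> (\<Sum>j\<in>J'. g j * a' j i) = 0" by blast
    define h where "h j = nat (g (Some j))" for j
    have gS: "0 \<le> g (Some j)" "g (Some j) \<le> ?D" "g (Some j) \<le> int (y j)" if "j \<in> S" for j
    proof -
      have "Some j \<in> J'" using that by (simp add: J'_def)
      note g(1)[OF this]
      moreover from this have "(of_int (g (Some j)) :: rat) \<le> of_int (int (y j))" by (simp add: z_def)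
      ultimately show "0 \<le> g (Some j)" "g (Some j) \<le> ?D" "g (Some j) \<le> int (y j)" by (auto simp only: of_int_le_iff)
    qed
    \<comment> \<open>The extra column has weight 1 in \<open>z\<close>, and an integral vector
      between 0 and \<open>z\<close> can use it at most once.\<close>
    have gN: "g None = 0 \<or> g None = 1"
    proof -
      have "None \<in> J'" by (simp add: J'_def)
      from g(1)[OF this] have "0 \<le> g None" "(of_int (g None) :: rat) \<le> of_int 1" by (auto simp: z_def)
      then show ?thesis by (simp only: of_int_le_iff) linarith
    qed
    have hker: "(\<Sum>j\<in>S. int (h j) * a j i) = g None * b i" if "i \<in> I" for i
      using g(3)[OF that] gS by (simp add: sumJ' a'_def h_def)
    have hy: "h j \<le> y j" if "j \<in> S" for j using gS(1,3)[OF that] by (simp add: h_def)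
    show False
    proof (cases "g None = 0")
      case True
      then obtain j1 where j1: "j1 \<in> S" "g (Some j1) \<noteq> 0" using g(2) by (auto simp: J'_def)
      then have j1: "j1 \<in> S" "h j1 > 0" using gS(1)[OF j1(1)] by (auto simp: h_def)
      have "(\<Sum>j\<in>S. int (y j - h j) * a j i) = b i" if "i \<in> I" for i
      proof -
        have "(\<Sum>j\<in>S. int (y j - h j) * a j i) = (\<Sum>j\<in>S. int (y j) * a j i) - (\<Sum>j\<in>S. int (h j) * a j i)"
          unfolding sum_subtractf[symmetric] by (rule sum.cong) (auto simp: of_nat_diff hy algebra_simps)
        then show ?thesis using hker[OF that] y that True by (simp add: P_def)
      qed
      then have "sum y S \<le> sum (\<lambda>j. y j - h j) S" by (intro min) (simp add: P_def)
      moreover have "sum (\<lambda>j. y j - h j) S < sum y S"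
        using j1 hy[of j1] SJ by (intro sum_strict_mono_ex1 bexI[of _ j1]) auto
      ultimately show False by simp
    next
      case False
      then have "P h" using hker gN by (simp add: P_def)
      then have "sum y S \<le> sum h S" by (rule min)
      moreover have "h j < y j"
      proof -
        have "h j \<le> (2 * (s + 1) * M) ^ (s + 1)" using gS(2)[OF j] unfolding h_def by linarith
        also have "\<dots> \<le> (s + 1) * (2 * (s + 1) * M) ^ (s + 1)" by simp
        also have "\<dots> < y j" using \<open>\<not> y j \<le> _\<close> by simp
        finally show ?thesis .
      qed
      then have "sum h S < sum y S" using j hy SJ by (intro sum_strict_mono_ex1) auto
      ultimately show False by simp
    qed
  qed
  define y' where "y' j = (if j \<in> S then y j else 0)" for j
  have eq: "(\<Sum>j\<in>J. int (y' j) * a j i) = b i" if "i \<in> I" for i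
  proof -
    have "(\<Sum>j\<in>J. int (y' j) * a j i) = (\<Sum>j\<in>S. int (y j) * a j i)"
      using J SJ by (intro sum.mono_neutral_cong_right) (auto simp: y'_def)
    then show ?thesis using y that by (simp add: P_def)
  qed
  have supp: "{j \<in> J. y' j \<noteq> 0} \<subseteq> S" by (auto simp: y'_def)
  show ?thesis
  proof (rule exI[of _ y'], rule exI[of _ s], intro conjI ballI)
    show "card {j \<in> J. y' j \<noteq> 0} \<le> s" unfolding s_def using supp SJ by (intro card_mono) auto
    show "{j \<in> J. y' j \<noteq> 0} \<subseteq> {j \<in> J. x j \<noteq> 0}" using supp u(2) by (auto simp: S_def)
    show "2 ^ s \<le> (2 * (s * M) + 1) ^ card I" using u(3) by (simp add: s_def S_def)
    show "y' j \<le> (s + 1) * (2 * (s + 1) * M) ^ (s + 1)" for j using bound[of j] by (simp add: y'_def)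
  qed (use eq in auto)
qed

section \<open>Normal form of runs\<close>

type_synonym trans = "nat \<times> int list \<times> nat"

abbreviation src :: "trans \<Rightarrow> nat" where "src \<equiv> fst"
abbreviation vec :: "trans \<Rightarrow> int list" where "vec t \<equiv> fst (snd t)"
abbreviation tgt :: "trans \<Rightarrow> nat" where "tgt t \<equiv> snd (snd t)"

fun vpath :: "vass \<Rightarrow> nat \<Rightarrow> trans list \<Rightarrow> nat \<Rightarrow> bool" where
  "vpath T p [] q \<longleftrightarrow> p = q"
| "vpath T p (t # \<pi>) q \<longleftrightarrow> t \<in> set T \<and> src t = p \<and> vpath T (tgt t) \<pi> q"

definition eff :: "trans list \<Rightarrow> nat \<Rightarrow> int" where
  "eff \<pi> i = sum_list (map (\<lambda>t. vec t ! i) \<pi>)"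

abbreviation wt :: "trans list \<Rightarrow> int" where "wt \<pi> \<equiv> eff \<pi> 0"

fun fire :: "int \<Rightarrow> trans list \<Rightarrow> bool" where
  "fire x [] \<longleftrightarrow> True"
| "fire x (t # \<pi>) \<longleftrightarrow> 0 \<le> x + vec t ! 0 \<and> fire (x + vec t ! 0) \<pi>"

lemma eff_simps [simp]: "eff [] i = 0" "eff (t # \<pi>) i = vec t ! i + eff \<pi> i" "eff (\<pi> @ \<pi>') i = eff \<pi> i + eff \<pi>' i"
  by (simp_all add: eff_def)

lemma vpath_append: "vpath T p (\<pi> @ \<pi>') q \<longleftrightarrow> (\<exists>r. vpath T p \<pi> r \<and> vpath T r \<pi>' q)"
  by (induction \<pi> arbitrary: p) auto

lemma vpath_ends: "vpath T p \<pi> q \<Longrightarrow> \<pi> \<noteq> [] \<Longrightarrow> src (hd \<pi>) = p \<and> tgt (last \<pi>) = q"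
proof (induction \<pi> arbitrary: p)
  case (Cons t \<pi>)
  then show ?case by (cases "\<pi> = []") auto
qed simp

lemma fire_append: "fire x (\<pi> @ \<pi>') \<longleftrightarrow> fire x \<pi> \<and> fire (x + wt \<pi>) \<pi>'"
  by (induction \<pi> arbitrary: x) (auto simp: add.assoc)

lemma fire_mono: "fire x \<pi> \<Longrightarrow> x \<le> y \<Longrightarrow> fire y \<pi>"
  by (induction \<pi> arbitrary: x y) force+

lemma fire_nonneg: "0 \<le> x \<Longrightarrow> fire x \<pi> \<Longrightarrow> 0 \<le> x + wt \<pi>"
  by (induction \<pi> arbitrary: x) (auto simp: add.assoc[symmetric])

lemma fire_prefix: "(\<And>n. n \<le> length \<pi> \<Longrightarrow> 0 \<le> x + wt (take n \<pi>)) \<Longrightarrow> fire x \<pi>"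
proof (induction \<pi> arbitrary: x)
  case (Cons t \<pi>)
  have "0 \<le> x + vec t ! 0" using Cons.prems[of 1] by simp
  moreover have "fire (x + vec t ! 0) \<pi>"
    using Cons.prems[of "Suc n" for n] by (intro Cons.IH) (force simp: add.assoc)
  ultimately show ?case by simp
qed simp

text \<open>The N-counter never drops below the smaller of its two end values, so nonnegative end
  values are enough for firing the cycle.\<close>

definition good_cycle :: "trans list \<Rightarrow> bool" where
  "good_cycle c \<longleftrightarrow> (\<forall>n \<le> length c. min 0 (wt c) \<le> wt (take n c))"

lemma good_fire: "good_cycle c \<Longrightarrow> 0 \<le> x \<Longrightarrow> 0 \<le> x + wt c \<Longrightarrow> fire x c"
  by (rule fire_prefix) (force simp: good_cycle_def min_def split: if_splits)

text \<open>Rotating a cycle to a point where the N-counter is minimal.\<close>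

lemma good_rotation: "\<exists>c1 c2. c = c1 @ c2 \<and> good_cycle (c2 @ c1)"
proof -
  obtain n where n: "n \<le> length c" "\<And>m. m \<le> length c \<Longrightarrow> wt (take n c) \<le> wt (take m c)"
    using arg_min_if_finite(1)[of "{..length c}" "\<lambda>n. wt (take n c)"] arg_min_least[of "{..length c}" _ "\<lambda>n. wt (take n c)"]
    by (metis atMost_iff empty_iff finite_atMost le0)
  define c1 c2 where "c1 = take n c" and "c2 = drop n c"
  have c: "c = c1 @ c2" by (simp add: c1_def c2_def)
  \<comment> \<open>With the cut at a minimal prefix, the prefixes that stay in \<open>c2\<close>
    have weight at least 0, and those that reach into \<open>c1\<close> have at least the weight of
    the whole cycle. These are the two arguments of the minimum in
    \<open>good_cycle\<close>.\<close>
  have m1: "wt c1 \<le> wt c1 + wt (take m c2)" if "m \<le> length c2" for m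
    using n(2)[of "n + m"] n(1) that by (auto simp: c1_def c2_def take_add)
  have m2: "wt c1 \<le> wt (take m c1)" if "m \<le> length c1" for m
    using n(2)[of m] that n(1) by (auto simp: c1_def min_def split: if_splits)
  have "good_cycle (c2 @ c1)" unfolding good_cycle_def
  proof (intro allI impI)
    fix k assume k: "k \<le> length (c2 @ c1)"
    show "min 0 (wt (c2 @ c1)) \<le> wt (take k (c2 @ c1))"
    proof (cases "k \<le> length c2")
      case True
      then show ?thesis using m1[of k] by auto
    next
      case False
      have "k - length c2 \<le> length c1" using k by auto
      from m2[OF this] show ?thesis using False by auto
    qed
  qed
  then show ?thesis using c by blast
qed

text \<open>A run with cycles attached: the transitions \<open>Tr\<close> form the skeleton, and
  \<open>Blk r C\<close> stands at a visit of state \<open>r\<close> for the cycles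
  \<open>C\<close>, traversed there in this order.\<close>

datatype item = Tr trans | Blk nat "trans list list"

fun flat :: "item \<Rightarrow> trans list" where
  "flat (Tr t) = [t]"
| "flat (Blk r C) = concat C"

definition flatten :: "item list \<Rightarrow> trans list" where
  "flatten l = concat (map flat l)"

lemma flatten_simps [simp]: "flatten [] = []" "flatten (i # l) = flat i @ flatten l" "flatten (l @ l') = flatten l @ flatten l'"
  by (simp_all add: flatten_def)

lemma flatten_Tr [simp]: "flatten (map Tr c) = c"
  by (induction c) auto

fun istep :: "vass \<Rightarrow> nat \<Rightarrow> nat \<Rightarrow> item \<Rightarrow> nat \<Rightarrow> bool" where
  "istep T N p (Tr t) q \<longleftrightarrow> t \<in> set T \<and> src t = p \<and> tgt t = q"
| "istep T N p (Blk r C) q \<longleftrightarrow> r = p \<and> q = p \<and> (\<forall>c \<in> set C. vpath T p c p \<and> good_cycle c \<and> length c \<le> N)"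

fun ipath :: "vass \<Rightarrow> nat \<Rightarrow> nat \<Rightarrow> item list \<Rightarrow> nat \<Rightarrow> bool" where
  "ipath T N p [] q \<longleftrightarrow> p = q"
| "ipath T N p (i # l) q \<longleftrightarrow> (\<exists>r. istep T N p i r \<and> ipath T N r l q)"

lemma ipath_append: "ipath T N p (l @ l') q \<longleftrightarrow> (\<exists>r. ipath T N p l r \<and> ipath T N r l' q)"
  by (induction l arbitrary: p) auto

lemma ipath_Tr: "ipath T N p (map Tr c) q \<longleftrightarrow> vpath T p c q"
  by (induction c arbitrary: p) auto

fun block_states :: "item list \<Rightarrow> nat set" where
  "block_states [] = {}"
| "block_states (Tr t # l) = block_states l"
| "block_states (Blk r C # l) = insert r (block_states l)"

text \<open>Every transition leaves a state with a block before it and enters a state with a block after it.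
  S and R collect the states of blocks outside of the list.\<close>

fun anchored :: "nat set \<Rightarrow> item list \<Rightarrow> nat set \<Rightarrow> bool" where
  "anchored S [] R \<longleftrightarrow> True"
| "anchored S (Tr t # l) R \<longleftrightarrow> src t \<in> S \<and> tgt t \<in> block_states l \<union> R \<and> anchored S l R"
| "anchored S (Blk r C # l) R \<longleftrightarrow> anchored (insert r S) l R"

lemma bs_append [simp]: "block_states (l @ l') = block_states l \<union> block_states l'"
  by (induction l rule: block_states.induct) auto

lemma bs_Tr [simp]: "block_states (map Tr c) = {}"
  by (induction c) auto

lemma anchored_append: "anchored S (l @ l') R \<longleftrightarrow> anchored S l (block_states l' \<union> R) \<and> anchored (S \<union> block_states l) l' R"
  by (induction S l R rule: anchored.induct) auto

lemma anchored_Tr: "anchored S (map Tr c) R \<longleftrightarrow> (\<forall>t \<in> set c. src t \<in> S \<and> tgt t \<in> R)"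
  by (induction c) auto

lemma bs_split: "r \<in> block_states l \<Longrightarrow> \<exists>A C B. l = A @ Blk r C # B"
proof (induction l rule: block_states.induct)
  case (2 t l)
  then obtain A C B where "l = A @ Blk r C # B" by auto
  then show ?case by (intro exI[of _ "Tr t # A"]) auto
next
  case (3 s C l)
  show ?case
  proof (cases "r = s")
    case True then show ?thesis by blast
  next
    case False
    with 3 obtain A C' B where "l = A @ Blk r C' # B" by auto
    then show ?thesis by (intro exI[of _ "Blk s C # A"]) auto
  qed
qed simp

definition nT :: "item list \<Rightarrow> nat" where "nT l = length (filter (\<lambda>i. case i of Tr t \<Rightarrow> True | _ \<Rightarrow> False) l)"
definition nB :: "item list \<Rightarrow> nat" where "nB l = length (filter (\<lambda>i. case i of Tr t \<Rightarrow> False | _ \<Rightarrow> True) l)"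

lemma nTB_simps [simp]: "nT [] = 0" "nB [] = 0" "nT (Tr t # l) = Suc (nT l)" "nB (Tr t # l) = nB l"
  "nT (Blk r C # l) = nT l" "nB (Blk r C # l) = Suc (nB l)" "nT (l @ l') = nT l + nT l'" "nB (l @ l') = nB l + nB l'"
  by (simp_all add: nT_def nB_def)

lemma nTB_Tr [simp]: "nT (map Tr c) = length c" "nB (map Tr c) = 0"
  by (induction c) auto

lemma length_nTB: "length l = nT l + nB l"
proof (induction l)
  case (Cons i l) then show ?case by (cases i) auto
qed simp

text \<open>The rotated cycle starts at a state \<open>r\<close> that \<open>c\<close> both leaves
  and enters, so anchoring provides blocks at \<open>r\<close> on both sides of \<open>c\<close>. A
  cycle of nonnegative weight goes to the front of an earlier block, and everything in between runs
  at least as high as before. A cycle of negative weight goes to the end of a later block, and what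
  lies in between is spared the decrease. The set of block states is unchanged, so anchoring
  survives.\<close>

lemma extract_cycle:
  assumes l: "l = A @ map Tr c @ B" and c: "c \<noteq> []" "length c \<le> N" "vpath T p0 c p0"
    and path: "ipath T N p l q" and anch: "anchored {} l {}" and fire: "fire x (flatten l)" and x: "0 \<le> x"
  shows "\<exists>l'. ipath T N p l' q \<and> anchored {} l' {} \<and> fire x (flatten l') \<and>
    (\<forall>i. eff (flatten l') i = eff (flatten l) i) \<and> nB l' = nB l \<and> nT l' < nT l"
proof -
  obtain c1 c2 where c12: "c = c1 @ c2" "good_cycle (c2 @ c1)" using good_rotation by blast
  define d where "d = c2 @ c1"
  have wd: "wt d = wt c" "length d = length c" and ed: "\<And>i. eff d i = eff c i" using c12 by (auto simp: d_def)
  obtain r where r: "vpath T p0 c1 r" "vpath T r c2 p0" using c(3) c12(1) by (auto simp: vpath_append)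
  have d: "vpath T r d r" "good_cycle d" "length d \<le> N" using r c12 wd c by (auto simp: d_def vpath_append)
  have ac: "src t \<in> block_states A" "tgt t \<in> block_states B" if "t \<in> set c" for t
    using anch that by (auto simp: l anchored_append anchored_Tr)
  have "r \<in> src ` set c"
  proof (cases c2)
    case Nil
    then show ?thesis using r c(1) c12(1) by (cases c1) auto
  qed (use r c12 in auto)
  moreover have "r \<in> tgt ` set c"
  proof (cases c1 rule: rev_cases)
    case Nil
    then show ?thesis using r c(1) c12(1) by (cases c2 rule: rev_cases) (auto simp: vpath_append)
  qed (use r c12 in \<open>auto simp: vpath_append\<close>)
  ultimately have rA: "r \<in> block_states A" and rB: "r \<in> block_states B" using ac by auto
  obtain p1 where p1: "ipath T N p A p1" "ipath T N p1 B q"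
  proof -
    from path obtain a b where ab: "ipath T N p A a" "vpath T a c b" "ipath T N b B q"
      by (auto simp: l ipath_append ipath_Tr)
    have "a = p0 \<and> b = p0" using vpath_ends[OF ab(2) c(1)] vpath_ends[OF c(3,1)] by simp
    then show thesis using ab that by blast
  qed
  show ?thesis
  proof (cases "0 \<le> wt c")
    case True
    obtain A1 C A2 where A: "A = A1 @ Blk r C # A2" using bs_split[OF rA] by blast
    define l' where "l' = A1 @ Blk r (d # C) # A2 @ B"
    have fl: "fire x (flatten A1)" "fire (x + wt (flatten A1)) (concat C @ flatten A2)"
      "fire (x + wt (flatten A1) + wt (concat C @ flatten A2) + wt c) (flatten B)"
      using fire by (auto simp: l A fire_append add_ac)
    have "0 \<le> x + wt (flatten A1)" using fire_nonneg[OF x fl(1)] .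
    then have "fire (x + wt (flatten A1)) d" using d(2) True wd by (intro good_fire) auto
    moreover have "fire (x + wt (flatten A1) + wt d) (concat C @ flatten A2)"
      by (rule fire_mono[OF fl(2)]) (use True wd in simp)
    ultimately have "fire x (flatten l')" using fl wd by (simp add: l'_def fire_append add_ac)
    moreover have "ipath T N p l' q" using p1 d by (auto simp: l'_def A ipath_append)
    moreover have "anchored {} l' {}" using anch by (auto simp: l'_def l A anchored_append)
    moreover have "eff (flatten l') i = eff (flatten l) i" for i by (simp add: l'_def l A ed)
    moreover have "nB l' = nB l" "nT l' < nT l" using c(1) by (auto simp: l'_def l A)
    ultimately show ?thesis by blast
  next
    case False
    obtain B1 C B2 where B: "B = B1 @ Blk r C # B2" using bs_split[OF rB] by blast
    define l' where "l' = A @ B1 @ Blk r (C @ [d]) # B2"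
    have fl: "fire x (flatten A)" "fire (x + wt (flatten A)) c" "fire (x + wt (flatten A) + wt c) (flatten B1 @ concat C)"
      "fire (x + wt (flatten A) + wt c + wt (flatten B1 @ concat C)) (flatten B2)"
      using fire by (auto simp: l B fire_append add_ac)
    have "0 \<le> x + wt (flatten A)" using fire_nonneg[OF x fl(1)] .
    then have "0 \<le> x + wt (flatten A) + wt c" using fire_nonneg[OF _ fl(2)] by blast
    \<comment> \<open>This is the value at which the moved cycle will end. The old run has the same
      value at this place, hence it is nonnegative.\<close>
    then have v: "0 \<le> x + wt (flatten A) + wt c + wt (flatten B1 @ concat C)" using fire_nonneg[OF _ fl(3)] by blast
    have "fire (x + wt (flatten A)) (flatten B1 @ concat C)"
      by (rule fire_mono[OF fl(3)]) (use False in simp)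
    moreover have "fire (x + wt (flatten A) + wt (flatten B1 @ concat C)) d"
      using d(2) False wd v by (intro good_fire) auto
    ultimately have "fire x (flatten l')" using fl wd by (simp add: l'_def fire_append add_ac)
    moreover have "ipath T N p l' q" using p1 d by (auto simp: l'_def B ipath_append)
    moreover have "anchored {} l' {}" using anch by (auto simp: l'_def l B anchored_append)
    moreover have "eff (flatten l') i = eff (flatten l) i" for i by (simp add: l'_def l B ed)
    moreover have "nB l' = nB l" "nT l' < nT l" using c(1) by (auto simp: l'_def l B)
    ultimately show ?thesis by blast
  qed
qed

text \<open>Pigeonhole: the blocks cut the transitions into \<open>nB l + 1\<close> stretches, one
  of which has at least \<open>N\<close> elements.\<close>

lemma long_factor:
  "N \<ge> 1 \<Longrightarrow> (nB l + 1) * N \<le> nT l \<Longrightarrow> \<exists>A c B. l = A @ map Tr c @ B \<and> length c = N"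
proof (induction "length l" arbitrary: l rule: less_induct)
  case less
  have "\<exists>c l'. l = map Tr c @ l' \<and> (l' = [] \<or> (\<exists>r C l''. l' = Blk r C # l''))"
  proof (induction l)
    case (Cons i l)
    then obtain c l' where "l = map Tr c @ l'" "l' = [] \<or> (\<exists>r C l''. l' = Blk r C # l'')" by blast
    then show ?case
      by (cases i) (metis append_Cons list.map(2), metis append_Nil list.map(1))
  qed auto
  then obtain c l' where l: "l = map Tr c @ l'" "l' = [] \<or> (\<exists>r C l''. l' = Blk r C # l'')" by blast
  show ?case
  proof (cases "N \<le> length c")
    case True
    have "l = [] @ map Tr (take N c) @ (map Tr (drop N c) @ l')"
      by (simp add: l(1) append_assoc[symmetric] map_append[symmetric] del: append_assoc map_append)
    then show ?thesis using True by (metis length_take min.absorb2)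
  next
    case False
    with less.prems l obtain r C l'' where l': "l' = Blk r C # l''" by auto
    have "(nB l'' + 1) * N \<le> nT l''" using less.prems l l' False by simp
    with less.hyps[of l''] less.prems(1) l l' obtain A d B where "l'' = A @ map Tr d @ B" "length d = N" by auto
    then show ?thesis using l l' by (intro exI[of _ "map Tr c @ Blk r C # A"]) auto
  qed
qed

section \<open>Repeated states on a path and the initial placement of blocks\<close>

lemma vpath_split_nth:
  "vpath T p \<pi> q \<Longrightarrow> i \<le> length \<pi> \<Longrightarrow>
    vpath T p (take i \<pi>) ((p # map tgt \<pi>) ! i) \<and> vpath T ((p # map tgt \<pi>) ! i) (drop i \<pi>) q"
proof (induction \<pi> arbitrary: p i)
  case (Cons t \<pi>)
  then show ?case by (cases i) auto
qed simp

text \<open>A path with \<open>card Q\<close> transitions passes through one more position than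
  there are states, so a state repeats.\<close>

lemma find_cycle:
  assumes "vpath T p \<pi> q" "set (p # map tgt \<pi>) \<subseteq> Q" "finite Q" "card Q \<le> length \<pi>"
  shows "\<exists>a c b r. \<pi> = a @ c @ b \<and> c \<noteq> [] \<and> vpath T r c r"
proof -
  let ?ws = "p # map tgt \<pi>"
  have "\<not> distinct ?ws"
  proof
    assume "distinct ?ws"
    then have "length ?ws = card (set ?ws)" by (metis distinct_card)
    also have "\<dots> \<le> card Q" using assms by (intro card_mono) auto
    finally show False using assms(4) by simp
  qed
  then obtain i j where ij: "i < j" "j < length ?ws" "?ws ! i = ?ws ! j"
    unfolding distinct_conv_nth by (metis linorder_neqE_nat)
  let ?c = "take (j - i) (drop i \<pi>)"
  have "vpath T (?ws ! i) (drop i \<pi>) q" using vpath_split_nth[OF assms(1), of i] ij by auto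
  then have "vpath T (?ws ! i) ?c ((?ws ! i # map tgt (drop i \<pi>)) ! (j - i))"
    using vpath_split_nth[of T "?ws ! i" "drop i \<pi>" q "j - i"] ij by auto
  moreover have "(?ws ! i # map tgt (drop i \<pi>)) ! (j - i) = ?ws ! j"
    using ij by (auto simp: nth_Cons' )
  moreover have "\<pi> = take i \<pi> @ ?c @ drop (j - i) (drop i \<pi>)" by (metis append_take_drop_id)
  moreover have "?c \<noteq> []" using ij by auto
  ultimately show ?thesis using ij(3) by metis
qed

text \<open>\<open>S\<close> collects the states visited so far. Empty blocks are put at the first
  visit of a state, when it is not yet in \<open>S\<close>, and at its last visit, when it is not
  entered again. These are the places to which cycles will be moved.\<close>

fun anc :: "nat set \<Rightarrow> nat \<Rightarrow> trans list \<Rightarrow> item list" where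
  "anc S p [] = [Blk p []]"
| "anc S p (t # \<pi>) = (if p \<notin> S \<or> p \<notin> tgt ` set (t # \<pi>) then [Blk p []] else []) @ Tr t # anc (insert p S) (tgt t) \<pi>"

lemma flatten_anc: "flatten (anc S p \<pi>) = \<pi>"
  by (induction S p \<pi> rule: anc.induct) auto

lemma ipath_anc: "vpath T p \<pi> q \<Longrightarrow> ipath T N p (anc S p \<pi>) q"
  by (induction S p \<pi> rule: anc.induct) auto

lemma bs_anc: "insert p (tgt ` set \<pi>) \<subseteq> block_states (anc S p \<pi>)"
  by (induction S p \<pi> rule: anc.induct) auto

lemma anchored_anc: "vpath T p \<pi> q \<Longrightarrow> anchored S (anc S p \<pi>) {}"
proof (induction S p \<pi> rule: anc.induct)
  case (2 S p t \<pi>)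
  then have IH: "anchored (insert p S) (anc (insert p S) (tgt t) \<pi>) {}" by simp
  have "tgt t \<in> block_states (anc (insert p S) (tgt t) \<pi>)" using bs_anc by blast
  with IH 2(2) show ?case by (auto simp: insert_absorb)
qed simp

text \<open>A charging argument: the block of a first visit is paid by a state leaving
  \<open>Q - S\<close>, that of a last visit by a state leaving the set of states still to come, and
  the final block by the last state of that set.\<close>

lemma nB_anc: "finite Q \<Longrightarrow> insert p (tgt ` set \<pi>) \<subseteq> Q \<Longrightarrow>
    nB (anc S p \<pi>) \<le> card (Q - S) + card (insert p (tgt ` set \<pi>))"
proof (induction S p \<pi> rule: anc.induct)
  case (2 S p t \<pi>)
  let ?V = "insert p (tgt ` set (t # \<pi>))" and ?V' = "insert (tgt t) (tgt ` set \<pi>)"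
  have IH: "nB (anc (insert p S) (tgt t) \<pi>) \<le> card (Q - insert p S) + card ?V'" using 2 by auto
  have V: "card ?V' \<le> card ?V" by (intro card_mono) auto
  show ?case
  proof (cases "p \<in> S")
    case False
    have "card (Q - insert p S) < card (Q - S)" using 2 False by (intro psubset_card_mono) auto
    then show ?thesis using IH V False by simp
  next
    case True
    then have eq: "Q - insert p S = Q - S" by auto
    show ?thesis
    proof (cases "p \<in> tgt ` set (t # \<pi>)")
      case True
      then show ?thesis using IH V \<open>p \<in> S\<close> eq by (auto simp del: image_eqI)
    next
      case False
      then have "card ?V = Suc (card ?V')" by simp
      then show ?thesis using IH False eq by simp
    qed
  qed
qed simp

text \<open>Among all forms of the run with at most \<open>2 * card Q\<close> blocks, one with the
  fewest skeleton transitions is taken. If the skeleton were longer than claimed, some stretch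
  between blocks would have \<open>card Q\<close> transitions and contain a short cycle, whose
  extraction keeps the number of blocks and shortens the skeleton.\<close>

theorem run_normal_form:
  assumes path: "vpath T p \<pi> q" and fire: "fire x \<pi>" and x: "0 \<le> x"
    and Q: "finite Q" "p \<in> Q" "tgt ` set T \<subseteq> Q" "src ` set T \<subseteq> Q"
  shows "\<exists>l. ipath T (card Q) p l q \<and> fire x (flatten l) \<and> (\<forall>i. eff (flatten l) i = eff \<pi> i) \<and>
    nB l \<le> 2 * card Q \<and> nT l \<le> (2 * card Q + 1) * card Q"
proof -
  define N where "N = card Q"
  have N1: "N \<ge> 1" using Q by (metis N_def One_nat_def Suc_leI card_gt_0_iff empty_iff)
  define P where "P l \<longleftrightarrow> ipath T N p l q \<and> fire x (flatten l) \<and> (\<forall>i. eff (flatten l) i = eff \<pi> i) \<and>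
    nB l \<le> 2 * N \<and> anchored {} l {}" for l
  have sub: "tgt ` set \<pi> \<subseteq> Q" if "vpath T p \<pi> q" for p \<pi> q
    using that Q(3) by (induction \<pi> arbitrary: p) auto
  have "nB (anc {} p \<pi>) \<le> card (Q - {}) + card (insert p (tgt ` set \<pi>))"
    using Q sub[OF path] by (intro nB_anc) auto
  also have "card (insert p (tgt ` set \<pi>)) \<le> card Q" using Q sub[OF path] by (intro card_mono) auto
  finally have "P (anc {} p \<pi>)"
    using path fire ipath_anc anchored_anc[OF path] by (auto simp: P_def flatten_anc N_def)
  then obtain l where l: "P l" and min: "\<And>l'. P l' \<Longrightarrow> nT l \<le> nT l'"
    using ex_has_least_nat[of P "anc {} p \<pi>" nT] by blast
  have "nT l \<le> (nB l + 1) * N"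
  proof (rule ccontr)
    assume "\<not> nT l \<le> (nB l + 1) * N"
    then obtain A c B where c: "l = A @ map Tr c @ B" "length c = N"
      using long_factor[OF N1, of l] by auto
    from l obtain a b where ab: "ipath T N p A a" "vpath T a c b" by (auto simp: P_def c ipath_append ipath_Tr)
    have "c \<noteq> []" using c(2) N1 by auto
    then have "a \<in> Q" using ab(2) Q(4) by (cases c) auto
    then obtain c1 c0 c2 r where cc: "c = c1 @ c0 @ c2" "c0 \<noteq> []" "vpath T r c0 r"
      using find_cycle[OF ab(2) _ Q(1)] sub[OF ab(2)] c(2) by (auto simp: N_def)
    have "l = (A @ map Tr c1) @ map Tr c0 @ (map Tr c2 @ B)" using c cc by simp
    moreover have "length c0 \<le> N" using c(2) cc(1) by simp
    moreover have lP: "ipath T N p l q" "anchored {} l {}" "fire x (flatten l)" using l by (auto simp: P_def)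
    ultimately obtain l' where
      "ipath T N p l' q" "anchored {} l' {}" "fire x (flatten l')"
      "\<forall>i. eff (flatten l') i = eff (flatten l) i" "nB l' = nB l" "nT l' < nT l"
      using extract_cycle[OF _ cc(2) _ cc(3) lP x] by blast
    then have "P l'" "nT l' < nT l" using l by (auto simp: P_def)
    then show False using min by fastforce
  qed
  also have "\<dots> \<le> (2 * N + 1) * N" using l by (intro mult_le_mono1) (simp add: P_def)
  finally show ?thesis using l by (auto simp: P_def N_def)
qed

section \<open>Accelerated runs with few and small multiplicities\<close>

type_synonym accel = "(trans list \<times> nat) list"

fun apath :: "vass \<Rightarrow> nat \<Rightarrow> accel \<Rightarrow> nat \<Rightarrow> bool" where
  "apath T p [] q \<longleftrightarrow> p = q"
| "apath T p ((c, m) # al) q \<longleftrightarrow> (\<exists>r. vpath T p c r \<and> (m = 1 \<or> r = p) \<and> apath T r al q)"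

text \<open>Only the first and the last of the \<open>m\<close> iterations are tested. The start
  values of the others lie between those of these two, and firing is monotone in the start
  value.\<close>

fun avalid :: "int \<Rightarrow> accel \<Rightarrow> bool" where
  "avalid x [] \<longleftrightarrow> True"
| "avalid x ((c, m) # al) \<longleftrightarrow> 1 \<le> m \<and> fire x c \<and> fire (x + (int m - 1) * wt c) c \<and> avalid (x + int m * wt c) al"

definition aeff :: "accel \<Rightarrow> nat \<Rightarrow> int" where
  "aeff al i = sum_list (map (\<lambda>(c, m). int m * eff c i) al)"

lemma aeff_simps [simp]: "aeff [] i = 0" "aeff ((c, m) # al) i = int m * eff c i + aeff al i" "aeff (al @ al') i = aeff al i + aeff al' i"
  by (simp_all add: aeff_def)

lemma apath_append: "apath T p (al @ al') q \<longleftrightarrow> (\<exists>r. apath T p al r \<and> apath T r al' q)"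
proof (induction al arbitrary: p)
  case (Cons b al)
  obtain c m where "b = (c, m)" by (cases b)
  then show ?case using Cons by simp blast
qed simp

lemma avalid_append: "avalid x (al @ al') \<longleftrightarrow> avalid x al \<and> avalid (x + aeff al 0) al'"
  by (induction x al rule: avalid.induct) (auto simp: add.assoc)

text \<open>With cycles that do not decrease the counter the start value is the lowest, so
  nonnegativity is carried from the left end to the right.\<close>

lemma avalid_nonneg:
  assumes "0 \<le> x" "\<And>c m. (c, m) \<in> set al \<Longrightarrow> good_cycle c \<and> 0 \<le> wt c \<and> 1 \<le> m"
  shows "avalid x al \<and> 0 \<le> x + aeff al 0"
  using assms
proof (induction x al rule: avalid.induct)
  case (2 x c m al)
  have c: "good_cycle c" "0 \<le> wt c" "1 \<le> m" using 2(3)[of c m] by auto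
  have "0 \<le> (int m - 1) * wt c" "0 \<le> int m * wt c" using c by auto
  then have "0 \<le> x + (int m - 1) * wt c" "0 \<le> x + int m * wt c" using 2(2) by auto
  moreover from this have "avalid (x + int m * wt c) al \<and> 0 \<le> x + int m * wt c + aeff al 0"
    using 2(3) by (intro 2(1)) auto
  ultimately show ?case using c 2(2) by (auto intro!: good_fire)
qed simp

text \<open>The mirror image of \<open>avalid_nonneg\<close>: the final value is the lowest, and its
  nonnegativity is carried back to the start.\<close>

lemma avalid_neg:
  assumes "0 \<le> x + aeff al 0" "\<And>c m. (c, m) \<in> set al \<Longrightarrow> good_cycle c \<and> wt c \<le> 0 \<and> 1 \<le> m"
  shows "avalid x al \<and> 0 \<le> x"
  using assms
proof (induction x al rule: avalid.induct)
  case (2 x c m al)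
  have c: "good_cycle c" "wt c \<le> 0" "1 \<le> m" using 2(3)[of c m] by auto
  have IH: "avalid (x + int m * wt c) al \<and> 0 \<le> x + int m * wt c"
    using 2(2,3) by (intro 2(1)) (auto simp: add.assoc)
  have "(int m - 1) * wt c \<le> 0" using c by (simp add: mult_nonneg_nonpos)
  moreover have "int m * wt c \<le> 1 * wt c" using c by (intro mult_right_mono_neg) auto
  moreover have "(int m - 1) * wt c = int m * wt c - wt c" by (simp add: algebra_simps)
  ultimately have "0 \<le> x + (int m - 1) * wt c" "0 \<le> x + (int m - 1) * wt c + wt c" "0 \<le> x" "0 \<le> x + wt c"
    using IH c by linarith+
  then show ?case using c IH by (auto intro!: good_fire)
qed simp

section \<open>From the normal form and multiplicities to accelerated runs\<close>

lemma ipath_nth: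
  "ipath T N p l q \<Longrightarrow> \<exists>st. st 0 = p \<and> st (length l) = q \<and> (\<forall>j < length l. istep T N (st j) (l ! j) (st (Suc j)))"
proof (induction l arbitrary: p)
  case (Cons i l)
  then obtain r st where "istep T N p i r" "st 0 = r" "st (length l) = q"
    "\<forall>j < length l. istep T N (st j) (l ! j) (st (Suc j))" by auto blast
  then show ?case
    by (intro exI[of _ "\<lambda>j. case j of 0 \<Rightarrow> p | Suc j \<Rightarrow> st j"]) (auto split: nat.splits simp: nth_Cons)
qed auto

fun cycles :: "item \<Rightarrow> trans list list" where
  "cycles (Tr t) = []"
| "cycles (Blk r C) = C"

fun skeleton :: "item \<Rightarrow> nat \<Rightarrow> int" where
  "skeleton (Tr t) i = vec t ! i"
| "skeleton (Blk r C) i = 0"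

text \<open>Equal cycles are merged, since a multiplicity is attached to the cycle and not to its
  occurrence. The cycles that do not decrease the N-counter come first, so that nonnegative values
  at both ends of the block suffice.\<close>

fun expand :: "(trans list \<Rightarrow> nat) \<Rightarrow> item \<Rightarrow> accel" where
  "expand y (Tr t) = [([t], 1)]"
| "expand y (Blk r C) = map (\<lambda>c. (c, y c)) (filter (\<lambda>c. y c \<noteq> 0 \<and> 0 \<le> wt c) (remdups C) @
     filter (\<lambda>c. y c \<noteq> 0 \<and> wt c < 0) (remdups C))"

lemma aeff_map: "distinct cs \<Longrightarrow> aeff (map (\<lambda>c. (c, y c)) cs) i = (\<Sum>c \<in> set cs. int (y c) * eff c i)"
  by (induction cs) auto

lemma aeff_expand: "aeff (expand y it) i = skeleton it i + (\<Sum>c \<in> set (cycles it). int (y c) * eff c i)"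
proof (cases it)
  case (Blk r C)
  have "aeff (expand y it) i = (\<Sum>c | c \<in> set C \<and> y c \<noteq> 0 \<and> 0 \<le> wt c. int (y c) * eff c i) +
     (\<Sum>c | c \<in> set C \<and> y c \<noteq> 0 \<and> wt c < 0. int (y c) * eff c i)"
    by (simp add: Blk aeff_map)
  also have "\<dots> = (\<Sum>c \<in> {c. c \<in> set C \<and> y c \<noteq> 0 \<and> 0 \<le> wt c} \<union> {c. c \<in> set C \<and> y c \<noteq> 0 \<and> wt c < 0}. int (y c) * eff c i)"
    by (intro sum.union_disjoint[symmetric]) auto
  also have "\<dots> = (\<Sum>c \<in> set C. int (y c) * eff c i)"
    by (intro sum.mono_neutral_left) auto
  finally show ?thesis by (simp add: Blk)
qed simp

text \<open>Makes the original run a solution of the linear system, with the numbers of occurrences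
  as multiplicities.\<close>

lemma sum_count_list: "(\<Sum>c \<in> set C. int (count_list C c) * eff c i) = eff (concat C) i"
proof (induction C)
  case (Cons d C)
  have "(\<Sum>c \<in> set (d # C). int (count_list (d # C) c) * eff c i)
      = (\<Sum>c \<in> set (d # C). (if c = d then eff c i else 0) + int (count_list C c) * eff c i)"
    by (rule sum.cong) (auto simp: algebra_simps)
  also have "\<dots> = eff d i + (\<Sum>c \<in> set (d # C). int (count_list C c) * eff c i)"
    by (simp add: sum.distrib)
  also have "(\<Sum>c \<in> set (d # C). int (count_list C c) * eff c i) = (\<Sum>c \<in> set C. int (count_list C c) * eff c i)"
    by (intro sum.mono_neutral_right) (auto simp: count_list_0_iff)
  finally show ?case using Cons by simp
qed simp

lemma eff_flat: "eff (flat it) i = skeleton it i + (\<Sum>c \<in> set (cycles it). int (count_list (cycles it) c) * eff c i)"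
  by (cases it) (auto simp: sum_count_list)

lemma length_expand: "length (expand y it) \<le> (case it of Tr t \<Rightarrow> 1 | _ \<Rightarrow> card {c \<in> set (cycles it). y c \<noteq> 0})"
proof (cases it)
  case (Blk r C)
  let ?A = "filter (\<lambda>c. y c \<noteq> 0 \<and> 0 \<le> wt c) (remdups C)" and ?B = "filter (\<lambda>c. y c \<noteq> 0 \<and> wt c < 0) (remdups C)"
  have "distinct (?A @ ?B)" by auto
  then have "length (?A @ ?B) = card (set (?A @ ?B))" by (rule distinct_card[symmetric])
  also have "set (?A @ ?B) = {c \<in> set C. y c \<noteq> 0}" by auto
  finally show ?thesis by (simp add: Blk)
qed simp

text \<open>The increasing cycles are justified from the left end of the block and the decreasing
  ones from the right end; nothing has to be known about the value between the two groups.\<close>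

lemma avalid_expand:
  assumes "istep T N p it q" "0 \<le> x" "0 \<le> x + aeff (expand y it) 0"
  shows "avalid x (expand y it)"
proof (cases it)
  case (Tr t)
  then show ?thesis using assms by simp
next
  case (Blk r C)
  let ?A = "map (\<lambda>c. (c, y c)) (filter (\<lambda>c. y c \<noteq> 0 \<and> 0 \<le> wt c) (remdups C))"
  let ?B = "map (\<lambda>c. (c, y c)) (filter (\<lambda>c. y c \<noteq> 0 \<and> wt c < 0) (remdups C))"
  have g: "good_cycle c" if "c \<in> set C" for c using assms(1) that Blk by auto
  have "avalid x ?A" using g assms(2) by (intro avalid_nonneg[THEN conjunct1]) auto
  moreover have "avalid (x + aeff ?A 0) ?B"
    using g assms(3) Blk by (intro avalid_neg[THEN conjunct1]) (auto simp: add.assoc)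
  ultimately show ?thesis by (simp add: Blk avalid_append)
qed

lemma apath_loops: "\<forall>(c, m) \<in> set al. vpath T p c p \<Longrightarrow> apath T p al p"
  by (induction al) auto

lemma apath_expand: "istep T N p it q \<Longrightarrow> apath T p (expand y it) q"
proof (cases it)
  case (Blk r C)
  assume *: "istep T N p it q"
  have "apath T p (expand y it) p" using * Blk by (intro apath_loops) auto
  then show ?thesis using * Blk by auto
qed auto

lemma concat_upt_Suc: "concat (map f [0..<Suc m]) = concat (map f [0..<m]) @ f m"
  by simp

text \<open>The unknowns are the multiplicities of the cycles in each item and the values of the
  N-counter after each item. The equations fix the total effect on every counter and tie these
  values to the multiplicities; as natural numbers they keep the N-counter nonnegative between
  items. The given run is one solution, and \<open>small_solution\<close> replaces it by a small
  one. \<open>M\<close> bounds coefficients and right-hand sides, and \<open>s\<close> bounds the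
  number of unknowns in use.\<close>

theorem accelerated_run:
  assumes path: "vpath T p \<pi> q" and fire: "fire x \<pi>" and x: "0 \<le> x" "x \<le> V"
    and Q: "finite Q" "p \<in> Q" "tgt ` set T \<subseteq> Q" "src ` set T \<subseteq> Q" and N: "N = card Q"
    and V: "\<And>t i. t \<in> set T \<Longrightarrow> i \<le> k \<Longrightarrow> \<bar>vec t ! i\<bar> \<le> V" "\<And>i. i \<le> k \<Longrightarrow> \<bar>eff \<pi> i\<bar> \<le> 2 * V" "1 \<le> V"
    and M: "int M = (int ((2 * N + 1) * N) + int N + 3) * V"
  shows "\<exists>al s. apath T p al q \<and> avalid x al \<and> (\<forall>i \<le> k. aeff al i = eff \<pi> i) \<and>
    (\<forall>(c, m) \<in> set al. length c \<le> N \<and> m \<le> (s + 1) * (2 * (s + 1) * M) ^ (s + 1)) \<and>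
    length al \<le> (2 * N + 1) * N + s \<and>
    2 ^ s \<le> (2 * (s * M) + 1) ^ (Suc k + ((2 * N + 1) * N + 2 * N))"
proof -
  have V0: "0 \<le> V" using V(3) by simp
  obtain l where l: "ipath T N p l q" "fire x (flatten l)" "\<And>i. eff (flatten l) i = eff \<pi> i"
    "nB l \<le> 2 * N" "nT l \<le> (2 * N + 1) * N"
    using run_normal_form[OF path fire x(1) Q] unfolding N by blast
  define n where "n = length l"
  have n_le: "n \<le> (2 * N + 1) * N + 2 * N" using l(4,5) by (simp add: n_def length_nTB)
  define cs where "cs j = set (cycles (l ! j))" for j
  obtain st where st: "st 0 = p" "st n = q" "\<And>j. j < n \<Longrightarrow> istep T N (st j) (l ! j) (st (Suc j))"
    using ipath_nth[OF l(1)] by (auto simp: n_def)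
  have cs: "vpath T (st j) c (st j)" "good_cycle c" "length c \<le> N" if "j < n" "c \<in> cs j" for j c
    using st(3)[OF that(1)] that(2) by (cases "l ! j"; auto simp: cs_def)+
  have vT: "t \<in> set T" if "vpath T a c b" "t \<in> set c" for a b c t
    using that by (induction c arbitrary: a) auto
  have effc: "\<bar>eff c i\<bar> \<le> int N * V" if "j < n" "c \<in> cs j" "i \<le> k" for j c i
  proof -
    have "\<bar>vec t ! i\<bar> \<le> V" if "t \<in> set c" for t using V(1) vT[OF cs(1)] that \<open>j < n\<close> \<open>c \<in> cs j\<close> \<open>i \<le> k\<close> by blast
    then have "\<bar>sum_list (map (\<lambda>t. vec t ! i) c)\<bar> \<le> int (length c) * V"
    proof (induction c)
      case (Cons t c)
      then have "\<bar>sum_list (map (\<lambda>t. vec t ! i) c)\<bar> \<le> int (length c) * V" "\<bar>vec t ! i\<bar> \<le> V" by auto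
      then show ?case by (simp add: algebra_simps)
    qed simp
    also have "\<dots> \<le> int N * V" using cs(3)[OF that(1,2)] V0 by (intro mult_right_mono) auto
    finally show ?thesis by (simp add: eff_def)
  qed
  define cnt where "cnt j c = count_list (cycles (l ! j)) c" for j c
  define item_eff where "item_eff y j i = skeleton (l ! j) i + (\<Sum>c \<in> cs j. int (y j c) * eff c i)" for y j i
  have flat_sum: "eff (flatten (take m l)) i = (\<Sum>j<m. item_eff cnt j i)" if "m \<le> n" for m i
    using that
  proof (induction m)
    case (Suc m)
    then have "take (Suc m) l = take m l @ [l ! m]" by (simp add: n_def take_Suc_conv_app_nth)
    then show ?case using Suc by (simp add: eff_flat item_eff_def cs_def cnt_def)
  qed simp
  have flat_nonneg: "0 \<le> x + (\<Sum>j<m. item_eff cnt j 0)" if "m \<le> n" for m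
  proof -
    have "fire x (flatten (take m l))" using l(2) append_take_drop_id[of m l] by (metis fire_append flatten_simps(3))
    from fire_nonneg[OF x(1) this] show ?thesis using flat_sum[OF that] by simp
  qed
  define base_sum where "base_sum m i = (\<Sum>j<m. skeleton (l ! j) i)" for m i
  have base_sum: "\<bar>base_sum m i\<bar> \<le> int ((2 * N + 1) * N) * V" if "m \<le> n" "i \<le> k" for m i
  proof -
    have "\<bar>base_sum m i\<bar> \<le> int (nT (take m l)) * V" using that(1)
    proof (induction m)
      case (Suc m)
      have "take (Suc m) l = take m l @ [l ! m]" using Suc.prems by (simp add: n_def take_Suc_conv_app_nth)
      moreover have "\<bar>skeleton (l ! m) i\<bar> \<le> int (nT [l ! m]) * V"
        using st(3)[of m] Suc.prems V(1) that(2) by (cases "l ! m") auto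
      moreover have "\<bar>base_sum m i\<bar> \<le> int (nT (take m l)) * V" using Suc by simp
      ultimately show ?case by (auto simp: base_sum_def algebra_simps)
    qed (simp add: base_sum_def)
    also have "nT (take m l) \<le> nT l" by (metis append_take_drop_id le_add1 nTB_simps(7))
    then have "int (nT (take m l)) * V \<le> int ((2 * N + 1) * N) * V"
      using l(5) V0 by (intro mult_right_mono of_nat_mono) simp_all
    finally show ?thesis .
  qed
  define K where "K = (SIGMA j : {..<n}. cs j)"
  define J where "J = Inl ` K \<union> Inr ` {..<n}"
  define I where "I = Inl ` {..k} \<union> Inr ` {..<n}"
  \<comment> \<open>A column \<open>Inl (j, c)\<close> is a cycle \<open>c\<close> of item
    \<open>j\<close>, a column \<open>Inr j\<close> the counter value after item \<open>j\<close>. A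
    row \<open>Inl i\<close> is the total effect on coordinate \<open>i\<close>, a row
    \<open>Inr m\<close> the balance of the N-counter after item \<open>m\<close>. The effect of the
    skeleton is moved to the right-hand side.\<close>
  define a where "a c i = (case c of
      Inl (j, c) \<Rightarrow> (case i of Inl i \<Rightarrow> eff c i | Inr m \<Rightarrow> if j \<le> m then wt c else 0)
    | Inr j \<Rightarrow> (case i of Inl i \<Rightarrow> 0 | Inr m \<Rightarrow> if j = m then -1 else 0))"
    for c :: "(nat \<times> trans list) + nat" and i :: "nat + nat"
  define b where "b i = (case i of Inl i \<Rightarrow> eff \<pi> i - base_sum n i | Inr m \<Rightarrow> - (x + base_sum (Suc m) 0))" for i :: "nat + nat"
  have finK: "finite K" by (auto simp: K_def cs_def)
  have finJ: "finite J" "finite I" using finK by (auto simp: J_def I_def)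
  have sumJ: "(\<Sum>c\<in>J. f c) = (\<Sum>j<n. \<Sum>c\<in>cs j. f (Inl (j, c))) + (\<Sum>j<n. f (Inr j))" for f :: "(nat \<times> trans list) + nat \<Rightarrow> int"
  proof -
    have "(\<Sum>c\<in>J. f c) = (\<Sum>c\<in>Inl ` K. f c) + (\<Sum>c\<in>Inr ` {..<n}. f c)"
      unfolding J_def using finK by (intro sum.union_disjoint) auto
    also have "(\<Sum>c\<in>Inl ` K. f c) = (\<Sum>jc\<in>K. f (Inl jc))" by (simp add: sum.reindex)
    also have "\<dots> = (\<Sum>j<n. \<Sum>c\<in>cs j. f (Inl (j, c)))" unfolding K_def by (subst sum.Sigma) (auto simp: cs_def split_def)
    also have "(\<Sum>c\<in>Inr ` {..<n}. f c) = (\<Sum>j<n. f (Inr j))" by (simp add: sum.reindex)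
    finally show ?thesis .
  qed
  have row_l: "(\<Sum>c\<in>J. int (y c) * a c (Inl i)) = (\<Sum>j<n. item_eff (\<lambda>j c. y (Inl (j, c))) j i) - base_sum n i" for y i
    by (simp add: sumJ a_def item_eff_def base_sum_def sum.distrib)
  \<comment> \<open>Only the items up to \<open>m\<close> contribute to row \<open>Inr m\<close>,
    and among the counter values only the one after item \<open>m\<close>, with coefficient
    -1.\<close>
  have row_r: "(\<Sum>c\<in>J. int (y c) * a c (Inr m)) = (\<Sum>j<Suc m. item_eff (\<lambda>j c. y (Inl (j, c))) j 0) - base_sum (Suc m) 0 - int (y (Inr m))"
    if "m < n" for y m
  proof -
    have "(\<Sum>j<n. \<Sum>c\<in>cs j. int (y (Inl (j, c))) * a (Inl (j, c)) (Inr m))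
        = (\<Sum>j<n. if j < Suc m then (\<Sum>c\<in>cs j. int (y (Inl (j, c))) * wt c) else 0)"
      by (intro sum.cong) (auto simp: a_def less_Suc_eq_le)
    also have "\<dots> = (\<Sum>j\<in>{..<n} \<inter> {j. j < Suc m}. (\<Sum>c\<in>cs j. int (y (Inl (j, c))) * wt c))"
      by (subst sum.inter_restrict) auto
    also have "{..<n} \<inter> {j. j < Suc m} = {..<Suc m}" using that by auto
    finally have 1: "(\<Sum>j<n. \<Sum>c\<in>cs j. int (y (Inl (j, c))) * a (Inl (j, c)) (Inr m)) = (\<Sum>j<Suc m. \<Sum>c\<in>cs j. int (y (Inl (j, c))) * wt c)" .
    have "(\<Sum>j<n. int (y (Inr j)) * a (Inr j) (Inr m)) = (\<Sum>j<n. if j = m then - int (y (Inr j)) else 0)"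
      by (rule sum.cong) (auto simp: a_def)
    also have "\<dots> = - int (y (Inr m))" using that by simp
    finally have 2: "(\<Sum>j<n. int (y (Inr j)) * a (Inr j) (Inr m)) = - int (y (Inr m))" .
    show ?thesis unfolding sumJ 1 2 item_eff_def base_sum_def sum.distrib by simp
  qed
  \<comment> \<open>The solution given by the run itself: numbers of occurrences and the counter
    values actually reached, which are nonnegative, so \<open>nat\<close> loses nothing.\<close>
  define u where "u c = (case c of Inl (j, c) \<Rightarrow> cnt j c | Inr m \<Rightarrow> nat (x + (\<Sum>j<Suc m. item_eff cnt j 0)))" for c
  have u_cnt: "(\<lambda>j c. u (Inl (j, c))) = cnt" by (simp add: u_def fun_eq_iff)
  have sol: "(\<Sum>c\<in>J. int (u c) * a c i) = b i" if i: "i \<in> I" for i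
  proof (cases i)
    case (Inl i')
    have "(\<Sum>j<n. item_eff cnt j i') = eff \<pi> i'" using flat_sum[of n i'] l(3)[of i'] by (simp add: n_def)
    then show ?thesis by (simp add: Inl row_l u_cnt b_def)
  next
    case (Inr m)
    then have m: "m < n" using i by (auto simp: I_def)
    have "int (u (Inr m)) = x + (\<Sum>j<Suc m. item_eff cnt j 0)"
      using flat_nonneg[of "Suc m"] m unfolding u_def by simp
    then show ?thesis unfolding Inr row_r[OF m] u_cnt by (simp add: b_def)
  qed
  \<comment> \<open>The summands of \<open>M\<close> stand for the skeleton and for one cycle, with
    room for the total effect or the start value.\<close>
  have Mge: "int N * V \<le> int M" "int ((2 * N + 1) * N) * V + 2 * V \<le> int M" "1 \<le> int M"
  proof -
    have M': "int M = int ((2 * N + 1) * N) * V + int N * V + 3 * V" unfolding M by (simp add: algebra_simps)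
    have "0 \<le> int ((2 * N + 1) * N) * V" "0 \<le> int N * V" using V0 by simp_all
    then show "int N * V \<le> int M" "int ((2 * N + 1) * N) * V + 2 * V \<le> int M" "1 \<le> int M"
      using M' V(3) by linarith+
  qed
  have aM: "\<bar>a c i\<bar> \<le> int M" if "c \<in> J" "i \<in> I" for i c
  proof (cases c)
    case (Inl jc)
    obtain j c' where jc: "jc = (j, c')" by (cases jc)
    have "j < n" "c' \<in> cs j" using that(1) by (auto simp: J_def K_def Inl jc)
    then have "\<bar>eff c' i'\<bar> \<le> int M" if "i' \<le> k" for i' using effc that Mge(1) by force
    then show ?thesis using that(2) Mge by (auto simp: Inl jc a_def I_def)
  next
    case (Inr j)
    then show ?thesis using Mge(3) that(2) by (auto simp: a_def I_def)
  qed
  have bM: "\<bar>b i\<bar> \<le> int M" if i: "i \<in> I" for i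
  proof (cases i)
    case (Inl i')
    then have "i' \<le> k" using i by (auto simp: I_def)
    then show ?thesis using V(2)[of i'] base_sum[of n i'] Mge(2) by (auto simp: Inl b_def abs_le_iff)
  next
    case (Inr m)
    then have m: "m < n" using i by (auto simp: I_def)
    then have "\<bar>base_sum (Suc m) 0\<bar> \<le> int ((2 * N + 1) * N) * V" using base_sum[of "Suc m" 0] by simp
    then show ?thesis using x V0 Mge(2) by (simp add: Inr b_def abs_le_iff)
  qed
  have "M \<ge> 1" using Mge(3) by simp
  from small_solution[where a = a and b = b and x = u, OF finJ this aM bM sol] obtain y s where y:
    "\<And>i. i \<in> I \<Longrightarrow> (\<Sum>c\<in>J. int (y c) * a c i) = b i" "{c \<in> J. y c \<noteq> 0} \<subseteq> {c \<in> J. u c \<noteq> 0}"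
    "card {c \<in> J. y c \<noteq> 0} \<le> s" "2 ^ s \<le> (2 * (s * M) + 1) ^ card I"
    "\<And>c. c \<in> J \<Longrightarrow> y c \<le> (s + 1) * (2 * (s + 1) * M) ^ (s + 1)" by blast
  define z where "z j c = y (Inl (j, c))" for j c
  have z: "(\<lambda>j c. y (Inl (j, c))) = z" by (simp add: z_def fun_eq_iff)
  have z_tot: "(\<Sum>j<n. item_eff z j i) = eff \<pi> i" if "i \<le> k" for i
    using y(1)[of "Inl i"] that by (simp add: I_def row_l z b_def)
  \<comment> \<open>Row \<open>Inr m'\<close> equates the counter value after item \<open>m'\<close>
    with the natural number \<open>y (Inr m')\<close>.\<close>
  have z_nonneg: "0 \<le> x + (\<Sum>j<m. item_eff z j 0)" if "m \<le> n" for m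
  proof (cases m)
    case (Suc m')
    then have m': "m' < n" using that by simp
    then have "(\<Sum>j<Suc m'. item_eff z j 0) - base_sum (Suc m') 0 - int (y (Inr m')) = - (x + base_sum (Suc m') 0)"
      using y(1)[of "Inr m'"] unfolding row_r[OF m'] z by (simp add: I_def b_def)
    then show ?thesis using Suc by simp
  qed (use x in simp)
  define ex where "ex j = expand (z j) (l ! j)" for j
  have ex_eff: "aeff (ex j) i = item_eff z j i" for j i
    by (simp add: ex_def aeff_expand item_eff_def cs_def)
  have pref: "apath T p (concat (map ex [0..<m])) (st m) \<and> avalid x (concat (map ex [0..<m])) \<and>
     (\<forall>i. aeff (concat (map ex [0..<m])) i = (\<Sum>j<m. item_eff z j i))" if "m \<le> n" for m
    using that
  proof (induction m)
    case 0 then show ?case by (simp add: st)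
  next
    case (Suc m)
    then have IH: "apath T p (concat (map ex [0..<m])) (st m)" "avalid x (concat (map ex [0..<m]))"
      "\<And>i. aeff (concat (map ex [0..<m])) i = (\<Sum>j<m. item_eff z j i)" by auto
    have s: "istep T N (st m) (l ! m) (st (Suc m))" using st(3) Suc.prems by simp
    have "apath T (st m) (ex m) (st (Suc m))" unfolding ex_def by (rule apath_expand[OF s])
    moreover have "avalid (x + (\<Sum>j<m. item_eff z j 0)) (ex m)"
      unfolding ex_def
    proof (rule avalid_expand[OF s])
      show "0 \<le> x + (\<Sum>j<m. item_eff z j 0)" using z_nonneg[of m] Suc.prems by simp
      show "0 \<le> x + (\<Sum>j<m. item_eff z j 0) + aeff (expand (z m) (l ! m)) 0"
        using z_nonneg[of "Suc m"] Suc.prems ex_eff[of m 0] by (simp add: ex_def add.assoc)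
    qed
    ultimately show ?case unfolding concat_upt_Suc using IH ex_eff by (auto simp: apath_append avalid_append)
  qed
  define al where "al = concat (map ex [0..<n])"
  \<comment> \<open>The length is at most the number of skeleton transitions plus the number of
    cycles in use; the latter correspond to distinct nonzero unknowns, of which there are at most
    \<open>s\<close>.\<close>
  have len: "length (concat (map ex [0..<m])) \<le> nT (take m l) + card {c \<in> Inl ` (SIGMA j : {..<m}. cs j). y c \<noteq> 0}" if "m \<le> n" for m
    using that
  proof (induction m)
    case (Suc m)
    let ?A = "{c \<in> Inl ` (SIGMA j : {..<m}. cs j). y c \<noteq> 0}" and ?B = "Inl ` Pair m ` {c \<in> cs m. z m c \<noteq> 0} :: ((nat \<times> trans list) + nat) set"
    have "{c \<in> Inl ` (SIGMA j : {..<Suc m}. cs j). y c \<noteq> 0} = ?A \<union> ?B"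
      by (auto simp: z_def less_Suc_eq)
    moreover have "card (?A \<union> ?B) = card ?A + card ?B" by (intro card_Un_disjoint) (auto simp: cs_def)
    moreover have "card ?B = card {c \<in> cs m. z m c \<noteq> 0}" by (simp add: card_image inj_on_def)
    moreover have "take (Suc m) l = take m l @ [l ! m]" using Suc.prems by (simp add: n_def take_Suc_conv_app_nth)
    moreover have "length (ex m) \<le> nT [l ! m] + card {c \<in> cs m. z m c \<noteq> 0}"
      using length_expand[of "z m" "l ! m"] by (cases "l ! m") (auto simp: ex_def cs_def)
    ultimately show ?case using Suc by simp
  qed simp
  have "card {c \<in> Inl ` (SIGMA j : {..<n}. cs j). y c \<noteq> 0} \<le> card {c \<in> J. y c \<noteq> 0}"
    using finJ by (intro card_mono) (auto simp: J_def K_def)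
  then have "length al \<le> nT l + s" using len[of n] y(3) by (simp add: al_def n_def)
  moreover have "length c \<le> N \<and> m \<le> (s + 1) * (2 * (s + 1) * M) ^ (s + 1)" if "(c, m) \<in> set al" for c m
  proof -
    from that obtain j where j: "j < n" "(c, m) \<in> set (ex j)" by (auto simp: al_def)
    show ?thesis
    proof (cases "l ! j")
      case (Tr t)
      have "N \<noteq> 0" using Q(1,2) N by auto
      moreover have "0 < (s + 1) * (2 * (s + 1) * M) ^ (s + 1)"
        using \<open>M \<ge> 1\<close> by (intro mult_pos_pos zero_less_power) auto
      moreover have "c = [t]" "m = 1" using j(2) Tr by (auto simp: ex_def)
      ultimately show ?thesis by (simp del: mult_Suc power_Suc)
    next
      case (Blk r C)
      then have "m = z j c" "c \<in> cs j" using j(2) by (auto simp: ex_def cs_def)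
      moreover from this have "Inl (j, c) \<in> J" using j(1) by (auto simp: J_def K_def)
      ultimately show ?thesis using cs(3) j(1) y(5) by (auto simp: z_def)
    qed
  qed
  moreover have "card I = Suc k + n"
    unfolding I_def by (subst card_Un_disjoint) (auto simp: card_image)
  then have "2 ^ s \<le> (2 * (s * M) + 1) ^ (Suc k + ((2 * N + 1) * N + 2 * N))"
    using y(4) n_le by (elim order_trans) (intro power_increasing, simp_all del: mult_Suc)
  ultimately show ?thesis using pref[of n] z_tot l(5) st(2)
    by (intro exI[of _ al] exI[of _ s]) (auto simp: al_def)
qed

section \<open>Turing machines over arbitrary finite sets\<close>

text \<open>The step function of \<open>tm_step\<close> for states and symbols of any type, so that
  a machine can be written with datatypes.\<close>

definition astep :: "('q \<Rightarrow> 'a \<Rightarrow> 'q \<times> 'a \<times> int) \<Rightarrow> 'q \<Rightarrow> 'q \<times> (int \<Rightarrow> 'a) \<times> int \<Rightarrow> 'q \<times> (int \<Rightarrow> 'a) \<times> int" where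
  "astep \<delta> acc c = (case c of (q, tp, h) \<Rightarrow>
     if q = acc then (q, tp, h)
     else (case \<delta> q (tp h) of (q', a', d) \<Rightarrow> (q', tp(h := a'), h + d)))"

text \<open>States and symbols are numbered by injections. The numbering of symbols has to send
  \<open>\<iota> i\<close> back to \<open>i\<close>, because input symbols and the blank are
  prescribed numbers; all other symbols receive codes from 8 on.\<close>

lemma abstract_tm:
  fixes \<delta> :: "'q \<Rightarrow> 'a \<Rightarrow> 'q \<times> 'a \<times> int" and \<iota> :: "nat \<Rightarrow> 'a"
  assumes fin: "finite Q" "finite \<Gamma>" and s0: "s0 \<in> Q" and acc: "acc \<in> Q"
    and inj: "inj_on \<iota> {..<8}" and sub: "\<iota> ` {..<8} \<subseteq> \<Gamma>"
    and closed: "\<And>q a. q \<in> Q \<Longrightarrow> a \<in> \<Gamma> \<Longrightarrow>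
      (case \<delta> q a of (q', a', d) \<Rightarrow> q' \<in> Q \<and> a' \<in> \<Gamma> \<and> d \<in> {-1, 0, 1})"
  shows "\<exists>M. tm_wf M \<and> (\<forall>w t. set w \<subseteq> {..<8} \<longrightarrow>
    (tm_accepts_within M w t \<longleftrightarrow> (\<exists>i \<le> t. fst ((astep \<delta> acc ^^ i)
       (s0, \<lambda>i. if 0 \<le> i \<and> i < int (length w) then \<iota> (w ! nat i) else \<iota> 0, 0)) = acc)))"
proof -
  obtain eq n where eq: "inj_on eq Q" "eq ` Q = {i::nat. i < n}"
    using finite_imp_inj_to_nat_seg[OF fin(1)] by metis
  obtain g m where g: "inj_on g \<Gamma>" "g ` \<Gamma> = {i::nat. i < m}"
    using finite_imp_inj_to_nat_seg[OF fin(2)] by metis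
  define ea where "ea a = (if a \<in> \<iota> ` {..<8} then inv_into {..<8} \<iota> a else g a + 8)" for a
  have ea_iota: "ea (\<iota> i) = i" if "i < 8" for i
    using that inj by (auto simp: ea_def inv_into_f_f)
  have small: "ea a < 8 \<longleftrightarrow> a \<in> \<iota> ` {..<8}" for a
    using inv_into_into[of a \<iota> "{..<8}"] by (auto simp: ea_def)
  have ea_inj: "inj_on ea \<Gamma>"
  proof (rule inj_onI)
    fix a b assume ab: "a \<in> \<Gamma>" "b \<in> \<Gamma>" "ea a = ea b"
    show "a = b"
    proof (cases "a \<in> \<iota> ` {..<8}")
      case True
      then have "b \<in> \<iota> ` {..<8}" using small ab(3) by metis
      then show ?thesis using True ab(3) by (auto simp: ea_iota)
    next
      case False
      then have "b \<notin> \<iota> ` {..<8}" using small ab(3) by metis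
      with False ab g(1) show ?thesis by (auto simp: ea_def inj_on_def)
    qed
  qed
  have ea_lt: "ea a < m + 8" if "a \<in> \<Gamma>" for a
  proof (cases "a \<in> \<iota> ` {..<8}")
    case True then show ?thesis using small[of a] by simp
  next
    case False
    moreover have "g a < m" using that g(2) by blast
    ultimately show ?thesis by (simp add: ea_def)
  qed
  have eq_lt: "eq q < n" if "q \<in> Q" for q using that eq(2) by blast
  define dq where "dq = inv_into Q eq"
  define da where "da = inv_into \<Gamma> ea"
  have dq: "dq (eq q) = q" if "q \<in> Q" for q using that eq(1) by (simp add: dq_def)
  have da: "da (ea a) = a" if "a \<in> \<Gamma>" for a using that ea_inj by (simp add: da_def)
  \<comment> \<open>Codes that denote no state or no symbol loop in place; the simulated computation
    never meets them.\<close>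
  define D where "D q a = (if q \<in> eq ` Q \<and> a \<in> ea ` \<Gamma>
     then (case \<delta> (dq q) (da a) of (q', a', d) \<Rightarrow> (eq q', ea a', d)) else (q, a, 0))" for q a
  define M where "M = \<lparr>tm_nstates = n, tm_nsyms = m + 8, tm_start = eq s0, tm_acc = eq acc, tm_delta = D\<rparr>"
  have D: "D (eq q) (ea a) = (case \<delta> q a of (q', a', d) \<Rightarrow> (eq q', ea a', d))" if "q \<in> Q" "a \<in> \<Gamma>" for q a
    using that by (simp add: D_def dq da)
  have wf: "tm_wf M"
    unfolding tm_wf_def
  proof (intro conjI allI impI)
    show "tm_start M < tm_nstates M" "tm_acc M < tm_nstates M" "8 \<le> tm_nsyms M"
      using eq_lt s0 acc by (auto simp: M_def)
    fix q a assume *: "q < tm_nstates M" "a < tm_nsyms M"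
    show "case tm_delta M q a of (q', a', d) \<Rightarrow> q' < tm_nstates M \<and> a' < tm_nsyms M \<and> d \<in> {- 1, 0, 1}"
    proof (cases "q \<in> eq ` Q \<and> a \<in> ea ` \<Gamma>")
      case True
      then obtain q0 a0 where "q0 \<in> Q" "q = eq q0" "a0 \<in> \<Gamma>" "a = ea a0" by blast
      then show ?thesis using closed[of q0 a0] eq_lt ea_lt
        by (auto simp: M_def D split: prod.splits)
    next
      case False
      then have "tm_delta M q a = (q, a, 0)" by (auto simp: M_def D_def)
      then show ?thesis using * by simp
    qed
  qed
  define C where "C c = (case c of (q, tp, h) \<Rightarrow> (eq q, (\<lambda>i. ea (tp i)), h))" for c :: "'q \<times> (int \<Rightarrow> 'a) \<times> int"
  define ok where "ok c = (case c of (q, tp, h) \<Rightarrow> q \<in> Q \<and> (\<forall>i. tp i \<in> \<Gamma>))" for c :: "'q \<times> (int \<Rightarrow> 'a) \<times> int"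
  have step: "ok (astep \<delta> acc c) \<and> tm_step M (C c) = C (astep \<delta> acc c)" if okc: "ok c" for c
  proof -
    obtain q tp h where c: "c = (q, tp, h)" by (cases c) auto
    have q: "q \<in> Q" and tp: "\<And>i. tp i \<in> \<Gamma>" using okc by (auto simp: ok_def c)
    show ?thesis
    proof (cases "q = acc")
      case True
      then show ?thesis using okc by (simp add: c astep_def tm_step_def C_def M_def)
    next
      case False
      have "eq q \<noteq> eq acc" using False eq(1) q acc by (auto simp: inj_on_def)
      moreover obtain q' a' d where dd: "\<delta> q (tp h) = (q', a', d)" by (cases "\<delta> q (tp h)") auto
      moreover have "q' \<in> Q" "a' \<in> \<Gamma>" using closed[OF q tp[of h]] dd by auto
      ultimately show ?thesis using False q tp
        by (auto simp: c astep_def tm_step_def C_def M_def D ok_def)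
    qed
  qed
  have iter: "ok ((astep \<delta> acc ^^ i) c) \<and> (tm_step M ^^ i) (C c) = C ((astep \<delta> acc ^^ i) c)" if "ok c" for c i
    using that by (induction i) (auto simp: step)
  have final: "tm_accepts_within M w t \<longleftrightarrow> (\<exists>i \<le> t. fst ((astep \<delta> acc ^^ i)
       (s0, \<lambda>i. if 0 \<le> i \<and> i < int (length w) then \<iota> (w ! nat i) else \<iota> 0, 0)) = acc)"
    if w: "set w \<subseteq> {..<8}" for w t
  proof -
    let ?c = "(s0, \<lambda>i. if 0 \<le> i \<and> i < int (length w) then \<iota> (w ! nat i) else \<iota> 0, 0) :: 'q \<times> (int \<Rightarrow> 'a) \<times> int"
    have wi: "w ! nat i < 8" if "0 \<le> i" "i < int (length w)" for i
      using w that by (metis lessThan_iff nat_less_iff nth_mem subsetD)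
    have okc: "ok ?c" using s0 sub wi by (auto simp: ok_def)
    have init: "tm_init M w = C ?c"
      using wi by (auto simp: tm_init_def C_def M_def ea_iota fun_eq_iff)
    have "fst ((tm_step M ^^ i) (tm_init M w)) = tm_acc M \<longleftrightarrow> fst ((astep \<delta> acc ^^ i) ?c) = acc" for i
    proof -
      obtain q tp h where c: "(astep \<delta> acc ^^ i) ?c = (q, tp, h)" by (cases "(astep \<delta> acc ^^ i) ?c") auto
      have "q \<in> Q" using iter[OF okc, of i] c by (simp add: ok_def)
      have "fst ((tm_step M ^^ i) (tm_init M w)) = eq q" unfolding init using iter[OF okc, of i] c by (simp add: C_def)
      then show ?thesis using eq(1) \<open>q \<in> Q\<close> acc c by (auto simp: M_def inj_on_def)
    qed
    then show ?thesis unfolding tm_accepts_within_def by simp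
  qed
  show ?thesis using wf final by blast
qed

section \<open>Scanning moves and acceptance of abstract machines\<close>

lemma astep_move: "q \<noteq> acc \<Longrightarrow> \<delta> q (tp h) = (q', a', d) \<Longrightarrow>
    astep \<delta> acc (q, tp, h) = (q', tp(h := a'), h + d)"
  by (simp add: astep_def)

lemma astep_acc: "(astep \<delta> acc ^^ i) (acc, tp, h) = (acc, tp, h)"
  by (induction i) (auto simp: astep_def)

lemma astep_stuck: "(astep \<delta> acc ^^ i) (q, tp, h) = (q, tp, h)" if "\<delta> q (tp h) = (q, tp h, 0)"
  using that by (induction i) (auto simp: astep_def)

text \<open>The machine is deterministic and its accepting state absorbing, so acceptance can be
  judged from any later configuration.\<close>

lemma astep_accepts_later:
  assumes "(astep \<delta> acc ^^ n) c = c'"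
  shows "(\<exists>i. fst ((astep \<delta> acc ^^ i) c) = acc) \<longleftrightarrow> (\<exists>i. fst ((astep \<delta> acc ^^ i) c') = acc)"
proof
  assume "\<exists>i. fst ((astep \<delta> acc ^^ i) c) = acc"
  then obtain i tp h where i: "(astep \<delta> acc ^^ i) c = (acc, tp, h)" by (metis prod.collapse)
  have "(astep \<delta> acc ^^ i) c' = (astep \<delta> acc ^^ n) ((astep \<delta> acc ^^ i) c)"
    unfolding assms[symmetric] by (metis add.commute comp_apply funpow_add)
  then show "\<exists>i. fst ((astep \<delta> acc ^^ i) c') = acc" using i astep_acc by (metis fst_conv)
next
  assume "\<exists>i. fst ((astep \<delta> acc ^^ i) c') = acc"
  then obtain i where "fst ((astep \<delta> acc ^^ i) c') = acc" by blast
  then have "fst ((astep \<delta> acc ^^ (i + n)) c) = acc" using assms by (simp add: funpow_add)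
  then show "\<exists>i. fst ((astep \<delta> acc ^^ i) c) = acc" by blast
qed

lemma astep_right:
  assumes "q \<noteq> acc" "\<And>i. h \<le> i \<Longrightarrow> i < h + int n \<Longrightarrow> \<delta> q (tp i) = (q, tp i, 1)"
  shows "(astep \<delta> acc ^^ n) (q, tp, h) = (q, tp, h + int n)"
  using assms(2)
proof (induction n)
  case (Suc n)
  have "(astep \<delta> acc ^^ n) (q, tp, h) = (q, tp, h + int n)" by (rule Suc.IH) (auto intro: Suc.prems)
  moreover have "\<delta> q (tp (h + int n)) = (q, tp (h + int n), 1)" by (rule Suc.prems) auto
  ultimately show ?case using assms(1) by (simp add: astep_move)
qed simp

lemma astep_left:
  assumes "q \<noteq> acc" "\<And>i. h - int n < i \<Longrightarrow> i \<le> h \<Longrightarrow> \<delta> q (tp i) = (q, tp i, -1)"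
  shows "(astep \<delta> acc ^^ n) (q, tp, h) = (q, tp, h - int n)"
  using assms(2)
proof (induction n)
  case (Suc n)
  have "(astep \<delta> acc ^^ n) (q, tp, h) = (q, tp, h - int n)" by (rule Suc.IH) (auto intro: Suc.prems)
  moreover have "\<delta> q (tp (h - int n)) = (q, tp (h - int n), -1)" by (rule Suc.prems) auto
  ultimately show ?case using assms(1) by (simp add: astep_move)
qed simp

section \<open>Nondeterministic queue machines\<close>

text \<open>Register 0 holds the input, the other registers are work queues.\<close>

datatype act = Pop nat nat | Push nat nat

type_synonym store = "nat \<Rightarrow> nat list"
type_synonym edge = "nat \<times> act option \<times> nat"

fun step_act :: "act \<Rightarrow> store \<Rightarrow> store option" where
  "step_act (Pop r a) \<sigma> = (case \<sigma> r of [] \<Rightarrow> None | b # bs \<Rightarrow> if b = a then Some (\<sigma>(r := bs)) else None)"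
| "step_act (Push r a) \<sigma> = Some (\<sigma>(r := \<sigma> r @ [a]))"

fun step_opt :: "act option \<Rightarrow> store \<Rightarrow> store option" where
  "step_opt None \<sigma> = Some \<sigma>"
| "step_opt (Some x) \<sigma> = step_act x \<sigma>"

inductive nrun :: "edge list \<Rightarrow> nat \<Rightarrow> store \<Rightarrow> nat \<Rightarrow> nat \<Rightarrow> store \<Rightarrow> bool" for E where
  nrun_refl: "nrun E q \<sigma> 0 q \<sigma>"
| nrun_step: "(q, x, q1) \<in> set E \<Longrightarrow> step_opt x \<sigma> = Some \<sigma>1 \<Longrightarrow> nrun E q1 \<sigma>1 n q' \<sigma>' \<Longrightarrow>
    nrun E q \<sigma> (Suc n) q' \<sigma>'"

text \<open>The certificate is read as a list of edge numbers in unary: each False advances the pointer j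
  into the edge list, a True fires the edge pointed to.\<close>

definition sel :: "edge list \<Rightarrow> nat \<times> nat \<times> store \<Rightarrow> bool \<Rightarrow> (nat \<times> nat \<times> store) option" where
  "sel E s b = (case s of (q, j, \<sigma>) \<Rightarrow>
     if b then (if j < length E \<and> fst (E ! j) = q
                then map_option (\<lambda>\<sigma>'. (snd (snd (E ! j)), 0, \<sigma>')) (step_opt (fst (snd (E ! j))) \<sigma>) else None)
     else (if Suc j < length E then Some (q, Suc j, \<sigma>) else None))"

text \<open>Acceptance may precede the end of the certificate, since the Turing machine halts as
  soon as it accepts. The pointer has to be 0 because the accepting state will be
  \<open>Home qf 0\<close>.\<close>

fun sel_accepts :: "edge list \<Rightarrow> nat \<Rightarrow> nat \<times> nat \<times> store \<Rightarrow> bool list \<Rightarrow> bool" where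
  "sel_accepts E qf s [] \<longleftrightarrow> fst s = qf \<and> fst (snd s) = 0"
| "sel_accepts E qf s (b # c) \<longleftrightarrow> fst s = qf \<and> fst (snd s) = 0 \<or>
     (\<exists>s'. sel E s b = Some s' \<and> sel_accepts E qf s' c)"

lemma sel_accepts_sound:
  "sel_accepts E qf (q, j, \<sigma>) c \<Longrightarrow> \<exists>n \<sigma>'. nrun E q \<sigma> n qf \<sigma>'"
proof (induction c arbitrary: q j \<sigma>)
  case Nil
  then show ?case by (auto intro: nrun_refl)
next
  case (Cons b c)
  show ?case
  proof (cases "q = qf \<and> j = 0")
    case True
    then show ?thesis by (auto intro: nrun_refl)
  next
    case False
    then obtain q' j' \<sigma>' where s: "sel E (q, j, \<sigma>) b = Some (q', j', \<sigma>')" "sel_accepts E qf (q', j', \<sigma>') c"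
      using Cons.prems by auto
    from Cons.IH[OF s(2)] obtain n \<sigma>'' where n: "nrun E q' \<sigma>' n qf \<sigma>''" by blast
    show ?thesis
    proof (cases b)
      case True
      with s(1) have "(q, fst (snd (E ! j)), q') \<in> set E" "step_opt (fst (snd (E ! j))) \<sigma> = Some \<sigma>'"
        by (auto simp: sel_def split: if_splits)
      then show ?thesis using n by (blast intro: nrun_step)
    next
      case False
      with s(1) n show ?thesis by (auto simp: sel_def split: if_splits)
    qed
  qed
qed

text \<open>The pointer value \<open>j\<close> is produced from 0 by \<open>j\<close> bits False;
  this turns an edge number into a part of the certificate.\<close>

lemma sel_accepts_advance:
  assumes "sel_accepts E qf (q, j, \<sigma>) c" "j < length E"
  shows "\<exists>c'. length c' = j + length c \<and> sel_accepts E qf (q, 0, \<sigma>) c'"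
  using assms
proof (induction j arbitrary: c)
  case (Suc j)
  then have "sel_accepts E qf (q, j, \<sigma>) (False # c)" by (auto simp: sel_def)
  then show ?case using Suc.IH[of "False # c"] Suc.prems by auto
qed auto

text \<open>Edge \<open>j\<close> costs \<open>j + 1\<close> bits, which is at most
  \<open>length E\<close>.\<close>

lemma sel_accepts_complete:
  "nrun E q \<sigma> n qf \<sigma>' \<Longrightarrow> \<exists>c. length c \<le> n * length E \<and> sel_accepts E qf (q, 0, \<sigma>) c"
proof (induction n arbitrary: q \<sigma>)
  case 0
  then have "q = qf" by (cases rule: nrun.cases) auto
  then show ?case by (intro exI[of _ "[]"]) auto
next
  case (Suc n)
  from Suc.prems obtain x q1 \<sigma>1 where e: "(q, x, q1) \<in> set E" "step_opt x \<sigma> = Some \<sigma>1" "nrun E q1 \<sigma>1 n qf \<sigma>'"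
    by (cases rule: nrun.cases) auto
  from Suc.IH[OF e(3)] obtain c where c: "length c \<le> n * length E" "sel_accepts E qf (q1, 0, \<sigma>1) c" by blast
  from e(1) obtain j where j: "j < length E" "E ! j = (q, x, q1)" by (metis in_set_conv_nth)
  have "sel_accepts E qf (q, j, \<sigma>) (True # c)" using c e j by (auto simp: sel_def)
  then obtain c' where "length c' = j + length (True # c)" "sel_accepts E qf (q, 0, \<sigma>) c'"
    using sel_accepts_advance j(1) by blast
  then show ?case using c j(1) by (intro exI[of _ c']) auto
qed

section \<open>Simulation by a Turing machine\<close>

text \<open>Tape layout: cell -1-j holds the j-th entries of all work queues (0: never used, 1: popped,
  a+2: symbol a); cells from 0 on hold the input, the separator (9 once it has been popped) and the
  certificate, with 8 for consumed symbols.\<close>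

datatype sy = Rc nat | Lc "nat \<Rightarrow> nat"

text \<open>\<open>Home\<close> crosses the input to the right, \<open>Sk\<close> skips spent
  certificate bits, \<open>Bk\<close> walks back to cell -1 with a pending action, \<open>Do\<close>
  searches the queue cells, \<open>Inn\<close> pops from the input, \<open>Rt\<close> returns to
  cell 0, and \<open>Rej\<close> is a dead end.\<close>

datatype st = Home nat nat | Sk nat nat | Bk "act option" nat nat | Do act nat | Inn nat nat | Rt nat | Rej

fun qm_delta :: "edge list \<Rightarrow> st \<Rightarrow> sy \<Rightarrow> st \<times> sy \<times> int" where
  "qm_delta E (Home q j) (Rc s) = ((if s = 7 \<or> s = 9 then Sk q j else Home q j), Rc s, 1)"
| "qm_delta E (Sk q j) (Rc s) =
     (if s = 8 then (Sk q j, Rc 8, 1)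
      else if s = 1 \<and> Suc j < length E then (Bk None q (Suc j), Rc 8, -1)
      else if s = 2 \<and> j < length E \<and> fst (E ! j) = q
        then (Bk (fst (snd (E ! j))) (snd (snd (E ! j))) 0, Rc 8, -1)
      else (Rej, Rc s, 0))"
| "qm_delta E (Bk x q j) (Rc s) = (Bk x q j, Rc s, -1)"
| "qm_delta E (Bk None q j) (Lc f) = (Home q j, Lc f, 1)"
| "qm_delta E (Bk (Some (Pop r a)) q j) (Lc f) = (if r = 0 then (Inn a q, Lc f, 1) else (Do (Pop r a) q, Lc f, 0))"
| "qm_delta E (Bk (Some (Push r a)) q j) (Lc f) = (Do (Push r a) q, Lc f, 0)"
| "qm_delta E (Inn a q) (Rc s) = (if s = 8 then (Inn a q, Rc 8, 1)
     else if s = a \<and> a \<le> 7 then (Bk None q 0, Rc (if a = 7 then 9 else 8), -1) else (Rej, Rc s, 0))"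
| "qm_delta E (Do (Push r a) q) (Lc f) =
     (if f r = 0 then (Rt q, Lc (f(r := a + 2)), 1) else (Do (Push r a) q, Lc f, -1))"
| "qm_delta E (Do (Pop r a) q) (Lc f) =
     (if f r = 1 then (Do (Pop r a) q, Lc f, -1)
      else if f r = a + 2 then (Rt q, Lc (f(r := 1)), 1) else (Rej, Lc f, 0))"
| "qm_delta E (Rt q) (Lc f) = (Rt q, Lc f, 1)"
| "qm_delta E (Rt q) (Rc s) = (Home q 0, Rc s, 0)"
| "qm_delta E s x = (Rej, x, 0)"

definition tape :: "(nat \<Rightarrow> nat \<Rightarrow> nat) \<Rightarrow> nat list \<Rightarrow> int \<Rightarrow> sy" where
  "tape cf xs i = (if i < 0 then Lc (cf (nat (-1 - i)))
     else if nat i < length xs then Rc (xs ! nat i) else Lc (\<lambda>_. 0))"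

text \<open>\<open>u r\<close> counts the entries popped from register \<open>r\<close> so far, and
  the queue occupies the cells after them. Register 0 has no track, as the input lives on the right
  half of the tape.\<close>

definition cells :: "nat \<Rightarrow> (nat \<Rightarrow> nat) \<Rightarrow> store \<Rightarrow> nat \<Rightarrow> nat \<Rightarrow> nat" where
  "cells K u \<sigma> j r = (if 1 \<le> r \<and> r \<le> K then
     (if j < u r then 1 else if j < u r + length (\<sigma> r) then \<sigma> r ! (j - u r) + 2 else 0) else 0)"

lemma tape_upd_R: "i < length xs \<Longrightarrow> (tape cf xs)(int i := Rc s) = tape cf (xs[i := s])"
  by (rule ext) (auto simp: tape_def nth_list_update)

lemma tape_upd_L: "(tape cf xs)(-1 - int j := Lc f) = tape (cf(j := f)) xs"
proof (rule ext)
  fix i :: int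
  show "((tape cf xs)(-1 - int j := Lc f)) i = tape (cf(j := f)) xs i"
    by (cases "i = -1 - int j") (auto simp: tape_def)
qed

lemma tape_R: "i < length xs \<Longrightarrow> tape cf xs (int i) = Rc (xs ! i)"
  by (simp add: tape_def)

lemma tape_L: "tape cf xs (-1 - int j) = Lc (cf j)"
  by (simp add: tape_def)

lemma tape_L1: "tape cf xs (-1) = Lc (cf 0)"
  using tape_L[of cf xs 0] by simp

lemma cells_push: "1 \<le> r \<Longrightarrow> r \<le> K \<Longrightarrow>
    (cells K u \<sigma>)(u r + length (\<sigma> r) := (cells K u \<sigma> (u r + length (\<sigma> r)))(r := a + 2))
     = cells K u (\<sigma>(r := \<sigma> r @ [a]))"
  by (intro ext) (auto simp: cells_def nth_append)

lemma cells_pop: "1 \<le> r \<Longrightarrow> r \<le> K \<Longrightarrow> \<sigma> r = a # bs \<Longrightarrow>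
    (cells K u \<sigma>)(u r := (cells K u \<sigma> (u r))(r := Suc 0))
     = cells K (u(r := Suc (u r))) (\<sigma>(r := bs))"
  by (intro ext) (auto simp: cells_def nth_Cons' Suc_diff_Suc)

text \<open>The right half of the tape: \<open>p\<close> consumed input symbols, the remaining input
  \<open>l\<close> with its separator, \<open>m\<close> spent certificate bits and the remaining
  certificate \<open>c\<close>. A popped separator becomes 9 and not 8, so that the border between
  input and certificate stays visible.\<close>

definition rl :: "nat \<Rightarrow> nat list \<Rightarrow> nat \<Rightarrow> bool list \<Rightarrow> nat list" where
  "rl p l m c = replicate p 8 @ (if l = [] then [9] else l) @ replicate m 8 @ enc_cert c"

definition inok :: "nat list \<Rightarrow> bool" where
  "inok l \<longleftrightarrow> l = [] \<or> (\<exists>v. set v \<subseteq> {1..6} \<and> l = v @ [7])"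

definition regs_ok :: "nat \<Rightarrow> act option \<Rightarrow> bool" where
  "regs_ok K x = (case x of None \<Rightarrow> True | Some (Pop r a) \<Rightarrow> r \<le> K | Some (Push r a) \<Rightarrow> 1 \<le> r \<and> r \<le> K)"

section \<open>Macro steps of the Turing machine\<close>

locale qm =
  fixes E :: "edge list" and qf :: nat
begin

abbreviation "stp \<equiv> astep (qm_delta E) (Home qf 0)"

lemma stp_right:
  assumes "q \<noteq> Home qf 0" "a + n \<le> length xs"
    "\<And>i. a \<le> i \<Longrightarrow> i < a + n \<Longrightarrow> qm_delta E q (Rc (xs ! i)) = (q, Rc (xs ! i), 1)"
  shows "(stp ^^ n) (q, tape cf xs, int a) = (q, tape cf xs, int (a + n))"
proof -
  have "(stp ^^ n) (q, tape cf xs, int a) = (q, tape cf xs, int a + int n)"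
  proof (rule astep_right)
    fix i assume "int a \<le> i" "i < int a + int n"
    then have "i = int (nat i)" "a \<le> nat i" "nat i < a + n" by auto
    then show "qm_delta E q (tape cf xs i) = (q, tape cf xs i, 1)"
      using assms tape_R[of "nat i" xs cf] by auto
  qed (fact assms)
  then show ?thesis by simp
qed

lemma Bk_left:
  assumes "n \<le> length xs"
  shows "(stp ^^ n) (Bk x q j, tape cf xs, int n - 1) = (Bk x q j, tape cf xs, -1)"
proof -
  have "(stp ^^ n) (Bk x q j, tape cf xs, int n - 1) = (Bk x q j, tape cf xs, int n - 1 - int n)"
    by (rule astep_left) (use assms in \<open>auto simp: tape_def\<close>)
  then show ?thesis by simp
qed

lemma Bk_home:
  assumes "n \<le> length xs"
  shows "(stp ^^ Suc n) (Bk None q j, tape cf xs, int n - 1) = (Home q j, tape cf xs, 0)"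
  by (simp add: Bk_left[OF assms] astep_move tape_L1 del: funpow.simps add: funpow.simps(2))
     (simp add: tape_upd_L[of _ _ 0, simplified])

lemma stp_trans: "(stp ^^ a) c = c1 \<Longrightarrow> (stp ^^ b) c1 = c2 \<Longrightarrow> (stp ^^ (b + a)) c = c2"
  by (simp add: funpow_add)

lemma seek:
  assumes "q \<noteq> qf \<or> j \<noteq> 0" "set ys \<subseteq> {1..6} \<union> {8}" "z = 7 \<or> z = 9" "xs = ys @ z # replicate m 8 @ bs"
  shows "(stp ^^ (m + Suc (length ys))) (Home q j, tape cf xs, 0) = (Sk q j, tape cf xs, int (Suc (length ys) + m))"
proof (rule stp_trans)
  have "(stp ^^ length ys) (Home q j, tape cf xs, int 0) = (Home q j, tape cf xs, int (0 + length ys))"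
  proof (rule stp_right)
    fix i assume "0 \<le> i" "i < 0 + length ys"
    then have "xs ! i \<in> {1..6} \<union> {8}" using assms(2,4) by (auto simp: nth_append dest!: nth_mem)
    then show "qm_delta E (Home q j) (Rc (xs ! i)) = (Home q j, Rc (xs ! i), 1)" by auto
  qed (use assms in auto)
  moreover have "stp (Home q j, tape cf xs, int (length ys)) = (Sk q j, tape cf xs, int (Suc (length ys)))"
  proof -
    have "xs ! length ys = z" using assms(4) by simp
    moreover have "length ys < length xs" using assms(4) by simp
    ultimately show ?thesis using assms(1,3)
      by (subst astep_move[where q' = "Sk q j" and a' = "tape cf xs (int (length ys))" and d = 1]) (auto simp: tape_R)
  qed
  ultimately show "(stp ^^ Suc (length ys)) (Home q j, tape cf xs, 0) = (Sk q j, tape cf xs, int (Suc (length ys)))"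
    by simp
  show "(stp ^^ m) (Sk q j, tape cf xs, int (Suc (length ys))) = (Sk q j, tape cf xs, int (Suc (length ys) + m))"
  proof (rule stp_right)
    fix i assume "Suc (length ys) \<le> i" "i < Suc (length ys) + m"
    then have "xs ! i = 8" using assms(4) by (auto simp: nth_append nth_Cons split: nat.splits)
    then show "qm_delta E (Sk q j) (Rc (xs ! i)) = (Sk q j, Rc (xs ! i), 1)" by auto
  qed (use assms in auto)
qed

lemma stp_R:
  assumes "q \<noteq> Home qf 0" "i < length xs" "qm_delta E q (Rc (xs ! i)) = (q', Rc s, d)"
  shows "stp (q, tape cf xs, int i) = (q', tape cf (xs[i := s]), int i + d)"
  using assms by (subst astep_move[where q' = q' and a' = "Rc s" and d = d]) (auto simp: tape_R tape_upd_R)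

lemma stp_L:
  assumes "q \<noteq> Home qf 0" "qm_delta E q (Lc (cf i)) = (q', Lc f, d)"
  shows "stp (q, tape cf xs, -1 - int i) = (q', tape (cf(i := f)) xs, -1 - int i + d)"
  using assms by (subst astep_move[where q' = q' and a' = "Lc f" and d = d]) (auto simp: tape_L tape_upd_L)

lemma stp_L0:
  assumes "q \<noteq> Home qf 0" "qm_delta E q (Lc (cf 0)) = (q', Lc (cf 0), d)"
  shows "stp (q, tape cf xs, -1) = (q', tape cf xs, -1 + d)"
  using stp_L[of q cf 0 q' "cf 0" d xs] assms by simp

lemma cells_left:
  assumes "\<And>i. i < n \<Longrightarrow> qm_delta E q (Lc (cf i)) = (q, Lc (cf i), -1)" "q \<noteq> Home qf 0"
  shows "(stp ^^ n) (q, tape cf xs, -1) = (q, tape cf xs, -1 - int n)"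
proof (rule astep_left)
  fix i assume i: "- 1 - int n < i" "i \<le> - 1"
  then have "i = -1 - int (nat (-1 - i))" "nat (-1 - i) < n" by auto
  then show "qm_delta E q (tape cf xs i) = (q, tape cf xs i, - 1)" using assms(1) tape_L by metis
qed fact

lemma Rt_home:
  assumes "xs \<noteq> []"
  shows "(stp ^^ Suc n) (Rt q, tape cf xs, - int n) = (Home q 0, tape cf xs, 0)"
proof -
  have "(stp ^^ n) (Rt q, tape cf xs, - int n) = (Rt q, tape cf xs, - int n + int n)"
    by (rule astep_right) (auto simp: tape_def)
  moreover have "stp (Rt q, tape cf xs, int 0) = (Home q 0, tape cf (xs[0 := xs ! 0]), int 0 + 0)"
    by (rule stp_R) (use assms in auto)
  ultimately show ?thesis by simp
qed

lemma push_sim: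
  assumes "1 \<le> r" "r \<le> K" "xs \<noteq> []" "h = u r + length (\<sigma> r)"
  shows "(stp ^^ (Suc h + (1 + (h + 1)))) (Bk (Some (Push r a)) q j, tape (cells K u \<sigma>) xs, -1)
    = (Home q 0, tape (cells K u (\<sigma>(r := \<sigma> r @ [a]))) xs, 0)"
proof (intro stp_trans)
  have "stp (Bk (Some (Push r a)) q j, tape (cells K u \<sigma>) xs, -1) = (Do (Push r a) q, tape (cells K u \<sigma>) xs, -1 + 0)"
    by (rule stp_L0) auto
  then show "(stp ^^ 1) (Bk (Some (Push r a)) q j, tape (cells K u \<sigma>) xs, -1) = (Do (Push r a) q, tape (cells K u \<sigma>) xs, -1)"
    by simp
  show "(stp ^^ h) (Do (Push r a) q, tape (cells K u \<sigma>) xs, -1) = (Do (Push r a) q, tape (cells K u \<sigma>) xs, -1 - int h)"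
    by (rule cells_left) (use assms in \<open>auto simp: cells_def\<close>)
  have "stp (Do (Push r a) q, tape (cells K u \<sigma>) xs, -1 - int h)
      = (Rt q, tape ((cells K u \<sigma>)(h := (cells K u \<sigma> h)(r := a + 2))) xs, -1 - int h + 1)"
    by (rule stp_L) (use assms in \<open>auto simp: cells_def\<close>)
  then show "(stp ^^ 1) (Do (Push r a) q, tape (cells K u \<sigma>) xs, -1 - int h)
      = (Rt q, tape (cells K u (\<sigma>(r := \<sigma> r @ [a]))) xs, - int h)"
    using cells_push[OF assms(1,2), of u \<sigma> a] assms(4) by simp
  show "(stp ^^ Suc h) (Rt q, tape (cells K u (\<sigma>(r := \<sigma> r @ [a]))) xs, - int h)
    = (Home q 0, tape (cells K u (\<sigma>(r := \<sigma> r @ [a]))) xs, 0)"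
    by (rule Rt_home) fact
qed

lemma pop_seek:
  assumes "1 \<le> r" "r \<le> K"
  shows "(stp ^^ (u r + 1)) (Bk (Some (Pop r a)) q j, tape (cells K u \<sigma>) xs, -1)
    = (Do (Pop r a) q, tape (cells K u \<sigma>) xs, -1 - int (u r))"
proof (intro stp_trans)
  have "stp (Bk (Some (Pop r a)) q j, tape (cells K u \<sigma>) xs, -1) = (Do (Pop r a) q, tape (cells K u \<sigma>) xs, -1 + 0)"
    by (rule stp_L0) (use assms in auto)
  then show "(stp ^^ 1) (Bk (Some (Pop r a)) q j, tape (cells K u \<sigma>) xs, -1) = (Do (Pop r a) q, tape (cells K u \<sigma>) xs, -1)"
    by simp
  show "(stp ^^ u r) (Do (Pop r a) q, tape (cells K u \<sigma>) xs, -1) = (Do (Pop r a) q, tape (cells K u \<sigma>) xs, -1 - int (u r))"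
    by (rule cells_left) (use assms in \<open>auto simp: cells_def\<close>)
qed

lemma pop_sim:
  assumes "1 \<le> r" "r \<le> K" "xs \<noteq> []" "\<sigma> r = a # bs"
  shows "(stp ^^ (Suc (u r) + (1 + (u r + 1)))) (Bk (Some (Pop r a)) q j, tape (cells K u \<sigma>) xs, -1)
    = (Home q 0, tape (cells K (u(r := Suc (u r))) (\<sigma>(r := bs))) xs, 0)"
proof (intro stp_trans[OF stp_trans[OF pop_seek]])
  have "stp (Do (Pop r a) q, tape (cells K u \<sigma>) xs, -1 - int (u r))
      = (Rt q, tape ((cells K u \<sigma>)(u r := (cells K u \<sigma> (u r))(r := 1))) xs, -1 - int (u r) + 1)"
    by (rule stp_L) (use assms in \<open>auto simp: cells_def\<close>)
  then show "(stp ^^ 1) (Do (Pop r a) q, tape (cells K u \<sigma>) xs, -1 - int (u r))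
      = (Rt q, tape (cells K (u(r := Suc (u r))) (\<sigma>(r := bs))) xs, - int (u r))"
    using cells_pop[where r = r and u = u and \<sigma> = \<sigma>, OF assms(1,2,4)] by simp
  show "(stp ^^ Suc (u r)) (Rt q, tape (cells K (u(r := Suc (u r))) (\<sigma>(r := bs))) xs, - int (u r))
    = (Home q 0, tape (cells K (u(r := Suc (u r))) (\<sigma>(r := bs))) xs, 0)"
    by (rule Rt_home) fact
qed fact+

lemma pop_fail:
  assumes "1 \<le> r" "r \<le> K" "step_act (Pop r a) \<sigma> = None"
  shows "\<exists>t tp h. (stp ^^ t) (Bk (Some (Pop r a)) q j, tape (cells K u \<sigma>) xs, -1) = (Rej, tp, h)"
proof -
  have "stp (Do (Pop r a) q, tape (cells K u \<sigma>) xs, -1 - int (u r))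
      = (Rej, tape ((cells K u \<sigma>)(u r := cells K u \<sigma> (u r))) xs, -1 - int (u r) + 0)"
    by (rule stp_L) (use assms in \<open>auto simp: cells_def split: list.splits if_splits\<close>)
  then have "(stp ^^ 1) (Do (Pop r a) q, tape (cells K u \<sigma>) xs, -1 - int (u r))
      = (Rej, tape (cells K u \<sigma>) xs, -1 - int (u r))" by simp
  from stp_trans[OF pop_seek[OF assms(1,2)] this] show ?thesis by blast
qed


lemma rl_split:
  assumes "inok l"
  shows "\<exists>ys z. set ys \<subseteq> {1..6} \<union> {8} \<and> (z = 7 \<or> z = 9) \<and> (\<forall>m c. rl p l m c = ys @ z # replicate m 8 @ enc_cert c)"
proof (cases "l = []")
  case True
  then show ?thesis by (intro exI[of _ "replicate p 8"] exI[of _ 9]) (auto simp: rl_def)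
next
  case False
  with assms obtain v where "set v \<subseteq> {1..6}" "l = v @ [7]" by (auto simp: inok_def)
  then show ?thesis by (intro exI[of _ "replicate p 8 @ v"] exI[of _ 7]) (auto simp: rl_def)
qed

lemma inn_seek:
  assumes "p < length (rl p l m c)"
  shows "(stp ^^ (p + 1)) (Bk (Some (Pop 0 a)) q j, tape cf (rl p l m c), -1) = (Inn a q, tape cf (rl p l m c), int (0 + p))"
proof (rule stp_trans)
  have "stp (Bk (Some (Pop 0 a)) q j, tape cf (rl p l m c), -1) = (Inn a q, tape cf (rl p l m c), -1 + 1)"
    by (rule stp_L0) auto
  then show "(stp ^^ 1) (Bk (Some (Pop 0 a)) q j, tape cf (rl p l m c), -1) = (Inn a q, tape cf (rl p l m c), int 0)"
    by simp
  show "(stp ^^ p) (Inn a q, tape cf (rl p l m c), int 0) = (Inn a q, tape cf (rl p l m c), int (0 + p))"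
    by (rule stp_right) (use assms in \<open>auto simp: rl_def nth_append\<close>)
qed

lemma length_rl: "length (rl p l m c) = p + (if l = [] then 1 else length l) + m + length c"
  by (simp add: rl_def enc_cert_def)

lemma inp_sim:
  assumes "inok (a # l)"
  shows "\<exists>p'. (stp ^^ (Suc p + (1 + (p + 1)))) (Bk (Some (Pop 0 a)) q j, tape cf (rl p (a # l) m c), -1)
    = (Home q 0, tape cf (rl p' l m c), 0) \<and> length (rl p' l m c) = length (rl p (a # l) m c) \<and> inok l"
proof -
  let ?xs = "rl p (a # l) m c"
  from assms have a: "a \<le> 7" "a \<noteq> 8" "a = 7 \<longleftrightarrow> l = []" and l: "inok l"
    by (auto simp: inok_def Cons_eq_append_conv)
  have len: "p < length ?xs" by (simp add: length_rl)
  have nth: "?xs ! p = a" by (simp add: rl_def nth_append)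
  \<comment> \<open>A popped separator is the 9 that \<open>rl\<close> shows for an empty input, not
    one more consumed 8.\<close>
  define p' where "p' = (if a = 7 then p else Suc p)"
  have "stp (Inn a q, tape cf ?xs, int p) = (Bk None q 0, tape cf (?xs[p := if a = 7 then 9 else 8]), int p + (-1))"
    by (rule stp_R) (use len nth a in auto)
  moreover have "?xs[p := if a = 7 then 9 else 8] = rl p' l m c"
    using a by (auto simp: p'_def rl_def list_update_append replicate_append_same replicate_app_Cons_same)
  ultimately have 1: "(stp ^^ 1) (Inn a q, tape cf ?xs, int (0 + p)) = (Bk None q 0, tape cf (rl p' l m c), int p - 1)"
    by simp
  have "length (rl p' l m c) = length ?xs" using a by (auto simp: p'_def length_rl)
  moreover from this have "(stp ^^ Suc p) (Bk None q 0, tape cf (rl p' l m c), int p - 1) = (Home q 0, tape cf (rl p' l m c), 0)"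
    using len by (intro Bk_home) simp
  ultimately show ?thesis using stp_trans[OF stp_trans[OF inn_seek[OF len] 1]] l by blast
qed

lemma inp_fail:
  assumes "step_act (Pop 0 a) \<sigma> = None" "inok (\<sigma> 0)"
  shows "\<exists>t tp h. (stp ^^ t) (Bk (Some (Pop 0 a)) q j, tape cf (rl p (\<sigma> 0) m c), -1) = (Rej, tp, h)"
proof -
  let ?xs = "rl p (\<sigma> 0) m c"
  have len: "p < length ?xs" by (simp add: length_rl)
  have nth: "?xs ! p = (if \<sigma> 0 = [] then 9 else hd (\<sigma> 0))"
    by (simp add: rl_def nth_append hd_conv_nth)
  have "\<sigma> 0 = [] \<or> hd (\<sigma> 0) \<le> 7"
  proof -
    have "hd (v @ [7]) \<le> 7" if "set v \<subseteq> {1..6::nat}" for v using that by (cases v) auto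
    then show ?thesis using assms(2) by (auto simp: inok_def)
  qed
  then have "?xs ! p \<noteq> 8" using nth by auto
  moreover have "\<not> (?xs ! p = a \<and> a \<le> 7)" using assms(1) nth by (auto split: list.splits if_splits)
  ultimately have "stp (Inn a q, tape cf ?xs, int p) = (Rej, tape cf (?xs[p := ?xs ! p]), int p + 0)"
    by (intro stp_R) (use len in auto)
  then have 1: "(stp ^^ 1) (Inn a q, tape cf ?xs, int (0 + p)) = (Rej, tape cf ?xs, int p)" by simp
  show ?thesis using stp_trans[OF inn_seek[OF len] 1] by blast
qed

text \<open>\<open>H\<close> bounds the cells in use on each track, and an action raises it by at
  most 1. That a failing action leads to \<open>Rej\<close> is what later lets acceptance by the
  Turing machine imply acceptance by \<open>sel_accepts\<close>.\<close>

lemma macro_sim: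
  assumes ok: "inok (\<sigma> 0)" "regs_ok K x" "p + 1 \<le> length (rl p (\<sigma> 0) m c)"
    and N: "N = length (rl p (\<sigma> 0) m c)" and H: "\<And>r. u r + length (\<sigma> r) \<le> H"
  shows "step_opt x \<sigma> = Some \<sigma>' \<Longrightarrow> \<exists>t u' p'. t \<le> 2 * N + 2 * H + 3 \<and>
      (stp ^^ t) (Bk x q 0, tape (cells K u \<sigma>) (rl p (\<sigma> 0) m c), -1)
       = (Home q 0, tape (cells K u' \<sigma>') (rl p' (\<sigma>' 0) m c), 0) \<and>
      inok (\<sigma>' 0) \<and> (\<forall>r. u' r + length (\<sigma>' r) \<le> Suc H) \<and> length (rl p' (\<sigma>' 0) m c) = N"
    and "step_opt x \<sigma> = None \<Longrightarrow> \<exists>t tp h.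
      (stp ^^ t) (Bk x q 0, tape (cells K u \<sigma>) (rl p (\<sigma> 0) m c), -1) = (Rej, tp, h)"
proof -
  have ne: "rl p (\<sigma> 0) m c \<noteq> []" by (auto simp: rl_def)
  have H': "u r + length (\<sigma> r) \<le> Suc H" for r using H[of r] by simp
  show "\<exists>t u' p'. t \<le> 2 * N + 2 * H + 3 \<and>
      (stp ^^ t) (Bk x q 0, tape (cells K u \<sigma>) (rl p (\<sigma> 0) m c), -1)
       = (Home q 0, tape (cells K u' \<sigma>') (rl p' (\<sigma>' 0) m c), 0) \<and>
      inok (\<sigma>' 0) \<and> (\<forall>r. u' r + length (\<sigma>' r) \<le> Suc H) \<and> length (rl p' (\<sigma>' 0) m c) = N"
    if st: "step_opt x \<sigma> = Some \<sigma>'"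
  proof (cases x)
    case None
    have "(stp ^^ Suc 0) (Bk None q 0, tape (cells K u \<sigma>) (rl p (\<sigma> 0) m c), int 0 - 1)
      = (Home q 0, tape (cells K u \<sigma>) (rl p (\<sigma> 0) m c), 0)" by (rule Bk_home) simp
    then show ?thesis using None st ok N H'
      by (intro exI[of _ "Suc 0"] exI[of _ u] exI[of _ p]) auto
  next
    case (Some y)
    show ?thesis
    proof (cases y)
      case (Push r a)
      have r: "1 \<le> r" "r \<le> K" using ok(2) Some Push by (auto simp: regs_ok_def)
      have \<sigma>': "\<sigma>' = \<sigma>(r := \<sigma> r @ [a])" using st Some Push by simp
      have hr: "u r + (length (\<sigma> r) + (u r + length (\<sigma> r))) \<le> 2 * length (rl p (\<sigma> 0) m c) + 2 * H"
        using H[of r] by linarith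
      show ?thesis unfolding Some Push
        by (rule exI, rule exI[of _ u], rule exI[of _ p], intro conjI, rule_tac[2] trans[OF push_sim[OF r ne refl]])
           (use H hr H' r ok N in \<open>auto simp: \<sigma>'\<close>)
    next
      case (Pop r a)
      show ?thesis
      proof (cases "r = 0")
        case True
        with st Some Pop obtain l where l: "\<sigma> 0 = a # l" "\<sigma>' = \<sigma>(0 := l)" by (auto split: list.splits if_splits)
        from inp_sim[of a l p q 0 "cells K u \<sigma>" m c] ok(1) l obtain p' where
          p': "(stp ^^ (Suc p + (1 + (p + 1)))) (Bk (Some (Pop 0 a)) q 0, tape (cells K u \<sigma>) (rl p (a # l) m c), -1)
            = (Home q 0, tape (cells K u \<sigma>) (rl p' l m c), 0)"
          "length (rl p' l m c) = length (rl p (a # l) m c)" "inok l" by auto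
        have "cells K u \<sigma>' = cells K u \<sigma>" by (intro ext) (auto simp: cells_def l)
        moreover have "u r + length (\<sigma>' r) \<le> Suc H" for r using H'[of r] by (auto simp: l)
        ultimately show ?thesis using p' l True Some Pop N ok(3)
          by (intro exI[of _ "Suc p + (1 + (p + 1))"] exI[of _ u] exI[of _ p']) auto
      next
        case False
        then have r: "1 \<le> r" "r \<le> K" using ok(2) Some Pop by (auto simp: regs_ok_def)
        with st Some Pop obtain l where l: "\<sigma> r = a # l" "\<sigma>' = \<sigma>(r := l)" by (auto split: list.splits if_splits)
        show ?thesis unfolding Some Pop
          by (rule exI, rule exI[of _ "u(r := Suc (u r))"], rule exI[of _ p], intro conjI,
              rule_tac[2] trans[OF pop_sim[where \<sigma> = \<sigma>, OF r ne l(1)]])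
             (use H H[of r] H' r ok N l in auto)
      qed
    qed
  qed
  show "\<exists>t tp h. (stp ^^ t) (Bk x q 0, tape (cells K u \<sigma>) (rl p (\<sigma> 0) m c), -1) = (Rej, tp, h)"
    if st: "step_opt x \<sigma> = None"
  proof -
    obtain r a where x: "x = Some (Pop r a)" "step_act (Pop r a) \<sigma> = None"
    proof (cases x)
      case (Some y)
      then show thesis using st that by (cases y) auto
    qed (use st in simp)
    show ?thesis
    proof (cases "r = 0")
      case True then show ?thesis using inp_fail ok(1) x by simp
    next
      case False then show ?thesis using pop_fail[of r K a \<sigma>] ok(2) x by (auto simp: regs_ok_def)
    qed
  qed
qed


lemma sel_read:
  assumes "q \<noteq> qf \<or> j \<noteq> 0" "inok l" and h: "h = length (rl p l m [])"
  shows "(stp ^^ h) (Home q j, tape cf (rl p l m c), 0) = (Sk q j, tape cf (rl p l m c), int h)"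
    and "c = b # c' \<Longrightarrow> rl p l m c ! h = (if b then 2 else 1)"
    and "c = b # c' \<Longrightarrow> h < length (rl p l m c)"
    and "c = b # c' \<Longrightarrow> (rl p l m c)[h := 8] = rl p l (Suc m) c'"
proof -
  from rl_split[OF assms(2)] obtain ys z where ys: "set ys \<subseteq> {1..6} \<union> {8}" "z = 7 \<or> z = 9"
    "\<And>m c. rl p l m c = ys @ z # replicate m 8 @ enc_cert c" by blast
  have h: "h = m + Suc (length ys)" unfolding h ys by (simp add: enc_cert_def)
  show "(stp ^^ h) (Home q j, tape cf (rl p l m c), 0) = (Sk q j, tape cf (rl p l m c), int h)"
    using seek[OF assms(1) ys(1,2) ys(3), where cf = cf] unfolding h by (simp add: add.commute)
  assume c: "c = b # c'"
  show "rl p l m c ! h = (if b then 2 else 1)"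
    unfolding ys c enc_cert_def h by (simp add: nth_append)
  show "h < length (rl p l m c)"
    unfolding ys c enc_cert_def h by simp
  show "(rl p l m c)[h := 8] = rl p l (Suc m) c'"
    unfolding ys c enc_cert_def h by (simp add: list_update_append replicate_app_Cons_same)
qed

text \<open>One certificate bit costs a walk to it and back, at most \<open>2 * N\<close> steps, and
  then the selected action.\<close>

lemma sel_sim:
  assumes ne: "q \<noteq> qf \<or> j \<noteq> 0" and ok: "inok (\<sigma> 0)" "\<forall>e \<in> set E. regs_ok K (fst (snd e))"
    and N: "N = length (rl p (\<sigma> 0) m (b # c))" and H: "\<And>r. u r + length (\<sigma> r) \<le> H"
  shows "sel E (q, j, \<sigma>) b = Some (q', j', \<sigma>') \<Longrightarrow> \<exists>t u' p'. t \<le> 4 * N + 2 * H + 6 \<and>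
      (stp ^^ t) (Home q j, tape (cells K u \<sigma>) (rl p (\<sigma> 0) m (b # c)), 0)
       = (Home q' j', tape (cells K u' \<sigma>') (rl p' (\<sigma>' 0) (Suc m) c), 0) \<and>
      inok (\<sigma>' 0) \<and> (\<forall>r. u' r + length (\<sigma>' r) \<le> Suc H) \<and> length (rl p' (\<sigma>' 0) (Suc m) c) = N"
    and "sel E (q, j, \<sigma>) b = None \<Longrightarrow> \<exists>t tp h.
      (stp ^^ t) (Home q j, tape (cells K u \<sigma>) (rl p (\<sigma> 0) m (b # c)), 0) = (Rej, tp, h)"
proof -
  let ?xs = "rl p (\<sigma> 0) m (b # c)" and ?ys = "rl p (\<sigma> 0) (Suc m) c" and ?cf = "cells K u \<sigma>"
  define h where "h = length (rl p (\<sigma> 0) m [])"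
  note rd = sel_read(1)[OF ne ok(1) h_def, of ?cf "b # c"] sel_read(2-4)[OF ne ok(1) h_def refl, of b c]
  have N': "N = length ?ys" "h < N" "p + 1 \<le> length ?ys" using N rd(3) by (simp_all add: length_rl)
  define good where "good \<longleftrightarrow> (if b then j < length E \<and> fst (E ! j) = q else Suc j < length E)"
  define x q1 j1 where "x = (if b then fst (snd (E ! j)) else None)"
    and "q1 = (if b then snd (snd (E ! j)) else q)" and "j1 = (if b then 0 else Suc j)"
  have bk: "\<exists>t. t \<le> 2 * N \<and> (stp ^^ t) (Home q j, tape ?cf ?xs, 0) = (Bk x q1 j1, tape ?cf ?ys, -1)" if "good"
  proof -
    have "stp (Sk q j, tape ?cf ?xs, int h) = (Bk x q1 j1, tape ?cf (?xs[h := 8]), int h + (-1))"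
      by (rule stp_R) (use rd that in \<open>auto simp: good_def x_def q1_def j1_def\<close>)
    then have "(stp ^^ 1) (Sk q j, tape ?cf ?xs, int h) = (Bk x q1 j1, tape ?cf ?ys, int h - 1)" by (simp add: rd(4))
    moreover have "(stp ^^ h) (Bk x q1 j1, tape ?cf ?ys, int h - 1) = (Bk x q1 j1, tape ?cf ?ys, -1)"
      by (rule Bk_left) (use N' in simp)
    ultimately have "(stp ^^ (h + (1 + h))) (Home q j, tape ?cf ?xs, 0) = (Bk x q1 j1, tape ?cf ?ys, -1)"
      using stp_trans[OF stp_trans[OF rd(1)]] by blast
    moreover have "h + (1 + h) \<le> 2 * N" using N'(2) by simp
    ultimately show ?thesis by blast
  qed
  have bad: "\<exists>t tp h. (stp ^^ t) (Home q j, tape ?cf ?xs, 0) = (Rej, tp, h)" if "\<not> good"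
  proof -
    have "stp (Sk q j, tape ?cf ?xs, int h) = (Rej, tape ?cf (?xs[h := ?xs ! h]), int h + 0)"
      by (rule stp_R) (use rd that in \<open>auto simp: good_def\<close>)
    then have "(stp ^^ 1) (Sk q j, tape ?cf ?xs, int h) = (Rej, tape ?cf ?xs, int h)" by simp
    from stp_trans[OF rd(1) this] show ?thesis by blast
  qed
  have regs: "regs_ok K x" if "good"
    using that ok(2) by (auto simp: good_def x_def regs_ok_def)
  have sel: "sel E (q, j, \<sigma>) b = (if good then map_option (\<lambda>\<sigma>'. (q1, j1, \<sigma>')) (step_opt x \<sigma>) else None)"
    by (auto simp: sel_def good_def x_def q1_def j1_def)
  show "\<exists>t u' p'. t \<le> 4 * N + 2 * H + 6 \<and>
      (stp ^^ t) (Home q j, tape ?cf ?xs, 0)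
       = (Home q' j', tape (cells K u' \<sigma>') (rl p' (\<sigma>' 0) (Suc m) c), 0) \<and>
      inok (\<sigma>' 0) \<and> (\<forall>r. u' r + length (\<sigma>' r) \<le> Suc H) \<and> length (rl p' (\<sigma>' 0) (Suc m) c) = N"
    if s: "sel E (q, j, \<sigma>) b = Some (q', j', \<sigma>')"
  proof -
    have g: good and st: "step_opt x \<sigma> = Some \<sigma>'" "q' = q1" "j' = j1" using s sel by (auto split: if_splits)
    from bk[OF g] obtain t where t: "t \<le> 2 * N" "(stp ^^ t) (Home q j, tape ?cf ?xs, 0) = (Bk x q1 j1, tape ?cf ?ys, -1)" by blast
    have "\<exists>t u' p'. t \<le> 2 * N + 2 * H + 3 \<and>
      (stp ^^ t) (Bk x q1 j1, tape ?cf ?ys, -1)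
       = (Home q1 j1, tape (cells K u' \<sigma>') (rl p' (\<sigma>' 0) (Suc m) c), 0) \<and>
      inok (\<sigma>' 0) \<and> (\<forall>r. u' r + length (\<sigma>' r) \<le> Suc H) \<and> length (rl p' (\<sigma>' 0) (Suc m) c) = N"
    proof (cases "j1 = 0")
      case True
      show ?thesis unfolding True by (rule macro_sim(1)[where \<sigma> = \<sigma> and u = u, OF ok(1) regs[OF g] N'(3,1) H st(1)])
    next
      case False
      then have x: "x = None" by (auto simp: j1_def x_def)
      have "(stp ^^ Suc 0) (Bk None q1 j1, tape ?cf ?ys, int 0 - 1) = (Home q1 j1, tape ?cf ?ys, 0)"
        by (rule Bk_home) simp
      then show ?thesis using st(1) x ok(1) H N'
        by (intro exI[of _ "Suc 0"] exI[of _ u] exI[of _ p]) (auto intro: le_SucI)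
    qed
    then obtain t' u' p' where t': "t' \<le> 2 * N + 2 * H + 3"
      "(stp ^^ t') (Bk x q1 j1, tape ?cf ?ys, -1)
       = (Home q1 j1, tape (cells K u' \<sigma>') (rl p' (\<sigma>' 0) (Suc m) c), 0)"
      "inok (\<sigma>' 0)" "\<forall>r. u' r + length (\<sigma>' r) \<le> Suc H" "length (rl p' (\<sigma>' 0) (Suc m) c) = N" by blast
    show ?thesis
      by (rule exI[of _ "t' + t"], rule exI[of _ u'], rule exI[of _ p'])
         (use stp_trans[OF t(2) t'(2)] t(1) t' st in auto)
  qed
  show "\<exists>t tp h. (stp ^^ t) (Home q j, tape ?cf ?xs, 0) = (Rej, tp, h)" if s: "sel E (q, j, \<sigma>) b = None"
  proof (cases good)
    case True
    with s sel have n: "step_opt x \<sigma> = None" by simp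
    \<comment> \<open>Only an action can fail, and an action is pending only after a bit True, which
      resets the pointer.\<close>
    then have "j1 = 0" by (auto simp: x_def j1_def split: if_splits)
    with macro_sim(2)[where \<sigma> = \<sigma> and u = u and q = q1, OF ok(1) regs[OF True] N'(3,1) H n] bk[OF True] show ?thesis
      using stp_trans by blast
  next
    case False
    then show ?thesis by (rule bad)
  qed
qed

lemma Rej_never:
  assumes "(stp ^^ t) c = (Rej, tp, h)"
  shows "fst ((stp ^^ i) c) \<noteq> Home qf 0"
proof -
  have "(stp ^^ i) (Rej, tp, h) = (Rej, tp, h)" for i by (rule astep_stuck) simp
  then show ?thesis using astep_accepts_later[OF assms] by auto
qed

text \<open>Induction on the certificate. The right half of the tape keeps its length
  \<open>N\<close>, while the tracks grow by at most one cell per bit; this is the reason for the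
  term \<open>H + length c\<close>.\<close>

lemma accept_sim:
  assumes "inok (\<sigma> 0)" "\<forall>e \<in> set E. regs_ok K (fst (snd e))"
    "N = length (rl p (\<sigma> 0) m c)" "\<And>r. u r + length (\<sigma> r) \<le> H"
  shows "(sel_accepts E qf (q, j, \<sigma>) c \<longrightarrow> (\<exists>i \<le> length c * (4 * N + 2 * (H + length c) + 6).
      fst ((stp ^^ i) (Home q j, tape (cells K u \<sigma>) (rl p (\<sigma> 0) m c), 0)) = Home qf 0)) \<and>
     ((\<exists>i. fst ((stp ^^ i) (Home q j, tape (cells K u \<sigma>) (rl p (\<sigma> 0) m c), 0)) = Home qf 0)
       \<longrightarrow> sel_accepts E qf (q, j, \<sigma>) c)"
  using assms
proof (induction c arbitrary: q j \<sigma> u p m H)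
  case Nil
  let ?xs = "rl p (\<sigma> 0) m []"
  show ?case
  proof (cases "q = qf \<and> j = 0")
    case False
    from sel_read(1)[OF _ Nil.prems(1) refl, of q j] False
    have "(stp ^^ length ?xs) (Home q j, tape (cells K u \<sigma>) ?xs, 0) = (Sk q j, tape (cells K u \<sigma>) ?xs, int (length ?xs))"
      by blast
    \<comment> \<open>The certificate is exhausted: the head stands on a blank cell, where
      \<open>Sk\<close> falls through to the rejecting default.\<close>
    moreover have "stp (Sk q j, tape (cells K u \<sigma>) ?xs, int (length ?xs)) = (Rej, tape (cells K u \<sigma>) ?xs, int (length ?xs))"
      by (subst astep_move[where q' = Rej and a' = "tape (cells K u \<sigma>) ?xs (int (length ?xs))" and d = 0]) (auto simp: tape_def)
    ultimately have "(stp ^^ Suc (length ?xs)) (Home q j, tape (cells K u \<sigma>) ?xs, 0) = (Rej, tape (cells K u \<sigma>) ?xs, int (length ?xs))"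
      by simp
    from Rej_never[OF this] False show ?thesis by auto
  qed auto
next
  case (Cons b c)
  let ?c = "(Home q j, tape (cells K u \<sigma>) (rl p (\<sigma> 0) m (b # c)), 0)"
  show ?case
  proof (cases "q = qf \<and> j = 0")
    case True
    then show ?thesis by auto
  next
    case False
    then have ne: "q \<noteq> qf \<or> j \<noteq> 0" by auto
    note sim = sel_sim[where \<sigma> = \<sigma> and u = u, OF ne Cons.prems(1,2,3,4)]
    show ?thesis
    proof (cases "sel E (q, j, \<sigma>) b")
      case None
      from sim(2)[OF None] obtain t tp h where "(stp ^^ t) ?c = (Rej, tp, h)" by blast
      then show ?thesis using Rej_never False None by auto
    next
      case (Some s)
      obtain q' j' \<sigma>' where s: "s = (q', j', \<sigma>')" by (cases s) auto
      from sim(1)[OF Some[unfolded s]] obtain t u' p' where t: "t \<le> 4 * N + 2 * H + 6"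
        "(stp ^^ t) ?c = (Home q' j', tape (cells K u' \<sigma>') (rl p' (\<sigma>' 0) (Suc m) c), 0)"
        "inok (\<sigma>' 0)" "\<And>r. u' r + length (\<sigma>' r) \<le> Suc H" "N = length (rl p' (\<sigma>' 0) (Suc m) c)" by blast
      note IH = Cons.IH[where \<sigma> = \<sigma>' and u = u', OF t(3) Cons.prems(2) t(5,4), of q' j']
      have "fst ((stp ^^ (i + t)) ?c) = fst ((stp ^^ i) (Home q' j', tape (cells K u' \<sigma>') (rl p' (\<sigma>' 0) (Suc m) c), 0))" for i
        using t(2) by (simp add: funpow_add)
      moreover have "i + t \<le> length (b # c) * (4 * N + 2 * (H + length (b # c)) + 6)"
        if "i \<le> length c * (4 * N + 2 * (Suc H + length c) + 6)" for i
        using that t(1) by (simp add: algebra_simps)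
      moreover have "sel_accepts E qf (q, j, \<sigma>) (b # c) = sel_accepts E qf (q', j', \<sigma>') c"
        using Some s ne by auto
      moreover note astep_accepts_later[OF t(2)]
      ultimately show ?thesis using IH by metis
    qed
  qed
qed

end


text \<open>The separator belongs to register 0, so that a program can recognize the end of the
  input by popping it.\<close>

definition init_store :: "nat list \<Rightarrow> store" where
  "init_store w = (\<lambda>r. if r = 0 then w @ [7] else [])"

lemma finite_L_cells: "finite {f :: nat \<Rightarrow> nat. \<forall>x. (x \<in> {..K} \<longrightarrow> f x \<in> {..G}) \<and> (x \<notin> {..K} \<longrightarrow> f x = 0)}"
  by (rule finite_set_of_finite_funs) auto

text \<open>Finiteness is the point: the states of the machine mention only states, actions and
  positions of \<open>E\<close>, and a queue cell is a function on the registers up to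
  \<open>K\<close> with bounded values. The sum \<open>G\<close> of all symbols in \<open>E\<close>
  is a crude bound for each of them. The blank 0 is represented by the empty queue cell.\<close>

lemma qm_tm:
  assumes "\<forall>e \<in> set E. regs_ok K (fst (snd e))"
  shows "\<exists>M. tm_wf M \<and> (\<forall>w t. set w \<subseteq> {1..<8} \<longrightarrow>
    (tm_accepts_within M w t \<longleftrightarrow> (\<exists>i \<le> t. fst ((astep (qm_delta E) (Home qf 0) ^^ i)
       (Home q0 0, \<lambda>i. if 0 \<le> i \<and> i < int (length w) then Rc (w ! nat i) else Lc (\<lambda>_. 0), 0)) = Home qf 0)))"
proof -
  define sym where "sym e = (case fst (snd e) of None \<Rightarrow> 0 | Some (Pop r a) \<Rightarrow> a | Some (Push r a) \<Rightarrow> a)" for e :: edge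
  define G where "G = sum_list (map sym E)"
  define QS where "QS = insert q0 (insert qf (fst ` set E \<union> (snd \<circ> snd) ` set E))"
  define JS where "JS = {..length E}"
  define OS where "OS = insert None ((fst \<circ> snd) ` set E)"
  define AS where "AS = {x. Some x \<in> OS}"
  define F where "F = {f :: nat \<Rightarrow> nat. \<forall>x. (x \<in> {..K} \<longrightarrow> f x \<in> {..G + 2}) \<and> (x \<notin> {..K} \<longrightarrow> f x = 0)}"
  define \<Gamma> where "\<Gamma> = Rc ` {..9} \<union> Lc ` F"
  define Q where "Q = case_prod Home ` (QS \<times> JS) \<union> case_prod Sk ` (QS \<times> JS) \<union> (\<lambda>(x, q, j). Bk x q j) ` (OS \<times> QS \<times> JS)
    \<union> case_prod Do ` (AS \<times> QS) \<union> case_prod Inn ` ({..G} \<times> QS) \<union> Rt ` QS \<union> {Rej}"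
  have symG: "a \<le> G" if "Pop r a \<in> AS \<or> Push r a \<in> AS" for r a
  proof -
    from that obtain e where "e \<in> set E" "sym e = a" by (force simp: AS_def OS_def sym_def)
    then show ?thesis using member_le_sum_list[of a "map sym E"] by (auto simp: G_def)
  qed
  have regs: "regs_ok K (Some x)" if "x \<in> AS" for x using that assms by (auto simp: AS_def OS_def)
  have OSE: "fst (snd (E ! j)) \<in> OS" "snd (snd (E ! j)) \<in> QS" if "j < length E" for j
    using that by (auto simp: OS_def QS_def)
  have finO: "finite OS" by (simp add: OS_def)
  have "AS \<subseteq> the ` OS" by (force simp: AS_def)
  then have finA: "finite AS" using finO finite_subset by blast
  define \<iota> where "\<iota> s = (if s = 0 then Lc (\<lambda>_. 0) else Rc s)" for s :: nat
  have "\<exists>M. tm_wf M \<and> (\<forall>w t. set w \<subseteq> {..<8} \<longrightarrow>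
    (tm_accepts_within M w t \<longleftrightarrow> (\<exists>i \<le> t. fst ((astep (qm_delta E) (Home qf 0) ^^ i)
       (Home q0 0, \<lambda>i. if 0 \<le> i \<and> i < int (length w) then \<iota> (w ! nat i) else \<iota> 0, 0)) = Home qf 0)))"
  proof (rule abstract_tm[where Q = Q and \<Gamma> = \<Gamma>])
    show "finite Q" using finO finA by (simp add: Q_def QS_def JS_def)
    show "finite \<Gamma>" unfolding \<Gamma>_def F_def using finite_L_cells by blast
    show "Home q0 0 \<in> Q" "Home qf 0 \<in> Q" by (force simp: Q_def QS_def JS_def)+
    show "inj_on \<iota> {..<8}" by (auto simp: inj_on_def \<iota>_def split: if_splits)
    show "\<iota> ` {..<8} \<subseteq> \<Gamma>" by (auto simp: \<iota>_def \<Gamma>_def F_def)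
    fix q a assume qa: "q \<in> Q" "a \<in> \<Gamma>"
    have HQ: "Home q j \<in> Q \<longleftrightarrow> q \<in> QS \<and> j \<in> JS" "Sk q j \<in> Q \<longleftrightarrow> q \<in> QS \<and> j \<in> JS"
      "Bk x q j \<in> Q \<longleftrightarrow> x \<in> OS \<and> q \<in> QS \<and> j \<in> JS" "Do y q \<in> Q \<longleftrightarrow> y \<in> AS \<and> q \<in> QS"
      "Inn b q \<in> Q \<longleftrightarrow> b \<le> G \<and> q \<in> QS" "Rt q \<in> Q \<longleftrightarrow> q \<in> QS" "Rej \<in> Q" for q j x y b
      by (auto simp: Q_def image_iff)
    have G: "Rc s \<in> \<Gamma> \<longleftrightarrow> s \<le> 9" "Lc f \<in> \<Gamma> \<longleftrightarrow> f \<in> F" for s f by (auto simp: \<Gamma>_def)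
    have OA: "Some x \<in> OS \<longleftrightarrow> x \<in> AS" "None \<in> OS" for x by (auto simp: AS_def OS_def)
    have J: "j \<in> JS \<longleftrightarrow> j \<le> length E" for j by (simp add: JS_def)
    have upd: "f(r := v) \<in> F" if "f \<in> F" "r \<le> K" "v \<le> G + 2" for f r v using that by (auto simp: F_def)
    have rg: "r \<le> K" if "Pop r a \<in> AS \<or> Push r a \<in> AS" for r a
      using that regs[of "Pop r a"] regs[of "Push r a"] by (auto simp: regs_ok_def)
    show "case qm_delta E q a of (q', a', d) \<Rightarrow> q' \<in> Q \<and> a' \<in> \<Gamma> \<and> d \<in> {-1, 0, 1}"
      using qa by (cases "(E, q, a)" rule: qm_delta.cases)
        (auto simp: HQ G OA J OSE intro!: upd intro: symG[OF disjI1] symG[OF disjI2] rg[OF disjI1] rg[OF disjI2])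
  qed
  then obtain M where M: "tm_wf M" "\<And>w t. set w \<subseteq> {..<8} \<Longrightarrow>
    (tm_accepts_within M w t \<longleftrightarrow> (\<exists>i \<le> t. fst ((astep (qm_delta E) (Home qf 0) ^^ i)
       (Home q0 0, \<lambda>i. if 0 \<le> i \<and> i < int (length w) then \<iota> (w ! nat i) else \<iota> 0, 0)) = Home qf 0))" by blast
  have "(\<lambda>i. if 0 \<le> i \<and> i < int (length w) then \<iota> (w ! nat i) else \<iota> 0)
      = (\<lambda>i. if 0 \<le> i \<and> i < int (length w) then Rc (w ! nat i) else Lc (\<lambda>_. 0))"
    and "set w \<subseteq> {..<8}" if w: "set w \<subseteq> {1..<8}" for w
  proof -
    have "w ! nat i \<noteq> 0" if "0 \<le> i" "i < int (length w)" for i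
      using w that nth_mem[of "nat i" w] by fastforce
    then show "(\<lambda>i. if 0 \<le> i \<and> i < int (length w) then \<iota> (w ! nat i) else \<iota> 0)
      = (\<lambda>i. if 0 \<le> i \<and> i < int (length w) then Rc (w ! nat i) else Lc (\<lambda>_. 0))"
      unfolding \<iota>_def by (intro ext) (metis (no_types, lifting))
    show "set w \<subseteq> {..<8}" using w by auto
  qed
  with M show ?thesis by (intro exI[of _ M] conjI allI impI) simp_all
qed

theorem qm_in_NP:
  assumes E: "q0 \<noteq> qf" "\<forall>e \<in> set E. regs_ok K (fst (snd e))"
    and sound: "\<And>w n \<sigma>'. w \<in> lists input_alphabet \<Longrightarrow> nrun E q0 (init_store w) n qf \<sigma>' \<Longrightarrow> w \<in> L"
    and compl: "\<And>w. w \<in> lists input_alphabet \<Longrightarrow> w \<in> L \<Longrightarrow>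
      \<exists>n \<sigma>'. n \<le> a * (length w + 1) ^ d \<and> nrun E q0 (init_store w) n qf \<sigma>'"
  shows "in_NP L"
proof -
  interpret qm E qf .
  obtain M where M: "tm_wf M" "\<And>w t. set w \<subseteq> {1..<8} \<Longrightarrow>
    (tm_accepts_within M w t \<longleftrightarrow> (\<exists>i \<le> t. fst ((stp ^^ i)
       (Home q0 0, \<lambda>i. if 0 \<le> i \<and> i < int (length w) then Rc (w ! nat i) else Lc (\<lambda>_. 0), 0)) = Home qf 0))"
    using qm_tm[OF E(2), of qf q0] by blast
  \<comment> \<open>The certificate has at most \<open>b * (length w + 1) ^ d\<close> bits, and each
    bit costs a number of steps linear in the lengths of certificate and input. Hence the product in
    \<open>A\<close> and the doubled exponent in \<open>D\<close>; the last summand of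
    \<open>A\<close> pays for the length of the certificate itself.\<close>
  define b where "b = a * length E"
  define A where "A = b * (6 * b + 18) + b"
  define D where "D = 2 * d + 1"
  show ?thesis unfolding in_NP_def
  proof (rule exI[of _ M], rule exI[of _ A], rule exI[of _ D], intro conjI ballI M(1))
    fix w assume w: "w \<in> lists input_alphabet"
    then have w6: "set w \<subseteq> {1..6}" by (auto simp: input_alphabet_def)
    let ?m = "length w + 1"
    let ?\<sigma> = "init_store w"
    have acc: "tm_accepts_within M (w @ [7] @ enc_cert c) t \<longleftrightarrow> (\<exists>i \<le> t. fst ((stp ^^ i)
       (Home q0 0, tape (cells K (\<lambda>_. 0) ?\<sigma>) (rl 0 (?\<sigma> 0) 0 c), 0)) = Home qf 0)" for c t
    proof -
      have "set (w @ [7] @ enc_cert c) \<subseteq> {1..<8}" using w6 by (force simp: enc_cert_def)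
      note M(2)[OF this, of t]
      moreover have "(\<lambda>i. if 0 \<le> i \<and> i < int (length (w @ [7] @ enc_cert c)) then Rc ((w @ [7] @ enc_cert c) ! nat i) else Lc (\<lambda>_. 0))
        = tape (cells K (\<lambda>_. 0) ?\<sigma>) (rl 0 (?\<sigma> 0) 0 c)"
        by (auto simp: fun_eq_iff tape_def rl_def cells_def init_store_def)
      ultimately show ?thesis by simp
    qed
    have ok: "inok (?\<sigma> 0)" using w6 by (auto simp: inok_def init_store_def)
    have H: "0 + length (?\<sigma> r) \<le> ?m" for r by (simp add: init_store_def)
    note sim = accept_sim[where \<sigma> = ?\<sigma> and u = "\<lambda>_. 0" and p = 0 and m = 0 and q = q0 and j = 0, OF ok E(2) refl H]
    show "w \<in> L \<longleftrightarrow> (\<exists>c. length c \<le> A * ?m ^ D \<and> tm_accepts_within M (w @ [7] @ enc_cert c) (A * ?m ^ D))"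
    proof
      assume "w \<in> L"
      from compl[OF w this] obtain n \<sigma>' where n: "n \<le> a * ?m ^ d" "nrun E q0 ?\<sigma> n qf \<sigma>'" by blast
      from sel_accepts_complete[OF n(2)] obtain c where
        c: "length c \<le> n * length E" "sel_accepts E qf (q0, 0, ?\<sigma>) c" by blast
      have c1: "length c \<le> b * ?m ^ d"
        using le_trans[OF c(1) mult_le_mono1[OF n(1), of "length E"]] unfolding b_def by (simp add: ac_simps)
      have m1: "?m ^ d \<ge> 1" by simp
      have le1: "b * ?m ^ d \<le> A * ?m ^ D" unfolding A_def D_def
        by (intro mult_le_mono power_increasing) auto
      let ?N = "length (rl 0 (?\<sigma> 0) 0 c)"
      have "?N = ?m + length c" by (simp add: length_rl init_store_def)
      then have "4 * ?N + 2 * (?m + length c) + 6 = 6 * length c + 6 * ?m + 6" by simp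
      also have "\<dots> \<le> 6 * (b * ?m ^ d) + 12 * ?m" using c1 by simp
      also have "\<dots> \<le> 6 * (b * (?m ^ d * ?m)) + 12 * (?m ^ d * ?m)"
        using m1 mult_le_mono1[OF m1, of ?m] by (intro add_mono mult_le_mono le_refl) (simp_all del: One_nat_def)
      also have "\<dots> \<le> (6 * b + 18) * (?m ^ d * ?m)" by (simp add: algebra_simps)
      finally have "length c * (4 * ?N + 2 * (?m + length c) + 6) \<le> (b * ?m ^ d) * ((6 * b + 18) * (?m ^ d * ?m))"
        by (intro mult_le_mono c1)
      also have "\<dots> = b * (6 * b + 18) * ?m ^ D"
      proof -
        have "x ^ D = x ^ d * (x ^ d * x)" for x :: nat unfolding D_def mult_2 power_add by simp
        then show ?thesis by (simp only: ac_simps)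
      qed
      also have "\<dots> \<le> A * ?m ^ D" by (simp add: A_def)
      finally have le2: "length c * (4 * ?N + 2 * (?m + length c) + 6) \<le> A * ?m ^ D" .
      from sim[of c] c(2) obtain i where "i \<le> length c * (4 * ?N + 2 * (?m + length c) + 6)"
        "fst ((stp ^^ i) (Home q0 0, tape (cells K (\<lambda>_. 0) ?\<sigma>) (rl 0 (?\<sigma> 0) 0 c), 0)) = Home qf 0" by blast
      then have "tm_accepts_within M (w @ [7] @ enc_cert c) (A * ?m ^ D)"
        unfolding acc using le2 le_trans by blast
      then show "\<exists>c. length c \<le> A * ?m ^ D \<and> tm_accepts_within M (w @ [7] @ enc_cert c) (A * ?m ^ D)"
        using c1 le1 le_trans by blast
    next
      assume "\<exists>c. length c \<le> A * ?m ^ D \<and> tm_accepts_within M (w @ [7] @ enc_cert c) (A * ?m ^ D)"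
      then obtain c where "sel_accepts E qf (q0, 0, ?\<sigma>) c" using acc sim by blast
      from sel_accepts_sound[OF this] sound[OF w] show "w \<in> L" by blast
    qed
  qed
qed

section \<open>Regular programs over queue actions\<close>

datatype rexp = Zero | One | Atom act | Seq rexp rexp | Alt rexp rexp | Star rexp

inductive lang :: "rexp \<Rightarrow> act list \<Rightarrow> bool" where
  lang_One: "lang One []"
| lang_Atom: "lang (Atom x) [x]"
| lang_Seq: "lang p \<alpha> \<Longrightarrow> lang q \<beta> \<Longrightarrow> lang (Seq p q) (\<alpha> @ \<beta>)"
| lang_Alt1: "lang p \<alpha> \<Longrightarrow> lang (Alt p q) \<alpha>"
| lang_Alt2: "lang q \<alpha> \<Longrightarrow> lang (Alt p q) \<alpha>"
| lang_Star0: "lang (Star p) []"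
| lang_StarS: "lang p \<alpha> \<Longrightarrow> lang (Star p) \<beta> \<Longrightarrow> lang (Star p) (\<alpha> @ \<beta>)"

inductive_cases lang_ZeroE [elim!]: "lang Zero \<alpha>"
inductive_cases lang_OneE [elim!]: "lang One \<alpha>"
inductive_cases lang_AtomE [elim!]: "lang (Atom x) \<alpha>"
inductive_cases lang_SeqE [elim!]: "lang (Seq p q) \<alpha>"
inductive_cases lang_AltE [elim!]: "lang (Alt p q) \<alpha>"

lemma lang_Star_induct [consumes 1, case_names Nil Cons]:
  assumes "lang (Star p) \<alpha>" "P []" "\<And>\<alpha> \<beta>. lang p \<alpha> \<Longrightarrow> lang (Star p) \<beta> \<Longrightarrow> P \<beta> \<Longrightarrow> P (\<alpha> @ \<beta>)"
  shows "P \<alpha>"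
  using assms(1) by (induction "Star p" \<alpha> rule: lang.induct) (auto intro: assms)

fun runs :: "store \<Rightarrow> act list \<Rightarrow> store \<Rightarrow> bool" where
  "runs \<sigma> [] \<sigma>' \<longleftrightarrow> \<sigma>' = \<sigma>"
| "runs \<sigma> (x # \<alpha>) \<sigma>' \<longleftrightarrow> (\<exists>\<sigma>1. step_act x \<sigma> = Some \<sigma>1 \<and> runs \<sigma>1 \<alpha> \<sigma>')"

lemma runs_append: "runs \<sigma> (\<alpha> @ \<beta>) \<sigma>' \<longleftrightarrow> (\<exists>\<sigma>1. runs \<sigma> \<alpha> \<sigma>1 \<and> runs \<sigma>1 \<beta> \<sigma>')"
  by (induction \<alpha> arbitrary: \<sigma>) auto

text \<open>Thompson's construction: edges leading from a to b, with fresh states from n on.\<close>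

fun thompson :: "rexp \<Rightarrow> nat \<Rightarrow> nat \<Rightarrow> nat \<Rightarrow> edge list \<times> nat" where
  "thompson Zero a b n = ([], n)"
| "thompson One a b n = ([(a, None, b)], n)"
| "thompson (Atom x) a b n = ([(a, Some x, b)], n)"
| "thompson (Seq p q) a b n = (let (E1, n1) = thompson p a n (Suc n); (E2, n2) = thompson q n b n1 in (E1 @ E2, n2))"
| "thompson (Alt p q) a b n = (let (E1, n1) = thompson p a b n; (E2, n2) = thompson q a b n1 in (E1 @ E2, n2))"
| "thompson (Star p) a b n = (let (E, n') = thompson p n (Suc n) (Suc (Suc n))
     in ((a, None, n) # (Suc n, None, n) # (n, None, b) # E, n'))"

lemma nrun_trans: "nrun E q \<sigma> m q1 \<sigma>1 \<Longrightarrow> nrun E q1 \<sigma>1 n q2 \<sigma>2 \<Longrightarrow> nrun E q \<sigma> (m + n) q2 \<sigma>2"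
  by (induction rule: nrun.induct) (auto intro: nrun_step)

lemma nrun_eps: "(q, None, q1) \<in> set E \<Longrightarrow> nrun E q1 \<sigma> n q2 \<sigma>2 \<Longrightarrow> nrun E q \<sigma> (Suc n) q2 \<sigma>2"
  by (rule nrun_step[where x = None]) auto

fun cst :: "rexp \<Rightarrow> nat" where
  "cst Zero = 1" | "cst One = 1" | "cst (Atom x) = 1"
| "cst (Seq p q) = cst p + cst q" | "cst (Alt p q) = cst p + cst q" | "cst (Star p) = 2 * cst p + 2"

text \<open>Rounds of a star that read the empty word are left out. Every remaining round has an
  action that pays for its edges without action, so the number of edges is linear in the length of
  the word; the factor 2 of \<open>cst\<close> at a star comes from here.\<close>

lemma thompson_complete:
  "lang p \<alpha> \<Longrightarrow> runs \<sigma> \<alpha> \<sigma>' \<Longrightarrow> set (fst (thompson p a b k)) \<subseteq> set E \<Longrightarrow>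
    \<exists>n \<le> cst p * (length \<alpha> + 1). nrun E a \<sigma> n b \<sigma>'"
proof (induction p arbitrary: \<alpha> \<sigma> \<sigma>' a b k)
  case Zero then show ?case by auto
next
  case One
  then have "\<sigma>' = \<sigma>" "(a, None, b) \<in> set E" by auto
  then have "nrun E a \<sigma> (Suc 0) b \<sigma>'" by (auto intro: nrun_eps[OF _ nrun_refl])
  then show ?case by (intro exI[of _ "Suc 0"]) auto
next
  case (Atom x)
  then have "nrun E a \<sigma> (Suc 0) b \<sigma>'" by (intro nrun_step[where x = "Some x"]) (auto intro: nrun_refl)
  then show ?case by (intro exI[of _ 1]) auto
next
  case (Seq p q)
  from Seq.prems(1) obtain \<beta> \<gamma> where \<alpha>: "\<alpha> = \<beta> @ \<gamma>" "lang p \<beta>" "lang q \<gamma>" by auto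
  with Seq.prems(2) obtain \<sigma>1 where \<sigma>1: "runs \<sigma> \<beta> \<sigma>1" "runs \<sigma>1 \<gamma> \<sigma>'" by (auto simp: runs_append)
  have E: "set (fst (thompson p a k (Suc k))) \<subseteq> set E" "set (fst (thompson q k b (snd (thompson p a k (Suc k))))) \<subseteq> set E"
    using Seq.prems(3) by (auto split: prod.splits)
  from Seq.IH(1)[OF \<alpha>(2) \<sigma>1(1) E(1)] Seq.IH(2)[OF \<alpha>(3) \<sigma>1(2) E(2)] obtain n1 n2 where
    "n1 \<le> cst p * (length \<beta> + 1)" "nrun E a \<sigma> n1 k \<sigma>1" "n2 \<le> cst q * (length \<gamma> + 1)" "nrun E k \<sigma>1 n2 b \<sigma>'" by blast
  moreover have "cst p * (length \<beta> + 1) \<le> cst p * (length \<alpha> + 1)" "cst q * (length \<gamma> + 1) \<le> cst q * (length \<alpha> + 1)"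
    unfolding \<alpha>(1) by (intro mult_le_mono2, simp)+
  ultimately have "n1 + n2 \<le> cst (Seq p q) * (length \<alpha> + 1)" "nrun E a \<sigma> (n1 + n2) b \<sigma>'"
    using nrun_trans by (simp_all only: cst.simps add_mult_distrib)
  then show ?case by blast
next
  case (Alt p q)
  have E: "set (fst (thompson p a b k)) \<subseteq> set E" "set (fst (thompson q a b (snd (thompson p a b k)))) \<subseteq> set E"
    using Alt.prems(3) by (auto split: prod.splits)
  from Alt.prems(1) show ?case
  proof
    assume "lang p \<alpha>"
    from Alt.IH(1)[OF this Alt.prems(2) E(1)] obtain n where "n \<le> cst p * (length \<alpha> + 1)" "nrun E a \<sigma> n b \<sigma>'" by blast
    moreover have "cst p * (length \<alpha> + 1) \<le> cst (Alt p q) * (length \<alpha> + 1)" by (intro mult_le_mono1) simp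
    ultimately show ?thesis using le_trans by blast
  next
    assume "lang q \<alpha>"
    from Alt.IH(2)[OF this Alt.prems(2) E(2)] obtain n where "n \<le> cst q * (length \<alpha> + 1)" "nrun E a \<sigma> n b \<sigma>'" by blast
    moreover have "cst q * (length \<alpha> + 1) \<le> cst (Alt p q) * (length \<alpha> + 1)" by (intro mult_le_mono1) simp
    ultimately show ?thesis using le_trans by blast
  qed
next
  case (Star p)
  let ?c = k and ?d = "Suc k"
  have E: "set (fst (thompson p ?c ?d (Suc (Suc k)))) \<subseteq> set E" "(a, None, ?c) \<in> set E" "(?d, None, ?c) \<in> set E" "(?c, None, b) \<in> set E"
    using Star.prems(3) by (auto split: prod.splits)
  have "\<exists>n \<le> (2 * cst p + 1) * length \<alpha> + 1. nrun E ?c \<sigma> n b \<sigma>'"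
    using Star.prems(1,2)
  proof (induction \<alpha> arbitrary: \<sigma> rule: lang_Star_induct)
    case Nil
    then have "nrun E ?c \<sigma> (Suc 0) b \<sigma>'" using E by (auto intro: nrun_eps[OF _ nrun_refl])
    then show ?case by (intro exI[of _ "Suc 0"]) auto
  next
    case (Cons \<beta> \<gamma>)
    then obtain \<sigma>1 where \<sigma>1: "runs \<sigma> \<beta> \<sigma>1" "runs \<sigma>1 \<gamma> \<sigma>'" by (auto simp: runs_append)
    from Cons.IH[OF \<sigma>1(2)] obtain n where n: "n \<le> (2 * cst p + 1) * length \<gamma> + 1" "nrun E ?c \<sigma>1 n b \<sigma>'" by blast
    show ?case
    proof (cases "\<beta> = []")
      case True
      then show ?thesis using n \<sigma>1 by auto
    next
      case False
      then have l: "1 \<le> length \<beta>" by (cases \<beta>) auto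
      from Star.IH[OF Cons(1) \<sigma>1(1) E(1)] obtain m where m: "m \<le> cst p * (length \<beta> + 1)" "nrun E ?c \<sigma> m ?d \<sigma>1" by blast
      have "nrun E ?c \<sigma> (m + Suc n) b \<sigma>'" using m(2) n(2) E(3) by (blast intro: nrun_trans nrun_eps)
      moreover have "m + Suc n \<le> (2 * cst p + 1) * length (\<beta> @ \<gamma>) + 1"
      proof -
        have "cst p * (length \<beta> + 1) \<le> cst p * (2 * length \<beta>)" using l by (intro mult_le_mono2) simp
        then have "m \<le> cst p * (2 * length \<beta>)" using m(1) by linarith
        then have "m + 1 \<le> (2 * cst p + 1) * length \<beta>" using l by (simp add: algebra_simps)
        then show ?thesis using n(1) by (simp add: algebra_simps)
      qed
      ultimately show ?thesis by blast
    qed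
  qed
  then obtain n where n: "n \<le> (2 * cst p + 1) * length \<alpha> + 1" "nrun E ?c \<sigma> n b \<sigma>'" by blast
  have "nrun E a \<sigma> (Suc n) b \<sigma>'" using n(2) E(2) by (rule nrun_eps[rotated])
  moreover have "Suc n \<le> cst (Star p) * (length \<alpha> + 1)" using n(1) by (simp add: algebra_simps)
  ultimately show ?case by blast
qed

text \<open>For soundness, states are labelled with sets of stores that are closed backwards along edges.\<close>

definition labelled :: "(nat \<Rightarrow> store set) \<Rightarrow> edge list \<Rightarrow> bool" where
  "labelled K E \<longleftrightarrow> (\<forall>q x q' \<sigma> \<sigma>'. (q, x, q') \<in> set E \<longrightarrow> step_opt x \<sigma> = Some \<sigma>' \<longrightarrow> \<sigma>' \<in> K q' \<longrightarrow> \<sigma> \<in> K q)"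

text \<open>The least set with which the start state of \<open>p\<close> can be labelled when its
  end state is labelled \<open>S\<close>.\<close>

definition wpre :: "rexp \<Rightarrow> store set \<Rightarrow> store set" where
  "wpre p S = {\<sigma>. \<exists>\<alpha> \<sigma>'. lang p \<alpha> \<and> runs \<sigma> \<alpha> \<sigma>' \<and> \<sigma>' \<in> S}"

lemma nrun_labelled: "nrun E q \<sigma> n q' \<sigma>' \<Longrightarrow> labelled K E \<Longrightarrow> \<sigma>' \<in> K q' \<Longrightarrow> \<sigma> \<in> K q"
  by (induction rule: nrun.induct) (auto simp: labelled_def)

text \<open>Fresh states of one part do not occur in the edges of an earlier part, so a labelling
  found for the earlier part is not disturbed by its extension to the later one.\<close>

lemma thompson_states:
  "a < n \<Longrightarrow> b < n \<Longrightarrow> n \<le> snd (thompson p a b n) \<and>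
    (\<forall>(q, x, q') \<in> set (fst (thompson p a b n)). q < snd (thompson p a b n) \<and> q' < snd (thompson p a b n))"
proof (induction p arbitrary: a b n)
  case (Seq p q)
  obtain E1 n1 E2 n2 where 1: "thompson p a n (Suc n) = (E1, n1)" "thompson q n b n1 = (E2, n2)" by fastforce
  then show ?case using Seq.IH(1)[of a "Suc n" n] Seq.IH(2)[of n n1 b] Seq.prems by (auto dest!: bspec)
next
  case (Alt p q)
  obtain E1 n1 E2 n2 where 1: "thompson p a b n = (E1, n1)" "thompson q a b n1 = (E2, n2)" by fastforce
  then show ?case using Alt.IH(1)[of a n b] Alt.IH(2)[of a n1 b] Alt.prems by (auto dest!: bspec)
next
  case (Star p)
  obtain E1 n1 where 1: "thompson p n (Suc n) (Suc (Suc n)) = (E1, n1)" by fastforce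
  then show ?case using Star.IH[of n "Suc (Suc n)" "Suc n"] Star.prems by (auto dest!: bspec)
qed auto

lemma labelled_cong:
  "labelled K E \<Longrightarrow> (\<And>q x q'. (q, x, q') \<in> set E \<Longrightarrow> K' q = K q \<and> K' q' = K q') \<Longrightarrow> labelled K' E"
  unfolding labelled_def by metis

lemma labelled_append [simp]: "labelled K (E @ E') \<longleftrightarrow> labelled K E \<and> labelled K E'"
  by (auto simp: labelled_def)

lemma wpre_Seq: "wpre p (wpre q S) \<subseteq> wpre (Seq p q) S"
  unfolding wpre_def by (auto simp: runs_append) (metis lang_Seq runs_append)

text \<open>A labelling of the old states extends to the fresh ones: the middle state of
  \<open>Seq\<close> gets the precondition of the second part, and both loop states of
  \<open>Star\<close> get that of the whole star. An inclusion is assumed for \<open>a\<close> and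
  \<open>b\<close>, and not an equality, because the branches of an alternative share their end
  states.\<close>

lemma thompson_sound:
  "a < n \<Longrightarrow> b < n \<Longrightarrow> wpre p (K0 b) \<subseteq> K0 a \<Longrightarrow>
    \<exists>K. (\<forall>s < n. K s = K0 s) \<and> labelled K (fst (thompson p a b n))"
proof (induction p arbitrary: a b n K0)
  case Zero
  show ?case by (intro exI[of _ K0]) (auto simp: labelled_def)
next
  case One
  have "\<sigma> \<in> K0 a" if "\<sigma> \<in> K0 b" for \<sigma>
  proof -
    have "\<sigma> \<in> wpre One (K0 b)" using that lang_One unfolding wpre_def by (metis (mono_tags, lifting) mem_Collect_eq runs.simps(1))
    then show ?thesis using One.prems(3) by blast
  qed
  then show ?case by (intro exI[of _ K0]) (auto simp: labelled_def)
next
  case (Atom x)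
  have "\<sigma> \<in> K0 a" if "step_act x \<sigma> = Some \<sigma>'" "\<sigma>' \<in> K0 b" for \<sigma> \<sigma>'
  proof -
    have "runs \<sigma> [x] \<sigma>'" using that by simp
    then have "\<sigma> \<in> wpre (Atom x) (K0 b)" using that(2) lang_Atom unfolding wpre_def by blast
    then show ?thesis using Atom.prems(3) by blast
  qed
  then show ?case by (intro exI[of _ K0]) (auto simp: labelled_def)
next
  case (Seq p q)
  obtain E1 n1 E2 n2 where th: "thompson p a n (Suc n) = (E1, n1)" "thompson q n b n1 = (E2, n2)" by fastforce
  define K0' where "K0' = K0(n := wpre q (K0 b))"
  have "wpre p (K0' n) \<subseteq> K0' a" using Seq.prems wpre_Seq[of p q "K0 b"] by (auto simp: K0'_def)
  with Seq.IH(1)[of a "Suc n" n K0'] Seq.prems th obtain K1 where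
    K1: "\<And>s. s < Suc n \<Longrightarrow> K1 s = K0' s" "labelled K1 E1" by auto
  have st: "Suc n \<le> n1" "\<And>q x q'. (q, x, q') \<in> set E1 \<Longrightarrow> q < n1 \<and> q' < n1"
    using thompson_states[of a "Suc n" n p] Seq.prems th by auto
  have "wpre q (K1 b) \<subseteq> K1 n" using K1(1)[of b] K1(1)[of n] Seq.prems by (auto simp: K0'_def)
  with Seq.IH(2)[of n n1 b K1] Seq.prems th st obtain K2 where
    K2: "\<And>s. s < n1 \<Longrightarrow> K2 s = K1 s" "labelled K2 E2" by auto
  have "labelled K2 E1" using K1(2) by (rule labelled_cong) (use st K2 in auto)
  moreover have "K2 s = K0 s" if "s < n" for s using that st K1(1)[of s] K2(1)[of s] by (auto simp: K0'_def)
  ultimately show ?case using K2 th by (intro exI[of _ K2]) auto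
next
  case (Alt p q)
  obtain E1 n1 E2 n2 where th: "thompson p a b n = (E1, n1)" "thompson q a b n1 = (E2, n2)" by fastforce
  have w: "wpre p (K0 b) \<subseteq> K0 a" "wpre q (K0 b) \<subseteq> K0 a"
    using Alt.prems(3) by (auto simp: wpre_def intro: lang_Alt1 lang_Alt2)
  with Alt.IH(1)[of a n b K0] Alt.prems th obtain K1 where
    K1: "\<And>s. s < n \<Longrightarrow> K1 s = K0 s" "labelled K1 E1" by auto
  have st: "n \<le> n1" "\<And>q x q'. (q, x, q') \<in> set E1 \<Longrightarrow> q < n1 \<and> q' < n1"
    using thompson_states[of a n b p] Alt.prems th by auto
  have "wpre q (K1 b) \<subseteq> K1 a" using K1(1)[of b] K1(1)[of a] Alt.prems w by auto
  with Alt.IH(2)[of a n1 b K1] Alt.prems th st obtain K2 where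
    K2: "\<And>s. s < n1 \<Longrightarrow> K2 s = K1 s" "labelled K2 E2" by auto
  have "labelled K2 E1" using K1(2) by (rule labelled_cong) (use st K2 in auto)
  moreover have "K2 s = K0 s" if "s < n" for s using that st K1(1)[of s] K2(1)[of s] by auto
  ultimately show ?case using K2 th by (intro exI[of _ K2]) auto
next
  case (Star p)
  obtain E1 n1 where th: "thompson p n (Suc n) (Suc (Suc n)) = (E1, n1)" by fastforce
  define W where "W = wpre (Star p) (K0 b)"
  define K0' where "K0' = K0(n := W, Suc n := W)"
  have "wpre p W \<subseteq> W" unfolding W_def wpre_def by (auto simp: runs_append) (metis lang_StarS runs_append)
  with Star.IH[of n "Suc (Suc n)" "Suc n" K0'] th obtain K1 where
    K1: "\<And>s. s < Suc (Suc n) \<Longrightarrow> K1 s = K0' s" "labelled K1 E1" by (auto simp: K0'_def)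
  have "K0 b \<subseteq> W" unfolding W_def wpre_def by (auto intro: lang_Star0 exI[of _ "[]"])
  moreover have "W \<subseteq> K0 a" using Star.prems W_def by simp
  ultimately show ?case using K1 Star.prems th
    by (intro exI[of _ K1]) (auto simp: labelled_def K0'_def)
qed

fun regs_okp :: "nat \<Rightarrow> rexp \<Rightarrow> bool" where
  "regs_okp K (Atom x) \<longleftrightarrow> regs_ok K (Some x)"
| "regs_okp K (Seq p q) \<longleftrightarrow> regs_okp K p \<and> regs_okp K q"
| "regs_okp K (Alt p q) \<longleftrightarrow> regs_okp K p \<and> regs_okp K q"
| "regs_okp K (Star p) \<longleftrightarrow> regs_okp K p"
| "regs_okp K _ \<longleftrightarrow> True"

lemma thompson_fst:
  "fst (thompson (Seq p q) a b n) = fst (thompson p a n (Suc n)) @ fst (thompson q n b (snd (thompson p a n (Suc n))))"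
  "fst (thompson (Alt p q) a b n) = fst (thompson p a b n) @ fst (thompson q a b (snd (thompson p a b n)))"
  "fst (thompson (Star p) a b n) = (a, None, n) # (Suc n, None, n) # (n, None, b) # fst (thompson p n (Suc n) (Suc (Suc n)))"
  by (simp_all split: prod.splits)

lemma thompson_regs: "regs_okp K p \<Longrightarrow> \<forall>e \<in> set (fst (thompson p a b n)). regs_ok K (fst (snd e))"
  by (induction p arbitrary: a b n) (auto simp: thompson_fst regs_ok_def[of _ None] simp del: thompson.simps(4-6), fastforce+)

definition exec :: "rexp \<Rightarrow> nat \<Rightarrow> store \<Rightarrow> store \<Rightarrow> bool" where
  "exec p n \<sigma> \<sigma>' \<longleftrightarrow> (\<exists>\<alpha>. lang p \<alpha> \<and> runs \<sigma> \<alpha> \<sigma>' \<and> length \<alpha> \<le> n)"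

theorem program_in_NP:
  assumes regs: "regs_okp K p"
    and sound: "\<And>w n \<sigma>'. w \<in> lists input_alphabet \<Longrightarrow> exec p n (init_store w) \<sigma>' \<Longrightarrow> w \<in> A"
    and compl: "\<And>w. w \<in> lists input_alphabet \<Longrightarrow> w \<in> A \<Longrightarrow> \<exists>\<sigma>'. exec p (a * (length w + 1) ^ d) (init_store w) \<sigma>'"
  shows "in_NP A"
proof -
  define E where "E = fst (thompson p 0 1 2)"
  show ?thesis
  proof (rule qm_in_NP[where E = E and K = K and ?q0.0 = 0 and qf = 1 and a = "cst p * (a + 1)" and d = d])
    show "\<forall>e \<in> set E. regs_ok K (fst (snd e))" unfolding E_def by (rule thompson_regs[OF regs])
  next
    fix w n \<sigma>' assume w: "w \<in> lists input_alphabet" and run: "nrun E 0 (init_store w) n 1 \<sigma>'"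
    \<comment> \<open>Labelling the final state with the single store that was reached turns the
      label of the start state into the existence of a word of \<open>p\<close> leading
      there.\<close>
    define K0 where "K0 s = (if s = (0 :: nat) then wpre p {\<sigma>'} else {\<sigma>'})" for s
    from thompson_sound[of 0 2 1 p K0] obtain Lb where
      Lb: "\<forall>s < 2. Lb s = K0 s" "labelled Lb E" by (auto simp: K0_def E_def)
    have "init_store w \<in> Lb 0" by (rule nrun_labelled[OF run Lb(2)]) (use Lb(1) in \<open>simp add: K0_def\<close>)
    then have "init_store w \<in> wpre p {\<sigma>'}" using Lb(1) by (simp add: K0_def)
    then show "w \<in> A" using sound[OF w] by (auto simp: wpre_def exec_def)
  next
    fix w assume w: "w \<in> lists input_alphabet" "w \<in> A"
    from compl[OF w] obtain \<sigma>' \<alpha> where \<alpha>: "lang p \<alpha>" "runs (init_store w) \<alpha> \<sigma>'" "length \<alpha> \<le> a * (length w + 1) ^ d"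
      by (auto simp: exec_def)
    from thompson_complete[OF \<alpha>(1,2), of 0 1 2 E] obtain n where
      n: "n \<le> cst p * (length \<alpha> + 1)" "nrun E 0 (init_store w) n 1 \<sigma>'" by (auto simp: E_def)
    have "length \<alpha> + 1 \<le> (a + 1) * (length w + 1) ^ d" 
    proof -
      have "1 \<le> (length w + 1) ^ d" by simp
      then show ?thesis using \<alpha>(3) unfolding add_mult_distrib by linarith
    qed
    then have "cst p * (length \<alpha> + 1) \<le> cst p * ((a + 1) * (length w + 1) ^ d)" by (rule mult_le_mono2)
    then have "n \<le> cst p * (a + 1) * (length w + 1) ^ d" using n(1) by (simp only: mult.assoc)
    then show "\<exists>n \<sigma>'. n \<le> cst p * (a + 1) * (length w + 1) ^ d \<and> nrun E 0 (init_store w) n 1 \<sigma>'"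
      using n(2) by blast
  qed simp
qed

section \<open>Reasoning about programs\<close>

lemma exec_mono: "exec p n \<sigma> \<sigma>' \<Longrightarrow> n \<le> m \<Longrightarrow> exec p m \<sigma> \<sigma>'"
  by (auto simp: exec_def)

lemma exec_One: "exec One n \<sigma> \<sigma>"
  by (auto simp: exec_def intro!: exI[of _ "[]"] lang_One)

lemma exec_Seq: "exec p n \<sigma> \<sigma>1 \<Longrightarrow> exec q m \<sigma>1 \<sigma>' \<Longrightarrow> exec (Seq p q) (n + m) \<sigma> \<sigma>'"
  unfolding exec_def by (metis add_mono lang_Seq length_append runs_append)

lemma exec_Alt1: "exec p n \<sigma> \<sigma>' \<Longrightarrow> exec (Alt p q) n \<sigma> \<sigma>'"
  by (auto simp: exec_def intro: lang_Alt1)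

lemma exec_Alt2: "exec q n \<sigma> \<sigma>' \<Longrightarrow> exec (Alt p q) n \<sigma> \<sigma>'"
  by (auto simp: exec_def intro: lang_Alt2)

lemma exec_Star0: "exec (Star p) n \<sigma> \<sigma>"
  by (auto simp: exec_def intro!: exI[of _ "[]"] lang_Star0)

lemma exec_StarS: "exec p n \<sigma> \<sigma>1 \<Longrightarrow> exec (Star p) m \<sigma>1 \<sigma>' \<Longrightarrow> exec (Star p) (n + m) \<sigma> \<sigma>'"
  unfolding exec_def by (metis add_mono lang_StarS length_append runs_append)

lemma exec_SeqE:
  assumes "exec (Seq p q) n \<sigma> \<sigma>'"
  obtains \<sigma>1 where "exec p n \<sigma> \<sigma>1" "exec q n \<sigma>1 \<sigma>'"
proof -
  from assms obtain \<alpha> \<beta> \<sigma>1 where "lang p \<alpha>" "lang q \<beta>" "runs \<sigma> \<alpha> \<sigma>1" "runs \<sigma>1 \<beta> \<sigma>'" "length (\<alpha> @ \<beta>) \<le> n"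
    unfolding exec_def by (auto simp: runs_append)
  then show thesis by (intro that[of \<sigma>1]) (auto simp: exec_def)
qed

lemma exec_AltE:
  assumes "exec (Alt p q) n \<sigma> \<sigma>'"
  obtains "exec p n \<sigma> \<sigma>'" | "exec q n \<sigma> \<sigma>'"
  using assms unfolding exec_def by blast

lemma exec_OneE: "exec One n \<sigma> \<sigma>' \<Longrightarrow> \<sigma>' = \<sigma>"
  by (auto simp: exec_def)

text \<open>The invariant rule for loops. A single round may be given the bound \<open>n\<close> of
  the whole loop, since in soundness proofs the bound carries no information.\<close>

lemma exec_Star_inv:
  assumes "exec (Star p) n \<sigma> \<sigma>'" "P \<sigma>" "\<And>\<sigma> \<sigma>'. P \<sigma> \<Longrightarrow> exec p n \<sigma> \<sigma>' \<Longrightarrow> P \<sigma>'"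
  shows "P \<sigma>'"
proof -
  obtain \<alpha> where \<alpha>: "lang (Star p) \<alpha>" "runs \<sigma> \<alpha> \<sigma>'" "length \<alpha> \<le> n" using assms(1) by (auto simp: exec_def)
  from \<alpha>(1) show ?thesis using \<alpha>(2,3) assms(2)
  proof (induction \<alpha> arbitrary: \<sigma> rule: lang_Star_induct)
    case (Cons \<alpha> \<beta>)
    then obtain \<sigma>1 where \<sigma>1: "runs \<sigma> \<alpha> \<sigma>1" "runs \<sigma>1 \<beta> \<sigma>'" by (auto simp: runs_append)
    then have "exec p n \<sigma> \<sigma>1" using Cons by (auto simp: exec_def)
    then show ?case using Cons \<sigma>1 assms(3) by auto
  qed auto
qed

section \<open>Words popped from and pushed to a register\<close>

fun pops :: "nat \<Rightarrow> act list \<Rightarrow> nat list" where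
  "pops r [] = []"
| "pops r (Pop r' a # \<alpha>) = (if r = r' then [a] else []) @ pops r \<alpha>"
| "pops r (Push r' a # \<alpha>) = pops r \<alpha>"

fun pushes :: "nat \<Rightarrow> act list \<Rightarrow> nat list" where
  "pushes r [] = []"
| "pushes r (Pop r' a # \<alpha>) = pushes r \<alpha>"
| "pushes r (Push r' a # \<alpha>) = (if r = r' then [a] else []) @ pushes r \<alpha>"

lemma pops_append [simp]: "pops r (\<alpha> @ \<beta>) = pops r \<alpha> @ pops r \<beta>"
  by (induction r \<alpha> rule: pops.induct) auto

lemma pushes_append [simp]: "pushes r (\<alpha> @ \<beta>) = pushes r \<alpha> @ pushes r \<beta>"
  by (induction r \<alpha> rule: pushes.induct) auto

text \<open>The interleaving of actions on different registers is irrelevant: only the words that are popped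
  from and pushed to each register matter.\<close>

lemma runs_fifo: "runs \<sigma> \<alpha> \<sigma>' \<Longrightarrow> \<sigma> r @ pushes r \<alpha> = pops r \<alpha> @ \<sigma>' r"
proof (induction \<alpha> arbitrary: \<sigma>)
  case (Cons x \<alpha>)
  then obtain \<sigma>1 where \<sigma>1: "step_act x \<sigma> = Some \<sigma>1" "\<sigma>1 r @ pushes r \<alpha> = pops r \<alpha> @ \<sigma>' r" by auto
  then show ?case by (cases x) (auto split: list.splits if_splits)
qed simp

text \<open>No pop has to wait for a push, because each register initially holds everything that
  will be popped from it; \<open>\<rho>\<close> is the rest, which stays in front of the pushed
  words.\<close>

lemma runs_safe: "(\<And>r. \<sigma> r = pops r \<alpha> @ \<rho> r) \<Longrightarrow> (\<And>r. \<sigma>' r = \<rho> r @ pushes r \<alpha>) \<Longrightarrow> runs \<sigma> \<alpha> \<sigma>'"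
proof (induction \<alpha> arbitrary: \<sigma> \<rho>)
  case Nil
  then show ?case by (auto simp: fun_eq_iff)
next
  case (Cons x \<alpha>)
  show ?case
  proof (cases x)
    case (Pop r a)
    have "runs (\<sigma>(r := tl (\<sigma> r))) \<alpha> \<sigma>'"
      by (rule Cons.IH[of _ \<rho>]) (use Cons.prems Pop in auto)
    moreover have "\<sigma> r = a # tl (\<sigma> r)" using Cons.prems(1)[of r] Pop by simp
    ultimately show ?thesis using Pop by (auto split: list.splits)
  next
    case (Push r a)
    have "runs (\<sigma>(r := \<sigma> r @ [a])) \<alpha> \<sigma>'"
      by (rule Cons.IH[of _ "\<rho>(r := \<rho> r @ [a])"]) (use Cons.prems Push in auto)
    then show ?thesis using Push by simp
  qed
qed

section \<open>Words, finite alternatives and loops as programs\<close>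

definition Word :: "act list \<Rightarrow> rexp" where
  "Word \<alpha> = foldr (\<lambda>x. Seq (Atom x)) \<alpha> One"

definition Alts :: "rexp list \<Rightarrow> rexp" where
  "Alts ps = foldr Alt ps Zero"

definition Loop :: "act list list \<Rightarrow> rexp" where
  "Loop ws = Star (Alts (map Word ws))"

lemma lang_Word [simp]: "lang (Word \<alpha>) \<beta> \<longleftrightarrow> \<beta> = \<alpha>"
proof (induction \<alpha> arbitrary: \<beta>)
  case Nil
  then show ?case by (auto simp: Word_def intro: lang_One)
next
  case (Cons x \<alpha>)
  have "Word (x # \<alpha>) = Seq (Atom x) (Word \<alpha>)" by (simp add: Word_def)
  moreover have "lang (Word \<alpha>) \<alpha>" using Cons by simp
  ultimately show ?case using Cons lang_Seq[OF lang_Atom[of x]] by auto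
qed

lemma lang_Alts [simp]: "lang (Alts ps) \<alpha> \<longleftrightarrow> (\<exists>p \<in> set ps. lang p \<alpha>)"
  by (induction ps) (auto simp: Alts_def intro: lang_Alt1 lang_Alt2)

lemma lang_Loop_induct [consumes 1, case_names Nil Cons]:
  assumes "lang (Loop ws) \<alpha>" "P []" "\<And>w \<beta>. w \<in> set ws \<Longrightarrow> P \<beta> \<Longrightarrow> P (w @ \<beta>)"
  shows "P \<alpha>"
  using assms(1) unfolding Loop_def by (induction rule: lang_Star_induct) (auto intro: assms(2,3))

lemma lang_Loop: "set vs \<subseteq> set ws \<Longrightarrow> lang (Loop ws) (concat vs)"
  by (induction vs) (auto simp: Loop_def intro!: lang_Star0 lang_StarS)

lemma regs_okp_Word [simp]: "regs_okp K (Word \<alpha>) \<longleftrightarrow> (\<forall>x \<in> set \<alpha>. regs_ok K (Some x))"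
  by (induction \<alpha>) (auto simp: Word_def)

lemma regs_okp_Alts [simp]: "regs_okp K (Alts ps) \<longleftrightarrow> (\<forall>p \<in> set ps. regs_okp K p)"
  by (induction ps) (auto simp: Alts_def)

section \<open>Integer vectors on queues\<close>

text \<open>An integer is written most significant bit first in two's complement: a sign 3 (nonnegative)
  or 4 (negative) followed by bits 1 (zero) and 2 (one); a vector is a sequence of integers followed by 5.
  The decoder keeps the components read so far in reverse order.\<close>

definition stepv :: "int list \<Rightarrow> nat \<Rightarrow> int list" where
  "stepv acc s = (if s = 3 then 0 # acc else if s = 4 then (-1) # acc else if s = 5 then acc
     else (case acc of [] \<Rightarrow> [] | h # t \<Rightarrow> (2 * h + int s - 1) # t))"

abbreviation rv :: "nat list \<Rightarrow> int list" where "rv f \<equiv> foldl stepv [] f"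

lemma stepv_simps [simp]:
  "stepv acc 3 = 0 # acc" "stepv acc 4 = (-1) # acc" "stepv acc 5 = acc" "stepv [] (Suc 0) = []" "stepv [] 2 = []"
  "stepv (h # t) (Suc 0) = 2 * h # t" "stepv (h # t) 2 = (2 * h + 1) # t"
  by (simp_all add: stepv_def)

definition vv :: "nat list \<Rightarrow> int list" where "vv f = rev (rv f)"

text \<open>Fixes only the alphabet and the end marker, which is enough to delimit the word in a
  queue. That digits follow a sign is enforced by the adder, which accepts nothing else.\<close>

definition isvec :: "nat list \<Rightarrow> bool" where
  "isvec f \<longleftrightarrow> (\<exists>g. f = g @ [5] \<and> set g \<subseteq> {1,2,3,4})"

text \<open>A word determines the first occurrence of a separator; all parsing of queue contents
  rests on this.\<close>

lemma split_unique: "a @ x # b = a' @ x # b' \<Longrightarrow> x \<notin> set a \<Longrightarrow> x \<notin> set a' \<Longrightarrow> a = a' \<and> b = b'"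
proof (induction a arbitrary: a')
  case Nil then show ?case by (cases a') auto
next
  case (Cons y a) then show ?case by (cases a') auto
qed

lemma isvec_prefix: "isvec f \<Longrightarrow> isvec g \<Longrightarrow> f @ u = g @ w \<Longrightarrow> f = g \<and> u = w"
proof -
  assume "isvec f" "isvec g" and eq: "f @ u = g @ w"
  then obtain f' g' where *: "f = f' @ [5]" "g = g' @ [5]" "set f' \<subseteq> {1,2,3,4}" "set g' \<subseteq> {1,2,3,4}"
    by (auto simp: isvec_def)
  then have "5 \<notin> set f'" "5 \<notin> set g'" by auto
  then show "f = g \<and> u = w" using split_unique[of f' 5 u g' w] eq * by auto
qed

lemma vv_snoc5 [simp]: "vv (g @ [5]) = rev (rv g)"
  by (simp add: vv_def stepv_def)

section \<open>The automaton for addition with guessed carries\<close>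

type_synonym letter = "nat \<times> nat \<times> nat"

text \<open>The indices of a digit set are the carry out of the digit and the carry into it; a sign
  set has only the carry into it. Combinations of signs and carry that overflow are absent, so a sum
  that does not fit the width cannot be formed.\<close>

definition sgn0 :: "letter list" where "sgn0 = [(3,3,3),(4,3,4),(3,4,4)]"
definition sgn1 :: "letter list" where "sgn1 = [(4,3,3),(3,4,3),(4,4,4)]"
definition d00 :: "letter list" where "d00 = [(1,1,1),(2,1,2),(1,2,2)]"
definition d01 :: "letter list" where "d01 = [(1,1,2)]"
definition d10 :: "letter list" where "d10 = [(2,2,1)]"
definition d11 :: "letter list" where "d11 = [(1,2,1),(2,1,1),(2,2,2)]"

text \<open>A letter carries digits of the summands and of the sum. Reading from the most significant bit,
  the carry c that is expected from the lower bits is guessed.\<close>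

inductive adds :: "nat \<Rightarrow> letter list \<Rightarrow> bool" where
  adds_Nil: "adds 0 []"
| adds_sgn0: "adds 0 ls \<Longrightarrow> l \<in> set sgn0 \<Longrightarrow> adds 0 (ls @ [l])"
| adds_sgn1: "adds 0 ls \<Longrightarrow> l \<in> set sgn1 \<Longrightarrow> adds 1 (ls @ [l])"
| adds_d00: "adds 0 ls \<Longrightarrow> ls \<noteq> [] \<Longrightarrow> l \<in> set d00 \<Longrightarrow> adds 0 (ls @ [l])"
| adds_d01: "adds 0 ls \<Longrightarrow> ls \<noteq> [] \<Longrightarrow> l \<in> set d01 \<Longrightarrow> adds 1 (ls @ [l])"
| adds_d10: "adds 1 ls \<Longrightarrow> ls \<noteq> [] \<Longrightarrow> l \<in> set d10 \<Longrightarrow> adds 0 (ls @ [l])"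
| adds_d11: "adds 1 ls \<Longrightarrow> ls \<noteq> [] \<Longrightarrow> l \<in> set d11 \<Longrightarrow> adds 1 (ls @ [l])"

abbreviation "lx \<equiv> (fst :: letter \<Rightarrow> nat)"
abbreviation ly :: "letter \<Rightarrow> nat" where "ly l \<equiv> fst (snd l)"
abbreviation lz :: "letter \<Rightarrow> nat" where "lz l \<equiv> snd (snd l)"

lemmas letters_def = sgn0_def sgn1_def d00_def d01_def d10_def d11_def

text \<open>While a carry is awaited, the current component of the sum is one more than the sum of
  the current components of the summands; the lower digits have to deliver this one.\<close>

lemma adds_value:
  "adds c ls \<Longrightarrow> set (map lx ls) \<union> set (map ly ls) \<union> set (map lz ls) \<subseteq> {1,2,3,4} \<and>
    (ls \<noteq> [] \<longrightarrow> rv (map lx ls) \<noteq> []) \<and> length (rv (map lx ls)) = length (rv (map ly ls)) \<and>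
    (if c = 0 then rv (map lz ls) = map2 (+) (rv (map lx ls)) (rv (map ly ls))
     else ls \<noteq> [] \<and> rv (map lz ls) = (hd (rv (map lx ls)) + hd (rv (map ly ls)) + 1) #
        map2 (+) (tl (rv (map lx ls))) (tl (rv (map ly ls))))"
proof (induction rule: adds.induct)
  case (adds_d00 ls l)
  then obtain h t h' t' where "rv (map lx ls) = h # t" "rv (map ly ls) = h' # t'"
    by (cases "rv (map lx ls)"; cases "rv (map ly ls)") auto
  then show ?case using adds_d00 by (auto simp: letters_def)
next
  case (adds_d01 ls l)
  then obtain h t h' t' where "rv (map lx ls) = h # t" "rv (map ly ls) = h' # t'"
    by (cases "rv (map lx ls)"; cases "rv (map ly ls)") auto
  then show ?case using adds_d01 by (auto simp: letters_def)
next
  case (adds_d10 ls l)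
  then obtain h t h' t' where "rv (map lx ls) = h # t" "rv (map ly ls) = h' # t'"
    by (cases "rv (map lx ls)"; cases "rv (map ly ls)") auto
  then show ?case using adds_d10 by (auto simp: letters_def)
next
  case (adds_d11 ls l)
  then obtain h t h' t' where "rv (map lx ls) = h # t" "rv (map ly ls) = h' # t'"
    by (cases "rv (map lx ls)"; cases "rv (map ly ls)") auto
  then show ?case using adds_d11 by (auto simp: letters_def)
qed (auto simp: letters_def)

text \<open>\<open>P\<close> selects letters and \<open>f\<close> translates a letter into queue
  actions, so that one automaton serves for adding, doubling and comparing.\<close>

definition A :: "(letter \<Rightarrow> bool) \<Rightarrow> (letter \<Rightarrow> act list) \<Rightarrow> letter list \<Rightarrow> rexp" where
  "A P f ls = Alts (map (\<lambda>l. Word (f l)) (filter P ls))"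

lemma lang_A [simp]: "lang (A P f ls) \<alpha> \<longleftrightarrow> (\<exists>l \<in> set ls. P l \<and> \<alpha> = f l)"
  by (auto simp: A_def)

text \<open>A stretch of digits read while a carry is awaited, up to the digit that generates it.
  Such a stretch is opened by a letter of \<open>d01\<close> or \<open>sgn1\<close>.\<close>

definition ones :: "(letter \<Rightarrow> bool) \<Rightarrow> (letter \<Rightarrow> act list) \<Rightarrow> rexp" where
  "ones P f = Seq (Star (A P f d11)) (A P f d10)"
definition digits :: "(letter \<Rightarrow> bool) \<Rightarrow> (letter \<Rightarrow> act list) \<Rightarrow> rexp" where
  "digits P f = Alt (A P f d00) (Seq (A P f d01) (ones P f))"
definition component :: "(letter \<Rightarrow> bool) \<Rightarrow> (letter \<Rightarrow> act list) \<Rightarrow> rexp" where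
  "component P f = Seq (Alt (A P f sgn0) (Seq (A P f sgn1) (ones P f))) (Star (digits P f))"
definition adder :: "(letter \<Rightarrow> bool) \<Rightarrow> (letter \<Rightarrow> act list) \<Rightarrow> rexp" where
  "adder P f = Seq (Star (component P f)) (Word (f (5,5,5)))"

context
  fixes P :: "letter \<Rightarrow> bool" and f :: "letter \<Rightarrow> act list"
begin

text \<open>With \<open>ne\<close> the part may only follow a nonempty prefix, as a digit needs a
  sign before it. Without \<open>ne\<close> it may stand anywhere and is itself nonempty, which
  supplies the prefix for what follows.\<close>

definition trans_ok :: "nat \<Rightarrow> nat \<Rightarrow> bool \<Rightarrow> act list \<Rightarrow> bool" where
  "trans_ok c c' ne \<alpha> \<longleftrightarrow> (\<exists>ls. (\<forall>l \<in> set ls. P l) \<and> \<alpha> = concat (map f ls) \<and>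
     (\<forall>pre. adds c pre \<longrightarrow> (ne \<longrightarrow> pre \<noteq> []) \<longrightarrow> adds c' (pre @ ls)) \<and> (\<not> ne \<longrightarrow> ls \<noteq> []))"

lemma trans_ok_append: "trans_ok c c' ne \<alpha> \<Longrightarrow> trans_ok c' c'' True \<beta> \<Longrightarrow> trans_ok c c'' ne (\<alpha> @ \<beta>)"
  unfolding trans_ok_def
proof (elim exE conjE)
  fix ls ls'
  assume *: "\<forall>l \<in> set ls. P l" "\<alpha> = concat (map f ls)" "\<forall>pre. adds c pre \<longrightarrow> (ne \<longrightarrow> pre \<noteq> []) \<longrightarrow> adds c' (pre @ ls)"
     "\<not> ne \<longrightarrow> ls \<noteq> []" "\<forall>l \<in> set ls'. P l" "\<beta> = concat (map f ls')"
     "\<forall>pre. adds c' pre \<longrightarrow> (True \<longrightarrow> pre \<noteq> []) \<longrightarrow> adds c'' (pre @ ls')"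
  have "adds c'' (pre @ ls @ ls')" if "adds c pre" "ne \<longrightarrow> pre \<noteq> []" for pre
    using *(3)[rule_format, of pre] *(4) *(7)[rule_format, of "pre @ ls"] that by auto
  then show "\<exists>ls. (\<forall>l \<in> set ls. P l) \<and> \<alpha> @ \<beta> = concat (map f ls) \<and>
     (\<forall>pre. adds c pre \<longrightarrow> (ne \<longrightarrow> pre \<noteq> []) \<longrightarrow> adds c'' (pre @ ls)) \<and> (\<not> ne \<longrightarrow> ls \<noteq> [])"
    using * by (intro exI[of _ "ls @ ls'"]) auto
qed

lemma trans_ok_Nil: "trans_ok c c True []"
  unfolding trans_ok_def by (intro exI[of _ "[]"]) auto

lemma trans_ok_single:
  "(\<And>pre. adds c pre \<Longrightarrow> (ne \<longrightarrow> pre \<noteq> []) \<Longrightarrow> adds c' (pre @ [l])) \<Longrightarrow> P l \<Longrightarrow> trans_ok c c' ne (f l)"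
  unfolding trans_ok_def by (rule exI[of _ "[l]"]) auto

lemma trans_ok_letter:
  "l \<in> set d00 \<Longrightarrow> P l \<Longrightarrow> trans_ok 0 0 True (f l)" "l \<in> set d01 \<Longrightarrow> P l \<Longrightarrow> trans_ok 0 (Suc 0) True (f l)"
  "l \<in> set d10 \<Longrightarrow> P l \<Longrightarrow> trans_ok (Suc 0) 0 True (f l)" "l \<in> set d11 \<Longrightarrow> P l \<Longrightarrow> trans_ok (Suc 0) (Suc 0) True (f l)"
  "l \<in> set sgn0 \<Longrightarrow> P l \<Longrightarrow> trans_ok 0 0 False (f l)" "l \<in> set sgn1 \<Longrightarrow> P l \<Longrightarrow> trans_ok 0 (Suc 0) False (f l)"
  by (rule trans_ok_single, simp_all add: adds.intros(2-7)[unfolded One_nat_def])+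

lemma trans_ok_ones: "lang (ones P f) \<alpha> \<Longrightarrow> trans_ok (Suc 0) 0 True \<alpha>"
proof -
  have "lang (Star (A P f d11)) \<alpha> \<Longrightarrow> trans_ok (Suc 0) (Suc 0) True \<alpha>" for \<alpha>
    by (induction rule: lang_Star_induct) (auto intro: trans_ok_Nil trans_ok_append trans_ok_letter)
  then show "lang (ones P f) \<alpha> \<Longrightarrow> trans_ok (Suc 0) 0 True \<alpha>"
    by (auto simp: ones_def intro!: trans_ok_append[where c' = "Suc 0"] intro: trans_ok_letter)
qed

lemma trans_ok_digits: "lang (digits P f) \<alpha> \<Longrightarrow> trans_ok 0 0 True \<alpha>"
  by (auto simp: digits_def intro!: trans_ok_append[where c' = "Suc 0"] intro: trans_ok_letter trans_ok_ones)

lemma trans_ok_component: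
  assumes "lang (component P f) \<alpha>"
  shows "trans_ok 0 0 False \<alpha>"
proof -
  have "lang (Star (digits P f)) \<alpha> \<Longrightarrow> trans_ok 0 0 True \<alpha>" for \<alpha>
    by (induction rule: lang_Star_induct) (auto intro: trans_ok_Nil trans_ok_append trans_ok_digits)
  moreover have "trans_ok 0 0 False \<alpha>" if "lang (Alt (A P f sgn0) (Seq (A P f sgn1) (ones P f))) \<alpha>" for \<alpha>
    using that by (auto intro!: trans_ok_append[where c' = "Suc 0"] intro: trans_ok_letter trans_ok_ones)
  moreover obtain \<beta> \<gamma> where "\<alpha> = \<beta> @ \<gamma>" "lang (Alt (A P f sgn0) (Seq (A P f sgn1) (ones P f))) \<beta>"
      "lang (Star (digits P f)) \<gamma>"
    using assms[unfolded component_def] by (rule lang_SeqE)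
  ultimately show ?thesis using trans_ok_append[of 0 0 False \<beta> 0 \<gamma>] by simp
qed

lemma adder_sound:
  assumes "lang (adder P f) \<alpha>"
  shows "\<exists>ls. adds 0 ls \<and> (\<forall>l \<in> set ls. P l) \<and> \<alpha> = concat (map f ls) @ f (5,5,5)"
proof -
  have "lang (Star (component P f)) \<alpha> \<Longrightarrow> \<exists>ls. (\<forall>l \<in> set ls. P l) \<and> \<alpha> = concat (map f ls) \<and>
     (\<forall>pre. adds 0 pre \<longrightarrow> adds 0 (pre @ ls))" for \<alpha>
  proof (induction rule: lang_Star_induct)
    case Nil then show ?case by (intro exI[of _ "[]"]) auto
  next
    case (Cons \<alpha> \<beta>)
    from trans_ok_component[OF Cons(1)] obtain ls where
      ls: "\<forall>l \<in> set ls. P l" "\<alpha> = concat (map f ls)" "\<forall>pre. adds 0 pre \<longrightarrow> adds 0 (pre @ ls)"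
      by (auto simp: trans_ok_def)
    from Cons(3) obtain ls' where "\<forall>l \<in> set ls'. P l" "\<beta> = concat (map f ls')" "\<forall>pre. adds 0 pre \<longrightarrow> adds 0 (pre @ ls')" by blast
    with ls show ?case by (intro exI[of _ "ls @ ls'"]) (auto simp flip: append_assoc)
  qed
  moreover obtain \<beta> where "lang (Star (component P f)) \<beta>" "\<alpha> = \<beta> @ f (5,5,5)" using assms by (auto simp: adder_def)
  ultimately obtain ls where "\<forall>l \<in> set ls. P l" "\<beta> = concat (map f ls)" "adds 0 ([] @ ls)" using adds_Nil by blast
  then show ?thesis using \<open>\<alpha> = \<beta> @ f (5,5,5)\<close> by (intro exI[of _ ls]) auto
qed

text \<open>A nonempty sequence of components. The last one is singled out because further digits
  may be appended to it.\<close>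

definition full :: "act list \<Rightarrow> bool" where
  "full \<alpha> \<longleftrightarrow> (\<exists>\<beta> \<gamma>. \<alpha> = \<beta> @ \<gamma> \<and> lang (Star (component P f)) \<beta> \<and> lang (component P f) \<gamma>)"

lemma lang_Star_snoc: "lang (Star p) \<alpha> \<Longrightarrow> lang p \<beta> \<Longrightarrow> lang (Star p) (\<alpha> @ \<beta>)"
proof (induction rule: lang_Star_induct)
  case Nil
  then show ?case using lang_StarS[OF _ lang_Star0] by auto
next
  case (Cons \<alpha> \<beta>')
  then show ?case using lang_StarS by auto
qed

lemma full_digits: "full \<alpha> \<Longrightarrow> lang (digits P f) \<delta> \<Longrightarrow> full (\<alpha> @ \<delta>)"
proof -
  assume "full \<alpha>" "lang (digits P f) \<delta>"
  then obtain \<beta> \<gamma> where 0: "\<alpha> = \<beta> @ \<gamma>" "lang (Star (component P f)) \<beta>" "lang (component P f) \<gamma>"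
    unfolding full_def by blast
  from 0(3)[unfolded component_def] obtain \<gamma>1 \<gamma>2 where \<gamma>: "\<gamma> = \<gamma>1 @ \<gamma>2"
    "lang (Alt (A P f sgn0) (Seq (A P f sgn1) (ones P f))) \<gamma>1" "lang (Star (digits P f)) \<gamma>2" by (rule lang_SeqE)
  note 1 = 0(1)[unfolded \<gamma>(1)] 0(2) \<gamma>(2,3)
  have "lang (component P f) (\<gamma>1 @ (\<gamma>2 @ \<delta>))"
    unfolding component_def by (intro lang_Seq 1(3) lang_Star_snoc[OF 1(4)]) fact
  then show ?thesis using 1 unfolding full_def by (intro exI[of _ \<beta>] exI[of _ "\<gamma>1 @ (\<gamma>2 @ \<delta>)"]) auto
qed

lemma full_star: "full \<alpha> \<Longrightarrow> lang (Star (component P f)) \<alpha>"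
  unfolding full_def using lang_Star_snoc by auto

lemma ones_Cons:
  assumes "lang (ones P f) \<tau>" "l \<in> set d11" "P l"
  shows "lang (ones P f) (f l @ \<tau>)"
proof -
  from assms(1)[unfolded ones_def] obtain \<alpha> \<beta> where \<tau>: "\<tau> = \<alpha> @ \<beta>" "lang (Star (A P f d11)) \<alpha>" "lang (A P f d10) \<beta>"
    by (rule lang_SeqE)
  have "lang (A P f d11) (f l)" using assms by auto
  from lang_Seq[OF lang_StarS[OF this \<tau>(2)] \<tau>(3)] show ?thesis by (simp add: ones_def \<tau>(1))
qed

lemma full_sgn:
  assumes "lang (Star (component P f)) \<beta>" "lang (Alt (A P f sgn0) (Seq (A P f sgn1) (ones P f))) \<gamma>"
  shows "full (\<beta> @ \<gamma>)"
proof -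
  have "lang (component P f) (\<gamma> @ [])" unfolding component_def by (intro lang_Seq assms lang_Star0)
  then show ?thesis using assms(1) unfolding full_def by auto
qed

text \<open>A word that awaits a carry is not yet in the language; it is described by all stretches
  \<open>\<tau>\<close> that complete it. This lets the induction proceed letter by letter although
  \<open>ones\<close> is a single block of the expression.\<close>

lemma adds_lang:
  "adds c ls \<Longrightarrow> \<forall>l \<in> set ls. P l \<Longrightarrow>
    (c = 0 \<longrightarrow> (if ls = [] then True else full (concat (map f ls)))) \<and>
    (c = 1 \<longrightarrow> (\<forall>\<tau>. lang (ones P f) \<tau> \<longrightarrow> full (concat (map f ls) @ \<tau>)))"
proof (induction rule: adds.induct)
  case adds_Nil
  then show ?case by simp
next
  case (adds_sgn0 ls l)
  have "lang (Star (component P f)) (concat (map f ls))"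
    using adds_sgn0 full_star by (cases "ls = []") (auto intro: lang_Star0)
  then have "full (concat (map f ls) @ f l)" using adds_sgn0 by (intro full_sgn lang_Alt1) auto
  then show ?case by simp
next
  case (adds_sgn1 ls l)
  have st: "lang (Star (component P f)) (concat (map f ls))"
    using adds_sgn1 full_star by (cases "ls = []") (auto intro: lang_Star0)
  have "full (concat (map f ls) @ (f l @ \<tau>))" if "lang (ones P f) \<tau>" for \<tau>
    using adds_sgn1 that by (intro full_sgn st lang_Alt2 lang_Seq) auto
  then show ?case by simp
next
  case (adds_d00 ls l)
  then have "full (concat (map f ls) @ f l)" by (intro full_digits) (auto simp: digits_def intro!: lang_Alt1)
  then show ?case by simp
next
  case (adds_d01 ls l)
  then have "full (concat (map f ls) @ (f l @ \<tau>))" if "lang (ones P f) \<tau>" for \<tau>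
    using that by (intro full_digits) (auto simp: digits_def intro!: lang_Alt2 lang_Seq)
  then show ?case by simp
next
  case (adds_d10 ls l)
  have "lang (ones P f) ([] @ f l)" unfolding ones_def using adds_d10 by (intro lang_Seq lang_Star0) auto
  then have "full (concat (map f ls) @ ([] @ f l))" using adds_d10 by auto
  then show ?case by simp
next
  case (adds_d11 ls l)
  have "full (concat (map f ls) @ (f l @ \<tau>))" if "lang (ones P f) \<tau>" for \<tau>
    using ones_Cons[OF that] adds_d11 by auto
  then show ?case by simp
qed

lemma adder_complete:
  assumes "adds 0 ls" "\<forall>l \<in> set ls. P l"
  shows "lang (adder P f) (concat (map f ls) @ f (5,5,5))"
  unfolding adder_def
proof (rule lang_Seq)
  show "lang (Star (component P f)) (concat (map f ls))"
    using adds_lang[OF assms] full_star by (cases "ls = []") (auto intro: lang_Star0)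
qed simp

end

section \<open>Two's complement digits of fixed width\<close>

fun dig :: "nat \<Rightarrow> int \<Rightarrow> nat list" where
  "dig 0 i = [if i < 0 then 4 else 3]"
| "dig (Suc W) i = dig W (i div 2) @ [nat (1 + i mod 2)]"

definition inrange :: "nat \<Rightarrow> int \<Rightarrow> bool" where
  "inrange W i \<longleftrightarrow> - (2 ^ W) \<le> i \<and> i < 2 ^ W"

lemma inrange_Suc: "inrange (Suc W) i \<Longrightarrow> inrange W (i div 2)"
  by (auto simp: inrange_def)

lemma length_dig [simp]: "length (dig W i) = Suc W"
  by (induction W arbitrary: i) auto

lemma mod2_cases: "i mod 2 = 0 \<or> i mod 2 = (1 :: int)"
  by presburger

lemma set_dig: "set (dig W i) \<subseteq> {1,2,3,4}"
proof (induction W arbitrary: i)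
  case (Suc W)
  then show ?case using mod2_cases[of i] by auto
qed auto

text \<open>The induction splits off the least significant digit, which is the last letter. Here
  \<open>c\<close> is the carry that enters the whole number, and \<open>c'\<close> the carry that
  its lowest digit passes on to the rest.\<close>

lemma adds_dig:
  "inrange W i \<Longrightarrow> inrange W j \<Longrightarrow> inrange W (i + j + int c) \<Longrightarrow> c = 0 \<or> c = 1 \<Longrightarrow>
    \<exists>ls. (\<forall>pre. adds 0 pre \<longrightarrow> adds c (pre @ ls)) \<and> ls \<noteq> [] \<and>
      map lx ls = dig W i \<and> map ly ls = dig W j \<and> map lz ls = dig W (i + j + int c)"
proof (induction W arbitrary: i j c)
  case 0
  let ?s = "\<lambda>i. if i < 0 then 4 else (3 :: nat)"
  let ?l = "(?s i, ?s j, ?s (i + j + int c))"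
  have "c = 0 \<Longrightarrow> ?l \<in> set sgn0" "c = 1 \<Longrightarrow> ?l \<in> set sgn1"
    using 0 by (auto simp: inrange_def letters_def)
  then show ?case using 0(4) by (intro exI[of _ "[?l]"]) (auto intro: adds.intros[simplified])
next
  case (Suc W)
  define x y z where "x = i mod 2" and "y = j mod 2" and "z = (i + j + int c) mod 2"
  define c' where "c' = nat ((x + y + int c) div 2)"
  have xy: "x = 0 \<or> x = 1" "y = 0 \<or> y = 1" using mod2_cases by (auto simp: x_def y_def)
  have c': "int c' = (x + y + int c) div 2" "c' = 0 \<or> c' = 1" using xy Suc.prems(4) by (auto simp: c'_def)
  have sum: "(i + j + int c) div 2 = i div 2 + j div 2 + int c'" unfolding c'(1) x_def y_def by presburger
  have z: "z = (x + y + int c) mod 2" unfolding x_def y_def z_def by presburger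
  have "inrange W (i div 2 + j div 2 + int c')" using inrange_Suc[OF Suc.prems(3)] sum by simp
  from Suc.IH[OF inrange_Suc[OF Suc.prems(1)] inrange_Suc[OF Suc.prems(2)] this c'(2)] obtain ls where
    ls: "\<forall>pre. adds 0 pre \<longrightarrow> adds c' (pre @ ls)" "ls \<noteq> []"
      "map lx ls = dig W (i div 2)" "map ly ls = dig W (j div 2)" "map lz ls = dig W (i div 2 + j div 2 + int c')" by blast
  define l where "l = (nat (1 + x), nat (1 + y), nat (1 + z))"
  have l: "c' = 0 \<and> c = 0 \<and> l \<in> set d00 \<or> c' = 0 \<and> c = 1 \<and> l \<in> set d01 \<or> c' = 1 \<and> c = 0 \<and> l \<in> set d10 \<or> c' = 1 \<and> c = 1 \<and> l \<in> set d11"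
    using xy Suc.prems(4) by (elim disjE; simp add: l_def z c'_def letters_def)
  have "adds c (pre @ ls @ [l])" if "adds 0 pre" for pre
  proof -
    have a: "adds c' (pre @ ls)" using ls(1) that by blast
    have "adds c ((pre @ ls) @ [l])" using l a ls(2) adds.intros(4-7)[of "pre @ ls" l] by auto
    then show ?thesis by simp
  qed
  then show ?case using ls sum
    by (intro exI[of _ "ls @ [l]"]) (auto simp: l_def x_def y_def z_def)
qed

text \<open>All components have the same width, so vectors of the same length align letter by
  letter.\<close>

definition fl :: "nat \<Rightarrow> int list \<Rightarrow> nat list" where
  "fl W v = concat (map (dig W) v) @ [5]"

lemma isvec_fl: "isvec (fl W v)"
  unfolding isvec_def fl_def using set_dig by auto

lemma length_fl: "length (fl W v) = length v * Suc W + 1"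
  by (simp add: fl_def length_concat sum_list_triv o_def)

lemma adds_fl:
  assumes "length u = length v" "\<And>i. i \<in> set u \<union> set v \<union> set (map2 (+) u v) \<Longrightarrow> inrange W i"
  shows "\<exists>ls. adds 0 ls \<and> map lx ls @ [5] = fl W u \<and> map ly ls @ [5] = fl W v \<and> map lz ls @ [5] = fl W (map2 (+) u v)"
proof -
  have "\<exists>ls. (\<forall>pre. adds 0 pre \<longrightarrow> adds 0 (pre @ ls)) \<and> map lx ls = concat (map (dig W) u) \<and>
     map ly ls = concat (map (dig W) v) \<and> map lz ls = concat (map (dig W) (map2 (+) u v))"
    using assms
  proof (induction u v rule: list_induct2)
    case Nil
    then show ?case by (intro exI[of _ "[]"]) auto
  next
    case (Cons i u j v)
    then obtain ls where ls: "\<forall>pre. adds 0 pre \<longrightarrow> adds 0 (pre @ ls)" "map lx ls = concat (map (dig W) u)"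
     "map ly ls = concat (map (dig W) v)" "map lz ls = concat (map (dig W) (map2 (+) u v))" by auto
    from adds_dig[of W i j 0] Cons.prems obtain ls0 where
      "\<forall>pre. adds 0 pre \<longrightarrow> adds 0 (pre @ ls0)" "map lx ls0 = dig W i" "map ly ls0 = dig W j" "map lz ls0 = dig W (i + j)" by auto
    with ls show ?case by (intro exI[of _ "ls0 @ ls"]) (auto simp flip: append_assoc)
  qed
  then obtain ls where ls: "\<forall>pre. adds 0 pre \<longrightarrow> adds 0 (pre @ ls)" "map lx ls = concat (map (dig W) u)"
     "map ly ls = concat (map (dig W) v)" "map lz ls = concat (map (dig W) (map2 (+) u v))" by blast
  have "adds 0 ([] @ ls)" using ls(1) adds_Nil by blast
  then show ?thesis using ls(2-4) by (intro exI[of _ ls]) (auto simp: fl_def)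
qed

lemma adds_vv:
  assumes "adds 0 ls"
  shows "isvec (map lx ls @ [5])" "isvec (map ly ls @ [5])" "isvec (map lz ls @ [5])"
    "length (vv (map lx ls @ [5])) = length (vv (map ly ls @ [5]))"
    "vv (map lz ls @ [5]) = map2 (+) (vv (map lx ls @ [5])) (vv (map ly ls @ [5]))"
proof -
  note val = adds_value[OF assms]
  show "isvec (map lx ls @ [5])" "isvec (map ly ls @ [5])" "isvec (map lz ls @ [5])"
    using val unfolding isvec_def by blast+
  show "length (vv (map lx ls @ [5])) = length (vv (map ly ls @ [5]))" using val by simp
  have "rev (map2 (+) a b) = map2 (+) (rev a) (rev b)" if "length a = length b" for a b :: "int list"
    using that by (simp add: rev_map zip_rev)
  then show "vv (map lz ls @ [5]) = map2 (+) (vv (map lx ls @ [5])) (vv (map ly ls @ [5]))"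
    using val by simp
qed

text \<open>The sign symbol starts the first component at 0 or -1, and appending bits does not
  change the sign of a number. In the reversed accumulator this component is the last
  element.\<close>

lemma sign_vv:
  assumes "isvec (s # g)"
  shows "s = 3 \<Longrightarrow> vv (s # g) \<noteq> [] \<and> 0 \<le> vv (s # g) ! 0" and "s = 4 \<Longrightarrow> vv (s # g) \<noteq> [] \<and> vv (s # g) ! 0 < 0"
proof -
  have g: "set g \<subseteq> {1,2,3,4,5}" using assms unfolding isvec_def by (auto simp: Cons_eq_append_conv)
  have pos: "foldl stepv acc g \<noteq> [] \<and> 0 \<le> last (foldl stepv acc g)"
    if "set g \<subseteq> {1,2,3,4,5}" "acc \<noteq> []" "0 \<le> last acc" for acc and g :: "nat list"
    using that
  proof (induction g arbitrary: acc)
    case (Cons x g)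
    have "stepv acc x \<noteq> [] \<and> 0 \<le> last (stepv acc x)"
      using Cons.prems by (auto simp: stepv_def split: list.splits if_splits)
    then show ?case using Cons by simp
  qed simp
  have neg: "foldl stepv acc g \<noteq> [] \<and> last (foldl stepv acc g) < 0"
    if "set g \<subseteq> {1,2,3,4,5}" "acc \<noteq> []" "last acc < 0" for acc and g :: "nat list"
    using that
  proof (induction g arbitrary: acc)
    case (Cons x g)
    have "stepv acc x \<noteq> [] \<and> last (stepv acc x) < 0"
      using Cons.prems by (auto simp: stepv_def split: list.splits if_splits)
    then show ?case using Cons by simp
  qed simp
  show "s = 3 \<Longrightarrow> vv (s # g) \<noteq> [] \<and> 0 \<le> vv (s # g) ! 0"
    using pos[OF g, of "[0]"] by (auto simp: vv_def stepv_def rev_nth last_conv_nth)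
  show "s = 4 \<Longrightarrow> vv (s # g) \<noteq> [] \<and> vv (s # g) ! 0 < 0"
    using neg[OF g, of "[-1]"] by (auto simp: vv_def stepv_def rev_nth last_conv_nth)
qed

section \<open>Reading the input\<close>

lemma exec_pass:
  assumes "lang p \<alpha>" "\<And>r. \<sigma> r = pops r \<alpha> @ \<rho> r" "\<And>r. \<sigma>' r = \<rho> r @ pushes r \<alpha>" "length \<alpha> \<le> n"
  shows "exec p n \<sigma> \<sigma>'"
  unfolding exec_def using assms runs_safe[of \<sigma> \<alpha> \<rho> \<sigma>'] by blast

text \<open>The soundness side of a pass: the word of actions is guessed, and the balance equation
  of each register then restricts the guess.\<close>

lemma exec_fifo:
  assumes "exec p n \<sigma> \<sigma>'"
  obtains \<alpha> where "lang p \<alpha>" "\<And>r. \<sigma> r @ pushes r \<alpha> = pops r \<alpha> @ \<sigma>' r"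
  using assms runs_fifo unfolding exec_def by blast

lemma lang_Loop_map: "lang (Loop (map f S)) \<alpha> \<longleftrightarrow> (\<exists>w. set w \<subseteq> set S \<and> \<alpha> = concat (map f w))"
proof
  assume "lang (Loop (map f S)) \<alpha>"
  then show "\<exists>w. set w \<subseteq> set S \<and> \<alpha> = concat (map f w)"
  proof (induction rule: lang_Loop_induct)
    case Nil then show ?case by (intro exI[of _ "[]"]) auto
  next
    case (Cons u \<beta>)
    then obtain s w where "s \<in> set S" "u = f s" "set w \<subseteq> set S" "\<beta> = concat (map f w)" by auto
    then show ?case by (intro exI[of _ "s # w"]) auto
  qed
next
  assume "\<exists>w. set w \<subseteq> set S \<and> \<alpha> = concat (map f w)"
  then show "lang (Loop (map f S)) \<alpha>" using lang_Loop[of "map f _" "map f S"] by fastforce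
qed

lemma pops_concat_map: "pops r (concat (map f w)) = concat (map (\<lambda>s. pops r (f s)) w)"
  by (induction w) auto

lemma pushes_concat_map: "pushes r (concat (map f w)) = concat (map (\<lambda>s. pushes r (f s)) w)"
  by (induction w) auto

lemma concat_map_Nil [simp]: "concat (map (\<lambda>s. []) w) = []"
  by (induction w) auto

lemma length_concat_le: "(\<And>l. l \<in> set ls \<Longrightarrow> length (f l) \<le> c) \<Longrightarrow> length (concat (map f ls)) \<le> c * length ls"
  by (induction ls) force+

section \<open>Canonical binary numerals\<close>

declare bin.simps [simp del]

definition bv :: "nat \<Rightarrow> nat list \<Rightarrow> nat" where
  "bv = foldl (\<lambda>m s. 2 * m + (s - 1))"

lemma bv_simps [simp]: "bv m [] = m" "bv m (s # w) = bv (2 * m + (s - 1)) w" "bv m (w @ w') = bv (bv m w) w'"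
  by (simp_all add: bv_def)

text \<open>The shape of the numerals produced by \<open>bin\<close>: no leading zeros. They have to
  be recognized exactly, since a word with another numeral encodes no instance.\<close>

definition canon :: "nat list \<Rightarrow> bool" where
  "canon u \<longleftrightarrow> u = [1] \<or> (\<exists>w. u = 2 # w \<and> set w \<subseteq> {1,2})"

lemma bv_bin: "bv 0 (bin n) = n"
proof (induction n rule: less_induct)
  case (less n)
  then show ?case by (cases "n < 2") (simp_all add: bin.simps[of n])
qed

lemma bin_pos: "n \<ge> 1 \<Longrightarrow> \<exists>w. bin n = 2 # w \<and> set w \<subseteq> {1,2}"
proof (induction n rule: less_induct)
  case (less n)
  show ?case
  proof (cases "n < 2")
    case True
    then show ?thesis using less.prems by (simp add: bin.simps[of n])
  next
    case False
    then have "n div 2 < n" "1 \<le> n div 2" by auto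
    then obtain w where "bin (n div 2) = 2 # w" "set w \<subseteq> {1,2}" using less.IH by blast
    moreover have "n mod 2 = 0 \<or> n mod 2 = 1" by presburger
    ultimately show ?thesis using False by (auto simp: bin.simps[of n])
  qed
qed

lemma canon_bin: "canon (bin n)"
proof (cases "n = 0")
  case True then show ?thesis by (simp add: canon_def bin.simps)
next
  case False then show ?thesis using bin_pos[of n] by (auto simp: canon_def)
qed

lemma bin_double: "1 \<le> m \<Longrightarrow> s = 1 \<or> s = 2 \<Longrightarrow> bin (2 * m + (s - 1)) = bin m @ [s]"
  using bin.simps[of "2 * m"] bin.simps[of "Suc (2 * m)"] by auto

lemma canon_unique: "canon u \<Longrightarrow> bin (bv 0 u) = u"
proof -
  have ge: "bv m w \<ge> m" for m w
  proof (induction w arbitrary: m)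
    case (Cons s w)
    have "m \<le> 2 * m + (s - 1)" by simp
    also have "\<dots> \<le> bv (2 * m + (s - 1)) w" by (rule Cons)
    finally show ?case by simp
  qed simp
  have "bin (bv 0 (2 # w)) = 2 # w" if "set w \<subseteq> {1,2}" for w
    using that
  proof (induction w rule: rev_induct)
    case Nil then show ?case by (simp add: bin.simps[of "Suc 0"])
  next
    case (snoc s w)
    let ?m = "bv 0 (2 # w)"
    have m: "?m \<ge> 1" using ge[of 1 w] by simp
    have eq: "bv 0 (2 # w @ [s]) = 2 * ?m + (s - 1)" by simp
    have s: "s = 1 \<or> s = 2" using snoc by auto
    have "bin (2 * ?m + (s - 1)) = bin ?m @ [s]" by (rule bin_double[OF m s])
    then show ?case using snoc eq by simp
  qed
  then show "canon u \<Longrightarrow> bin (bv 0 u) = u" by (auto simp: canon_def bin.simps[of 0])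
qed

lemma set_bin: "set (bin n) \<subseteq> {1,2}"
  using canon_bin[of n] by (auto simp: canon_def)

lemma bin_inj: "bin m = bin n \<longleftrightarrow> m = n"
  using bv_bin by metis

lemma length_bin: "n < 2 ^ W \<Longrightarrow> W \<ge> 1 \<Longrightarrow> length (bin n) \<le> W"
proof (induction W arbitrary: n)
  case (Suc W)
  show ?case
  proof (cases "n < 2")
    case True then show ?thesis by (simp add: bin.simps[of n])
  next
    case False
    then have "W \<ge> 1" using Suc.prems by (cases W) auto
    then have "length (bin (n div 2)) \<le> W" using Suc by auto
    then show ?thesis using False by (simp add: bin.simps[of n])
  qed
qed simp

definition copy_bin :: "nat \<Rightarrow> rexp" where
  "copy_bin r = (let f = \<lambda>s. [Pop 0 s, Push r s] in Alt (Word (f 1)) (Seq (Word (f 2)) (Loop (map f [1, 2]))))"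

lemma lang_copy_bin: "lang (copy_bin r) \<alpha> \<longleftrightarrow> (\<exists>n. \<alpha> = concat (map (\<lambda>s. [Pop 0 s, Push r s]) (bin n)))"
proof
  let ?f = "\<lambda>s. [Pop 0 s, Push r s]"
  assume "lang (copy_bin r) \<alpha>"
  then have "\<exists>u. canon u \<and> \<alpha> = concat (map ?f u)"
    unfolding copy_bin_def Let_def
  proof (elim lang_AltE)
    assume "lang (Word (?f 1)) \<alpha>"
    then show ?thesis by (intro exI[of _ "[1]"]) (auto simp: canon_def)
  next
    assume "lang (Seq (Word (?f 2)) (Loop (map ?f [1, 2]))) \<alpha>"
    then obtain \<beta> where \<beta>: "\<alpha> = ?f 2 @ \<beta>" "lang (Loop (map ?f [1, 2])) \<beta>" by (elim lang_SeqE) auto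
    then obtain w where "set w \<subseteq> {1,2}" "\<beta> = concat (map ?f w)" unfolding lang_Loop_map by auto
    then show ?thesis using \<beta> by (intro exI[of _ "2 # w"]) (auto simp: canon_def)
  qed
  then show "\<exists>n. \<alpha> = concat (map ?f (bin n))" using canon_unique by metis
next
  let ?f = "\<lambda>s. [Pop 0 s, Push r s]"
  assume "\<exists>n. \<alpha> = concat (map ?f (bin n))"
  then obtain n where \<alpha>: "\<alpha> = concat (map ?f (bin n))" by blast
  from canon_bin[of n] consider "bin n = [1]" | w where "bin n = 2 # w" "set w \<subseteq> {1,2}" by (auto simp: canon_def)
  then show "lang (copy_bin r) \<alpha>"
  proof cases
    case 1
    then show ?thesis unfolding copy_bin_def Let_def \<alpha> by (intro lang_Alt1) simp
  next
    case 2
    have "lang (Seq (Word (?f 2)) (Loop (map ?f [1, 2]))) (?f 2 @ concat (map ?f w))"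
      by (intro lang_Seq) (use 2 lang_Loop_map[of ?f "[1,2]"] in auto)
    then show ?thesis unfolding copy_bin_def Let_def \<alpha> using 2 by (intro lang_Alt2) simp
  qed
qed

text \<open>The second equation is the rule that complementing all bits sends \<open>m\<close> to
  \<open>-1 - m\<close>.\<close>

lemma stepv_bits:
  assumes "set w \<subseteq> {1,2}"
  shows "foldl stepv (int m # t) w = int (bv m w) # t"
    and "foldl stepv ((-1 - int m) # t) (map (\<lambda>s. 3 - s) w) = (-1 - int (bv m w)) # t"
proof -
  have "foldl stepv (int m # t) w = int (bv m w) # t \<and>
    foldl stepv ((-1 - int m) # t) (map (\<lambda>s. 3 - s) w) = (-1 - int (bv m w)) # t"
    using assms
  proof (induction w arbitrary: m)
    case (Cons s w)
    have s: "s = 1 \<or> s = 2" using Cons.prems by auto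
    then have "stepv (int m # t) s = int (2 * m + (s - 1)) # t"
      "stepv ((-1 - int m) # t) (3 - s) = (-1 - int (2 * m + (s - 1))) # t" by auto
    then show ?case using Cons.IH[of "2 * m + (s - 1)"] Cons.prems by (simp del: of_nat_add of_nat_mult)
  qed simp
  then show "foldl stepv (int m # t) w = int (bv m w) # t"
    "foldl stepv ((-1 - int m) # t) (map (\<lambda>s. 3 - s) w) = (-1 - int (bv m w)) # t" by auto
qed

text \<open>Padding leaves a sign unchanged: zeros after 0, ones after -1. The third equation
  concerns the zeros at the end of a negative number.\<close>

lemma stepv_ones: "foldl stepv (0 # t) (replicate z 1) = 0 # t" "foldl stepv (-1 # t) (replicate z 2) = -1 # t"
  "foldl stepv (- int m # t) (replicate z 1) = - int (bv m (replicate z 1)) # t"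
proof (induction z arbitrary: m)
  case (Suc z)
  {
    case 1 show ?case using Suc by simp
  next
    case 2 show ?case using Suc by simp
  next
    case 3
    show ?case using Suc(3)[of "2 * m"] by simp
  }
qed auto

text \<open>Reduces equality with \<open>dig\<close> to shape and value; it identifies the words
  that are obtained by padding and complementing.\<close>

lemma dig_unique:
  "length w = W \<Longrightarrow> set w \<subseteq> {1,2} \<Longrightarrow> s = 3 \<or> s = 4 \<Longrightarrow> foldl stepv acc (s # w) = i # acc \<Longrightarrow> dig W i = s # w"
proof (induction W arbitrary: w i)
  case 0
  then show ?case by auto
next
  case (Suc W)
  then obtain w' d where w: "w = w' @ [d]" by (cases w rule: rev_cases) auto
  have d: "d = 1 \<or> d = 2" using Suc.prems w by auto
  have ne: "foldl stepv (h # t) w' \<noteq> []" for h t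
  proof -
    have "set w' \<subseteq> {1,2}" using Suc.prems w by auto
    then show ?thesis by (induction w' arbitrary: h t) auto
  qed
  obtain h t where ht: "foldl stepv acc (s # w') = h # t" using ne Suc.prems(3) by (cases "foldl stepv acc (s # w')") auto
  then have "i = 2 * h + int d - 1" "t = acc" using Suc.prems(4) d by (auto simp: w)
  then have "i div 2 = h" "nat (1 + i mod 2) = d" using d by auto
  moreover have "dig W h = s # w'" by (rule Suc.IH) (use Suc.prems w ht \<open>t = acc\<close> in auto)
  ultimately show ?case by (simp add: w)
qed

text \<open>The length of the padding is guessed, so that all numbers can be brought to a common
  width.\<close>

definition load_nat :: "nat \<Rightarrow> rexp" where
  "load_nat r = Seq (Word [Push r 3]) (Seq (Loop [[Push r 1]]) (Seq (copy_bin r) (Word [Pop 0 4])))"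

text \<open>The digits of a negative number are those of its magnitude, complemented except for the last 1
  and the zeros after it.\<close>

definition load_neg :: "nat \<Rightarrow> rexp" where
  "load_neg r = (let f = \<lambda>s. [Pop 0 s, Push r s]; g = \<lambda>s. [Pop 0 s, Push r (3 - s)]; tail = Seq (Word (f 2)) (Loop [f 1]) in
     Seq (Word [Pop 0 3, Push r 4]) (Seq (Loop [[Push r 2]])
      (Seq (Alt tail (Seq (Word (g 2)) (Seq (Loop (map g [1, 2])) tail))) (Word [Pop 0 4]))))"

definition load_int :: "nat \<Rightarrow> rexp" where
  "load_int r = Alt (load_nat r) (load_neg r)"

definition idle :: "nat set \<Rightarrow> act list \<Rightarrow> bool" where
  "idle R \<alpha> \<longleftrightarrow> (\<forall>r. r \<notin> R \<longrightarrow> pops r \<alpha> = [] \<and> pushes r \<alpha> = [])"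

lemma idle_append [simp]: "idle R (\<alpha> @ \<beta>) \<longleftrightarrow> idle R \<alpha> \<and> idle R \<beta>"
  by (auto simp: idle_def)

lemma idle_Nil [simp]: "idle R []"
  by (simp add: idle_def)

lemma idle_Cons [simp]: "idle R (Pop r a # \<alpha>) \<longleftrightarrow> r \<in> R \<and> idle R \<alpha>" "idle R (Push r a # \<alpha>) \<longleftrightarrow> r \<in> R \<and> idle R \<alpha>"
  by (auto simp: idle_def)

lemma idle_concat: "(\<And>s. s \<in> set w \<Longrightarrow> idle R (f s)) \<Longrightarrow> idle R (concat (map f w))"
  by (induction w) auto

lemma idleD: "idle R \<alpha> \<Longrightarrow> r \<notin> R \<Longrightarrow> pops r \<alpha> = []" "idle R \<alpha> \<Longrightarrow> r \<notin> R \<Longrightarrow> pushes r \<alpha> = []"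
  by (auto simp: idle_def)

lemma lang_Loop_single: "lang (Loop [u]) \<alpha> \<longleftrightarrow> (\<exists>z. \<alpha> = concat (replicate z u))"
proof -
  have "lang (Loop (map (\<lambda>_. u) [()])) \<alpha> \<longleftrightarrow> (\<exists>w :: unit list. \<alpha> = concat (map (\<lambda>_. u) w))"
    unfolding lang_Loop_map by auto
  then show ?thesis by (auto simp: map_replicate_const) (metis length_replicate)
qed

lemma pops_replicate: "pops r (concat (replicate z u)) = concat (replicate z (pops r u))"
  "pushes r (concat (replicate z u)) = concat (replicate z (pushes r u))"
  by (induction z; simp)+

lemma pops_replicate_single:
  "pops r (replicate z x) = concat (replicate z (pops r [x]))"
  "pushes r (replicate z x) = concat (replicate z (pushes r [x]))"
  using pops_replicate[of r z "[x]"] by simp_all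

lemma idle_replicate [simp]: "idle R u \<Longrightarrow> idle R (concat (replicate z u))"
  by (induction z) auto

lemma idle_replicate_single [simp]: "idle R [x] \<Longrightarrow> idle R (replicate z x)"
  using idle_replicate[of R "[x]" z] by simp

lemma foldl_load_nat: "foldl stepv acc (3 # replicate z 1 @ bin n) = int n # acc"
  using stepv_bits(1)[OF set_bin, of 0 acc n] stepv_ones(1)[of acc z] by (simp add: bv_bin)

text \<open>If the bits before the last 1 have value \<open>u\<close>, their complement gives
  \<open>-1 - u\<close>, and appending the kept 1 gives \<open>-(2 * u + 1)\<close>. The zeros after
  it only double.\<close>

lemma foldl_load_neg:
  assumes "set u \<subseteq> {1,2}"
  shows "foldl stepv acc (4 # replicate z 2 @ map (\<lambda>s. 3 - s) u @ 2 # replicate y 1)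
    = - int (bv 0 (u @ 2 # replicate y 1)) # acc"
  using stepv_bits(2)[OF assms, of 0 acc] stepv_ones(3)[of "2 * bv 0 u + 1" acc y] stepv_ones(2)[of acc z]
  by (simp add: algebra_simps)

lemma load_int_sound:
  assumes "lang (if nn then load_nat r else load_int r) \<alpha>" "2 \<le> r"
  shows "\<exists>i. pops 0 \<alpha> = enc_int i \<and> pushes 0 \<alpha> = [] \<and> pops r \<alpha> = [] \<and> idle {0, r} \<alpha> \<and>
    set (pushes r \<alpha>) \<subseteq> {1,2,3,4} \<and> (\<forall>acc. foldl stepv acc (pushes r \<alpha>) = i # acc) \<and> (nn \<longrightarrow> 0 \<le> i)"
proof -
  have nat: ?thesis if l: "lang (load_nat r) \<alpha>"
  proof -
    from l obtain z n where \<alpha>: "\<alpha> = [Push r 3] @ concat (replicate z [Push r 1]) @ concat (map (\<lambda>s. [Pop 0 s, Push r s]) (bin n)) @ [Pop 0 4]"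
      unfolding load_nat_def lang_copy_bin lang_Loop_single by (elim lang_SeqE) (auto simp: lang_copy_bin lang_Loop_single)
    have "pushes r \<alpha> = 3 # replicate z 1 @ bin n"
      using assms(2) by (simp add: \<alpha> pops_replicate pops_replicate_single pushes_concat_map)
    moreover have "pops 0 \<alpha> = enc_int (int n)" "pushes 0 \<alpha> = []" "pops r \<alpha> = []" "idle {0, r} \<alpha>"
      using assms(2) by (auto simp: \<alpha> pops_replicate pops_replicate_single pops_concat_map pushes_concat_map enc_int_def intro!: idle_concat)
    ultimately show ?thesis using foldl_load_nat set_bin[of n] by (intro exI[of _ "int n"]) auto
  qed
  have neg: ?thesis if l: "lang (load_neg r) \<alpha>" "\<not> nn"
  proof -
    let ?f = "\<lambda>s. [Pop 0 s, Push r s]" and ?g = "\<lambda>s. [Pop 0 s, Push r (3 - s)]"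
    define R where "R = Alt (Seq (Word (?f 2)) (Loop [?f 1])) (Seq (Word (?g 2)) (Seq (Loop (map ?g [1, 2])) (Seq (Word (?f 2)) (Loop [?f 1]))))"
    have "lang (Seq (Word [Pop 0 3, Push r 4]) (Seq (Loop [[Push r 2]]) (Seq R (Word [Pop 0 4])))) \<alpha>"
      using l(1) unfolding load_neg_def Let_def R_def .
    then obtain z \<beta> where \<alpha>: "\<alpha> = [Pop 0 3, Push r 4] @ concat (replicate z [Push r 2]) @ \<beta> @ [Pop 0 4]" and
      \<beta>: "lang R \<beta>"
      by (elim lang_SeqE) (auto simp only: lang_Word lang_Loop_single)
    have "\<exists>u y. (u = [] \<or> (\<exists>w. u = 2 # w)) \<and> set u \<subseteq> {1,2} \<and> \<beta> = concat (map ?g u) @ ?f 2 @ concat (replicate y (?f 1))"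
      using \<beta> unfolding R_def
    proof (elim lang_AltE)
      assume "lang (Seq (Word (?f 2)) (Loop [?f 1])) \<beta>"
      then show ?thesis by (elim lang_SeqE) (auto simp: lang_Loop_single intro!: exI[of _ "[]"])
    next
      assume "lang (Seq (Word (?g 2)) (Seq (Loop (map ?g [1, 2])) (Seq (Word (?f 2)) (Loop [?f 1])))) \<beta>"
      then obtain \<gamma> y where "\<beta> = ?g 2 @ \<gamma> @ ?f 2 @ concat (replicate y (?f 1))" "lang (Loop (map ?g [1, 2])) \<gamma>"
        by (elim lang_SeqE) (auto simp: lang_Loop_single simp del: list.map)
      moreover from this obtain w where "set w \<subseteq> {1,2}" "\<gamma> = concat (map ?g w)" unfolding lang_Loop_map by auto
      ultimately show ?thesis by (intro exI[of _ "2 # w"] exI[of _ y]) auto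
    qed
    then obtain u y where u: "u = [] \<or> (\<exists>w. u = 2 # w)" "set u \<subseteq> {1,2}" "\<beta> = concat (map ?g u) @ ?f 2 @ concat (replicate y (?f 1))" by blast
    define t where "t = u @ 2 # replicate y 1"
    define n where "n = bv 0 t"
    have "canon t" using u(1,2) by (auto simp: t_def canon_def)
    then have bin: "bin n = t" unfolding n_def by (rule canon_unique)
    \<comment> \<open>\<open>enc_int\<close> writes a minus sign only before a nonzero magnitude;
      the kept bit 1 guarantees that the numeral is nonzero.\<close>
    have "n \<noteq> 0"
    proof
      assume "n = 0"
      then have "bin n = [1]" by (simp add: bin.simps)
      moreover have "2 \<in> set (bin n)" by (simp add: bin t_def)
      ultimately show False by simp
    qed
    then have "enc_int (- int n) = 3 # t @ [4]" by (simp add: enc_int_def bin)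
    moreover have "pops 0 \<alpha> = 3 # t @ [4]" "pushes 0 \<alpha> = []" "pops r \<alpha> = []"
      using assms(2) by (simp_all add: \<alpha> u(3) t_def pops_replicate pops_replicate_single pops_concat_map pushes_concat_map)
    moreover have "idle {0, r} (concat (map ?g u))" by (rule idle_concat) simp
    then have "idle {0, r} \<alpha>" by (simp add: \<alpha> u(3))
    moreover have p: "pushes r \<alpha> = 4 # replicate z 2 @ map (\<lambda>s. 3 - s) u @ 2 # replicate y 1"
      using assms(2) by (simp add: \<alpha> u(3) pops_replicate pops_replicate_single pushes_concat_map)
    moreover have "foldl stepv acc (pushes r \<alpha>) = (- int n) # acc" for acc
      unfolding p n_def t_def by (rule foldl_load_neg[OF u(2)])
    ultimately show ?thesis using u(2) that(2) by (intro exI[of _ "- int n"]) auto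
  qed
  show ?thesis using assms(1) nat neg by (cases nn) (auto simp: load_int_def)
qed

lemma load_int_complete:
  assumes W: "1 \<le> W" "\<bar>i\<bar> < 2 ^ W" and nn: "nn \<longrightarrow> 0 \<le> i" and r: "2 \<le> r"
  shows "\<exists>\<alpha>. lang (if nn then load_nat r else load_int r) \<alpha> \<and> pops 0 \<alpha> = enc_int i \<and> pushes 0 \<alpha> = [] \<and>
    pops r \<alpha> = [] \<and> idle {0, r} \<alpha> \<and> pushes r \<alpha> = dig W i \<and> length \<alpha> \<le> 2 * W + 3"
proof (cases "0 \<le> i")
  case True
  define n where "n = nat i"
  let ?f = "\<lambda>s. [Pop 0 s, Push r s]"
  have "int n < int (2 ^ W)" using W True by (simp add: n_def)
  then have "n < 2 ^ W" by linarith
  then have len: "length (bin n) \<le> W" using W length_bin by blast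
  define z where "z = W - length (bin n)"
  define \<alpha> where "\<alpha> = [Push r 3] @ concat (replicate z [Push r 1]) @ concat (map ?f (bin n)) @ [Pop 0 4]"
  have "lang (load_nat r) \<alpha>"
    unfolding load_nat_def \<alpha>_def by (intro lang_Seq) (auto simp: lang_Loop_single lang_copy_bin simp del: concat_replicate_single)
  then have "lang (if nn then load_nat r else load_int r) \<alpha>" by (auto simp: load_int_def intro: lang_Alt1)
  moreover have p: "pushes r \<alpha> = 3 # (replicate z 1 @ bin n)"
    using r by (simp add: \<alpha>_def pops_replicate pops_replicate_single pushes_concat_map)
  moreover have "dig W i = 3 # (replicate z 1 @ bin n)"
    using foldl_load_nat[of "[]" z n] set_bin[of n] len True
    by (intro dig_unique[where acc = "[]"]) (auto simp: z_def n_def)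
  moreover have "pops 0 \<alpha> = enc_int i" "pushes 0 \<alpha> = []" "pops r \<alpha> = []"
    using r True by (simp_all add: \<alpha>_def n_def enc_int_def pops_replicate pops_replicate_single pops_concat_map pushes_concat_map)
  moreover have "idle {0, r} (concat (map ?f (bin n)))" by (rule idle_concat) simp
  then have "idle {0, r} \<alpha>" by (simp add: \<alpha>_def)
  moreover have "length \<alpha> \<le> 2 * W + 3"
    using length_concat_le[of "bin n" ?f 2] len by (simp add: \<alpha>_def z_def)
  ultimately show ?thesis by (intro exI[of _ \<alpha>]) auto
next
  case False
  define n where "n = nat (- i)"
  have i: "i = - int n" "n \<ge> 1" using False by (auto simp: n_def)
  let ?f = "\<lambda>s. [Pop 0 s, Push r s]" and ?g = "\<lambda>s. [Pop 0 s, Push r (3 - s)]"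
  have "int n < int (2 ^ W)" using W i by simp
  then have "n < 2 ^ W" by linarith
  then have len: "length (bin n) \<le> W" using W length_bin by blast
  obtain w where w: "bin n = 2 # w" "set w \<subseteq> {1,2}" using bin_pos[OF i(2)] by blast
  \<comment> \<open>The split at the last bit 1: the bits before it are complemented, the others are
    kept.\<close>
  then obtain u ys where uy: "bin n = u @ 2 # ys" "2 \<notin> set ys" by (metis list.set_intros(1) split_list_last)
  have "set ys \<subseteq> {1}" using uy set_bin[of n] by auto
  then have ys: "ys = replicate (length ys) 1" by (induction ys) auto
  define y where "y = length ys"
  have bin: "bin n = u @ 2 # replicate y 1" using uy ys by (simp add: y_def)
  have u: "u = [] \<or> (\<exists>w. u = 2 # w \<and> set w \<subseteq> {1,2})" "set u \<subseteq> {1,2}"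
    using w uy set_bin[of n] by (auto simp: append_eq_Cons_conv)
  define z where "z = W - length (bin n)"
  define \<beta> where "\<beta> = concat (map ?g u) @ ?f 2 @ concat (replicate y (?f 1))"
  define \<alpha> where "\<alpha> = [Pop 0 3, Push r 4] @ concat (replicate z [Push r 2]) @ \<beta> @ [Pop 0 4]"
  let ?tail = "Seq (Word (?f 2)) (Loop [?f 1])"
  have tail: "lang ?tail (?f 2 @ concat (replicate y (?f 1)))"
    by (intro lang_Seq) (auto simp: lang_Loop_single)
  have "lang (Alt ?tail (Seq (Word (?g 2)) (Seq (Loop (map ?g [1, 2])) ?tail))) \<beta>"
  proof (cases "u = []")
    case True
    then show ?thesis unfolding \<beta>_def using tail by (intro lang_Alt1) simp
  next
    case False
    then obtain w where w: "u = 2 # w" "set w \<subseteq> {1,2}" using u by auto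
    have "lang (Loop (map ?g [1, 2])) (concat (map ?g w))" unfolding lang_Loop_map using w(2) by auto
    then have "lang (Seq (Word (?g 2)) (Seq (Loop (map ?g [1, 2])) ?tail)) (?g 2 @ concat (map ?g w) @ ?f 2 @ concat (replicate y (?f 1)))"
      by (intro lang_Seq tail) auto
    then show ?thesis unfolding \<beta>_def w(1) by (intro lang_Alt2) simp
  qed
  then have "lang (load_neg r) \<alpha>"
    unfolding load_neg_def Let_def \<alpha>_def by (intro lang_Seq) (auto simp: lang_Loop_single simp del: concat_replicate_single)
  moreover have "\<not> nn" using nn False by simp
  ultimately have "lang (if nn then load_nat r else load_int r) \<alpha>" by (auto simp: load_int_def intro: lang_Alt2)
  moreover have p: "pushes r \<alpha> = 4 # (replicate z 2 @ map (\<lambda>s. 3 - s) u @ 2 # replicate y 1)"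
    using r by (simp add: \<alpha>_def \<beta>_def pops_replicate pops_replicate_single pushes_concat_map)
  moreover have "dig W i = 4 # (replicate z 2 @ map (\<lambda>s. 3 - s) u @ 2 # replicate y 1)"
  proof (rule dig_unique[where acc = "[]"])
    show "foldl stepv [] (4 # (replicate z 2 @ map (\<lambda>s. 3 - s) u @ 2 # replicate y 1)) = i # []"
    proof -
      have bb: "bv 0 (u @ 2 # replicate y 1) = n" using bv_bin[of n] unfolding bin .
      show ?thesis using foldl_load_neg[OF u(2), of "[]" z y] unfolding bb i(1) .
    qed
    show "length (replicate z 2 @ map (\<lambda>s. 3 - s) u @ 2 # replicate y 1) = W"
      using len by (simp add: z_def bin)
    show "set (replicate z 2 @ map (\<lambda>s. 3 - s) u @ 2 # replicate y 1) \<subseteq> {1, 2}" using u(2) by auto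
  qed simp
  moreover have "pops 0 \<alpha> = enc_int i" "pushes 0 \<alpha> = []" "pops r \<alpha> = []"
    using r False by (simp_all add: \<alpha>_def \<beta>_def n_def[symmetric] bin enc_int_def pops_replicate pops_replicate_single pops_concat_map pushes_concat_map)
  moreover have "idle {0, r} (concat (map ?g u))" by (rule idle_concat) simp
  then have "idle {0, r} \<alpha>" by (simp add: \<alpha>_def \<beta>_def)
  moreover have "length \<alpha> \<le> 2 * W + 3"
    using length_concat_le[of u ?g 2] length_concat_le[of "replicate y 1" ?f 2] len by (simp add: \<alpha>_def \<beta>_def z_def bin)
  ultimately show ?thesis by (intro exI[of _ \<alpha>]) auto
qed

text \<open>Register 1 holds k in unary and is rotated by one symbol for each component after the
  first, so that exactly k + 1 components are read. The flag \<open>nn\<close> demands a nonnegative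
  first component, as a configuration has it.\<close>

definition load_vec :: "bool \<Rightarrow> nat \<Rightarrow> rexp" where
  "load_vec nn r = Seq (if nn then load_nat r else load_int r)
    (Seq (Star (Seq (Word [Pop 1 1, Push 1 1]) (load_int r))) (Word [Pop 1 2, Push 1 2, Pop 0 5, Push r 5]))"

lemma load_ints_sound:
  assumes "lang (Star (Seq (Word [Pop 1 1, Push 1 1]) (load_int r))) \<alpha>" "2 \<le> r"
  shows "\<exists>v. pops 0 \<alpha> = concat (map enc_int v) \<and> pushes 0 \<alpha> = [] \<and> pops 1 \<alpha> = replicate (length v) 1 \<and>
    pushes 1 \<alpha> = replicate (length v) 1 \<and> pops r \<alpha> = [] \<and> idle {0, 1, r} \<alpha> \<and>
    set (pushes r \<alpha>) \<subseteq> {1,2,3,4} \<and> (\<forall>acc. foldl stepv acc (pushes r \<alpha>) = rev v @ acc)"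
  using assms(1)
proof (induction rule: lang_Star_induct)
  case Nil
  then show ?case by (intro exI[of _ "[]"]) auto
next
  case (Cons \<alpha> \<beta>)
  from Cons(1) obtain \<gamma> where \<gamma>: "\<alpha> = [Pop 1 1, Push 1 1] @ \<gamma>" "lang (if False then load_nat r else load_int r) \<gamma>"
    by (elim lang_SeqE) auto
  from load_int_sound[OF \<gamma>(2) assms(2)] obtain i where i: "pops 0 \<gamma> = enc_int i" "pushes 0 \<gamma> = []" "pops r \<gamma> = []"
    "idle {0, r} \<gamma>" "set (pushes r \<gamma>) \<subseteq> {1,2,3,4}" "\<And>acc. foldl stepv acc (pushes r \<gamma>) = i # acc" by blast
  have i1: "pops 1 \<gamma> = []" "pushes 1 \<gamma> = []" using idleD[OF i(4), of 1] assms(2) by auto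
  have "idle {0, 1, r} \<gamma>" using i(4) by (auto simp: idle_def)
  moreover from Cons(3) obtain v where "pops 0 \<beta> = concat (map enc_int v)" "pushes 0 \<beta> = []" "pops 1 \<beta> = replicate (length v) 1"
    "pushes 1 \<beta> = replicate (length v) 1" "pops r \<beta> = []" "idle {0, 1, r} \<beta>"
    "set (pushes r \<beta>) \<subseteq> {1,2,3,4}" "\<forall>acc. foldl stepv acc (pushes r \<beta>) = rev v @ acc" by blast
  ultimately show ?case using i i1 assms(2) by (intro exI[of _ "i # v"]) (auto simp: \<gamma>(1))
qed

lemma load_vec_sound:
  assumes "lang (load_vec nn r) \<alpha>" "2 \<le> r"
  shows "\<exists>v. v \<noteq> [] \<and> pops 0 \<alpha> = enc_vec v \<and> pushes 0 \<alpha> = [] \<and> pops 1 \<alpha> = replicate (length v - 1) 1 @ [2] \<and>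
    pushes 1 \<alpha> = replicate (length v - 1) 1 @ [2] \<and> pops r \<alpha> = [] \<and> idle {0, 1, r} \<alpha> \<and>
    isvec (pushes r \<alpha>) \<and> vv (pushes r \<alpha>) = v \<and> (nn \<longrightarrow> 0 \<le> v ! 0)"
proof -
  obtain \<beta> \<gamma> where \<alpha>: "\<alpha> = \<beta> @ \<gamma> @ [Pop 1 2, Push 1 2, Pop 0 5, Push r 5]" "lang (if nn then load_nat r else load_int r) \<beta>"
    "lang (Star (Seq (Word [Pop 1 1, Push 1 1]) (load_int r))) \<gamma>"
    using assms(1) unfolding load_vec_def
    by (elim lang_SeqE[where p = "if nn then load_nat r else load_int r"] lang_SeqE[where q = "Word [Pop 1 2, Push 1 2, Pop 0 5, Push r 5]"]) simp
  from load_int_sound[OF \<alpha>(2) assms(2)] obtain i where i: "pops 0 \<beta> = enc_int i" "pushes 0 \<beta> = []" "pops r \<beta> = []"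
    "idle {0, r} \<beta>" "set (pushes r \<beta>) \<subseteq> {1,2,3,4}" "\<And>acc. foldl stepv acc (pushes r \<beta>) = i # acc" "nn \<longrightarrow> 0 \<le> i" by blast
  have i1: "pops 1 \<beta> = []" "pushes 1 \<beta> = []" using idleD[OF i(4), of 1] assms(2) by auto
  have i2: "idle {0, 1, r} \<beta>" using i(4) by (auto simp: idle_def)
  from load_ints_sound[OF \<alpha>(3) assms(2)] obtain v where v: "pops 0 \<gamma> = concat (map enc_int v)" "pushes 0 \<gamma> = []"
    "pops 1 \<gamma> = replicate (length v) 1" "pushes 1 \<gamma> = replicate (length v) 1" "pops r \<gamma> = []" "idle {0, 1, r} \<gamma>"
    "set (pushes r \<gamma>) \<subseteq> {1,2,3,4}" "\<And>acc. foldl stepv acc (pushes r \<gamma>) = rev v @ acc" by blast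
  have p: "pushes r \<alpha> = (pushes r \<beta> @ pushes r \<gamma>) @ [5]" using assms(2) by (simp add: \<alpha>(1))
  have "isvec (pushes r \<alpha>)" unfolding isvec_def p using i(5) v(7) by auto
  moreover have "vv (pushes r \<alpha>) = i # v" unfolding p vv_snoc5 using i(6) v(8) by simp
  ultimately show ?thesis using i i1 i2 v assms(2) by (intro exI[of _ "i # v"]) (auto simp: \<alpha>(1) enc_vec_def)
qed

lemma load_ints_complete:
  assumes W: "1 \<le> W" "\<And>i. i \<in> set v \<Longrightarrow> \<bar>i\<bar> < 2 ^ W" and r: "2 \<le> r"
  shows "\<exists>\<alpha>. lang (Star (Seq (Word [Pop 1 1, Push 1 1]) (load_int r))) \<alpha> \<and> pops 0 \<alpha> = concat (map enc_int v) \<and> pushes 0 \<alpha> = [] \<and>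
    pops 1 \<alpha> = replicate (length v) 1 \<and> pushes 1 \<alpha> = replicate (length v) 1 \<and> pops r \<alpha> = [] \<and> idle {0, 1, r} \<alpha> \<and>
    pushes r \<alpha> = concat (map (dig W) v) \<and> length \<alpha> \<le> length v * (2 * W + 5)"
  using assms(2)
proof (induction v)
  case Nil
  then show ?case by (intro exI[of _ "[]"]) (auto intro: lang_Star0)
next
  case (Cons i v)
  then obtain \<beta> where \<beta>: "lang (Star (Seq (Word [Pop 1 1, Push 1 1]) (load_int r))) \<beta>" "pops 0 \<beta> = concat (map enc_int v)" "pushes 0 \<beta> = []"
    "pops 1 \<beta> = replicate (length v) 1" "pushes 1 \<beta> = replicate (length v) 1" "pops r \<beta> = []" "idle {0, 1, r} \<beta>"
    "pushes r \<beta> = concat (map (dig W) v)" "length \<beta> \<le> length v * (2 * W + 5)" by auto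
  from load_int_complete[OF W(1) _ _ r, of i False] Cons.prems obtain \<gamma> where
    \<gamma>: "lang (load_int r) \<gamma>" "pops 0 \<gamma> = enc_int i" "pushes 0 \<gamma> = []" "pops r \<gamma> = []" "idle {0, r} \<gamma>" "pushes r \<gamma> = dig W i"
      "length \<gamma> \<le> 2 * W + 3" by auto
  have i1: "pops 1 \<gamma> = []" "pushes 1 \<gamma> = []" using idleD[OF \<gamma>(5), of 1] r by auto
  have i2: "idle {0, 1, r} \<gamma>" using \<gamma>(5) by (auto simp: idle_def)
  have "lang (Star (Seq (Word [Pop 1 1, Push 1 1]) (load_int r))) (([Pop 1 1, Push 1 1] @ \<gamma>) @ \<beta>)"
    by (intro lang_StarS lang_Seq \<beta> \<gamma>) simp
  then show ?case using \<beta> \<gamma> i1 i2 r by (intro exI[of _ "([Pop 1 1, Push 1 1] @ \<gamma>) @ \<beta>"]) auto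
qed

lemma load_vec_complete:
  assumes W: "1 \<le> W" "\<And>i. i \<in> set v \<Longrightarrow> \<bar>i\<bar> < 2 ^ W" and v: "v \<noteq> []" "nn \<longrightarrow> 0 \<le> v ! 0" and r: "2 \<le> r"
  shows "\<exists>\<alpha>. lang (load_vec nn r) \<alpha> \<and> pops 0 \<alpha> = enc_vec v \<and> pushes 0 \<alpha> = [] \<and> pops 1 \<alpha> = replicate (length v - 1) 1 @ [2] \<and>
    pushes 1 \<alpha> = replicate (length v - 1) 1 @ [2] \<and> pops r \<alpha> = [] \<and> idle {0, 1, r} \<alpha> \<and> pushes r \<alpha> = fl W v \<and>
    length \<alpha> \<le> length v * (2 * W + 5) + 4"
proof -
  obtain i v' where v': "v = i # v'" using v(1) by (cases v) auto
  from load_int_complete[OF W(1) _ _ r, of i nn] W(2)[of i] v v' obtain \<gamma> where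
    \<gamma>: "lang (if nn then load_nat r else load_int r) \<gamma>" "pops 0 \<gamma> = enc_int i" "pushes 0 \<gamma> = []" "pops r \<gamma> = []" "idle {0, r} \<gamma>" "pushes r \<gamma> = dig W i"
      "length \<gamma> \<le> 2 * W + 3" by auto
  have i1: "pops 1 \<gamma> = []" "pushes 1 \<gamma> = []" using idleD[OF \<gamma>(5), of 1] r by auto
  have i2: "idle {0, 1, r} \<gamma>" using \<gamma>(5) by (auto simp: idle_def)
  from load_ints_complete[OF W(1) _ r, of v'] W(2) v' obtain \<beta> where
    \<beta>: "lang (Star (Seq (Word [Pop 1 1, Push 1 1]) (load_int r))) \<beta>" "pops 0 \<beta> = concat (map enc_int v')" "pushes 0 \<beta> = []"
    "pops 1 \<beta> = replicate (length v') 1" "pushes 1 \<beta> = replicate (length v') 1" "pops r \<beta> = []" "idle {0, 1, r} \<beta>"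
    "pushes r \<beta> = concat (map (dig W) v')" "length \<beta> \<le> length v' * (2 * W + 5)" by auto
  have "lang (load_vec nn r) (\<gamma> @ \<beta> @ [Pop 1 2, Push 1 2, Pop 0 5, Push r 5])"
    unfolding load_vec_def by (intro lang_Seq \<beta> \<gamma>) simp
  then show ?thesis using \<beta> \<gamma> i1 i2 r
    by (intro exI[of _ "\<gamma> @ \<beta> @ [Pop 1 2, Push 1 2, Pop 0 5, Push r 5]"]) (auto simp: v' enc_vec_def fl_def)
qed

text \<open>The markers 6, 5 and 7 end the source state, the vector and the transition, which makes
  the queue of transitions uniquely parsable.\<close>

definition encT :: "nat \<times> nat list \<times> nat \<Rightarrow> nat list" where
  "encT t = (case t of (p, f, q) \<Rightarrow> bin p @ [6] @ f @ bin q @ [7])"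

definition load_trans :: rexp where
  "load_trans = Seq (copy_bin 2) (Seq (Word [Pop 0 4, Push 2 6]) (Seq (load_vec False 2) (Seq (copy_bin 2) (Word [Pop 0 5, Push 2 7]))))"

definition load_conf :: "nat \<Rightarrow> nat \<Rightarrow> rexp" where
  "load_conf rp rx = Seq (copy_bin rp) (Seq (Word [Pop 0 4, Push rp 6]) (load_vec True rx))"

abbreviation cpb :: "nat \<Rightarrow> nat \<Rightarrow> act list" where "cpb r n \<equiv> concat (map (\<lambda>s. [Pop 0 s, Push r s]) (bin n))"

lemma cpb_proj:
  assumes "1 \<le> r"
  shows "pops 0 (cpb r n) = bin n" "pushes r (cpb r n) = bin n" "pushes 0 (cpb r n) = []" "pops r (cpb r n) = []" "idle {0, r} (cpb r n)"
  using assms by (auto simp: pops_concat_map pushes_concat_map intro!: idle_concat)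

lemma length_cpb: "length (cpb r n) = 2 * length (bin n)"
  by (simp add: length_concat o_def sum_list_triv)

definition ulist :: "nat \<Rightarrow> nat list" where "ulist k = replicate k 1 @ [2]"

lemma ulist_prefix: "ulist k @ u = ulist l @ w \<Longrightarrow> k = l \<and> u = w"
  unfolding ulist_def using split_unique[of "replicate k 1" 2 u "replicate l 1" w]
  by (auto simp: replicate_eq_replicate)

lemma load_trans_sound:
  assumes "lang load_trans \<alpha>"
  shows "\<exists>p v q f. v \<noteq> [] \<and> pops 0 \<alpha> = enc_trans (p, v, q) \<and> pushes 0 \<alpha> = [] \<and> pops 1 \<alpha> = ulist (length v - 1) \<and>
    pushes 1 \<alpha> = ulist (length v - 1) \<and> pops 2 \<alpha> = [] \<and> idle {0, 1, 2} \<alpha> \<and> pushes 2 \<alpha> = encT (p, f, q) \<and> isvec f \<and> vv f = v"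
proof -
  obtain p \<beta> q where \<alpha>: "\<alpha> = cpb 2 p @ [Pop 0 4, Push 2 6] @ \<beta> @ cpb 2 q @ [Pop 0 5, Push 2 7]" "lang (load_vec False 2) \<beta>"
    using assms unfolding load_trans_def by (elim lang_SeqE[where p = "copy_bin 2"] lang_SeqE[where p = "Word _"] lang_SeqE[where p = "load_vec False 2"])
      (auto simp only: lang_copy_bin lang_Word)
  from load_vec_sound[OF \<alpha>(2)] obtain v where v: "v \<noteq> []" "pops 0 \<beta> = enc_vec v" "pushes 0 \<beta> = []" "pops 1 \<beta> = replicate (length v - 1) 1 @ [2]"
    "pushes 1 \<beta> = replicate (length v - 1) 1 @ [2]" "pops 2 \<beta> = []" "idle {0, 1, 2} \<beta>" "isvec (pushes 2 \<beta>)" "vv (pushes 2 \<beta>) = v" by auto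
  have c: "pops 1 (cpb 2 n) = []" "pushes 1 (cpb 2 n) = []" "idle {0, 1, 2} (cpb 2 n)" for n
    using cpb_proj(5)[of 2 n] by (auto simp: idle_def)
  show ?thesis
    by (rule exI[of _ p], rule exI[of _ v], rule exI[of _ q], rule exI[of _ "pushes 2 \<beta>"])
       (use v c cpb_proj[of 2] in \<open>simp add: \<alpha>(1) enc_trans_def encT_def ulist_def\<close>)
qed

lemma load_trans_complete:
  assumes "1 \<le> W" "\<And>i. i \<in> set v \<Longrightarrow> \<bar>i\<bar> < 2 ^ W" "v \<noteq> []"
  shows "\<exists>\<alpha>. lang load_trans \<alpha> \<and> pops 0 \<alpha> = enc_trans (p, v, q) \<and> pushes 0 \<alpha> = [] \<and> pops 1 \<alpha> = ulist (length v - 1) \<and>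
    pushes 1 \<alpha> = ulist (length v - 1) \<and> pops 2 \<alpha> = [] \<and> idle {0, 1, 2} \<alpha> \<and> pushes 2 \<alpha> = encT (p, fl W v, q) \<and>
    length \<alpha> \<le> length v * (2 * W + 5) + 8 + 2 * length (bin p) + 2 * length (bin q)"
proof -
  from load_vec_complete[OF assms(1,2,3), of False 2] obtain \<beta> where v: "lang (load_vec False 2) \<beta>" "pops 0 \<beta> = enc_vec v" "pushes 0 \<beta> = []"
    "pops 1 \<beta> = replicate (length v - 1) 1 @ [2]" "pushes 1 \<beta> = replicate (length v - 1) 1 @ [2]" "pops 2 \<beta> = []" "idle {0, 1, 2} \<beta>"
    "pushes 2 \<beta> = fl W v" "length \<beta> \<le> length v * (2 * W + 5) + 4" by auto
  have c: "pops 1 (cpb 2 n) = []" "pushes 1 (cpb 2 n) = []" "idle {0, 1, 2} (cpb 2 n)" for n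
    using cpb_proj(5)[of 2 n] by (auto simp: idle_def)
  have "lang load_trans (cpb 2 p @ [Pop 0 4, Push 2 6] @ \<beta> @ cpb 2 q @ [Pop 0 5, Push 2 7])"
    unfolding load_trans_def by (intro lang_Seq v(1)) (auto simp: lang_copy_bin)
  then show ?thesis using v c cpb_proj[of 2] length_cpb[of 2]
    by (intro exI[of _ "cpb 2 p @ [Pop 0 4, Push 2 6] @ \<beta> @ cpb 2 q @ [Pop 0 5, Push 2 7]"])
       (simp add: enc_trans_def encT_def ulist_def)
qed

lemma load_conf_sound:
  assumes "lang (load_conf rp rx) \<alpha>" "2 \<le> rp" "2 \<le> rx" "rp \<noteq> rx"
  shows "\<exists>p v. v \<noteq> [] \<and> 0 \<le> v ! 0 \<and> pops 0 \<alpha> = enc_conf (p, v) \<and> pushes 0 \<alpha> = [] \<and> pops 1 \<alpha> = ulist (length v - 1) \<and>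
    pushes 1 \<alpha> = ulist (length v - 1) \<and> pops rp \<alpha> = [] \<and> pops rx \<alpha> = [] \<and> idle {0, 1, rp, rx} \<alpha> \<and>
    pushes rp \<alpha> = bin p @ [6] \<and> isvec (pushes rx \<alpha>) \<and> vv (pushes rx \<alpha>) = v"
proof -
  obtain p \<beta> where \<alpha>: "\<alpha> = cpb rp p @ [Pop 0 4, Push rp 6] @ \<beta>" "lang (load_vec True rx) \<beta>"
    using assms(1) unfolding load_conf_def by (elim lang_SeqE[where p = "copy_bin rp"] lang_SeqE[where p = "Word _"])
      (auto simp only: lang_copy_bin lang_Word)
  from load_vec_sound[OF \<alpha>(2) assms(3)] obtain v where v: "v \<noteq> []" "pops 0 \<beta> = enc_vec v" "pushes 0 \<beta> = []" "pops 1 \<beta> = replicate (length v - 1) 1 @ [2]"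
    "pushes 1 \<beta> = replicate (length v - 1) 1 @ [2]" "pops rx \<beta> = []" "idle {0, 1, rx} \<beta>" "isvec (pushes rx \<beta>)" "vv (pushes rx \<beta>) = v" "0 \<le> v ! 0" by auto
  have c: "pops 1 (cpb rp p) = []" "pushes 1 (cpb rp p) = []" "pops rx (cpb rp p) = []" "pushes rx (cpb rp p) = []" "idle {0, 1, rp, rx} (cpb rp p)"
    using cpb_proj(5)[of rp p] assms by (auto simp: idle_def)
  have b: "pops rp \<beta> = []" "pushes rp \<beta> = []" "idle {0, 1, rp, rx} \<beta>" using v(7) assms by (auto simp: idle_def)
  show ?thesis
    by (rule exI[of _ p], rule exI[of _ v])
       (use v c b assms cpb_proj[of rp p] in \<open>simp add: \<alpha>(1) enc_conf_def ulist_def\<close>)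
qed

lemma load_conf_complete:
  assumes "1 \<le> W" "\<And>i. i \<in> set v \<Longrightarrow> \<bar>i\<bar> < 2 ^ W" "v \<noteq> []" "0 \<le> v ! 0" and r: "2 \<le> rp" "2 \<le> rx" "rp \<noteq> rx"
  shows "\<exists>\<alpha>. lang (load_conf rp rx) \<alpha> \<and> pops 0 \<alpha> = enc_conf (p, v) \<and> pushes 0 \<alpha> = [] \<and> pops 1 \<alpha> = ulist (length v - 1) \<and>
    pushes 1 \<alpha> = ulist (length v - 1) \<and> pops rp \<alpha> = [] \<and> pops rx \<alpha> = [] \<and> idle {0, 1, rp, rx} \<alpha> \<and>
    pushes rp \<alpha> = bin p @ [6] \<and> pushes rx \<alpha> = fl W v \<and> length \<alpha> \<le> length v * (2 * W + 5) + 6 + 2 * length (bin p)"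
proof -
  from load_vec_complete[OF assms(1,2,3), of True rx] assms obtain \<beta> where v: "lang (load_vec True rx) \<beta>" "pops 0 \<beta> = enc_vec v" "pushes 0 \<beta> = []"
    "pops 1 \<beta> = replicate (length v - 1) 1 @ [2]" "pushes 1 \<beta> = replicate (length v - 1) 1 @ [2]" "pops rx \<beta> = []" "idle {0, 1, rx} \<beta>"
    "pushes rx \<beta> = fl W v" "length \<beta> \<le> length v * (2 * W + 5) + 4" by auto
  have c: "pops 1 (cpb rp p) = []" "pushes 1 (cpb rp p) = []" "pops rx (cpb rp p) = []" "pushes rx (cpb rp p) = []" "idle {0, 1, rp, rx} (cpb rp p)"
    using cpb_proj(5)[of rp p] assms by (auto simp: idle_def)
  have b: "pops rp \<beta> = []" "pushes rp \<beta> = []" "idle {0, 1, rp, rx} \<beta>" using v(7) assms by (auto simp: idle_def)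
  have "lang (load_conf rp rx) (cpb rp p @ [Pop 0 4, Push rp 6] @ \<beta>)"
    unfolding load_conf_def by (intro lang_Seq v(1)) (auto simp: lang_copy_bin)
  then show ?thesis using v c b r cpb_proj[of rp p] length_cpb[of rp p]
    by (intro exI[of _ "cpb rp p @ [Pop 0 4, Push rp 6] @ \<beta>"]) (simp add: enc_conf_def ulist_def)
qed

lemma exec_Word: "runs \<sigma> \<alpha> \<sigma>' \<Longrightarrow> length \<alpha> \<le> n \<Longrightarrow> exec (Word \<alpha>) n \<sigma> \<sigma>'"
  by (auto simp: exec_def)

lemma exec_WordE: "exec (Word \<alpha>) n \<sigma> \<sigma>' \<Longrightarrow> runs \<sigma> \<alpha> \<sigma>'"
  by (auto simp: exec_def)

lemma runs_Pop: "runs \<sigma> (Pop r a # \<alpha>) \<sigma>' \<longleftrightarrow> (\<exists>bs. \<sigma> r = a # bs \<and> runs (\<sigma>(r := bs)) \<alpha> \<sigma>')"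
  by (auto split: list.splits if_splits)

lemma runs_Push: "runs \<sigma> (Push r a # \<alpha>) \<sigma>' \<longleftrightarrow> runs (\<sigma>(r := \<sigma> r @ [a])) \<alpha> \<sigma>'"
  by simp

section \<open>The number of Z-counters in unary\<close>

definition dbl_u :: "bool \<Rightarrow> rexp" where
  "dbl_u d = Seq (Loop [[Pop 1 1, Push 1 1, Push 1 1]]) (Word ([Pop 1 2] @ (if d then [Push 1 1] else []) @ [Push 1 2]))"

definition dbl_word :: "nat \<Rightarrow> bool \<Rightarrow> act list" where
  "dbl_word m d = concat (replicate m [Pop 1 1, Push 1 1, Push 1 1]) @ [Pop 1 2] @ (if d then [Push 1 1] else []) @ [Push 1 2]"

lemma dbl_word_proj: "pops 1 (dbl_word m d) = ulist m" "pushes 1 (dbl_word m d) = ulist (2 * m + (if d then 1 else 0))"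
  "idle {1} (dbl_word m d)" "length (dbl_word m d) \<le> 3 * m + 3"
proof -
  have "concat (replicate m [a, a]) = replicate (2 * m) a" for a :: nat by (induction m) auto
  then show "pushes 1 (dbl_word m d) = ulist (2 * m + (if d then 1 else 0))"
    by (simp add: dbl_word_def pops_replicate ulist_def replicate_append_same)
  show "pops 1 (dbl_word m d) = ulist m" by (simp add: dbl_word_def pops_replicate ulist_def)
  show "idle {1} (dbl_word m d)" by (simp add: dbl_word_def)
  show "length (dbl_word m d) \<le> 3 * m + 3"
    by (simp add: dbl_word_def length_concat sum_list_replicate)
qed

lemma dbl_u_sound:
  assumes "exec (dbl_u d) n \<sigma> \<sigma>'" "\<sigma> 1 = ulist k"
  shows "\<sigma>' = \<sigma>(1 := ulist (2 * k + (if d then 1 else 0)))"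
proof -
  obtain \<alpha> where \<alpha>: "lang (dbl_u d) \<alpha>" "\<And>r. \<sigma> r @ pushes r \<alpha> = pops r \<alpha> @ \<sigma>' r" by (rule exec_fifo[OF assms(1)], blast)
  then obtain m where m: "\<alpha> = dbl_word m d"
    unfolding dbl_u_def dbl_word_def by (elim lang_SeqE) (auto simp only: lang_Loop_single lang_Word)
  have "ulist k @ pushes 1 \<alpha> = ulist m @ \<sigma>' 1" using \<alpha>(2)[of 1] assms(2) m dbl_word_proj(1) by simp
  then have "k = m" "\<sigma>' 1 = pushes 1 \<alpha>" using ulist_prefix by metis+
  moreover have "\<sigma>' r = \<sigma> r" if "r \<noteq> 1" for r using \<alpha>(2)[of r] idleD[OF dbl_word_proj(3), of r m d] that m by simp
  ultimately show ?thesis using dbl_word_proj(2) m by (auto simp: fun_eq_iff)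
qed

lemma dbl_u_complete:
  assumes "\<sigma> 1 = ulist k"
  shows "exec (dbl_u d) (3 * k + 3) \<sigma> (\<sigma>(1 := ulist (2 * k + (if d then 1 else 0))))"
proof (rule exec_pass[where \<alpha> = "dbl_word k d" and \<rho> = "\<sigma>(1 := [])"])
  show "lang (dbl_u d) (dbl_word k d)" unfolding dbl_u_def dbl_word_def
    by (intro lang_Seq) (auto simp: lang_Loop_single)
  show "\<sigma> r = pops r (dbl_word k d) @ (\<sigma>(1 := [])) r" for r
    using idleD[OF dbl_word_proj(3), of r k d] dbl_word_proj(1)[of k d] assms by (cases "r = 1") auto
  show "(\<sigma>(1 := ulist (2 * k + (if d then 1 else 0)))) r = (\<sigma>(1 := [])) r @ pushes r (dbl_word k d)" for r
    using idleD[OF dbl_word_proj(3), of r k d] dbl_word_proj(2)[of k d] by (cases "r = 1") auto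
qed (rule dbl_word_proj)

definition dstep :: "nat \<Rightarrow> rexp" where "dstep s = Seq (Word [Pop 0 s]) (dbl_u (s = 2))"

text \<open>Horner's scheme on a unary register. The unary form is affordable, since a configuration
  of the input lists k + 1 components.\<close>

definition load_k :: rexp where
  "load_k = Seq (Word [Push 1 2]) (Seq (Alt (dstep 1) (Seq (dstep 2) (Star (Alt (dstep 1) (dstep 2))))) (Word [Pop 0 6]))"

lemma dstep_sound:
  assumes "exec (dstep s) n \<sigma> \<sigma>'" "\<sigma> 1 = ulist k" "s = 1 \<or> s = 2"
  shows "\<exists>u. \<sigma> 0 = s # u \<and> \<sigma>' = \<sigma>(0 := u, 1 := ulist (2 * k + (s - 1)))"
proof -
  from assms(1) obtain \<sigma>1 where 1: "exec (Word [Pop 0 s]) n \<sigma> \<sigma>1" "exec (dbl_u (s = 2)) n \<sigma>1 \<sigma>'"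
    unfolding dstep_def by (rule exec_SeqE)
  from exec_WordE[OF 1(1)] obtain u where u: "\<sigma> 0 = s # u" "\<sigma>1 = \<sigma>(0 := u)" by (auto simp: runs_Pop simp del: runs.simps(2))
  have "\<sigma>1 1 = ulist k" using u assms by simp
  from dbl_u_sound[OF 1(2) this] show ?thesis using u assms(3) by auto
qed

lemma dstep_complete:
  assumes "\<sigma> 0 = s # u" "\<sigma> 1 = ulist k" "s = 1 \<or> s = 2"
  shows "exec (dstep s) (3 * k + 4) \<sigma> (\<sigma>(0 := u, 1 := ulist (2 * k + (s - 1))))"
proof -
  have "exec (Word [Pop 0 s]) 1 \<sigma> (\<sigma>(0 := u))" by (rule exec_Word) (use assms in auto)
  moreover have "exec (dbl_u (s = 2)) (3 * k + 3) (\<sigma>(0 := u)) ((\<sigma>(0 := u))(1 := ulist (2 * k + (if s = 2 then 1 else 0))))"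
    by (rule dbl_u_complete) (use assms in simp)
  ultimately have "exec (dstep s) (1 + (3 * k + 3)) \<sigma> ((\<sigma>(0 := u))(1 := ulist (2 * k + (if s = 2 then 1 else 0))))"
    unfolding dstep_def by (rule exec_Seq)
  moreover have "(if s = 2 then 1 else 0) = s - 1" using assms(3) by auto
  ultimately show ?thesis by (simp only: add.commute numeral_eq_Suc) simp
qed

lemma load_k_sound:
  assumes "exec load_k n \<sigma> \<sigma>'" "\<sigma> 1 = []"
  shows "\<exists>k rest. \<sigma> 0 = bin k @ [6] @ rest \<and> \<sigma>' = \<sigma>(0 := rest, 1 := ulist k)"
proof -
  from assms(1) obtain \<sigma>1 \<sigma>2 where 1: "exec (Word [Push 1 2]) n \<sigma> \<sigma>1"
    "exec (Alt (dstep 1) (Seq (dstep 2) (Star (Alt (dstep 1) (dstep 2))))) n \<sigma>1 \<sigma>2" "exec (Word [Pop 0 6]) n \<sigma>2 \<sigma>'"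
    unfolding load_k_def by (elim exec_SeqE)
  have \<sigma>1: "\<sigma>1 = \<sigma>(1 := ulist 0)" using exec_WordE[OF 1(1)] assms(2) by (simp add: ulist_def)
  have "\<exists>u rest. canon u \<and> \<sigma> 0 = u @ rest \<and> \<sigma>2 = \<sigma>(0 := rest, 1 := ulist (bv 0 u))"
    using 1(2)
  proof (elim exec_AltE)
    assume "exec (dstep 1) n \<sigma>1 \<sigma>2"
    from dstep_sound[OF this, of 0] obtain u where "\<sigma> 0 = 1 # u" "\<sigma>2 = \<sigma>(0 := u, 1 := ulist 0)" by (auto simp: \<sigma>1)
    then show ?thesis by (intro exI[of _ "[1]"] exI[of _ u]) (auto simp: canon_def)
  next
    assume "exec (Seq (dstep 2) (Star (Alt (dstep 1) (dstep 2)))) n \<sigma>1 \<sigma>2"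
    then obtain \<sigma>3 where 3: "exec (dstep 2) n \<sigma>1 \<sigma>3" "exec (Star (Alt (dstep 1) (dstep 2))) n \<sigma>3 \<sigma>2" by (rule exec_SeqE)
    from dstep_sound[OF 3(1), of 0] obtain u where u: "\<sigma> 0 = 2 # u" "\<sigma>3 = \<sigma>(0 := u, 1 := ulist 1)" by (auto simp: \<sigma>1)
    define P where "P \<tau> \<longleftrightarrow> (\<exists>w rest. set w \<subseteq> {1,2} \<and> \<sigma> 0 = 2 # w @ rest \<and> \<tau> = \<sigma>(0 := rest, 1 := ulist (bv 0 (2 # w))))" for \<tau>
    have "P \<sigma>3" unfolding P_def using u by (intro exI[of _ "[]"] exI[of _ u]) auto
    with 3(2) have "P \<sigma>2"
    proof (rule exec_Star_inv)
      fix \<tau> \<tau>' assume "P \<tau>" and ex: "exec (Alt (dstep 1) (dstep 2)) n \<tau> \<tau>'"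
      then obtain w rest where w: "set w \<subseteq> {1,2}" "\<sigma> 0 = 2 # w @ rest" "\<tau> = \<sigma>(0 := rest, 1 := ulist (bv 0 (2 # w)))"
        unfolding P_def by blast
      from ex obtain s where s: "s = 1 \<or> s = 2" "exec (dstep s) n \<tau> \<tau>'" by (auto elim: exec_AltE)
      from dstep_sound[OF s(2) _ s(1), of "bv 0 (2 # w)"] w obtain rest' where "rest = s # rest'"
        "\<tau>' = \<tau>(0 := rest', 1 := ulist (2 * bv 0 (2 # w) + (s - 1)))" by auto
      then show "P \<tau>'" unfolding P_def using w s
        by (intro exI[of _ "w @ [s]"] exI[of _ rest']) (auto simp: fun_eq_iff)
    qed
    then obtain w rest where "set w \<subseteq> {1,2}" "\<sigma> 0 = 2 # w @ rest" "\<sigma>2 = \<sigma>(0 := rest, 1 := ulist (bv 0 (2 # w)))"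
      unfolding P_def by blast
    then show ?thesis by (intro exI[of _ "2 # w"] exI[of _ rest]) (auto simp: canon_def)
  qed
  then obtain u rest where u: "canon u" "\<sigma> 0 = u @ rest" "\<sigma>2 = \<sigma>(0 := rest, 1 := ulist (bv 0 u))" by blast
  from exec_WordE[OF 1(3)] u obtain rest' where "rest = 6 # rest'" "\<sigma>' = \<sigma>2(0 := rest')"
    by (auto simp: runs_Pop simp del: runs.simps(2))
  then show ?thesis using u canon_unique[OF u(1)] by (intro exI[of _ "bv 0 u"] exI[of _ rest']) (auto simp: fun_eq_iff)
qed

lemma load_k_complete:
  assumes "\<sigma> 0 = bin k @ [6] @ rest" "\<sigma> 1 = []"
  shows "exec load_k (length (bin k) * (3 * k + 4) + 2) \<sigma> (\<sigma>(0 := rest, 1 := ulist k))"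
proof -
  \<comment> \<open>The intermediate values of Horner's scheme do not exceed the final one, so a
    single bound serves for all rounds.\<close>
  have mono: "m \<le> bv m w" for m w
  proof (induction w arbitrary: m)
    case (Cons s w)
    have "m \<le> 2 * m + (s - 1)" by simp
    also have "\<dots> \<le> bv (2 * m + (s - 1)) w" by (rule Cons)
    finally show ?case by simp
  qed simp
  have loop: "exec (Star (Alt (dstep 1) (dstep 2))) (length w * (3 * bv m w + 4)) \<tau> (\<tau>(0 := u, 1 := ulist (bv m w)))"
    if "set w \<subseteq> {1,2}" "\<tau> 0 = w @ u" "\<tau> 1 = ulist m" for w u \<tau> m
    using that
  proof (induction w arbitrary: \<tau> m)
    case Nil
    then have "\<tau>(0 := u, 1 := ulist (bv m [])) = \<tau>" by (auto simp: fun_eq_iff)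
    then show ?case using exec_Star0 by metis
  next
    case (Cons s w)
    let ?m = "2 * m + (s - 1)" let ?\<tau> = "\<tau>(0 := w @ u, 1 := ulist ?m)"
    have s: "s = 1 \<or> s = 2" using Cons.prems by auto
    have "exec (dstep s) (3 * m + 4) \<tau> ?\<tau>" by (rule dstep_complete) (use Cons.prems s in auto)
    then have "exec (Alt (dstep 1) (dstep 2)) (3 * m + 4) \<tau> ?\<tau>" using s exec_Alt1 exec_Alt2 by blast
    then have "exec (Alt (dstep 1) (dstep 2)) (3 * bv ?m w + 4) \<tau> ?\<tau>"
      by (rule exec_mono) (use mono[of ?m w] in simp)
    moreover have "exec (Star (Alt (dstep 1) (dstep 2))) (length w * (3 * bv ?m w + 4)) ?\<tau> (?\<tau>(0 := u, 1 := ulist (bv ?m w)))"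
      by (rule Cons.IH) (use Cons.prems in auto)
    ultimately have "exec (Star (Alt (dstep 1) (dstep 2))) (3 * bv ?m w + 4 + length w * (3 * bv ?m w + 4)) \<tau> (?\<tau>(0 := u, 1 := ulist (bv ?m w)))"
      by (rule exec_StarS)
    moreover have "?\<tau>(0 := u, 1 := ulist (bv ?m w)) = \<tau>(0 := u, 1 := ulist (bv m (s # w)))" by (auto simp: fun_eq_iff)
    ultimately show ?case by (simp only: length_Cons mult_Suc bv_simps)
  qed
  let ?\<sigma>1 = "\<sigma>(1 := ulist 0)"
  have 1: "exec (Word [Push 1 2]) 1 \<sigma> ?\<sigma>1" by (rule exec_Word) (use assms in \<open>simp_all add: ulist_def\<close>)
  let ?\<sigma>2 = "\<sigma>(0 := 6 # rest, 1 := ulist k)"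
  have 2: "exec (Alt (dstep 1) (Seq (dstep 2) (Star (Alt (dstep 1) (dstep 2))))) (length (bin k) * (3 * k + 4)) ?\<sigma>1 ?\<sigma>2"
  proof (cases "k = 0")
    case True
    have "exec (dstep 1) (3 * 0 + 4) ?\<sigma>1 (?\<sigma>1(0 := 6 # rest, 1 := ulist (2 * 0 + (1 - 1))))"
      by (rule dstep_complete) (use assms True in \<open>auto simp: bin.simps[of 0]\<close>)
    moreover have "?\<sigma>1(0 := 6 # rest, 1 := ulist (2 * 0 + (1 - 1))) = ?\<sigma>2" using True by (auto simp: fun_eq_iff)
    ultimately show ?thesis using True by (intro exec_Alt1) (simp add: bin.simps[of 0])
  next
    case False
    then obtain w where w: "bin k = 2 # w" "set w \<subseteq> {1,2}" using bin_pos[of k] by auto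
    have k: "bv 1 w = k" using bv_bin[of k] w by simp
    let ?\<tau> = "?\<sigma>1(0 := w @ 6 # rest, 1 := ulist (2 * 0 + (2 - 1)))"
    have "exec (dstep 2) (3 * 0 + 4) ?\<sigma>1 ?\<tau>" by (rule dstep_complete) (use assms w in auto)
    then have "exec (dstep 2) (3 * k + 4) ?\<sigma>1 ?\<tau>" by (rule exec_mono) simp
    moreover have "exec (Star (Alt (dstep 1) (dstep 2))) (length w * (3 * bv 1 w + 4)) ?\<tau> (?\<tau>(0 := 6 # rest, 1 := ulist (bv 1 w)))"
      by (rule loop) (use w in auto)
    moreover have "?\<tau>(0 := 6 # rest, 1 := ulist (bv 1 w)) = ?\<sigma>2" using k by (auto simp: fun_eq_iff)
    ultimately have "exec (Seq (dstep 2) (Star (Alt (dstep 1) (dstep 2)))) (3 * k + 4 + length w * (3 * k + 4)) ?\<sigma>1 ?\<sigma>2"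
      using exec_Seq k by metis
    then show ?thesis using w(1) by (intro exec_Alt2) simp
  qed
  have 3: "exec (Word [Pop 0 6]) 1 ?\<sigma>2 (\<sigma>(0 := rest, 1 := ulist k))"
    by (rule exec_Word) (simp_all add: runs_Pop runs_Push fun_upd_twist del: runs.simps(2))
  have "exec load_k (1 + (length (bin k) * (3 * k + 4) + 1)) \<sigma> (\<sigma>(0 := rest, 1 := ulist k))"
    unfolding load_k_def by (intro exec_Seq[OF 1] exec_Seq[OF 2] 3)
  then show ?thesis by (rule exec_mono) simp
qed

section \<open>Transitions, configurations and the whole input\<close>

definition rep_trans :: "nat \<Rightarrow> nat \<times> int list \<times> nat \<Rightarrow> nat \<times> nat list \<times> nat \<Rightarrow> bool" where
  "rep_trans k t t' \<longleftrightarrow> fst t = fst t' \<and> snd (snd t) = snd (snd t') \<and> isvec (fst (snd t')) \<and>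
     vv (fst (snd t')) = fst (snd t) \<and> length (fst (snd t)) = Suc k"

definition tqueue :: "(nat \<times> nat list \<times> nat) list \<Rightarrow> nat list" where
  "tqueue TT = concat (map encT TT) @ [8]"

text \<open>Each transition pops a complete unary number from register 1 and pushes it back. As the
  register holds k, the balance equation forces every vector to have k + 1 components.\<close>

lemma load_transs_sound:
  assumes "exec (Star load_trans) n \<sigma> \<sigma>'" "\<sigma> 1 = ulist k" "\<sigma> 2 = []"
  shows "\<exists>T TT rest. \<sigma> 0 = concat (map enc_trans T) @ rest \<and> list_all2 (rep_trans k) T TT \<and>
     \<sigma>' = \<sigma>(0 := rest, 2 := concat (map encT TT))"
proof (rule exec_Star_inv[OF assms(1)])
  show "\<exists>T TT rest. \<sigma> 0 = concat (map enc_trans T) @ rest \<and> list_all2 (rep_trans k) T TT \<and>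
     \<sigma> = \<sigma>(0 := rest, 2 := concat (map encT TT))"
    using assms by (intro exI[of _ "[]"] exI[of _ "\<sigma> 0"]) (auto simp: fun_eq_iff)
  fix \<tau> \<tau>'
  assume "\<exists>T TT rest. \<sigma> 0 = concat (map enc_trans T) @ rest \<and> list_all2 (rep_trans k) T TT \<and>
     \<tau> = \<sigma>(0 := rest, 2 := concat (map encT TT))" and ex: "exec load_trans n \<tau> \<tau>'"
  then obtain T TT rest where *: "\<sigma> 0 = concat (map enc_trans T) @ rest" "list_all2 (rep_trans k) T TT"
     "\<tau> = \<sigma>(0 := rest, 2 := concat (map encT TT))" by blast
  obtain \<alpha> where \<alpha>: "lang load_trans \<alpha>" "\<And>r. \<tau> r @ pushes r \<alpha> = pops r \<alpha> @ \<tau>' r" by (rule exec_fifo[OF ex], blast)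
  from load_trans_sound[OF \<alpha>(1)] obtain p v q f where l: "v \<noteq> []" "pops 0 \<alpha> = enc_trans (p, v, q)" "pushes 0 \<alpha> = []" "pops 1 \<alpha> = ulist (length v - 1)"
    "pushes 1 \<alpha> = ulist (length v - 1)" "pops 2 \<alpha> = []" "idle {0, 1, 2} \<alpha>" "pushes 2 \<alpha> = encT (p, f, q)" "isvec f" "vv f = v" by blast
  have "ulist k @ ulist (length v - 1) = ulist (length v - 1) @ \<tau>' 1" using \<alpha>(2)[of 1] l * assms(2) by simp
  then have k: "k = length v - 1" and t1: "\<tau>' 1 = ulist k" using ulist_prefix by metis+
  have t0: "rest = enc_trans (p, v, q) @ \<tau>' 0" using \<alpha>(2)[of 0] l * by simp
  have t2: "\<tau>' 2 = concat (map encT TT) @ encT (p, f, q)" using \<alpha>(2)[of 2] l * by simp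
  have other: "\<tau>' r = \<sigma> r" if "r \<noteq> 0" "r \<noteq> 1" "r \<noteq> 2" for r using \<alpha>(2)[of r] idleD[OF l(7), of r] that * by simp
  have "\<tau>' = \<sigma>(0 := \<tau>' 0, 2 := concat (map encT (TT @ [(p, f, q)])))"
  proof
    fix r show "\<tau>' r = (\<sigma>(0 := \<tau>' 0, 2 := concat (map encT (TT @ [(p, f, q)])))) r"
      using t1 t2 other[of r] assms(2) by (cases "r = 1") auto
  qed
  moreover have "rep_trans k (p, v, q) (p, f, q)" using l k by (cases v) (auto simp: rep_trans_def)
  ultimately show "\<exists>T TT rest. \<sigma> 0 = concat (map enc_trans T) @ rest \<and> list_all2 (rep_trans k) T TT \<and>
     \<tau>' = \<sigma>(0 := rest, 2 := concat (map encT TT))"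
    using * t0 by (intro exI[of _ "T @ [(p, v, q)]"] exI[of _ "TT @ [(p, f, q)]"] exI[of _ "\<tau>' 0"])
      (auto intro: list_all2_appendI)
qed

lemma load_transs_complete:
  assumes "1 \<le> W" "\<And>t i. t \<in> set T \<Longrightarrow> i \<in> set (fst (snd t)) \<Longrightarrow> \<bar>i\<bar> < 2 ^ W" "\<And>t. t \<in> set T \<Longrightarrow> length (fst (snd t)) = Suc k"
    and b: "\<And>t. t \<in> set T \<Longrightarrow> length (bin (fst t)) \<le> b \<and> length (bin (snd (snd t))) \<le> b"
    and "\<sigma> 0 = concat (map enc_trans T) @ rest" "\<sigma> 1 = ulist k"
  shows "exec (Star load_trans) (length T * (Suc k * (2 * W + 5) + 8 + 4 * b)) \<sigma>
    (\<sigma>(0 := rest, 2 := \<sigma> 2 @ concat (map (\<lambda>(p, v, q). encT (p, fl W v, q)) T)))"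
  using assms(2-)
proof (induction T arbitrary: \<sigma>)
  case Nil
  then have "\<sigma>(0 := rest, 2 := \<sigma> 2 @ concat (map (\<lambda>(p, v, q). encT (p, fl W v, q)) [])) = \<sigma>" by (auto simp: fun_eq_iff)
  then show ?case using exec_Star0 by metis
next
  case (Cons t T)
  obtain p v q where t: "t = (p, v, q)" by (cases t)
  have v: "length v = Suc k" "v \<noteq> []" using Cons.prems(2)[of t] t by auto
  have b: "length (bin p) \<le> b" "length (bin q) \<le> b" using Cons.prems(3)[of t] t by auto
  from load_trans_complete[OF assms(1) _ v(2), of p q] Cons.prems(1)[of t] t obtain \<alpha> where
    \<alpha>: "lang load_trans \<alpha>" "pops 0 \<alpha> = enc_trans (p, v, q)" "pushes 0 \<alpha> = []" "pops 1 \<alpha> = ulist (length v - 1)"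
    "pushes 1 \<alpha> = ulist (length v - 1)" "pops 2 \<alpha> = []" "idle {0, 1, 2} \<alpha>" "pushes 2 \<alpha> = encT (p, fl W v, q)"
    "length \<alpha> \<le> length v * (2 * W + 5) + 8 + 2 * length (bin p) + 2 * length (bin q)" by auto
  let ?u = "concat (map enc_trans T) @ rest"
  let ?\<sigma> = "\<sigma>(0 := ?u, 2 := \<sigma> 2 @ encT (p, fl W v, q))"
  have A: "exec load_trans (Suc k * (2 * W + 5) + 8 + 4 * b) \<sigma> ?\<sigma>"
  proof (rule exec_pass[OF \<alpha>(1), where \<rho> = "\<sigma>(0 := ?u, 1 := [])"])
    show "\<sigma> r = pops r \<alpha> @ (\<sigma>(0 := ?u, 1 := [])) r" for r
      using Cons.prems(4,5) t \<alpha> v idleD(1)[OF \<alpha>(7), of r] by (cases "r \<in> {0,1,2}") auto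
    show "?\<sigma> r = (\<sigma>(0 := ?u, 1 := [])) r @ pushes r \<alpha>" for r
      using Cons.prems(4,5) t \<alpha> v idleD(2)[OF \<alpha>(7), of r] by (cases "r \<in> {0,1,2}") auto
    show "length \<alpha> \<le> Suc k * (2 * W + 5) + 8 + 4 * b" using \<alpha>(9) v b by simp
  qed
  have B: "exec (Star load_trans) (length T * (Suc k * (2 * W + 5) + 8 + 4 * b)) ?\<sigma>
    (?\<sigma>(0 := rest, 2 := ?\<sigma> 2 @ concat (map (\<lambda>(p, v, q). encT (p, fl W v, q)) T)))"
    by (rule Cons.IH) (use Cons.prems in auto)
  have eq: "?\<sigma>(0 := rest, 2 := ?\<sigma> 2 @ concat (map (\<lambda>(p, v, q). encT (p, fl W v, q)) T))
    = \<sigma>(0 := rest, 2 := \<sigma> 2 @ concat (map (\<lambda>(p, v, q). encT (p, fl W v, q)) (t # T)))" by (auto simp: t fun_eq_iff)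
  show ?case using exec_StarS[OF A B] unfolding eq by (simp only: length_Cons mult_Suc)
qed

lemma load_conf_exec_sound:
  assumes "exec (load_conf rp rx) n \<sigma> \<sigma>'" "\<sigma> 1 = ulist k" "\<sigma> rp = []" "\<sigma> rx = []" and r: "2 \<le> rp" "2 \<le> rx" "rp \<noteq> rx"
  shows "\<exists>c f rest. \<sigma> 0 = enc_conf c @ rest \<and> conf_wf k c \<and> isvec f \<and> vv f = snd c \<and>
    \<sigma>' = \<sigma>(0 := rest, rp := bin (fst c) @ [6], rx := f)"
proof -
  obtain \<alpha> where \<alpha>: "lang (load_conf rp rx) \<alpha>" "\<And>r. \<sigma> r @ pushes r \<alpha> = pops r \<alpha> @ \<sigma>' r" by (rule exec_fifo[OF assms(1)], blast)
  from load_conf_sound[OF \<alpha>(1) r] obtain p v where l: "v \<noteq> []" "0 \<le> v ! 0" "pops 0 \<alpha> = enc_conf (p, v)" "pushes 0 \<alpha> = []" "pops 1 \<alpha> = ulist (length v - 1)"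
    "pushes 1 \<alpha> = ulist (length v - 1)" "pops rp \<alpha> = []" "pops rx \<alpha> = []" "idle {0, 1, rp, rx} \<alpha>"
    "pushes rp \<alpha> = bin p @ [6]" "isvec (pushes rx \<alpha>)" "vv (pushes rx \<alpha>) = v" by blast
  have "ulist k @ ulist (length v - 1) = ulist (length v - 1) @ \<sigma>' 1" using \<alpha>(2)[of 1] l assms(2) by simp
  then have k: "k = length v - 1" and t1: "\<sigma>' 1 = ulist k" using ulist_prefix by metis+
  have e1: "\<sigma>' rp = bin p @ [6]" using \<alpha>(2)[of rp] l(7,10) assms(3) by simp
  have e2: "\<sigma>' rx = pushes rx \<alpha>" using \<alpha>(2)[of rx] l(8) assms(4) by simp
  have e3: "\<sigma>' x = \<sigma> x" if "x \<notin> {0, 1, rp, rx}" for x using \<alpha>(2)[of x] idleD[OF l(9) that] by simp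
  have "\<sigma>' = \<sigma>(0 := \<sigma>' 0, rp := bin p @ [6], rx := pushes rx \<alpha>)"
  proof
    fix x
    consider "x = 0" | "x = 1" | "x = rp" | "x = rx" | "x \<notin> {0, 1, rp, rx}" by blast
    then show "\<sigma>' x = (\<sigma>(0 := \<sigma>' 0, rp := bin p @ [6], rx := pushes rx \<alpha>)) x"
      by cases (use e1 e2 e3 t1 assms(2) r in simp_all)
  qed
  moreover have "\<sigma> 0 = enc_conf (p, v) @ \<sigma>' 0" using \<alpha>(2)[of 0] l by simp
  moreover have "conf_wf k (p, v)" using l(1,2) k by (cases v) (auto simp: conf_wf_def)
  ultimately show ?thesis using l by (intro exI[of _ "(p, v)"] exI[of _ "pushes rx \<alpha>"] exI[of _ "\<sigma>' 0"]) auto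
qed

lemma load_conf_exec_complete:
  assumes "1 \<le> W" "\<And>i. i \<in> set (snd c) \<Longrightarrow> \<bar>i\<bar> < 2 ^ W" "conf_wf k c" and b: "length (bin (fst c)) \<le> b"
    and "\<sigma> 0 = enc_conf c @ rest" "\<sigma> 1 = ulist k" "\<sigma> rp = []" "\<sigma> rx = []" and r: "2 \<le> rp" "2 \<le> rx" "rp \<noteq> rx"
  shows "exec (load_conf rp rx) (Suc k * (2 * W + 5) + 6 + 2 * b) \<sigma>
    (\<sigma>(0 := rest, rp := bin (fst c) @ [6], rx := fl W (snd c)))"
proof -
  obtain p v where c: "c = (p, v)" by (cases c)
  have v: "length v = Suc k" "v \<noteq> []" "0 \<le> v ! 0" using assms(3) by (auto simp: c conf_wf_def)
  from load_conf_complete[OF assms(1) _ v(2,3) r, of p] assms(2) c obtain \<alpha> where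
    \<alpha>: "lang (load_conf rp rx) \<alpha>" "pops 0 \<alpha> = enc_conf (p, v)" "pushes 0 \<alpha> = []" "pops 1 \<alpha> = ulist (length v - 1)"
    "pushes 1 \<alpha> = ulist (length v - 1)" "pops rp \<alpha> = []" "pops rx \<alpha> = []" "idle {0, 1, rp, rx} \<alpha>"
    "pushes rp \<alpha> = bin p @ [6]" "pushes rx \<alpha> = fl W v" "length \<alpha> \<le> length v * (2 * W + 5) + 6 + 2 * length (bin p)" by auto
  show ?thesis
  proof (rule exec_pass[OF \<alpha>(1), where \<rho> = "\<sigma>(0 := rest, 1 := [])"])
    fix x
    consider "x = 0" | "x = 1" | "x = rp" | "x = rx" | "x \<notin> {0, 1, rp, rx}" by blast
    then show "\<sigma> x = pops x \<alpha> @ (\<sigma>(0 := rest, 1 := [])) x"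
      by cases (use assms(5-8) r \<alpha>(2,4,6,7) v(1) c idleD(1)[OF \<alpha>(8), of x] in simp_all)
    consider "x = 0" | "x = 1" | "x = rp" | "x = rx" | "x \<notin> {0, 1, rp, rx}" by blast
    then show "(\<sigma>(0 := rest, rp := bin (fst c) @ [6], rx := fl W (snd c))) x = (\<sigma>(0 := rest, 1 := [])) x @ pushes x \<alpha>"
      by cases (use assms(5-8) r \<alpha>(3,5,9,10) v(1) c idleD(2)[OF \<alpha>(8), of x] in simp_all)
  next
    show "length \<alpha> \<le> Suc k * (2 * W + 5) + 6 + 2 * b" using \<alpha>(11) v b c by simp
  qed
qed

text \<open>The last action pops the separator 7 behind the input, so that nothing can follow the
  second configuration. The 8 pushed to register 2 marks the end of the transitions.\<close>

definition load :: rexp where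
  "load = Seq load_k (Seq (Star load_trans) (Seq (Word [Pop 0 6, Push 2 8]) (Seq (load_conf 7 3)
     (Seq (Word [Pop 0 6]) (Seq (load_conf 10 9) (Word [Pop 0 7]))))))"

definition loaded :: "nat \<Rightarrow> (nat \<times> nat list \<times> nat) list \<Rightarrow> nat \<Rightarrow> nat list \<Rightarrow> nat \<Rightarrow> nat list \<Rightarrow> store" where
  "loaded k TT p f q g = (\<lambda>_. [])(1 := ulist k, 2 := tqueue TT, 7 := bin p @ [6], 3 := f, 10 := bin q @ [6], 9 := g)"

lemma load_sound:
  assumes "exec load n (init_store w) \<sigma>" "set w \<subseteq> {1..6}"
  shows "\<exists>k T TT s t f g. w = enc_instance k T s t \<and> vass_wf k T \<and> conf_wf k s \<and> conf_wf k t \<and>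
    list_all2 (rep_trans k) T TT \<and> isvec f \<and> vv f = snd s \<and> isvec g \<and> vv g = snd t \<and>
    \<sigma> = loaded k TT (fst s) f (fst t) g"
proof -
  from assms(1) obtain \<sigma>1 \<sigma>2 \<sigma>3 \<sigma>4 \<sigma>5 \<sigma>6 where ex: "exec load_k n (init_store w) \<sigma>1" "exec (Star load_trans) n \<sigma>1 \<sigma>2"
    "exec (Word [Pop 0 6, Push 2 8]) n \<sigma>2 \<sigma>3" "exec (load_conf 7 3) n \<sigma>3 \<sigma>4" "exec (Word [Pop 0 6]) n \<sigma>4 \<sigma>5"
    "exec (load_conf 10 9) n \<sigma>5 \<sigma>6" "exec (Word [Pop 0 7]) n \<sigma>6 \<sigma>"
    unfolding load_def by (elim exec_SeqE)
  have i: "init_store w 0 = w @ [7]" "\<And>r. r \<noteq> 0 \<Longrightarrow> init_store w r = []" by (auto simp: init_store_def)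
  from load_k_sound[OF ex(1)] i obtain k r1 where 1: "w @ [7] = bin k @ [6] @ r1" "\<sigma>1 = (init_store w)(0 := r1, 1 := ulist k)" by auto
  from load_transs_sound[OF ex(2), of k] i 1 obtain T TT r2 where 2: "r1 = concat (map enc_trans T) @ r2"
    "list_all2 (rep_trans k) T TT" "\<sigma>2 = \<sigma>1(0 := r2, 2 := concat (map encT TT))" by auto
  from exec_WordE[OF ex(3)] obtain r3 where 3: "r2 = 6 # r3" "\<sigma>3 = \<sigma>2(0 := r3, 2 := tqueue TT)"
    by (auto simp: runs_Pop 2 tqueue_def simp del: runs.simps(2)) (auto simp: fun_eq_iff)
  from load_conf_exec_sound[OF ex(4), of k] i 1 2 3 obtain s f r4 where 4: "r3 = enc_conf s @ r4" "conf_wf k s" "isvec f"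
    "vv f = snd s" "\<sigma>4 = \<sigma>3(0 := r4, 7 := bin (fst s) @ [6], 3 := f)" by auto
  from exec_WordE[OF ex(5)] obtain r5 where 5: "r4 = 6 # r5" "\<sigma>5 = \<sigma>4(0 := r5)"
    by (auto simp: runs_Pop 4 simp del: runs.simps(2))
  from load_conf_exec_sound[OF ex(6), of k] i 1 2 3 4 5 obtain t g r6 where 6: "r5 = enc_conf t @ r6" "conf_wf k t" "isvec g"
    "vv g = snd t" "\<sigma>6 = \<sigma>5(0 := r6, 10 := bin (fst t) @ [6], 9 := g)" by auto
  from exec_WordE[OF ex(7)] obtain r7 where 7: "r6 = 7 # r7" "\<sigma> = \<sigma>6(0 := r7)"
    by (auto simp: runs_Pop 6 simp del: runs.simps(2))
  have eq: "w @ 7 # [] = enc_instance k T s t @ 7 # r7"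
    using 1 2 3 4 5 6 7 by (simp add: enc_instance_def)
  have "7 \<notin> set w" using assms(2) by auto
  moreover have "r7 = [] \<or> 7 \<in> set w" using eq by (cases r7 rule: rev_cases) (auto simp: append_eq_append_conv2 Cons_eq_append_conv append_eq_Cons_conv)
  ultimately have r7: "r7 = []" by blast
  then have w: "w = enc_instance k T s t" using eq by simp
  have "vass_wf k T" using 2(2) by (induction rule: list_all2_induct) (auto simp: vass_wf_def rep_trans_def)
  moreover have "\<sigma> = loaded k TT (fst s) f (fst t) g"
    by (auto simp: fun_eq_iff loaded_def 1 2 3 4 5 6 7 r7 init_store_def)
  ultimately show ?thesis using w 2 4 6 by blast
qed

lemma load_complete:
  assumes W: "1 \<le> W" "\<And>t i. t \<in> set T \<Longrightarrow> i \<in> set (fst (snd t)) \<Longrightarrow> \<bar>i\<bar> < 2 ^ W"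
      "\<And>i. i \<in> set (snd s) \<union> set (snd t) \<Longrightarrow> \<bar>i\<bar> < 2 ^ W"
    and wf: "vass_wf k T" "conf_wf k s" "conf_wf k t"
    and b: "\<And>t. t \<in> set T \<Longrightarrow> length (bin (fst t)) \<le> b \<and> length (bin (snd (snd t))) \<le> b"
       "length (bin (fst s)) \<le> b" "length (bin (fst t)) \<le> b"
  shows "exec load (length (bin k) * (3 * k + 4) + (length T + 2) * (Suc k * (2 * W + 5) + 8 + 4 * b) + 6)
    (init_store (enc_instance k T s t)) (loaded k (map (\<lambda>(p, v, q). (p, fl W v, q)) T) (fst s) (fl W (snd s)) (fst t) (fl W (snd t)))"
proof -
  let ?w = "enc_instance k T s t" and ?c = "Suc k * (2 * W + 5) + 8 + 4 * b"
  define r3 where "r3 = enc_conf t @ [7]"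
  define r2 where "r2 = enc_conf s @ 6 # r3"
  define r1 where "r1 = concat (map enc_trans T) @ 6 # r2"
  let ?\<sigma>0 = "init_store ?w"
  define \<sigma>1 where "\<sigma>1 = ?\<sigma>0(0 := r1, 1 := ulist k)"
  define \<sigma>2 where "\<sigma>2 = \<sigma>1(0 := 6 # r2, 2 := \<sigma>1 2 @ concat (map (\<lambda>(p, v, q). encT (p, fl W v, q)) T))"
  define \<sigma>3 where "\<sigma>3 = \<sigma>2(0 := r2, 2 := \<sigma>2 2 @ [8])"
  define \<sigma>4 where "\<sigma>4 = \<sigma>3(0 := 6 # r3, 7 := bin (fst s) @ [6], 3 := fl W (snd s))"
  define \<sigma>5 where "\<sigma>5 = \<sigma>4(0 := r3)"
  define \<sigma>6 where "\<sigma>6 = \<sigma>5(0 := [7], 10 := bin (fst t) @ [6], 9 := fl W (snd t))"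
  define \<sigma>7 where "\<sigma>7 = \<sigma>6(0 := [])"
  have i: "?\<sigma>0 0 = bin k @ [6] @ r1" "\<And>r. r \<noteq> 0 \<Longrightarrow> ?\<sigma>0 r = []"
    by (auto simp: init_store_def enc_instance_def r1_def r2_def r3_def)
  have 1: "exec load_k (length (bin k) * (3 * k + 4) + 2) ?\<sigma>0 \<sigma>1"
    unfolding \<sigma>1_def by (rule load_k_complete) (use i in auto)
  have 2: "exec (Star load_trans) (length T * ?c) \<sigma>1 \<sigma>2"
    unfolding \<sigma>2_def by (rule load_transs_complete[where k = k]) (use W wf b in \<open>auto simp: \<sigma>1_def r1_def vass_wf_def\<close>)
  have 3: "exec (Word [Pop 0 6, Push 2 8]) 2 \<sigma>2 \<sigma>3"
    by (rule exec_Word) (simp_all add: runs_Pop runs_Push \<sigma>2_def \<sigma>3_def del: runs.simps(2))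
  have 4: "exec (load_conf 7 3) (Suc k * (2 * W + 5) + 6 + 2 * b) \<sigma>3 \<sigma>4"
    unfolding \<sigma>4_def by (rule load_conf_exec_complete[where k = k]) (use W wf b i in \<open>auto simp: \<sigma>1_def \<sigma>2_def \<sigma>3_def r2_def\<close>)
  have 5: "exec (Word [Pop 0 6]) 1 \<sigma>4 \<sigma>5"
    by (rule exec_Word) (simp_all add: runs_Pop runs_Push \<sigma>4_def \<sigma>5_def del: runs.simps(2))
  have 6: "exec (load_conf 10 9) (Suc k * (2 * W + 5) + 6 + 2 * b) \<sigma>5 \<sigma>6"
    unfolding \<sigma>6_def by (rule load_conf_exec_complete[where k = k]) (use W wf b i in \<open>auto simp: \<sigma>1_def \<sigma>2_def \<sigma>3_def \<sigma>4_def \<sigma>5_def r3_def\<close>)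
  have 7: "exec (Word [Pop 0 7]) 1 \<sigma>6 \<sigma>7"
    by (rule exec_Word) (simp_all add: runs_Pop runs_Push \<sigma>6_def \<sigma>7_def del: runs.simps(2))
  have "concat (map (\<lambda>(p, v, q). encT (p, fl W v, q)) T) @ [8] = tqueue (map (\<lambda>(p, v, q). (p, fl W v, q)) T)"
    by (auto simp: tqueue_def o_def split_def)
  then have \<sigma>7: "\<sigma>7 = loaded k (map (\<lambda>(p, v, q). (p, fl W v, q)) T) (fst s) (fl W (snd s)) (fst t) (fl W (snd t))"
    using i by (auto simp: fun_eq_iff loaded_def \<sigma>1_def \<sigma>2_def \<sigma>3_def \<sigma>4_def \<sigma>5_def \<sigma>6_def \<sigma>7_def)
  note ex = exec_Seq[OF 1 exec_Seq[OF 2 exec_Seq[OF 3 exec_Seq[OF 4 exec_Seq[OF 5 exec_Seq[OF 6 7]]]]]]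
  show ?thesis unfolding load_def \<sigma>7[symmetric] by (rule exec_mono[OF ex]) (simp add: algebra_simps)
qed

section \<open>Passes over the work queues\<close>

lemma upd_eqI: "(\<And>x. x \<noteq> r \<Longrightarrow> \<sigma>' x = \<sigma> x) \<Longrightarrow> \<sigma>' r = v \<Longrightarrow> \<sigma>' = \<sigma>(r := v)"
  by (auto simp: fun_eq_iff)

definition endw :: "nat set \<Rightarrow> nat \<Rightarrow> nat list \<Rightarrow> bool" where
  "endw S e f \<longleftrightarrow> e \<notin> S \<and> (\<exists>g. f = g @ [e] \<and> set g \<subseteq> S)"

lemma isvec_term: "isvec f \<longleftrightarrow> endw {1,2,3,4} 5 f"
  by (auto simp: isvec_def endw_def)

lemma term_bin: "endw {1,2} 6 (bin p @ [6])"
  using set_bin by (auto simp: endw_def)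

lemma term_prefix: "endw S e f \<Longrightarrow> endw S e g \<Longrightarrow> f @ u = g @ w \<Longrightarrow> f = g \<and> u = w"
proof -
  assume "endw S e f" "endw S e g" and eq: "f @ u = g @ w"
  then obtain f' g' where *: "f = f' @ [e]" "g = g' @ [e]" "e \<notin> set f'" "e \<notin> set g'"
    by (auto simp: endw_def)
  then show "f = g \<and> u = w" using split_unique[of f' e u g' w] eq by auto
qed

text \<open>A pass over one terminated word. If \<open>F\<close> pushes back every symbol it pops, a
  register that holds just this word is the same after the pass as before.\<close>

definition cps :: "nat list \<Rightarrow> nat \<Rightarrow> (nat \<Rightarrow> act list) \<Rightarrow> rexp" where
  "cps S e F = Seq (Loop (map F S)) (Word (F e))"

lemma lang_cps: "e \<notin> set S \<Longrightarrow> lang (cps S e F) \<alpha> \<longleftrightarrow> (\<exists>g. endw (set S) e g \<and> \<alpha> = concat (map F g))"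
proof
  assume e: "e \<notin> set S" "lang (cps S e F) \<alpha>"
  then obtain w where "set w \<subseteq> set S" "\<alpha> = concat (map F w) @ F e"
    unfolding cps_def by (elim lang_SeqE) (auto simp: lang_Loop_map)
  then show "\<exists>g. endw (set S) e g \<and> \<alpha> = concat (map F g)" using e by (intro exI[of _ "w @ [e]"]) (auto simp: endw_def)
next
  assume e: "e \<notin> set S" "\<exists>g. endw (set S) e g \<and> \<alpha> = concat (map F g)"
  then obtain w where w: "set w \<subseteq> set S" "\<alpha> = concat (map F w) @ F e" by (auto simp: endw_def)
  show "lang (cps S e F) \<alpha>" unfolding cps_def w(2) by (rule lang_Seq) (use w(1) in \<open>auto simp: lang_Loop_map\<close>)
qed

text \<open>The word \<open>g\<close> is guessed by the program. Together with
  \<open>term_prefix\<close> the balance equations identify it with the contents of the registers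
  that are read.\<close>

lemma cps_sound:
  assumes "exec (cps S e F) n \<sigma> \<sigma>'" "e \<notin> set S"
  obtains g where "endw (set S) e g" "\<And>r. \<sigma> r @ concat (map (\<lambda>s. pushes r (F s)) g) = concat (map (\<lambda>s. pops r (F s)) g) @ \<sigma>' r"
proof -
  obtain \<alpha> where \<alpha>: "lang (cps S e F) \<alpha>" "\<And>r. \<sigma> r @ pushes r \<alpha> = pops r \<alpha> @ \<sigma>' r"
    by (rule exec_fifo[OF assms(1)], blast)
  then show thesis using that assms(2) by (auto simp: lang_cps pops_concat_map pushes_concat_map)
qed

lemma cps_complete:
  assumes "endw (set S) e g" "\<And>r. \<sigma> r = concat (map (\<lambda>s. pops r (F s)) g) @ \<rho> r"
    "\<And>r. \<sigma>' r = \<rho> r @ concat (map (\<lambda>s. pushes r (F s)) g)" "\<And>s. length (F s) \<le> c" "c * length g \<le> n"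
  shows "exec (cps S e F) n \<sigma> \<sigma>'"
proof (rule exec_pass[where \<alpha> = "concat (map F g)" and \<rho> = \<rho>])
  have "e \<notin> set S" using assms(1) by (simp add: endw_def)
  then show "lang (cps S e F) (concat (map F g))" using lang_cps assms(1) by blast
  show "length (concat (map F g)) \<le> n" using length_concat_le[of g F c] assms(4,5) by (meson le_trans)
qed (use assms in \<open>auto simp: pops_concat_map pushes_concat_map\<close>)

definition copy :: "nat list \<Rightarrow> nat \<Rightarrow> nat \<Rightarrow> nat \<Rightarrow> rexp" where
  "copy S e r r' = cps S e (\<lambda>s. [Pop r s, Push r s, Push r' s])"
definition clear :: "nat list \<Rightarrow> nat \<Rightarrow> nat \<Rightarrow> rexp" where
  "clear S e r = cps S e (\<lambda>s. [Pop r s])"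
definition guess :: "nat list \<Rightarrow> nat \<Rightarrow> nat \<Rightarrow> rexp" where
  "guess S e r = cps S e (\<lambda>s. [Push r s])"
definition same :: "nat list \<Rightarrow> nat \<Rightarrow> nat \<Rightarrow> nat \<Rightarrow> rexp" where
  "same S e r r' = cps S e (\<lambda>s. [Pop r s, Pop r' s])"
definition same_keep :: "nat list \<Rightarrow> nat \<Rightarrow> nat \<Rightarrow> nat \<Rightarrow> rexp" where
  "same_keep S e r r' = cps S e (\<lambda>s. [Pop r s, Push r s, Pop r' s])"

lemma copy_sound:
  assumes "exec (copy S e r r') n \<sigma> \<sigma>'" "endw (set S) e (\<sigma> r)" "r \<noteq> r'"
  shows "\<sigma>' = \<sigma>(r' := \<sigma> r' @ \<sigma> r)"
proof -
  have "e \<notin> set S" using assms(2) by (simp add: endw_def)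
  from cps_sound[OF assms(1)[unfolded copy_def] this] obtain g where g: "endw (set S) e g"
    "\<And>x. \<sigma> x @ concat (map (\<lambda>s. pushes x [Pop r s, Push r s, Push r' s]) g) = concat (map (\<lambda>s. pops x [Pop r s, Push r s, Push r' s]) g) @ \<sigma>' x" by blast
  have "\<sigma> r = g" "\<sigma>' r = g" using term_prefix[OF assms(2) g(1), of g "\<sigma>' r"] g(2)[of r] assms(3) by auto
  moreover have "\<sigma>' r' = \<sigma> r' @ g" using g(2)[of r'] assms(3) by simp
  moreover have "\<sigma>' x = \<sigma> x" if "x \<noteq> r" "x \<noteq> r'" for x using g(2)[of x] that by simp
  ultimately have "\<sigma>' = \<sigma>(r' := \<sigma> r' @ g)" by (intro upd_eqI) (metis, simp)
  then show ?thesis using \<open>\<sigma> r = g\<close> by simp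
qed

lemma copy_complete:
  assumes "endw (set S) e (\<sigma> r)" "r \<noteq> r'"
  shows "exec (copy S e r r') (3 * length (\<sigma> r)) \<sigma> (\<sigma>(r' := \<sigma> r' @ \<sigma> r))"
  unfolding copy_def
proof (rule cps_complete[OF assms(1), where \<rho> = "\<sigma>(r := [])" and c = 3])
  show "\<sigma> x = concat (map (\<lambda>s. pops x [Pop r s, Push r s, Push r' s]) (\<sigma> r)) @ (\<sigma>(r := [])) x" for x
    by (cases "x = r") auto
  show "(\<sigma>(r' := \<sigma> r' @ \<sigma> r)) x = (\<sigma>(r := [])) x @ concat (map (\<lambda>s. pushes x [Pop r s, Push r s, Push r' s]) (\<sigma> r))" for x
    using assms(2) by (cases "x = r"; cases "x = r'") auto
qed auto

lemma clear_sound: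
  assumes "exec (clear S e r) n \<sigma> \<sigma>'" "endw (set S) e (\<sigma> r)"
  shows "\<sigma>' = \<sigma>(r := [])"
proof -
  have "e \<notin> set S" using assms(2) by (simp add: endw_def)
  from cps_sound[OF assms(1)[unfolded clear_def] this] obtain g where g: "endw (set S) e g"
    "\<And>x. \<sigma> x @ concat (map (\<lambda>s. pushes x [Pop r s]) g) = concat (map (\<lambda>s. pops x [Pop r s]) g) @ \<sigma>' x" by blast
  have "\<sigma>' r = []" using term_prefix[OF assms(2) g(1), of "[]" "\<sigma>' r"] g(2)[of r] by auto
  moreover have "\<sigma>' x = \<sigma> x" if "x \<noteq> r" for x using g(2)[of x] that by simp
  ultimately show ?thesis by (intro upd_eqI) auto
qed

lemma clear_complete:
  assumes "endw (set S) e (\<sigma> r)"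
  shows "exec (clear S e r) (length (\<sigma> r)) \<sigma> (\<sigma>(r := []))"
  unfolding clear_def
proof (rule cps_complete[OF assms(1), where \<rho> = "\<sigma>(r := [])" and c = 1])
  show "\<sigma> x = concat (map (\<lambda>s. pops x [Pop r s]) (\<sigma> r)) @ (\<sigma>(r := [])) x" for x
    by (cases "x = r") auto
qed auto

lemma guess_sound:
  assumes "exec (guess S e r) n \<sigma> \<sigma>'" "e \<notin> set S" "\<sigma> r = []"
  shows "\<exists>g. endw (set S) e g \<and> \<sigma>' = \<sigma>(r := g)"
proof -
  from cps_sound[OF assms(1)[unfolded guess_def] assms(2)] obtain g where g: "endw (set S) e g"
    "\<And>x. \<sigma> x @ concat (map (\<lambda>s. pushes x [Push r s]) g) = concat (map (\<lambda>s. pops x [Push r s]) g) @ \<sigma>' x" by blast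
  have "\<sigma>' r = g" using g(2)[of r] assms(3) by simp
  moreover have "\<sigma>' x = \<sigma> x" if "x \<noteq> r" for x using g(2)[of x] that by simp
  ultimately have "\<sigma>' = \<sigma>(r := g)" by (intro upd_eqI) auto
  then show ?thesis using g(1) by blast
qed

lemma guess_complete:
  assumes "endw (set S) e g" "\<sigma> r = []"
  shows "exec (guess S e r) (length g) \<sigma> (\<sigma>(r := g))"
  unfolding guess_def
proof (rule cps_complete[OF assms(1), where \<rho> = \<sigma> and c = 1])
  show "(\<sigma>(r := g)) x = \<sigma> x @ concat (map (\<lambda>s. pushes x [Push r s]) g)" for x
    using assms(2) by (cases "x = r") auto
qed auto

lemma same_sound:
  assumes "exec (same S e r r') n \<sigma> \<sigma>'" "endw (set S) e (\<sigma> r)" "endw (set S) e (\<sigma> r')" "r \<noteq> r'"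
  shows "\<sigma> r = \<sigma> r'"
proof -
  have "e \<notin> set S" using assms(2) by (simp add: endw_def)
  from cps_sound[OF assms(1)[unfolded same_def] this] obtain g where g: "endw (set S) e g"
    "\<And>x. \<sigma> x @ concat (map (\<lambda>s. pushes x [Pop r s, Pop r' s]) g) = concat (map (\<lambda>s. pops x [Pop r s, Pop r' s]) g) @ \<sigma>' x" by blast
  have "\<sigma> r = g" using term_prefix[OF assms(2) g(1), of "[]" "\<sigma>' r"] g(2)[of r] assms(4) by auto
  moreover have "\<sigma> r' = g" using term_prefix[OF assms(3) g(1), of "[]" "\<sigma>' r'"] g(2)[of r'] assms(4) by auto
  ultimately show ?thesis by simp
qed

lemma same_sound_other:
  assumes "exec (same S e r r') n \<sigma> \<sigma>'" "e \<notin> set S" "x \<noteq> r" "x \<noteq> r'"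
  shows "\<sigma>' x = \<sigma> x"
proof -
  from cps_sound[OF assms(1)[unfolded same_def] assms(2)] obtain g where
    "\<And>x. \<sigma> x @ concat (map (\<lambda>s. pushes x [Pop r s, Pop r' s]) g) = concat (map (\<lambda>s. pops x [Pop r s, Pop r' s]) g) @ \<sigma>' x" by blast
  from this[of x] show ?thesis using assms by simp
qed

lemma same_complete:
  assumes "endw (set S) e (\<sigma> r)" "\<sigma> r = \<sigma> r'" "r \<noteq> r'"
  shows "exec (same S e r r') (2 * length (\<sigma> r)) \<sigma> (\<sigma>(r := [], r' := []))"
  unfolding same_def
proof (rule cps_complete[OF assms(1), where \<rho> = "\<sigma>(r := [], r' := [])" and c = 2])
  show "\<sigma> x = concat (map (\<lambda>s. pops x [Pop r s, Pop r' s]) (\<sigma> r)) @ (\<sigma>(r := [], r' := [])) x" for x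
    using assms by (cases "x = r"; cases "x = r'") auto
qed auto

lemma same_keep_sound:
  assumes "exec (same_keep S e r r') n \<sigma> \<sigma>'" "endw (set S) e (\<sigma> r)" "endw (set S) e (\<sigma> r')" "r \<noteq> r'"
  shows "\<sigma> r = \<sigma> r' \<and> \<sigma>' = \<sigma>(r' := [])"
proof -
  have "e \<notin> set S" using assms(2) by (simp add: endw_def)
  from cps_sound[OF assms(1)[unfolded same_keep_def] this] obtain g where g: "endw (set S) e g"
    "\<And>x. \<sigma> x @ concat (map (\<lambda>s. pushes x [Pop r s, Push r s, Pop r' s]) g) = concat (map (\<lambda>s. pops x [Pop r s, Push r s, Pop r' s]) g) @ \<sigma>' x" by blast
  have "\<sigma> r = g" "\<sigma>' r = g" using term_prefix[OF assms(2) g(1), of g "\<sigma>' r"] g(2)[of r] assms(4) by auto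
  moreover have "\<sigma> r' = g" "\<sigma>' r' = []" using term_prefix[OF assms(3) g(1), of "[]" "\<sigma>' r'"] g(2)[of r'] assms(4) by auto
  moreover have "\<sigma>' x = \<sigma> x" if "x \<noteq> r" "x \<noteq> r'" for x using g(2)[of x] that by simp
  ultimately have "\<sigma>' = \<sigma>(r' := [])" by (intro upd_eqI) (metis, simp)
  then show ?thesis using \<open>\<sigma> r = g\<close> \<open>\<sigma> r' = g\<close> by simp
qed

lemma same_keep_complete:
  assumes "endw (set S) e (\<sigma> r)" "\<sigma> r = \<sigma> r'" "r \<noteq> r'"
  shows "exec (same_keep S e r r') (3 * length (\<sigma> r)) \<sigma> (\<sigma>(r' := []))"
  unfolding same_keep_def
proof (rule cps_complete[OF assms(1), where \<rho> = "\<sigma>(r := [], r' := [])" and c = 3])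
  show "\<sigma> x = concat (map (\<lambda>s. pops x [Pop r s, Push r s, Pop r' s]) (\<sigma> r)) @ (\<sigma>(r := [], r' := [])) x" for x
    using assms by (cases "x = r"; cases "x = r'") auto
  show "(\<sigma>(r' := [])) x = (\<sigma>(r := [], r' := [])) x @ concat (map (\<lambda>s. pushes x [Pop r s, Push r s, Pop r' s]) (\<sigma> r))" for x
    using assms by (cases "x = r"; cases "x = r'") auto
qed auto

abbreviation "V \<equiv> [1, 2, 3, 4 :: nat]"
abbreviation "B \<equiv> [1, 2 :: nat]"

lemma set_V: "endw (set V) 5 f \<longleftrightarrow> isvec f"
  by (simp add: isvec_term)

text \<open>A queue cannot be inspected without popping, so after the test of its first symbol the
  whole word is rotated.\<close>

definition sign :: "nat \<Rightarrow> nat \<Rightarrow> rexp" where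
  "sign r s = Seq (Word [Pop r s, Push r s]) (cps V 5 (\<lambda>s. [Pop r s, Push r s]))"

lemma sign_sound:
  assumes "exec (sign r s) n \<sigma> \<sigma>'" "isvec (\<sigma> r)" "s = 3 \<or> s = 4"
  shows "\<sigma>' = \<sigma> \<and> (\<exists>g. \<sigma> r = s # g)"
proof -
  obtain \<alpha> where \<alpha>: "lang (sign r s) \<alpha>" "\<And>x. \<sigma> x @ pushes x \<alpha> = pops x \<alpha> @ \<sigma>' x"
    by (rule exec_fifo[OF assms(1)], blast)
  then obtain \<beta> where \<beta>: "\<alpha> = [Pop r s, Push r s] @ \<beta>" "lang (cps V 5 (\<lambda>s. [Pop r s, Push r s])) \<beta>"
    unfolding sign_def by (elim lang_SeqE) auto
  then obtain g where g: "isvec g" "\<beta> = concat (map (\<lambda>s. [Pop r s, Push r s]) g)" using lang_cps[of 5 V] set_V by auto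
  have p: "pops r \<alpha> = s # g" "pushes r \<alpha> = s # g" by (simp_all add: \<beta> g pops_concat_map pushes_concat_map)
  have "isvec (s # g)" using g(1) assms(3) unfolding isvec_def by (metis append_Cons insert_subset insertCI list.simps(15))
  then have "\<sigma> r = s # g" "\<sigma>' r = s # g" using isvec_prefix[OF assms(2), of "s # g" "s # g" "\<sigma>' r"] \<alpha>(2)[of r] p by auto
  moreover have "\<sigma>' x = \<sigma> x" if "x \<noteq> r" for x using \<alpha>(2)[of x] that by (simp add: \<beta> g pops_concat_map pushes_concat_map)
  ultimately show ?thesis by (metis ext)
qed

lemma sign_complete:
  assumes "\<sigma> r = s # g" "isvec (s # g)" "s = 3 \<or> s = 4"
  shows "exec (sign r s) (2 * length (\<sigma> r)) \<sigma> \<sigma>"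
proof (rule exec_pass[where \<alpha> = "[Pop r s, Push r s] @ concat (map (\<lambda>s. [Pop r s, Push r s]) g)" and \<rho> = "\<sigma>(r := [])"])
  have "isvec g" using assms(2,3) by (auto simp: isvec_def Cons_eq_append_conv)
  then show "lang (sign r s) ([Pop r s, Push r s] @ concat (map (\<lambda>s. [Pop r s, Push r s]) g))"
    unfolding sign_def by (intro lang_Seq) (use lang_cps[of 5 V] set_V in auto)
  show "\<sigma> x = pops x ([Pop r s, Push r s] @ concat (map (\<lambda>s. [Pop r s, Push r s]) g)) @ (\<sigma>(r := [])) x" for x
    using assms(1) by (cases "x = r") (auto simp: pops_concat_map)
  show "\<sigma> x = (\<sigma>(r := [])) x @ pushes x ([Pop r s, Push r s] @ concat (map (\<lambda>s. [Pop r s, Push r s]) g))" for x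
    using assms(1) by (cases "x = r") (auto simp: pushes_concat_map)
  show "length ([Pop r s, Push r s] @ concat (map (\<lambda>s. [Pop r s, Push r s]) g)) \<le> 2 * length (\<sigma> r)"
    using assms(1) length_concat_le[of g "\<lambda>s. [Pop r s, Push r s]" 2] by simp
qed

section \<open>Addition, doubling and comparison of vectors on registers\<close>

definition add :: "nat \<Rightarrow> nat \<Rightarrow> rexp" where
  "add r r' = adder (\<lambda>_. True) (\<lambda>(x, y, z). [Pop r x, Pop r' y, Push r' y, Push r z])"
definition dbl :: "nat \<Rightarrow> rexp" where
  "dbl r = adder (\<lambda>(x, y, z). x = y) (\<lambda>(x, y, z). [Pop r x, Push r z])"
text \<open>Serves to confirm a guessed effect \<open>y\<close>: the old vector \<open>b\<close>
  plus \<open>y\<close> is compared with the new vector \<open>x\<close> digit by digit, which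
  avoids subtraction.\<close>

definition chk :: "nat \<Rightarrow> nat \<Rightarrow> nat \<Rightarrow> rexp" where
  "chk b y x = adder (\<lambda>_. True) (\<lambda>(u, v, w). [Pop b u, Pop y v, Push y v, Pop x w, Push x w])"

lemma adder_exec_sound:
  assumes "exec (adder P F) n \<sigma> \<sigma>'"
  obtains ls where "adds 0 ls" "\<forall>l \<in> set ls. P l"
    "\<And>r. \<sigma> r @ concat (map (\<lambda>l. pushes r (F l)) (ls @ [(5,5,5)])) = concat (map (\<lambda>l. pops r (F l)) (ls @ [(5,5,5)])) @ \<sigma>' r"
proof -
  obtain \<alpha> where \<alpha>: "lang (adder P F) \<alpha>" "\<And>r. \<sigma> r @ pushes r \<alpha> = pops r \<alpha> @ \<sigma>' r"
    by (rule exec_fifo[OF assms(1)], blast)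
  from adder_sound[OF \<alpha>(1)] obtain ls where "adds 0 ls" "\<forall>l \<in> set ls. P l" "\<alpha> = concat (map F ls) @ F (5,5,5)" by blast
  then show thesis using that[of ls] \<alpha>(2) by (simp add: pops_concat_map pushes_concat_map)
qed

lemma adder_exec_complete:
  assumes "adds 0 ls" "\<forall>l \<in> set ls. P l"
    and "\<And>r. \<sigma> r = concat (map (\<lambda>l. pops r (F l)) (ls @ [(5,5,5)])) @ \<rho> r"
    and "\<And>r. \<sigma>' r = \<rho> r @ concat (map (\<lambda>l. pushes r (F l)) (ls @ [(5,5,5)]))"
    and "\<And>l. length (F l) \<le> c" "c * (length ls + 1) \<le> n"
  shows "exec (adder P F) n \<sigma> \<sigma>'"
proof (rule exec_pass[OF adder_complete[OF assms(1,2)], where \<rho> = \<rho>])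
  have "length (concat (map F (ls @ [(5,5,5)]))) \<le> c * length (ls @ [(5,5,5)])" by (rule length_concat_le) (use assms in blast)
  then show "length (concat (map F ls) @ F (5,5,5)) \<le> n" using assms(6) by simp
qed (use assms in \<open>auto simp: pops_concat_map pushes_concat_map\<close>)

lemma add_sound:
  assumes "exec (add r r') n \<sigma> \<sigma>'" "isvec (\<sigma> r)" "isvec (\<sigma> r')" "r \<noteq> r'"
  shows "\<exists>f. isvec f \<and> \<sigma>' = \<sigma>(r := f) \<and> length (vv (\<sigma> r)) = length (vv (\<sigma> r')) \<and> vv f = map2 (+) (vv (\<sigma> r)) (vv (\<sigma> r'))"
proof -
  obtain ls where ls: "adds 0 ls"
    "\<And>x. \<sigma> x @ concat (map (\<lambda>l. pushes x (case l of (x, y, z) \<Rightarrow> [Pop r x, Pop r' y, Push r' y, Push r z])) (ls @ [(5,5,5)]))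
       = concat (map (\<lambda>l. pops x (case l of (x, y, z) \<Rightarrow> [Pop r x, Pop r' y, Push r' y, Push r z])) (ls @ [(5,5,5)])) @ \<sigma>' x"
    using assms(1) unfolding add_def by (rule adder_exec_sound) blast
  note vv = adds_vv[OF ls(1)]
  have 1: "\<sigma> r @ map lz ls @ [5] = (map lx ls @ [5]) @ \<sigma>' r" using ls(2)[of r] assms(4) by (simp add: split_def)
  have 2: "\<sigma> r' @ map ly ls @ [5] = (map ly ls @ [5]) @ \<sigma>' r'" using ls(2)[of r'] assms(4) by (simp add: split_def)
  have 3: "\<sigma>' x = \<sigma> x" if "x \<noteq> r" "x \<noteq> r'" for x using ls(2)[of x] that by (simp add: split_def)
  have "\<sigma> r = map lx ls @ [5]" "\<sigma>' r = map lz ls @ [5]" using isvec_prefix[OF assms(2) vv(1) 1] by auto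
  moreover have r': "\<sigma> r' = map ly ls @ [5]" "\<sigma>' r' = map ly ls @ [5]" using isvec_prefix[OF assms(3) vv(2) 2] by auto
  moreover have "\<sigma>' = \<sigma>(r := map lz ls @ [5])"
  proof (rule upd_eqI)
    fix x assume "x \<noteq> r"
    then show "\<sigma>' x = \<sigma> x" using 3 r' by (cases "x = r'") simp_all
  qed fact
  ultimately show ?thesis using vv by (intro exI[of _ "map lz ls @ [5]"]) simp
qed

lemma dbl_sound:
  assumes "exec (dbl r) n \<sigma> \<sigma>'" "isvec (\<sigma> r)"
  shows "\<exists>f. isvec f \<and> \<sigma>' = \<sigma>(r := f) \<and> vv f = map2 (+) (vv (\<sigma> r)) (vv (\<sigma> r))"
proof -
  obtain ls where ls: "adds 0 ls" "\<forall>l \<in> set ls. (case l of (x, y, z) \<Rightarrow> x = y)"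
    "\<And>x. \<sigma> x @ concat (map (\<lambda>l. pushes x (case l of (x, y, z) \<Rightarrow> [Pop r x, Push r z])) (ls @ [(5,5,5)]))
       = concat (map (\<lambda>l. pops x (case l of (x, y, z) \<Rightarrow> [Pop r x, Push r z])) (ls @ [(5,5,5)])) @ \<sigma>' x"
    using assms(1) unfolding dbl_def by (rule adder_exec_sound) blast
  note vv = adds_vv[OF ls(1)]
  have xy: "map ly ls = map lx ls" using ls(2) by auto
  have 1: "\<sigma> r @ map lz ls @ [5] = (map lx ls @ [5]) @ \<sigma>' r" using ls(3)[of r] by (simp add: split_def)
  have 3: "\<sigma>' x = \<sigma> x" if "x \<noteq> r" for x using ls(3)[of x] that by (simp add: split_def)
  have "\<sigma> r = map lx ls @ [5]" "\<sigma>' r = map lz ls @ [5]" using isvec_prefix[OF assms(2) vv(1) 1] by auto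
  moreover have "\<sigma>' = \<sigma>(r := map lz ls @ [5])" by (rule upd_eqI) fact+
  ultimately show ?thesis using vv xy by (intro exI[of _ "map lz ls @ [5]"]) simp
qed

lemma chk_sound:
  assumes "exec (chk b y x) n \<sigma> \<sigma>'" "isvec (\<sigma> b)" "isvec (\<sigma> y)" "isvec (\<sigma> x)" "b \<noteq> y" "b \<noteq> x" "y \<noteq> x"
  shows "\<sigma>' = \<sigma>(b := []) \<and> length (vv (\<sigma> b)) = length (vv (\<sigma> y)) \<and> vv (\<sigma> x) = map2 (+) (vv (\<sigma> b)) (vv (\<sigma> y))"
proof -
  obtain ls where ls: "adds 0 ls"
    "\<And>r. \<sigma> r @ concat (map (\<lambda>l. pushes r (case l of (u, v, w) \<Rightarrow> [Pop b u, Pop y v, Push y v, Pop x w, Push x w])) (ls @ [(5,5,5)]))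
       = concat (map (\<lambda>l. pops r (case l of (u, v, w) \<Rightarrow> [Pop b u, Pop y v, Push y v, Pop x w, Push x w])) (ls @ [(5,5,5)])) @ \<sigma>' r"
    using assms(1) unfolding chk_def by (rule adder_exec_sound) blast
  note vv = adds_vv[OF ls(1)]
  have 1: "\<sigma> b @ [] = (map lx ls @ [5]) @ \<sigma>' b" using ls(2)[of b] assms by (simp add: split_def)
  have 2: "\<sigma> y @ map ly ls @ [5] = (map ly ls @ [5]) @ \<sigma>' y" using ls(2)[of y] assms by (simp add: split_def)
  have 3: "\<sigma> x @ map lz ls @ [5] = (map lz ls @ [5]) @ \<sigma>' x" using ls(2)[of x] assms by (simp add: split_def)
  have 4: "\<sigma>' r = \<sigma> r" if "r \<noteq> b" "r \<noteq> y" "r \<noteq> x" for r using ls(2)[of r] that by (simp add: split_def)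
  have b: "\<sigma> b = map lx ls @ [5]" "\<sigma>' b = []" using isvec_prefix[OF assms(2) vv(1) 1] by auto
  have y: "\<sigma> y = map ly ls @ [5]" "\<sigma>' y = map ly ls @ [5]" using isvec_prefix[OF assms(3) vv(2) 2] by auto
  have x: "\<sigma> x = map lz ls @ [5]" "\<sigma>' x = map lz ls @ [5]" using isvec_prefix[OF assms(4) vv(3) 3] by auto
  have "\<sigma>' = \<sigma>(b := [])"
  proof (rule upd_eqI)
    fix r assume "r \<noteq> b"
    then consider "r = y" | "r = x" | "r \<noteq> b" "r \<noteq> y" "r \<noteq> x" by blast
    then show "\<sigma>' r = \<sigma> r" by cases (simp_all add: x y 4)
  qed fact
  then show ?thesis using vv(4,5) unfolding b(1) y(1) x(1) by blast
qed

lemma adds_fl_length: "map lx ls @ [5] = fl W u \<Longrightarrow> length ls + 1 = length (fl W u)"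
  by (drule arg_cong[where f = length]) simp

lemma add_complete:
  assumes "\<sigma> r = fl W u" "\<sigma> r' = fl W v" "r \<noteq> r'" "length u = length v"
    "\<And>i. i \<in> set u \<union> set v \<union> set (map2 (+) u v) \<Longrightarrow> inrange W i"
  shows "exec (add r r') (4 * length (fl W u)) \<sigma> (\<sigma>(r := fl W (map2 (+) u v)))"
proof -
  obtain ls where ls: "adds 0 ls" "map lx ls @ [5] = fl W u" "map ly ls @ [5] = fl W v" "map lz ls @ [5] = fl W (map2 (+) u v)"
    using adds_fl[OF assms(4,5)] by blast
  show ?thesis unfolding add_def
  proof (rule adder_exec_complete[OF ls(1), where \<rho> = "\<sigma>(r := [], r' := [])" and c = 4])
    fix x
    show "\<sigma> x = concat (map (\<lambda>l. pops x (case l of (x, y, z) \<Rightarrow> [Pop r x, Pop r' y, Push r' y, Push r z])) (ls @ [(5,5,5)])) @ (\<sigma>(r := [], r' := [])) x"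
      using assms(1-3) ls by (cases "x = r"; cases "x = r'") (simp_all add: split_def)
    show "(\<sigma>(r := fl W (map2 (+) u v))) x = (\<sigma>(r := [], r' := [])) x @ concat (map (\<lambda>l. pushes x (case l of (x, y, z) \<Rightarrow> [Pop r x, Pop r' y, Push r' y, Push r z])) (ls @ [(5,5,5)]))"
      using assms(1-3) ls by (cases "x = r"; cases "x = r'") (simp_all add: split_def)
  qed (use adds_fl_length[OF ls(2)] in \<open>auto split: prod.splits\<close>)
qed

lemma dbl_complete:
  assumes "\<sigma> r = fl W u" "\<And>i. i \<in> set u \<union> set (map2 (+) u u) \<Longrightarrow> inrange W i"
  shows "exec (dbl r) (2 * length (fl W u)) \<sigma> (\<sigma>(r := fl W (map2 (+) u u)))"
proof -
  obtain ls where ls: "adds 0 ls" "map lx ls @ [5] = fl W u" "map ly ls @ [5] = fl W u" "map lz ls @ [5] = fl W (map2 (+) u u)"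
    using adds_fl[of u u W] assms(2) by auto
  have "map lx ls = map ly ls" using ls(2,3) by (metis append_same_eq)
  then have P: "\<forall>l \<in> set ls. (case l of (x, y, z) \<Rightarrow> x = y)" by auto
  show ?thesis unfolding dbl_def
  proof (rule adder_exec_complete[OF ls(1) P, where \<rho> = "\<sigma>(r := [])" and c = 2])
    fix x
    show "\<sigma> x = concat (map (\<lambda>l. pops x (case l of (x, y, z) \<Rightarrow> [Pop r x, Push r z])) (ls @ [(5,5,5)])) @ (\<sigma>(r := [])) x"
      using assms(1) ls by (cases "x = r") (simp_all add: split_def)
    show "(\<sigma>(r := fl W (map2 (+) u u))) x = (\<sigma>(r := [])) x @ concat (map (\<lambda>l. pushes x (case l of (x, y, z) \<Rightarrow> [Pop r x, Push r z])) (ls @ [(5,5,5)]))"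
      using assms(1) ls by (cases "x = r") (simp_all add: split_def)
  qed (use adds_fl_length[OF ls(2)] in \<open>auto split: prod.splits\<close>)
qed

lemma chk_complete:
  assumes "\<sigma> b = fl W u" "\<sigma> y = fl W v" "\<sigma> x = fl W (map2 (+) u v)" "b \<noteq> y" "b \<noteq> x" "y \<noteq> x" "length u = length v"
    "\<And>i. i \<in> set u \<union> set v \<union> set (map2 (+) u v) \<Longrightarrow> inrange W i"
  shows "exec (chk b y x) (5 * length (fl W u)) \<sigma> (\<sigma>(b := []))"
proof -
  obtain ls where ls: "adds 0 ls" "map lx ls @ [5] = fl W u" "map ly ls @ [5] = fl W v" "map lz ls @ [5] = fl W (map2 (+) u v)"
    using adds_fl[OF assms(7,8)] by blast
  show ?thesis unfolding chk_def
  proof (rule adder_exec_complete[OF ls(1), where \<rho> = "\<sigma>(b := [], y := [], x := [])" and c = 5])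
    fix r
    show "\<sigma> r = concat (map (\<lambda>l. pops r (case l of (u, v, w) \<Rightarrow> [Pop b u, Pop y v, Push y v, Pop x w, Push x w])) (ls @ [(5,5,5)])) @ (\<sigma>(b := [], y := [], x := [])) r"
      using assms(1-6) ls by (cases "r = b"; cases "r = y"; cases "r = x") (simp_all add: split_def)
    show "(\<sigma>(b := [])) r = (\<sigma>(b := [], y := [], x := [])) r @ concat (map (\<lambda>l. pushes r (case l of (u, v, w) \<Rightarrow> [Pop b u, Pop y v, Push y v, Pop x w, Push x w])) (ls @ [(5,5,5)]))"
      using assms(1-6) ls by (cases "r = b"; cases "r = y"; cases "r = x") (simp_all add: split_def)
  qed (use adds_fl_length[OF ls(2)] in \<open>auto split: prod.splits\<close>)
qed

section \<open>The nondeterministic reachability program\<close>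

text \<open>Registers: 1 holds k in unary, 2 the transitions, 3 and 7 the current vector and state, 9 and 10
  the target, 4 the effect of a cycle, 5 and 8 the vector and state at its start, 6 a multiple of the effect.\<close>

definition skip :: rexp where "skip = cps [1,2,3,4,5,6] 7 (\<lambda>s. [Pop 2 s, Push 2 s])"
definition read_src :: rexp where "read_src = cps B 6 (\<lambda>s. [Pop 7 s, Pop 2 s, Push 2 s])"
definition read_tgt :: rexp where
  "read_tgt = Seq (Loop (map (\<lambda>s. [Pop 2 s, Push 2 s, Push 7 s]) B)) (Word [Pop 2 7, Push 2 7, Push 7 6])"
text \<open>One full rotation of the queue of transitions. The transitions around the chosen one
  pass unchanged, its source is compared with the current state, and its vector is added directly
  from the queue.\<close>

definition step_pass :: rexp where
  "step_pass = Seq (Star skip) (Seq read_src (Seq (add 3 2) (Seq read_tgt (Seq (Star skip) (Word [Pop 2 8, Push 2 8])))))"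
definition step :: rexp where "step = Seq step_pass (sign 3 3)"

text \<open>Acceleration: the effect of a cycle is guessed and checked afterwards against
  the execution of the cycle. A multiple of it can be added before (if the cycle decreases the N-counter)
  or after (otherwise); the multiple is built by doubling.\<close>

definition jump :: rexp where
  "jump = Seq (copy V 5 4 6) (Seq (Star (Seq (Alt One (add 3 6)) (dbl 6))) (clear V 5 6))"
text \<open>The executed iteration is the lowest one: it follows the jump if the cycle decreases the
  N-counter and precedes it otherwise. The copies in registers 5 and 8 allow the check that it is a
  cycle with the guessed effect.\<close>

definition cycle :: rexp where
  "cycle = Seq (guess V 5 4) (Seq (copy B 6 7 8) (Seq (Alt One (Seq (sign 4 4) jump)) (Seq (copy V 5 3 5)
     (Seq (Star step) (Seq (chk 5 4 3) (Seq (same_keep B 6 7 8) (Seq (Alt One (Seq (sign 4 3) jump)) (clear V 5 4))))))))"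
definition prog :: rexp where
  "prog = Seq load (Seq (Star (Alt step cycle)) (Seq (same B 6 7 10) (same V 5 3 9)))"

section \<open>Soundness of a single transition\<close>

definition blocks :: "nat list list \<Rightarrow> nat list" where
  "blocks ws = concat (map (\<lambda>w. w @ [7]) ws)"

lemma blocks_append [simp]: "blocks (us @ ws) = blocks us @ blocks ws"
  by (simp add: blocks_def)

lemma blocks_simps [simp]: "blocks [] = []" "blocks (w # ws) = w @ 7 # blocks ws"
  by (simp_all add: blocks_def)

lemma blocks_unique:
  "blocks us = blocks ws \<Longrightarrow> \<forall>w \<in> set us \<union> set ws. 7 \<notin> set w \<Longrightarrow> us = ws"
proof (induction us arbitrary: ws)
  case Nil then show ?case by (cases ws) auto
next
  case (Cons u us)
  then obtain w ws' where ws: "ws = w # ws'" by (cases ws) auto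
  then show ?case using Cons split_unique[of u 7 "blocks us" w "blocks ws'"] by auto
qed

lemma skips_lang:
  assumes "lang (Star skip) \<alpha>"
  shows "\<exists>ws. (\<forall>w \<in> set ws. set w \<subseteq> {1,2,3,4,5,6}) \<and> pops 2 \<alpha> = blocks ws \<and> pushes 2 \<alpha> = blocks ws \<and> idle {2} \<alpha>"
  using assms
proof (induction rule: lang_Star_induct)
  case Nil then show ?case by (intro exI[of _ "[]"]) auto
next
  case (Cons \<alpha> \<beta>)
  from Cons(1) obtain g where g: "endw {1,2,3,4,5,6} 7 g" "\<alpha> = concat (map (\<lambda>s. [Pop 2 s, Push 2 s]) g)"
    unfolding skip_def by (auto simp: lang_cps)
  then obtain w where w: "g = w @ [7]" "set w \<subseteq> {1,2,3,4,5,6}" by (auto simp: endw_def)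
  have i: "idle {2} \<alpha>" unfolding g(2) by (rule idle_concat) simp
  have p: "pops 2 \<alpha> = w @ [7]" "pushes 2 \<alpha> = w @ [7]" unfolding g(2) w(1) by (simp_all add: pops_concat_map pushes_concat_map)
  from Cons(3) obtain ws where "\<forall>w \<in> set ws. set w \<subseteq> {1,2,3,4,5,6}" "pops 2 \<beta> = blocks ws" "pushes 2 \<beta> = blocks ws" "idle {2} \<beta>" by blast
  then show ?case using i p w(2) by (intro exI[of _ "w # ws"]) simp
qed

lemma skips_complete:
  assumes "\<forall>w \<in> set ws. set w \<subseteq> {1,2,3,4,5,6}"
  shows "lang (Star skip) (concat (map (\<lambda>s. [Pop 2 s, Push 2 s]) (blocks ws)))"
  using assms
proof (induction ws)
  case Nil then show ?case by (simp add: lang_Star0)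
next
  case (Cons w ws)
  have "endw {1,2,3,4,5,6} 7 (w @ [7])" using Cons.prems by (auto simp: endw_def)
  then have "lang skip (concat (map (\<lambda>s. [Pop 2 s, Push 2 s]) (w @ [7])))" unfolding skip_def by (subst lang_cps) auto
  from lang_StarS[OF this Cons.IH] Cons.prems show ?case by simp
qed

lemma step_pass_lang:
  assumes "lang step_pass \<alpha>"
  shows "\<exists>ws a ls b ws'. (\<forall>w \<in> set ws \<union> set ws'. set w \<subseteq> {1,2,3,4,5,6}) \<and> set a \<subseteq> {1,2} \<and> set b \<subseteq> {1,2} \<and> adds 0 ls \<and>
    pops 2 \<alpha> = blocks (ws @ [a @ [6] @ (map ly ls @ [5]) @ b] @ ws') @ [8] \<and> pushes 2 \<alpha> = pops 2 \<alpha> \<and>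
    pops 7 \<alpha> = a @ [6] \<and> pushes 7 \<alpha> = b @ [6] \<and> pops 3 \<alpha> = map lx ls @ [5] \<and> pushes 3 \<alpha> = map lz ls @ [5] \<and> idle {2,3,7} \<alpha>"
proof -
  from assms obtain \<alpha>1 \<alpha>2 \<alpha>3 \<alpha>4 \<alpha>5 where \<alpha>: "\<alpha> = \<alpha>1 @ \<alpha>2 @ \<alpha>3 @ \<alpha>4 @ \<alpha>5 @ [Pop 2 8, Push 2 8]"
    "lang (Star skip) \<alpha>1" "lang read_src \<alpha>2" "lang (add 3 2) \<alpha>3" "lang read_tgt \<alpha>4" "lang (Star skip) \<alpha>5"
    unfolding step_pass_def by (elim lang_SeqE) simp
  from skips_lang[OF \<alpha>(2)] obtain ws where 1: "\<forall>w \<in> set ws. set w \<subseteq> {1,2,3,4,5,6}" "pops 2 \<alpha>1 = blocks ws" "pushes 2 \<alpha>1 = blocks ws" "idle {2} \<alpha>1" by blast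
  from skips_lang[OF \<alpha>(6)] obtain ws' where 5: "\<forall>w \<in> set ws'. set w \<subseteq> {1,2,3,4,5,6}" "pops 2 \<alpha>5 = blocks ws'" "pushes 2 \<alpha>5 = blocks ws'" "idle {2} \<alpha>5" by blast
  from \<alpha>(3) obtain g where g: "endw {1,2} 6 g" "\<alpha>2 = concat (map (\<lambda>s. [Pop 7 s, Pop 2 s, Push 2 s]) g)"
    unfolding read_src_def by (auto simp: lang_cps)
  then obtain a where a: "g = a @ [6]" "set a \<subseteq> {1,2}" by (auto simp: endw_def)
  have 2: "pops 2 \<alpha>2 = a @ [6]" "pushes 2 \<alpha>2 = a @ [6]" "pops 7 \<alpha>2 = a @ [6]" "pushes 7 \<alpha>2 = []" "pops 3 \<alpha>2 = []" "pushes 3 \<alpha>2 = []"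
    unfolding g(2) a(1) by (simp_all add: pops_concat_map pushes_concat_map)
  have i2: "idle {2,3,7} \<alpha>2" unfolding g(2) by (rule idle_concat) simp
  from adder_sound[OF \<alpha>(4)[unfolded add_def]] obtain ls where ls: "adds 0 ls"
    "\<alpha>3 = concat (map (\<lambda>(x, y, z). [Pop 3 x, Pop 2 y, Push 2 y, Push 3 z]) (ls @ [(5,5,5)]))" by auto
  have 3: "pops 2 \<alpha>3 = map ly ls @ [5]" "pushes 2 \<alpha>3 = map ly ls @ [5]" "pops 7 \<alpha>3 = []" "pushes 7 \<alpha>3 = []"
     "pops 3 \<alpha>3 = map lx ls @ [5]" "pushes 3 \<alpha>3 = map lz ls @ [5]"
    unfolding ls(2) pops_concat_map pushes_concat_map by (simp_all add: split_def)
  have i3: "idle {2,3,7} \<alpha>3" unfolding ls(2) by (rule idle_concat) (simp add: split_def)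
  from \<alpha>(5) obtain b where b: "set b \<subseteq> {1,2}" "\<alpha>4 = concat (map (\<lambda>s. [Pop 2 s, Push 2 s, Push 7 s]) b) @ [Pop 2 7, Push 2 7, Push 7 6]"
    unfolding read_tgt_def by (elim lang_SeqE) (auto simp: lang_Loop_map simp del: list.map)
  have 4: "pops 2 \<alpha>4 = b @ [7]" "pushes 2 \<alpha>4 = b @ [7]" "pops 7 \<alpha>4 = []" "pushes 7 \<alpha>4 = b @ [6]" "pops 3 \<alpha>4 = []" "pushes 3 \<alpha>4 = []"
    unfolding b(2) by (simp_all add: pops_concat_map pushes_concat_map)
  have "idle {2,3,7} (concat (map (\<lambda>s. [Pop 2 s, Push 2 s, Push 7 s]) b))" by (rule idle_concat) simp
  then have i4: "idle {2,3,7} \<alpha>4" unfolding b(2) by simp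
  have i1: "idle {2,3,7} \<alpha>1" "idle {2,3,7} \<alpha>5" using 1(4) 5(4) by (auto simp: idle_def)
  have z: "pops 7 \<alpha>1 = []" "pushes 7 \<alpha>1 = []" "pops 3 \<alpha>1 = []" "pushes 3 \<alpha>1 = []"
    "pops 7 \<alpha>5 = []" "pushes 7 \<alpha>5 = []" "pops 3 \<alpha>5 = []" "pushes 3 \<alpha>5 = []" using 1(4) 5(4) by (auto simp: idle_def)
  show ?thesis
    by (rule exI[of _ ws], rule exI[of _ a], rule exI[of _ ls], rule exI[of _ b], rule exI[of _ ws'])
       (use 1(1-3) 5(1-3) 2 3 4 a(2) b(1) ls(1) i1 i2 i3 i4 z in \<open>simp add: \<alpha>(1) ball_Un\<close>)
qed

abbreviation body :: "nat \<times> nat list \<times> nat \<Rightarrow> nat list" where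
  "body t \<equiv> bin (fst t) @ [6] @ fst (snd t) @ bin (snd (snd t))"

lemma tqueue_blocks: "tqueue TT = blocks (map body TT) @ [8]"
proof -
  have "concat (map encT TT) = blocks (map body TT)" by (induction TT) (auto simp: encT_def)
  then show ?thesis by (simp add: tqueue_def)
qed

lemma set_body: "isvec (fst (snd t)) \<Longrightarrow> set (body t) \<subseteq> {1,2,3,4,5,6}"
  using set_bin[of "fst t"] set_bin[of "snd (snd t)"] by (auto simp: isvec_def)

lemma set_blocks: "\<forall>w \<in> set ws. set w \<subseteq> {1,2,3,4,5,6} \<Longrightarrow> 8 \<notin> set (blocks ws)"
  by (induction ws) auto

text \<open>The balance of register 2 equates two parsings of the queue of transitions, the stored
  and the guessed one. The markers 8, 7, 6 and 5 can be located uniquely, so the guessed source,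
  vector and target are those of one stored transition.\<close>

lemma step_pass_sound:
  assumes "exec step_pass n \<sigma> \<sigma>'" "\<sigma> 2 = tqueue TT" "\<forall>t \<in> set TT. isvec (fst (snd t))" "\<sigma> 7 = bin p @ [6]" "isvec (\<sigma> 3)"
  shows "\<exists>f q g. (p, f, q) \<in> set TT \<and> isvec g \<and> \<sigma>' = \<sigma>(7 := bin q @ [6], 3 := g) \<and>
    length (vv (\<sigma> 3)) = length (vv f) \<and> vv g = map2 (+) (vv (\<sigma> 3)) (vv f)"
proof -
  obtain \<alpha> where \<alpha>: "lang step_pass \<alpha>" "\<And>r. \<sigma> r @ pushes r \<alpha> = pops r \<alpha> @ \<sigma>' r"
    by (rule exec_fifo[OF assms(1)], blast)
  from step_pass_lang[OF \<alpha>(1)] obtain ws a ls b ws' where l: "\<forall>w \<in> set ws \<union> set ws'. set w \<subseteq> {1,2,3,4,5,6}" "set a \<subseteq> {1,2}" "set b \<subseteq> {1,2}" "adds 0 ls"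
    "pops 2 \<alpha> = blocks (ws @ [a @ [6] @ (map ly ls @ [5]) @ b] @ ws') @ [8]" "pushes 2 \<alpha> = pops 2 \<alpha>"
    "pops 7 \<alpha> = a @ [6]" "pushes 7 \<alpha> = b @ [6]" "pops 3 \<alpha> = map lx ls @ [5]" "pushes 3 \<alpha> = map lz ls @ [5]" "idle {2,3,7} \<alpha>" by blast
  note vv = adds_vv[OF l(4)]
  let ?m = "a @ [6] @ (map ly ls @ [5]) @ b"
  have ly: "set (map ly ls) \<subseteq> {1,2,3,4}" using vv(2) by (auto simp: isvec_def)
  then have m: "set ?m \<subseteq> {1,2,3,4,5,6}" using l(2,3) by auto
  have all: "\<forall>w \<in> set (map body TT) \<union> set (ws @ [?m] @ ws'). set w \<subseteq> {1,2,3,4,5,6}"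
  proof
    fix w assume "w \<in> set (map body TT) \<union> set (ws @ [?m] @ ws')"
    then consider t where "t \<in> set TT" "w = body t" | "w \<in> set ws \<union> set ws'" | "w = ?m" by auto
    then show "set w \<subseteq> {1,2,3,4,5,6}"
    proof cases
      case 1 then show ?thesis using set_body[of t] assms(3) by blast
    next
      case 2 then show ?thesis using l(1) by blast
    next
      case 3 then show ?thesis using m by blast
    qed
  qed
  have "blocks (map body TT) @ 8 # pushes 2 \<alpha> = blocks (ws @ [?m] @ ws') @ 8 # \<sigma>' 2"
    using \<alpha>(2)[of 2] assms(2) l(5) by (simp add: tqueue_blocks)
  moreover have "8 \<notin> set (blocks (map body TT))" "8 \<notin> set (blocks (ws @ [?m] @ ws'))"
    by (rule set_blocks, use all in blast)+
  ultimately have *: "blocks (map body TT) = blocks (ws @ [?m] @ ws') \<and> pushes 2 \<alpha> = \<sigma>' 2"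
    by (intro split_unique)
  then have eq: "blocks (map body TT) = blocks (ws @ [?m] @ ws')" and p2: "\<sigma>' 2 = pushes 2 \<alpha>" by simp_all
  have "map body TT = ws @ [?m] @ ws'" 
  proof (rule blocks_unique[OF eq], rule ballI)
    fix w assume "w \<in> set (map body TT) \<union> set (ws @ [?m] @ ws')"
    then have "set w \<subseteq> {1,2,3,4,5,6}" using all by blast
    then show "7 \<notin> set w" by auto
  qed
  then have "?m \<in> set (map body TT)" by simp
  then obtain t where t: "t \<in> set TT" "body t = ?m" by auto
  have "6 \<notin> set a" using l(2) by auto
  moreover have "6 \<notin> set (bin n)" for n using set_bin[of n] by auto
  ultimately have no6: "6 \<notin> set a" "\<And>n. 6 \<notin> set (bin n)" by simp_all
  then have t1: "bin (fst t) = a" "fst (snd t) @ bin (snd (snd t)) = (map ly ls @ [5]) @ b"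
    using t(2) split_unique[of "bin (fst t)" 6 "fst (snd t) @ bin (snd (snd t))" a "(map ly ls @ [5]) @ b"] no6 by auto
  have t2: "fst (snd t) = map ly ls @ [5]" "bin (snd (snd t)) = b"
    using isvec_prefix[OF _ vv(2) t1(2)] assms(3) t(1) by auto
  have "bin p @ 6 # (b @ [6]) = a @ 6 # \<sigma>' 7" using \<alpha>(2)[of 7] assms(4) l(7,8) by simp
  then have pa: "bin p = a" "\<sigma>' 7 = b @ [6]" using split_unique[of "bin p" 6 "b @ [6]" a "\<sigma>' 7"] no6 by auto
  then have pt: "p = fst t" using t1(1) bin_inj by metis
  have x: "\<sigma> 3 = map lx ls @ [5]" "\<sigma>' 3 = map lz ls @ [5]"
    using isvec_prefix[OF assms(5) vv(1), of "map lz ls @ [5]" "\<sigma>' 3"] \<alpha>(2)[of 3] l(9,10) by auto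
  have s2: "\<sigma>' 2 = \<sigma> 2" using p2 l(5,6) eq assms(2) by (simp add: tqueue_blocks)
  have "\<sigma>' = \<sigma>(7 := bin (snd (snd t)) @ [6], 3 := map lz ls @ [5])"
  proof
    fix r :: nat
    consider "r = 2" | "r = 3" | "r = 7" | "r \<notin> {2,3,7}" by blast
    then show "\<sigma>' r = (\<sigma>(7 := bin (snd (snd t)) @ [6], 3 := map lz ls @ [5])) r"
    proof cases
      case 4 then show ?thesis using \<alpha>(2)[of r] idleD[OF l(11) 4] by simp
    qed (use s2 x pa t2 in simp_all)
  qed
  moreover have "(p, fst (snd t), snd (snd t)) \<in> set TT" using t(1) pt by simp
  ultimately show ?thesis using vv(3-5) unfolding t2(1) x(1)
    by (intro exI[of _ "map ly ls @ [5]"] exI[of _ "snd (snd t)"] exI[of _ "map lz ls @ [5]"]) (use t2(1) in auto)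
qed

lemma rep_in:
  assumes "list_all2 (rep_trans k) T TT" "(p, f, q) \<in> set TT"
  shows "(p, vv f, q) \<in> set T \<and> length (vv f) = Suc k \<and> isvec f"
  using assms by (induction rule: list_all2_induct) (auto simp: rep_trans_def prod_eq_iff)

lemma rep_isvec: "list_all2 (rep_trans k) T TT \<Longrightarrow> \<forall>t \<in> set TT. isvec (fst (snd t))"
  by (induction rule: list_all2_induct) (auto simp: rep_trans_def)

lemma step_sound:
  assumes "exec step n \<sigma> \<sigma>'" "\<sigma> 2 = tqueue TT" "list_all2 (rep_trans k) T TT" "\<sigma> 7 = bin p @ [6]" "isvec (\<sigma> 3)"
  shows "\<exists>q g. isvec g \<and> \<sigma>' = \<sigma>(7 := bin q @ [6], 3 := g) \<and> vass_step T (p, vv (\<sigma> 3)) (q, vv g) \<and>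
    length (vv g) = Suc k \<and> length (vv (\<sigma> 3)) = Suc k"
proof -
  from assms(1) obtain \<sigma>1 where 1: "exec step_pass n \<sigma> \<sigma>1" "exec (sign 3 3) n \<sigma>1 \<sigma>'"
    unfolding step_def by (rule exec_SeqE)
  from step_pass_sound[OF 1(1) assms(2) rep_isvec[OF assms(3)] assms(4,5)] obtain f q g where
    g: "(p, f, q) \<in> set TT" "isvec g" "\<sigma>1 = \<sigma>(7 := bin q @ [6], 3 := g)" "length (vv (\<sigma> 3)) = length (vv f)" "vv g = map2 (+) (vv (\<sigma> 3)) (vv f)" by blast
  have "isvec (\<sigma>1 3)" using g by simp
  have "\<sigma>1 3 = g" using g(3) by simp
  with sign_sound[OF 1(2) \<open>isvec (\<sigma>1 3)\<close>] obtain h where h: "\<sigma>' = \<sigma>1" "g = 3 # h" by auto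
  have "0 \<le> vv g ! 0" using sign_vv(1)[of 3 h] g(2) h(2) by simp
  then have "vass_step T (p, vv (\<sigma> 3)) (q, vv g)" unfolding vass_step_def using rep_in[OF assms(3) g(1)] g(5) by auto
  moreover have "length (vv g) = Suc k" "length (vv (\<sigma> 3)) = Suc k" using g(4,5) rep_in[OF assms(3) g(1)] by simp_all
  ultimately show ?thesis using g(2,3) h(1) by blast
qed

section \<open>Soundness of acceleration\<close>

definition sm :: "int list \<Rightarrow> int \<Rightarrow> int list \<Rightarrow> int list" where
  "sm x a y = map2 (\<lambda>u v. u + a * v) x y"

lemma length_sm [simp]: "length (sm x a y) = min (length x) (length y)"
  by (simp add: sm_def)

lemma nth_sm [simp]: "i < length x \<Longrightarrow> i < length y \<Longrightarrow> sm x a y ! i = x ! i + a * y ! i"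
  by (simp add: sm_def)

lemma sm_0: "length x \<le> length y \<Longrightarrow> sm x 0 y = x"
  by (auto intro: nth_equalityI)

lemma sm_1: "sm x 1 y = map2 (+) x y"
  by (simp add: sm_def)

lemma sm_sm: "sm (sm x a y) b y = sm x (a + b) y"
  by (rule nth_equalityI) (auto simp: algebra_simps)

text \<open>Loop invariant: register 6 holds a multiple of the guessed effect, and register 3 its
  start value plus another multiple. The guess may have a wrong number of components, hence the
  conditional conclusion; the length is confirmed only by the later \<open>chk\<close>.\<close>

lemma jump_sound:
  assumes "exec jump n \<sigma> \<sigma>'" "\<sigma> 6 = []" "isvec (\<sigma> 3)" "isvec (\<sigma> 4)"
  shows "\<exists>f a. isvec f \<and> \<sigma>' = \<sigma>(3 := f) \<and> length (vv f) = length (vv (\<sigma> 3)) \<and>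
    (length (vv (\<sigma> 3)) = length (vv (\<sigma> 4)) \<longrightarrow> vv f = sm (vv (\<sigma> 3)) (int a) (vv (\<sigma> 4)))"
proof -
  from assms(1) obtain \<sigma>1 \<sigma>2 where ex: "exec (copy V 5 4 6) n \<sigma> \<sigma>1" "exec (Star (Seq (Alt One (add 3 6)) (dbl 6))) n \<sigma>1 \<sigma>2"
    "exec (clear V 5 6) n \<sigma>2 \<sigma>'" unfolding jump_def by (elim exec_SeqE)
  have \<sigma>1: "\<sigma>1 = \<sigma>(6 := \<sigma> 4)" using copy_sound[OF ex(1)] assms(2,4) by (simp add: set_V[simplified])
  define P where "P \<tau> \<longleftrightarrow> (\<exists>f z a b. isvec f \<and> isvec z \<and> \<tau> = \<sigma>(3 := f, 6 := z) \<and> length (vv f) = length (vv (\<sigma> 3)) \<and>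
     length (vv z) = length (vv (\<sigma> 4)) \<and> (\<forall>i < length (vv z). vv z ! i = int b * vv (\<sigma> 4) ! i) \<and>
     (length (vv (\<sigma> 3)) = length (vv (\<sigma> 4)) \<longrightarrow> vv f = sm (vv (\<sigma> 3)) (int a) (vv (\<sigma> 4))))" for \<tau>
  have "P \<sigma>1" unfolding P_def using assms
    by (intro exI[of _ "\<sigma> 3"] exI[of _ "\<sigma> 4"] exI[of _ 0] exI[of _ 1]) (auto simp: \<sigma>1 sm_0)
  with ex(2) have "P \<sigma>2"
  proof (rule exec_Star_inv)
    fix \<tau> \<tau>' assume "P \<tau>" and st: "exec (Seq (Alt One (add 3 6)) (dbl 6)) n \<tau> \<tau>'"
    then obtain f z a b where P: "isvec f" "isvec z" "\<tau> = \<sigma>(3 := f, 6 := z)" "length (vv f) = length (vv (\<sigma> 3))"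
      "length (vv z) = length (vv (\<sigma> 4))" "\<forall>i < length (vv z). vv z ! i = int b * vv (\<sigma> 4) ! i"
      "length (vv (\<sigma> 3)) = length (vv (\<sigma> 4)) \<longrightarrow> vv f = sm (vv (\<sigma> 3)) (int a) (vv (\<sigma> 4))" unfolding P_def by blast
    from st obtain \<tau>1 where t: "exec (Alt One (add 3 6)) n \<tau> \<tau>1" "exec (dbl 6) n \<tau>1 \<tau>'" by (rule exec_SeqE)
    have "\<exists>f' a'. isvec f' \<and> \<tau>1 = \<sigma>(3 := f', 6 := z) \<and> length (vv f') = length (vv (\<sigma> 3)) \<and>
      (length (vv (\<sigma> 3)) = length (vv (\<sigma> 4)) \<longrightarrow> vv f' = sm (vv (\<sigma> 3)) (int a') (vv (\<sigma> 4)))"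
      using t(1)
    proof (rule exec_AltE)
      assume "exec One n \<tau> \<tau>1"
      then have "\<tau>1 = \<tau>" by (rule exec_OneE)
      then show ?thesis using P by blast
    next
      assume "exec (add 3 6) n \<tau> \<tau>1"
      from add_sound[OF this] P(1-3) obtain f' where f': "isvec f'" "\<tau>1 = \<tau>(3 := f')" "length (vv f) = length (vv z)" "vv f' = map2 (+) (vv f) (vv z)" by auto
      have "vv f' = sm (vv (\<sigma> 3)) (int (a + b)) (vv (\<sigma> 4))"
      proof (rule nth_equalityI)
        show "length (vv f') = length (sm (vv (\<sigma> 3)) (int (a + b)) (vv (\<sigma> 4)))" using P f' by simp
        fix i assume "i < length (vv f')"
        then show "vv f' ! i = sm (vv (\<sigma> 3)) (int (a + b)) (vv (\<sigma> 4)) ! i" using P f' by (simp add: algebra_simps)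
      qed
      then show ?thesis using f' P by (intro exI[of _ f'] exI[of _ "a + b"]) (auto simp: fun_eq_iff)
    qed
    then obtain f' a' where f': "isvec f'" "\<tau>1 = \<sigma>(3 := f', 6 := z)" "length (vv f') = length (vv (\<sigma> 3))"
      "length (vv (\<sigma> 3)) = length (vv (\<sigma> 4)) \<longrightarrow> vv f' = sm (vv (\<sigma> 3)) (int a') (vv (\<sigma> 4))" by blast
    from dbl_sound[OF t(2)] f'(2) P(2) obtain z' where z': "isvec z'" "\<tau>' = \<tau>1(6 := z')" "vv z' = map2 (+) (vv z) (vv z)" by auto
    show "P \<tau>'" unfolding P_def
      by (rule exI[of _ f'], rule exI[of _ z'], rule exI[of _ a'], rule exI[of _ "2 * b"])
         (use f' z' P(5,6) in \<open>simp add: algebra_simps\<close>)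
  qed
  then obtain f z a where P: "isvec f" "isvec z" "\<sigma>2 = \<sigma>(3 := f, 6 := z)" "length (vv f) = length (vv (\<sigma> 3))"
    "length (vv (\<sigma> 3)) = length (vv (\<sigma> 4)) \<longrightarrow> vv f = sm (vv (\<sigma> 3)) (int a) (vv (\<sigma> 4))" unfolding P_def by blast
  have "\<sigma>' = \<sigma>2(6 := [])" using clear_sound[OF ex(3)] P by (simp add: set_V[simplified])
  then have "\<sigma>' = \<sigma>(3 := f)" using P(3) assms(2) by (auto simp: fun_eq_iff)
  then show ?thesis using P by blast
qed

text \<open>A shift that does not lower the N-counter keeps every step legal, as the other counters
  are unconstrained.\<close>

lemma reach_shift:
  assumes "vass_reach T (p, u) (q, w)" "vass_wf k T" "length u = Suc k" "length y = Suc k" "0 \<le> c * y ! 0"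
  shows "length w = Suc k \<and> vass_reach T (p, sm u c y) (q, sm w c y)"
proof -
  have "length (snd d) = Suc k \<and> vass_reach T (p, sm u c y) (fst d, sm (snd d) c y)" if "vass_reach T (p, u) d" for d
    using that unfolding vass_reach_def
  proof (induction rule: rtranclp_induct)
    case base
    then show ?case using assms by simp
  next
    case (step d d')
    from step(2) obtain v where v: "(fst d, v, fst d') \<in> set T" "snd d' = map2 (+) (snd d) v" "0 \<le> snd d' ! 0"
      by (auto simp: vass_step_def)
    have lv: "length v = Suc k" using v(1) assms(2) by (auto simp: vass_wf_def)
    have l: "length (snd d') = Suc k" using step.IH lv v(2) by simp
    have "sm (snd d') c y = map2 (+) (sm (snd d) c y) v"
      by (rule nth_equalityI) (use v(2) lv l step.IH assms(4) in auto)
    moreover have "0 \<le> sm (snd d') c y ! 0" using v(3) l assms(4,5) by simp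
    ultimately have "vass_step T (fst d, sm (snd d) c y) (fst d', sm (snd d') c y)"
      unfolding vass_step_def using v(1) by auto
    then show ?case using step.IH l by (auto intro: rtranclp.rtrancl_into_rtrancl)
  qed
  from this[OF assms(1)] show ?thesis by simp
qed

text \<open>The executed iteration starts after \<open>a\<close> others. By the sign conditions no
  other iteration starts at a lower N-counter, so \<open>reach_shift\<close> carries it over to each
  of them, and all \<open>a + 1 + b\<close> iterations are chained.\<close>

lemma reach_accelerate:
  assumes r: "vass_reach T (p, sm x (int a) y) (p, sm x (int a + 1) y)" and wf: "vass_wf k T"
    and l: "length x = Suc k" "length y = Suc k" and ab: "a = 0 \<or> y ! 0 \<le> 0" "b = 0 \<or> 0 \<le> y ! 0"
  shows "vass_reach T (p, x) (p, sm x (int a + 1 + int b) y)"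
proof -
  have one: "vass_reach T (p, sm x (int i) y) (p, sm x (int i + 1) y)" if "i \<le> a + b" for i
  proof -
    have "0 \<le> (int i - int a) * y ! 0"
    proof (cases "i \<le> a")
      case True
      then show ?thesis using ab(1) by (cases "i = a") (auto simp: mult_nonpos_nonpos)
    next
      case False
      then show ?thesis using ab(2) that by auto
    qed
    from reach_shift[OF r wf _ l(2) this] l show ?thesis by (simp add: sm_sm algebra_simps)
  qed
  have "vass_reach T (p, x) (p, sm x (int i) y)" if "i \<le> a + b + 1" for i
    using that
  proof (induction i)
    case 0
    then show ?case using sm_0[of x y] l by (simp add: vass_reach_def)
  next
    case (Suc i)
    then have "vass_reach T (p, x) (p, sm x (int i) y)" "vass_reach T (p, sm x (int i) y) (p, sm x (int i + 1) y)" using one by auto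
    then show ?case unfolding vass_reach_def by (simp add: add.commute)
  qed
  from this[of "a + b + 1"] show ?thesis by (simp add: algebra_simps)
qed

lemma steps_sound:
  assumes "exec (Star step) n \<sigma> \<sigma>'" "\<sigma> 2 = tqueue TT" "list_all2 (rep_trans k) T TT" "\<sigma> 7 = bin p @ [6]" "isvec (\<sigma> 3)"
  shows "\<exists>q g. isvec g \<and> \<sigma>' = \<sigma>(7 := bin q @ [6], 3 := g) \<and> vass_reach T (p, vv (\<sigma> 3)) (q, vv g)"
proof (rule exec_Star_inv[OF assms(1)])
  show "\<exists>q g. isvec g \<and> \<sigma> = \<sigma>(7 := bin q @ [6], 3 := g) \<and> vass_reach T (p, vv (\<sigma> 3)) (q, vv g)"
    using assms by (intro exI[of _ p] exI[of _ "\<sigma> 3"]) (auto simp: vass_reach_def fun_eq_iff)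
  fix \<tau> \<tau>'
  assume "\<exists>q g. isvec g \<and> \<tau> = \<sigma>(7 := bin q @ [6], 3 := g) \<and> vass_reach T (p, vv (\<sigma> 3)) (q, vv g)" and ex: "exec step n \<tau> \<tau>'"
  then obtain q g where g: "isvec g" "\<tau> = \<sigma>(7 := bin q @ [6], 3 := g)" "vass_reach T (p, vv (\<sigma> 3)) (q, vv g)" by blast
  from step_sound[OF ex _ assms(3), of q] g assms(2) obtain q' g' where g': "isvec g'" "\<tau>' = \<tau>(7 := bin q' @ [6], 3 := g')"
    "vass_step T (q, vv g) (q', vv g')" by auto
  have "vass_reach T (p, vv (\<sigma> 3)) (q', vv g')" using g(3) g'(3) unfolding vass_reach_def by (rule rtranclp.rtrancl_into_rtrancl)
  then show "\<exists>q g. isvec g \<and> \<tau>' = \<sigma>(7 := bin q @ [6], 3 := g) \<and> vass_reach T (p, vv (\<sigma> 3)) (q, vv g)"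
    using g g' by (intro exI[of _ q'] exI[of _ g']) (auto simp: fun_eq_iff)
qed

text \<open>The success of \<open>chk\<close> shows that the guessed effect has k + 1 components and
  is the effect of the executed steps. Only then can the first jump be evaluated, although it took
  place before.\<close>

lemma cycle_sound:
  assumes "exec cycle n \<sigma> \<sigma>'" "\<sigma> 2 = tqueue TT" "list_all2 (rep_trans k) T TT" "vass_wf k T" "\<sigma> 7 = bin p @ [6]" "isvec (\<sigma> 3)"
    "length (vv (\<sigma> 3)) = Suc k" "\<sigma> 4 = []" "\<sigma> 5 = []" "\<sigma> 6 = []" "\<sigma> 8 = []"
  shows "\<exists>g. isvec g \<and> \<sigma>' = \<sigma>(3 := g) \<and> length (vv g) = Suc k \<and> vass_reach T (p, vv (\<sigma> 3)) (p, vv g)"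
proof -
  from assms(1) obtain \<sigma>1 \<sigma>2 \<sigma>3 \<sigma>4 \<sigma>5 \<sigma>6 \<sigma>7 \<sigma>8 where ex: "exec (guess V 5 4) n \<sigma> \<sigma>1" "exec (copy B 6 7 8) n \<sigma>1 \<sigma>2"
    "exec (Alt One (Seq (sign 4 4) jump)) n \<sigma>2 \<sigma>3" "exec (copy V 5 3 5) n \<sigma>3 \<sigma>4" "exec (Star step) n \<sigma>4 \<sigma>5"
    "exec (chk 5 4 3) n \<sigma>5 \<sigma>6" "exec (same_keep B 6 7 8) n \<sigma>6 \<sigma>7" "exec (Alt One (Seq (sign 4 3) jump)) n \<sigma>7 \<sigma>8" "exec (clear V 5 4) n \<sigma>8 \<sigma>'"
    unfolding cycle_def by (elim exec_SeqE)
  have tb: "endw (set B) 6 (bin p @ [6])" for p using term_bin by simp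
  let ?x = "vv (\<sigma> 3)"
  from guess_sound[OF ex(1) _ assms(8)] obtain y where y: "isvec y" "\<sigma>1 = \<sigma>(4 := y)" by (auto simp: set_V[simplified])
  have 2: "\<sigma>2 = \<sigma>1(8 := bin p @ [6])" using copy_sound[OF ex(2)] tb[of p] y assms by simp
  have "\<exists>f a. isvec f \<and> \<sigma>3 = \<sigma>2(3 := f) \<and> length (vv f) = Suc k \<and> (Suc k = length (vv y) \<longrightarrow> vv f = sm ?x (int a) (vv y)) \<and>
     (a = 0 \<or> vv y ! 0 \<le> 0)"
    using ex(3)
  proof (rule exec_AltE)
    assume "exec One n \<sigma>2 \<sigma>3"
    then have "\<sigma>3 = \<sigma>2" by (rule exec_OneE)
    then show ?thesis using assms y 2 by (intro exI[of _ "\<sigma> 3"] exI[of _ 0]) (auto simp: sm_0 fun_eq_iff)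
  next
    assume "exec (Seq (sign 4 4) jump) n \<sigma>2 \<sigma>3"
    then obtain \<tau> where \<tau>: "exec (sign 4 4) n \<sigma>2 \<tau>" "exec jump n \<tau> \<sigma>3" by (rule exec_SeqE)
    from sign_sound[OF \<tau>(1)] y 2 obtain g where g: "\<tau> = \<sigma>2" "y = 4 # g" by auto
    have "vv y ! 0 \<le> 0" using sign_vv(2)[of 4 g] y g by force
    moreover from jump_sound[OF \<tau>(2)] g y 2 assms obtain f a where "isvec f" "\<sigma>3 = \<sigma>2(3 := f)" "length (vv f) = length ?x"
      "length ?x = length (vv y) \<longrightarrow> vv f = sm ?x (int a) (vv y)" by auto
    ultimately show ?thesis using assms(7) by (intro exI[of _ f] exI[of _ a]) auto
  qed
  then obtain f a where f: "isvec f" "\<sigma>3 = \<sigma>2(3 := f)" "length (vv f) = Suc k" "Suc k = length (vv y) \<longrightarrow> vv f = sm ?x (int a) (vv y)"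
     "a = 0 \<or> vv y ! 0 \<le> 0" by blast
  have 4: "\<sigma>4 = \<sigma>3(5 := f)" using copy_sound[OF ex(4)] f y 2 assms by (simp add: set_V[simplified])
  from steps_sound[OF ex(5) _ assms(3), of p] f y 2 4 assms obtain q g where g: "isvec g" "\<sigma>5 = \<sigma>4(7 := bin q @ [6], 3 := g)"
    "vass_reach T (p, vv f) (q, vv g)" by auto
  have 6: "\<sigma>6 = \<sigma>5(5 := [])" "length (vv f) = length (vv y)" "vv g = map2 (+) (vv f) (vv y)"
    using chk_sound[OF ex(6)] f y 2 4 g by auto
  have 7: "bin q = bin p" "\<sigma>7 = \<sigma>6(8 := [])"
    using same_keep_sound[OF ex(7)] tb[of p] tb[of q] f y 2 4 g 6 by auto
  have q: "q = p" using 7(1) bin_inj by simp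
  have ly: "length (vv y) = Suc k" using 6(2) f(3) by simp
  have vf: "vv f = sm ?x (int a) (vv y)" using f(4) ly by simp
  have vg: "vv g = sm ?x (int a + 1) (vv y)" unfolding 6(3) vf sm_1[symmetric] sm_sm ..
  have \<sigma>7: "\<sigma>7 = \<sigma>(3 := g, 4 := y)"
    using assms(5,9,11) q by (auto simp: fun_eq_iff y(2) 2 f(2) 4 g(2) 6(1) 7(2))
  have "\<exists>h b. isvec h \<and> \<sigma>8 = \<sigma>(3 := h, 4 := y) \<and> length (vv h) = Suc k \<and> vv h = sm ?x (int a + 1 + int b) (vv y) \<and> (b = 0 \<or> 0 \<le> vv y ! 0)"
    using ex(8)
  proof (rule exec_AltE)
    assume "exec One n \<sigma>7 \<sigma>8"
    then have "\<sigma>8 = \<sigma>7" by (rule exec_OneE)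
    then show ?thesis using \<sigma>7 g(1) vg ly assms(7) by (intro exI[of _ g] exI[of _ 0]) auto
  next
    assume "exec (Seq (sign 4 3) jump) n \<sigma>7 \<sigma>8"
    then obtain \<tau> where \<tau>: "exec (sign 4 3) n \<sigma>7 \<tau>" "exec jump n \<tau> \<sigma>8" by (rule exec_SeqE)
    from sign_sound[OF \<tau>(1)] y \<sigma>7 obtain g' where g': "\<tau> = \<sigma>7" "y = 3 # g'" by auto
    have "0 \<le> vv y ! 0" using sign_vv(1)[of 3 g'] y g' by force
    moreover from jump_sound[OF \<tau>(2)] g' y \<sigma>7 g assms obtain h b where h: "isvec h" "\<sigma>8 = \<sigma>7(3 := h)" "length (vv h) = length (vv g)"
      "length (vv g) = length (vv y) \<longrightarrow> vv h = sm (vv g) (int b) (vv y)" by auto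
    moreover have "vv h = sm ?x (int a + 1 + int b) (vv y)" using h(3,4) vg ly assms(7) by (simp add: sm_sm)
    ultimately show ?thesis using vg ly assms(7) by (intro exI[of _ h] exI[of _ b]) (auto simp: \<sigma>7 fun_eq_iff)
  qed
  then obtain h b where h: "isvec h" "\<sigma>8 = \<sigma>(3 := h, 4 := y)" "length (vv h) = Suc k" "vv h = sm ?x (int a + 1 + int b) (vv y)" "b = 0 \<or> 0 \<le> vv y ! 0" by blast
  have "\<sigma>' = \<sigma>8(4 := [])" using clear_sound[OF ex(9)] h y by (simp add: set_V[simplified])
  then have "\<sigma>' = \<sigma>(3 := h)" using assms(8) h(2) by (auto simp: fun_eq_iff)
  moreover have "vass_reach T (p, ?x) (p, vv h)"
    unfolding h(4) by (rule reach_accelerate[OF _ assms(4,7) ly f(5) h(5)]) (use g(3) vf vg q in simp)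
  ultimately show ?thesis using h by blast
qed

text \<open>The loop invariant is the store after loading with the source configuration replaced by
  some configuration reachable from it.\<close>

theorem prog_sound:
  assumes "exec prog n (init_store w) \<sigma>" "set w \<subseteq> {1..6}"
  shows "w \<in> REACH_1N"
proof -
  from assms(1) obtain \<sigma>1 \<sigma>2 \<sigma>3 where ex: "exec load n (init_store w) \<sigma>1" "exec (Star (Alt step cycle)) n \<sigma>1 \<sigma>2"
    "exec (same B 6 7 10) n \<sigma>2 \<sigma>3" "exec (same V 5 3 9) n \<sigma>3 \<sigma>" unfolding prog_def by (elim exec_SeqE)
  from load_sound[OF ex(1) assms(2)] obtain k T TT s t f g where l: "w = enc_instance k T s t" "vass_wf k T" "conf_wf k s" "conf_wf k t"
    "list_all2 (rep_trans k) T TT" "isvec f" "vv f = snd s" "isvec g" "vv g = snd t" "\<sigma>1 = loaded k TT (fst s) f (fst t) g" by blast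
  define P where "P \<tau> \<longleftrightarrow> (\<exists>p f'. isvec f' \<and> length (vv f') = Suc k \<and> \<tau> = loaded k TT p f' (fst t) g \<and> vass_reach T s (p, vv f'))" for \<tau>
  have "P \<sigma>1" unfolding P_def using l by (intro exI[of _ "fst s"] exI[of _ f]) (auto simp: vass_reach_def conf_wf_def)
  with ex(2) have "P \<sigma>2"
  proof (rule exec_Star_inv)
    fix \<tau> \<tau>' assume "P \<tau>" and ex: "exec (Alt step cycle) n \<tau> \<tau>'"
    then obtain p f' where P: "isvec f'" "length (vv f') = Suc k" "\<tau> = loaded k TT p f' (fst t) g" "vass_reach T s (p, vv f')" unfolding P_def by blast
    have r: "\<tau> 2 = tqueue TT" "\<tau> 7 = bin p @ [6]" "\<tau> 3 = f'" "\<tau> 4 = []" "\<tau> 5 = []" "\<tau> 6 = []" "\<tau> 8 = []" unfolding P(3) loaded_def by simp_all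
    from ex show "P \<tau>'"
    proof (rule exec_AltE)
      assume "exec step n \<tau> \<tau>'"
      from step_sound[OF this r(1) l(5) r(2)] P(1) r(3) obtain q h where h: "isvec h" "\<tau>' = \<tau>(7 := bin q @ [6], 3 := h)"
        "vass_step T (p, vv f') (q, vv h)" "length (vv h) = Suc k" by auto
      have "\<tau>' = loaded k TT q h (fst t) g" unfolding h(2) P(3) loaded_def by (auto simp: fun_eq_iff)
      moreover have "vass_reach T s (q, vv h)" using P(4) h(3) unfolding vass_reach_def by (rule rtranclp.rtrancl_into_rtrancl)
      ultimately show ?thesis unfolding P_def using h by blast
    next
      assume "exec cycle n \<tau> \<tau>'"
      from cycle_sound[OF this r(1) l(5,2) r(2)] P(1,2) r obtain h where h: "isvec h" "\<tau>' = \<tau>(3 := h)" "length (vv h) = Suc k"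
        "vass_reach T (p, vv f') (p, vv h)" by auto
      have "\<tau>' = loaded k TT p h (fst t) g" unfolding h(2) P(3) loaded_def by (auto simp: fun_eq_iff)
      moreover have "vass_reach T s (p, vv h)" using P(4) h(4) unfolding vass_reach_def by (rule rtranclp_trans)
      ultimately show ?thesis unfolding P_def using h by blast
    qed
  qed
  then obtain p f' where P: "isvec f'" "\<sigma>2 = loaded k TT p f' (fst t) g" "vass_reach T s (p, vv f')" unfolding P_def by blast
  have r: "\<sigma>2 7 = bin p @ [6]" "\<sigma>2 10 = bin (fst t) @ [6]" "\<sigma>2 3 = f'" "\<sigma>2 9 = g" unfolding P(2) loaded_def by simp_all
  have "bin p = bin (fst t)" using same_sound[OF ex(3)] r term_bin by simp
  then have p: "p = fst t" using bin_inj by simp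
  have "\<sigma>3 3 = f'" "\<sigma>3 9 = g" using same_sound_other[OF ex(3)] r by simp_all
  then have "f' = g" using same_sound[OF ex(4)] P(1) l(8) by (simp add: set_V[simplified])
  then have "vass_reach T s t" using P(3) p l(9) by simp
  then show ?thesis unfolding REACH_1N_def using l by blast
qed

section \<open>Executions of the reachability program\<close>

lemma dig_sign: "\<exists>g. dig W i = (if i < 0 then 4 else 3) # g"
proof (induction W arbitrary: i)
  case (Suc W)
  obtain g where "dig W (i div 2) = (if i div 2 < 0 then 4 else 3) # g" using Suc by blast
  moreover have "i div 2 < 0 \<longleftrightarrow> i < 0" by presburger
  ultimately show ?case by simp
qed simp

lemma fl_sign: "v \<noteq> [] \<Longrightarrow> \<exists>g. fl W v = (if v ! 0 < 0 then 4 else 3) # g"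
  using dig_sign[of W "hd v"] by (cases v) (auto simp: fl_def)

lemma sign_fl_complete:
  assumes "\<sigma> r = fl W v" "v \<noteq> []" "s = (if v ! 0 < 0 then 4 else 3)"
  shows "exec (sign r s) (2 * length (fl W v)) \<sigma> \<sigma>"
proof -
  obtain g where g: "fl W v = s # g" using fl_sign[OF assms(2)] assms(3) by auto
  have "isvec (s # g)" using isvec_fl[of W v] g by simp
  moreover have "s = 3 \<or> s = 4" using assms(3) by simp
  ultimately show ?thesis using sign_complete[of \<sigma> r s g] assms(1) g by simp
qed

lemma lang_Star_append: "lang (Star p) \<alpha> \<Longrightarrow> lang (Star p) \<beta> \<Longrightarrow> lang (Star p) (\<alpha> @ \<beta>)"
  by (induction rule: lang_Star_induct) (auto intro: lang_StarS)

lemma exec_Star_append: "exec (Star p) n \<sigma> \<sigma>1 \<Longrightarrow> exec (Star p) m \<sigma>1 \<sigma>' \<Longrightarrow> exec (Star p) (n + m) \<sigma> \<sigma>'"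
  unfolding exec_def by (metis add_mono lang_Star_append length_append runs_append)

lemma exec_Star_1: "exec p n \<sigma> \<sigma>' \<Longrightarrow> exec (Star p) n \<sigma> \<sigma>'"
  using exec_StarS[of p n \<sigma> \<sigma>' 0 \<sigma>'] exec_Star0 by simp

lemma exec_Star_Alt1: "exec (Star p) n \<sigma> \<sigma>' \<Longrightarrow> exec (Star (Alt p q)) n \<sigma> \<sigma>'"
proof -
  have "lang (Star (Alt p q)) \<alpha>" if "lang (Star p) \<alpha>" for \<alpha>
    using that by (induction rule: lang_Star_induct) (auto intro: lang_Star0 lang_StarS lang_Alt1)
  then show "exec (Star p) n \<sigma> \<sigma>' \<Longrightarrow> ?thesis" unfolding exec_def by blast
qed

abbreviation flat_trans :: "nat \<Rightarrow> vass \<Rightarrow> (nat \<times> nat list \<times> nat) list" where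
  "flat_trans W T \<equiv> map (\<lambda>(p, v, q). (p, fl W v, q)) T"

lemma step_pass_complete:
  assumes "\<sigma> 2 = tqueue (flat_trans W T)" "\<sigma> 7 = bin p @ [6]" "\<sigma> 3 = fl W x" "(p, v, q) \<in> set T" "length x = length v"
    "\<And>i. i \<in> set x \<union> set v \<union> set (map2 (+) x v) \<Longrightarrow> inrange W i"
  shows "exec step_pass (4 * length (\<sigma> 2)) \<sigma> (\<sigma>(7 := bin q @ [6], 3 := fl W (map2 (+) x v)))"
proof -
  obtain T1 T2 where T: "T = T1 @ (p, v, q) # T2" using assms(4) by (meson split_list)
  obtain ls where ls: "adds 0 ls" "map lx ls @ [5] = fl W x" "map ly ls @ [5] = fl W v" "map lz ls @ [5] = fl W (map2 (+) x v)"
    using adds_fl[OF assms(5,6)] by blast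
  let ?w1 = "map body (flat_trans W T1)" and ?w2 = "map body (flat_trans W T2)"
  have bod: "\<forall>w \<in> set (map body (flat_trans W T')). set w \<subseteq> {1,2,3,4,5,6}" for T'
  proof
    fix w assume "w \<in> set (map body (flat_trans W T'))"
    then obtain t where t: "t \<in> set (flat_trans W T')" "w = body t" unfolding set_map[of body] by (rule imageE)
    then have "isvec (fst (snd t))" by (auto simp: isvec_fl)
    then show "set w \<subseteq> {1,2,3,4,5,6}" unfolding t(2) by (rule set_body)
  qed
  define \<alpha>1 where "\<alpha>1 = concat (map (\<lambda>s. [Pop 2 s, Push 2 s]) (blocks ?w1))"
  define \<alpha>2 where "\<alpha>2 = concat (map (\<lambda>s. [Pop 7 s, Pop 2 s, Push 2 s]) (bin p @ [6]))"
  define \<alpha>3 where "\<alpha>3 = concat (map (\<lambda>(x, y, z). [Pop 3 x, Pop 2 y, Push 2 y, Push 3 z]) (ls @ [(5,5,5)]))"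
  define \<alpha>4 where "\<alpha>4 = concat (map (\<lambda>s. [Pop 2 s, Push 2 s, Push 7 s]) (bin q)) @ [Pop 2 7, Push 2 7, Push 7 6]"
  define \<alpha>5 where "\<alpha>5 = concat (map (\<lambda>s. [Pop 2 s, Push 2 s]) (blocks ?w2))"
  note defs = \<alpha>1_def \<alpha>2_def \<alpha>3_def \<alpha>4_def \<alpha>5_def
  define \<alpha> where "\<alpha> = \<alpha>1 @ \<alpha>2 @ \<alpha>3 @ \<alpha>4 @ \<alpha>5 @ [Pop 2 8, Push 2 8]"
  have s2: "\<sigma> 2 = blocks ?w1 @ (bin p @ [6]) @ (map ly ls @ [5]) @ (bin q @ [7]) @ blocks ?w2 @ [8]"
    unfolding assms(1) tqueue_blocks T ls(3) by simp
  have s3: "\<sigma> 3 = map lx ls @ [5]" by (simp only: assms(3) ls(2))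
  have p2: "pops 2 \<alpha> = \<sigma> 2" "pushes 2 \<alpha> = \<sigma> 2"
    unfolding s2 \<alpha>_def defs by (simp_all add: pops_concat_map pushes_concat_map split_def)
  have p3: "pops 3 \<alpha> = \<sigma> 3" "pushes 3 \<alpha> = fl W (map2 (+) x v)"
    unfolding s3 ls(4)[symmetric] \<alpha>_def defs by (simp_all add: pops_concat_map pushes_concat_map split_def)
  have p7: "pops 7 \<alpha> = \<sigma> 7" "pushes 7 \<alpha> = bin q @ [6]"
    unfolding assms(2) \<alpha>_def defs by (simp_all add: pops_concat_map pushes_concat_map split_def)
  have po: "pops r \<alpha> = []" "pushes r \<alpha> = []" if "r \<noteq> 2" "r \<noteq> 3" "r \<noteq> 7" for r
    unfolding \<alpha>_def defs using that by (simp_all add: pops_concat_map pushes_concat_map split_def)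
  show ?thesis
  proof (rule exec_pass[where \<alpha> = \<alpha> and \<rho> = "\<sigma>(2 := [], 3 := [], 7 := [])"])
    have "lang (Star skip) \<alpha>1" "lang (Star skip) \<alpha>5" unfolding defs by (rule skips_complete[OF bod])+
    moreover have "lang read_src \<alpha>2" unfolding read_src_def \<alpha>2_def
      proof (rule lang_cps[THEN iffD2])
      show "\<exists>g. endw (set B) 6 g \<and> concat (map (\<lambda>s. [Pop 7 s, Pop 2 s, Push 2 s]) (bin p @ [6])) = concat (map (\<lambda>s. [Pop 7 s, Pop 2 s, Push 2 s]) g)"
        by (rule exI[of _ "bin p @ [6]"]) (simp only: term_bin list.set simp_thms)
    qed simp
    moreover have "lang (add 3 2) \<alpha>3" unfolding add_def \<alpha>3_def
      using adder_complete[OF ls(1), of "\<lambda>_. True" "\<lambda>(x, y, z). [Pop 3 x, Pop 2 y, Push 2 y, Push 3 z]"] by simp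
    moreover have "lang read_tgt \<alpha>4" unfolding read_tgt_def \<alpha>4_def
    proof (rule lang_Seq)
      show "lang (Loop (map (\<lambda>s. [Pop 2 s, Push 2 s, Push 7 s]) B)) (concat (map (\<lambda>s. [Pop 2 s, Push 2 s, Push 7 s]) (bin q)))"
        unfolding lang_Loop_map by (rule exI[of _ "bin q"]) (simp only: set_bin list.set simp_thms)
    qed (simp only: lang_Word)
    ultimately show "lang step_pass \<alpha>" unfolding step_pass_def \<alpha>_def by (intro lang_Seq) simp_all
    show "\<sigma> r = pops r \<alpha> @ (\<sigma>(2 := [], 3 := [], 7 := [])) r" for r
      using p2 p3 p7 po[of r] by (cases "r = 2"; cases "r = 3"; cases "r = 7") (simp_all)
    show "(\<sigma>(7 := bin q @ [6], 3 := fl W (map2 (+) x v))) r = (\<sigma>(2 := [], 3 := [], 7 := [])) r @ pushes r \<alpha>" for r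
      using p2 p3 p7 po[of r] by (cases "r = 2"; cases "r = 3"; cases "r = 7") (simp_all)
    have "length \<alpha>1 \<le> 4 * length (blocks ?w1)" "length \<alpha>5 \<le> 4 * length (blocks ?w2)" "length \<alpha>2 \<le> 4 * length (bin p @ [6])"
      "length \<alpha>3 \<le> 4 * length (ls @ [(5,5,5)])" unfolding defs by (rule length_concat_le; auto)+
    moreover have "length \<alpha>4 \<le> 4 * length (bin q) + 3"
      using length_concat_le[of "bin q" "\<lambda>s. [Pop 2 s, Push 2 s, Push 7 s]" 4] by (simp add: \<alpha>4_def)
    ultimately show "length \<alpha> \<le> 4 * length (\<sigma> 2)" unfolding s2 \<alpha>_def by simp
  qed
qed

lemma step_complete:
  assumes "\<sigma> 2 = tqueue (flat_trans W T)" "\<sigma> 7 = bin p @ [6]" "\<sigma> 3 = fl W x" "(p, v, q) \<in> set T" "length x = length v" "x \<noteq> []"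
    "\<And>i. i \<in> set x \<union> set v \<union> set (map2 (+) x v) \<Longrightarrow> inrange W i" "0 \<le> map2 (+) x v ! 0"
  shows "exec step (4 * length (\<sigma> 2) + 2 * length (\<sigma> 3)) \<sigma> (\<sigma>(7 := bin q @ [6], 3 := fl W (map2 (+) x v)))"
  unfolding step_def
proof (rule exec_Seq[OF step_pass_complete[OF assms(1-5,7)]])
  have "exec (sign 3 3) (2 * length (fl W (map2 (+) x v))) (\<sigma>(7 := bin q @ [6], 3 := fl W (map2 (+) x v))) (\<sigma>(7 := bin q @ [6], 3 := fl W (map2 (+) x v)))"
    by (rule sign_fl_complete) (use assms in \<open>auto simp: zip_eq_Nil_iff\<close>)
  moreover have "length (fl W (map2 (+) x v)) = length (\<sigma> 3)" using assms by (simp add: length_fl)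
  ultimately show "exec (sign 3 3) (2 * length (\<sigma> 3)) (\<sigma>(7 := bin q @ [6], 3 := fl W (map2 (+) x v))) (\<sigma>(7 := bin q @ [6], 3 := fl W (map2 (+) x v)))"
    by simp
qed

definition effv :: "nat \<Rightarrow> trans list \<Rightarrow> int list" where
  "effv k c = map (eff c) [0..<Suc k]"

lemma effv_simps [simp]: "length (effv k c) = Suc k" "i \<le> k \<Longrightarrow> effv k c ! i = eff c i"
  by (simp_all add: effv_def nth_append le_Suc_eq del: upt_Suc)

lemma inrangeI: "\<bar>i\<bar> < 2 ^ W \<Longrightarrow> inrange W i"
  by (simp add: inrange_def abs_less_iff)

lemma inrange_nth: "(\<And>i. i < length v \<Longrightarrow> \<bar>v ! i\<bar> < 2 ^ W) \<Longrightarrow> i \<in> set v \<Longrightarrow> inrange W i"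
  by (auto simp: in_set_conv_nth intro: inrangeI)

lemma eff_bound: "(\<And>t. t \<in> set c \<Longrightarrow> \<bar>vec t ! i\<bar> \<le> D) \<Longrightarrow> \<bar>eff c i\<bar> \<le> int (length c) * D"
proof (induction c)
  case (Cons t c)
  have "\<bar>eff c i\<bar> \<le> int (length c) * D" "\<bar>vec t ! i\<bar> \<le> D" using Cons by auto
  moreover have "int (length (t # c)) * D = int (length c) * D + D" by (simp add: algebra_simps)
  ultimately show ?case by simp
qed simp

lemma steps_complete:
  assumes "vass_wf k T" "\<And>t i. t \<in> set T \<Longrightarrow> i \<le> k \<Longrightarrow> \<bar>vec t ! i\<bar> \<le> D"
    "vpath T p c q" "fire (x ! 0) c" "length x = Suc k"
    "\<And>i. i \<le> k \<Longrightarrow> \<bar>x ! i\<bar> + (int (length c) + 1) * D < 2 ^ W"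
    "\<sigma> 2 = tqueue (flat_trans W T)" "\<sigma> 7 = bin p @ [6]" "\<sigma> 3 = fl W x"
  shows "exec (Star step) (length c * (4 * length (\<sigma> 2) + 2 * length (\<sigma> 3))) \<sigma> (\<sigma>(7 := bin q @ [6], 3 := fl W (sm x 1 (effv k c))))"
  using assms(3-)
proof (induction c arbitrary: \<sigma> p x)
  case Nil
  have "sm x 1 (effv k []) = x" using Nil by (intro nth_equalityI) auto
  then show ?case using Nil by (simp add: exec_Star0 fun_upd_idem)
next
  case (Cons t c)
  obtain v r where t: "t = (p, v, r)" "(p, v, r) \<in> set T" "vpath T r c q" using Cons.prems(1) by (cases t) auto
  have lv: "length v = Suc k" using t(2) assms(1) by (auto simp: vass_wf_def)
  have bv: "\<bar>v ! i\<bar> \<le> D" if "i \<le> k" for i using assms(2)[OF t(2) that] by simp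
  have D: "0 \<le> D" using bv[of 0] by simp
  have cA: "0 \<le> int (length c) * D" using D by simp
  have bx: "\<bar>x ! i\<bar> + (int (length c) * D + D + D) < 2 ^ W" if "i \<le> k" for i
    using Cons.prems(4)[OF that] by (simp add: algebra_simps)
  let ?x = "map2 (+) x v"
  let ?\<sigma> = "\<sigma>(7 := bin r @ [6], 3 := fl W ?x)"
  have nx: "?x ! i = x ! i + v ! i" if "i \<le> k" for i using that Cons.prems(3) lv by simp
  have lx: "length ?x = Suc k" using Cons.prems(3) lv by simp
  have "exec step (4 * length (\<sigma> 2) + 2 * length (\<sigma> 3)) \<sigma> ?\<sigma>"
  proof (rule step_complete[OF Cons.prems(5,6,7) t(2)])
    show "inrange W i" if "i \<in> set x \<union> set v \<union> set ?x" for i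
    proof -
      have "\<bar>x ! i\<bar> < 2 ^ W" "\<bar>v ! i\<bar> < 2 ^ W" "\<bar>?x ! i\<bar> < 2 ^ W" if "i \<le> k" for i
        using bx[OF that] bv[OF that] cA D nx[OF that] by linarith+
      then show ?thesis using that inrange_nth[of x W i] inrange_nth[of v W i] inrange_nth[of ?x W i] Cons.prems(3) lv lx
        by (metis UnE less_Suc_eq_le)
    qed
    show "0 \<le> ?x ! 0" using Cons.prems(2) nx[of 0] t(1) by simp
  qed (use Cons.prems(3) lv in auto)
  moreover have "exec (Star step) (length c * (4 * length (?\<sigma> 2) + 2 * length (?\<sigma> 3))) ?\<sigma> (?\<sigma>(7 := bin q @ [6], 3 := fl W (sm ?x 1 (effv k c))))"
  proof (rule Cons.IH[OF t(3) _ lx])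
    show "fire (?x ! 0) c" using Cons.prems(2) nx[of 0] t(1) by simp
    show "\<bar>?x ! i\<bar> + (int (length c) + 1) * D < 2 ^ W" if "i \<le> k" for i
    proof -
      have "(int (length c) + 1) * D = int (length c) * D + D" by (simp add: algebra_simps)
      then show ?thesis using bx[OF that] bv[OF that] nx[OF that] by linarith
    qed
  qed (use Cons.prems(5) in simp_all)
  moreover have "sm ?x 1 (effv k c) = sm x 1 (effv k (t # c))"
    by (rule nth_equalityI) (use Cons.prems(3) lv t(1) in auto)
  moreover have "length (?\<sigma> 3) = length (\<sigma> 3)" using Cons.prems(3,7) lx by (simp add: length_fl)
  ultimately have "exec (Star step) ((4 * length (\<sigma> 2) + 2 * length (\<sigma> 3)) + length c * (4 * length (\<sigma> 2) + 2 * length (\<sigma> 3))) \<sigma> (?\<sigma>(7 := bin q @ [6], 3 := fl W (sm x 1 (effv k (t # c)))))"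
    using exec_StarS by simp
  moreover have "?\<sigma>(7 := bin q @ [6], 3 := fl W (sm x 1 (effv k (t # c)))) = \<sigma>(7 := bin q @ [6], 3 := fl W (sm x 1 (effv k (t # c))))"
    by (simp add: fun_eq_iff)
  moreover have "(4 * length (\<sigma> 2) + 2 * length (\<sigma> 3)) + length c * (4 * length (\<sigma> 2) + 2 * length (\<sigma> 3)) = length (t # c) * (4 * length (\<sigma> 2) + 2 * length (\<sigma> 3))" by simp
  ultimately show ?case by (simp only:)
qed

text \<open>Exactly \<open>h\<close> rounds are made, one per bit of \<open>a\<close> from the least
  significant on. Register 6 is doubled in each of them, also beyond the leading bit of
  \<open>a\<close>, and therefore \<open>2 ^ h\<close> times its entries have to fit the
  width.\<close>

lemma doubling_complete:
  assumes "a < 2 ^ h" "\<sigma> 3 = fl W x" "\<sigma> 6 = fl W z" "length x = l" "length z = l"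
    "\<And>i. i < l \<Longrightarrow> \<bar>x ! i\<bar> + int a * \<bar>z ! i\<bar> < 2 ^ W \<and> 2 ^ h * \<bar>z ! i\<bar> < 2 ^ W"
  shows "\<exists>z'. length z' = l \<and> exec (Star (Seq (Alt One (add 3 6)) (dbl 6))) (h * (6 * (l * Suc W + 1))) \<sigma>
    (\<sigma>(3 := fl W (sm x (int a) z), 6 := fl W z'))"
  using assms
proof (induction h arbitrary: a \<sigma> x z)
  case 0
  then have eq: "\<sigma>(3 := fl W (sm x (int a) z), 6 := fl W z) = \<sigma>" using sm_0[of x z] by (simp add: fun_eq_iff)
  show ?case by (rule exI[of _ z], rule conjI, rule 0(5), unfold eq, rule exec_Star0)
next
  case (Suc h)
  define b c where "b = a div 2" and "c = a mod 2"
  have a: "a = 2 * b + c" "c = 0 \<or> c = 1" by (auto simp: b_def c_def)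
  have b: "b < 2 ^ h" using Suc.prems(1) by (auto simp: b_def)
  let ?L = "l * Suc W + 1"
  let ?x = "sm x (int c) z" and ?z = "map2 (+) z z"
  have lx: "length ?x = l" "length ?z = l" using Suc.prems by auto
  have nz: "?x ! i = x ! i + int c * z ! i" "?z ! i = 2 * z ! i" if "i < l" for i using that Suc.prems(4,5) by auto
  have bd: "\<bar>x ! i\<bar> + 2 * (int b * \<bar>z ! i\<bar>) + int c * \<bar>z ! i\<bar> < 2 ^ W" "2 * (2 ^ h * \<bar>z ! i\<bar>) < 2 ^ W" if "i < l" for i
    using Suc.prems(6)[OF that] unfolding a(1) by (simp_all add: algebra_simps)
  have p: "1 * \<bar>z ! i\<bar> \<le> 2 ^ h * \<bar>z ! i\<bar>" "0 \<le> int b * \<bar>z ! i\<bar>" for i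
    by (intro mult_right_mono) simp_all
  have cz: "\<bar>int c * z ! i\<bar> = int c * \<bar>z ! i\<bar>" "0 \<le> int c * \<bar>z ! i\<bar>" for i by (simp_all add: abs_mult)
  have bds: "\<bar>x ! i\<bar> < 2 ^ W" "\<bar>z ! i\<bar> < 2 ^ W" "\<bar>?x ! i\<bar> < 2 ^ W" "\<bar>?z ! i\<bar> < 2 ^ W" if "i < l" for i
    unfolding nz[OF that] using bd[OF that] p[of i] cz[of i] by linarith+
  have 1: "exec (Alt One (add 3 6)) (4 * ?L) \<sigma> (\<sigma>(3 := fl W ?x))"
  proof (cases "c = 0")
    case True
    then have "\<sigma>(3 := fl W ?x) = \<sigma>" using Suc.prems sm_0[of x z] by (simp add: fun_eq_iff)
    then show ?thesis using exec_Alt1[OF exec_One] by simp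
  next
    case False
    then have x: "?x = map2 (+) x z" using a(2) by (simp add: sm_1)
    have "exec (add 3 6) (4 * length (fl W x)) \<sigma> (\<sigma>(3 := fl W (map2 (+) x z)))"
    proof (rule add_complete[OF Suc.prems(2,3)])
      fix i assume "i \<in> set x \<union> set z \<union> set (map2 (+) x z)"
      then show "inrange W i" using bds inrange_nth[of x W i] inrange_nth[of z W i] inrange_nth[of ?x W i] Suc.prems(4,5) lx x
        by (metis UnE)
    qed (use Suc.prems in simp_all)
    then show ?thesis using x Suc.prems(4) exec_Alt2 by (simp add: length_fl)
  qed
  have 2: "exec (dbl 6) (2 * ?L) (\<sigma>(3 := fl W ?x)) (\<sigma>(3 := fl W ?x, 6 := fl W ?z))"
  proof -
    have "exec (dbl 6) (2 * length (fl W z)) (\<sigma>(3 := fl W ?x)) ((\<sigma>(3 := fl W ?x))(6 := fl W ?z))"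
    proof (rule dbl_complete)
      fix i assume "i \<in> set z \<union> set ?z"
      then show "inrange W i" using bds inrange_nth[of z W i] inrange_nth[of ?z W i] Suc.prems(5) lx by (metis UnE)
    qed (use Suc.prems in simp)
    then show ?thesis using Suc.prems(5) by (simp add: length_fl)
  qed
  have "\<exists>z'. length z' = l \<and> exec (Star (Seq (Alt One (add 3 6)) (dbl 6))) (h * (6 * ?L)) (\<sigma>(3 := fl W ?x, 6 := fl W ?z))
    ((\<sigma>(3 := fl W ?x, 6 := fl W ?z))(3 := fl W (sm ?x (int b) ?z), 6 := fl W z'))"
  proof (rule Suc.IH[OF b _ _ lx])
    fix i assume i: "i < l"
    have "\<bar>?x ! i\<bar> \<le> \<bar>x ! i\<bar> + int c * \<bar>z ! i\<bar>" unfolding nz[OF i] cz(1)[symmetric] by (rule abs_triangle_ineq)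
    moreover have "int b * \<bar>?z ! i\<bar> = 2 * (int b * \<bar>z ! i\<bar>)" "2 ^ h * \<bar>?z ! i\<bar> = 2 * (2 ^ h * \<bar>z ! i\<bar>)" unfolding nz[OF i] by (simp_all add: abs_mult)
    ultimately show "\<bar>?x ! i\<bar> + int b * \<bar>?z ! i\<bar> < 2 ^ W \<and> 2 ^ h * \<bar>?z ! i\<bar> < 2 ^ W" using bd[OF i] by linarith
  qed simp_all
  then obtain z' where z': "length z' = l" "exec (Star (Seq (Alt One (add 3 6)) (dbl 6))) (h * (6 * ?L)) (\<sigma>(3 := fl W ?x, 6 := fl W ?z))
    ((\<sigma>(3 := fl W ?x, 6 := fl W ?z))(3 := fl W (sm ?x (int b) ?z), 6 := fl W z'))" by blast
  have "sm ?x (int b) ?z = sm x (int a) z"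
    by (rule nth_equalityI) (use Suc.prems(4,5) a(1) in \<open>auto simp: algebra_simps\<close>)
  then have eq: "(\<sigma>(3 := fl W ?x, 6 := fl W ?z))(3 := fl W (sm ?x (int b) ?z), 6 := fl W z') = \<sigma>(3 := fl W (sm x (int a) z), 6 := fl W z')"
    by (simp add: fun_eq_iff)
  have "4 * ?L + 2 * ?L + h * (6 * ?L) = Suc h * (6 * ?L)" by (simp add: algebra_simps)
  with exec_StarS[OF exec_Seq[OF 1 2] z'(2)] z'(1) show ?case unfolding eq by metis
qed

lemma jump_complete:
  assumes "a < 2 ^ h" "\<sigma> 3 = fl W x" "\<sigma> 4 = fl W y" "\<sigma> 6 = []" "length x = l" "length y = l"
    "\<And>i. i < l \<Longrightarrow> \<bar>x ! i\<bar> + int a * \<bar>y ! i\<bar> < 2 ^ W \<and> 2 ^ h * \<bar>y ! i\<bar> < 2 ^ W"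
  shows "exec jump ((6 * h + 4) * (l * Suc W + 1)) \<sigma> (\<sigma>(3 := fl W (sm x (int a) y)))"
proof -
  let ?L = "l * Suc W + 1"
  have 1: "exec (copy V 5 4 6) (3 * ?L) \<sigma> (\<sigma>(6 := fl W y))"
    using copy_complete[of V 5 \<sigma> 4 6] assms by (simp add: set_V[simplified] isvec_fl length_fl)
  have "\<exists>z'. length z' = l \<and> exec (Star (Seq (Alt One (add 3 6)) (dbl 6))) (h * (6 * ?L)) (\<sigma>(6 := fl W y))
    ((\<sigma>(6 := fl W y))(3 := fl W (sm x (int a) y), 6 := fl W z'))"
    by (rule doubling_complete[OF assms(1) _ _ assms(5-7)]) (use assms in simp_all)
  then obtain z where z: "length z = l" "exec (Star (Seq (Alt One (add 3 6)) (dbl 6))) (h * (6 * ?L)) (\<sigma>(6 := fl W y))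
    ((\<sigma>(6 := fl W y))(3 := fl W (sm x (int a) y), 6 := fl W z))" by blast
  let ?\<tau> = "(\<sigma>(6 := fl W y))(3 := fl W (sm x (int a) y), 6 := fl W z)"
  have "exec (clear V 5 6) (length (?\<tau> 6)) ?\<tau> (?\<tau>(6 := []))"
    by (rule clear_complete) (simp add: set_V[simplified] isvec_fl)
  moreover have "?\<tau>(6 := []) = \<sigma>(3 := fl W (sm x (int a) y))" using assms(4) by (simp add: fun_eq_iff)
  ultimately have 3: "exec (clear V 5 6) ?L ?\<tau> (\<sigma>(3 := fl W (sm x (int a) y)))" using z(1) by (simp add: length_fl)
  have "3 * ?L + (h * (6 * ?L) + ?L) = (6 * h + 4) * ?L" by (simp add: algebra_simps)
  with exec_Seq[OF 1 exec_Seq[OF z(2) 3]] show ?thesis unfolding jump_def by metis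
qed

lemma optional_jump_complete:
  assumes "a = 0 \<or> s = (if y ! 0 < 0 then 4 else 3)"
    "a < 2 ^ h" "\<sigma> 3 = fl W x" "\<sigma> 4 = fl W y" "\<sigma> 6 = []" "length x = Suc k" "length y = Suc k"
    "\<And>i. i \<le> k \<Longrightarrow> \<bar>x ! i\<bar> + int a * \<bar>y ! i\<bar> < 2 ^ W \<and> 2 ^ h * \<bar>y ! i\<bar> < 2 ^ W"
  shows "exec (Alt One (Seq (sign 4 s) jump)) ((6 * h + 6) * (Suc k * Suc W + 1)) \<sigma> (\<sigma>(3 := fl W (sm x (int a) y)))"
proof (cases "a = 0")
  case True
  then have "\<sigma>(3 := fl W (sm x (int a) y)) = \<sigma>" using assms sm_0[of x y] by (simp add: fun_eq_iff)
  then show ?thesis using exec_Alt1[OF exec_One] by simp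
next
  case False
  have 1: "exec (sign 4 s) (2 * length (fl W y)) \<sigma> \<sigma>" by (rule sign_fl_complete) (use assms False in auto)
  have 2: "exec jump ((6 * h + 4) * (Suc k * Suc W + 1)) \<sigma> (\<sigma>(3 := fl W (sm x (int a) y)))"
    by (rule jump_complete[OF assms(2-7)]) (use assms(8) in simp)
  have "2 * l + (6 * h + 4) * l = (6 * h + 6) * l" for l :: nat by (simp add: algebra_simps)
  then have cost: "2 * length (fl W y) + (6 * h + 4) * (Suc k * Suc W + 1) = (6 * h + 6) * (Suc k * Suc W + 1)"
    unfolding length_fl assms(7) .
  show ?thesis using exec_Alt2[OF exec_Seq[OF 1 2]] unfolding cost .
qed

text \<open>The two firing hypotheses concern the first and the last iteration; the program executes
  the lower of the two and obtains the other \<open>m - 1\<close> iterations by a jump.\<close>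

lemma cycle_complete:
  assumes wf: "vass_wf k T" and D0: "0 \<le> D" and D: "\<And>t i. t \<in> set T \<Longrightarrow> i \<le> k \<Longrightarrow> \<bar>vec t ! i\<bar> \<le> D"
    and c: "vpath T p c p" "fire (x ! 0) c" "fire (x ! 0 + (int m - 1) * wt c) c" and m: "1 \<le> m" "m \<le> 2 ^ h"
    and x: "length x = Suc k" "\<And>i. i \<le> k \<Longrightarrow> \<bar>x ! i\<bar> + (2 ^ h + 1) * ((int (length c) + 1) * D) < 2 ^ W"
    and \<sigma>: "\<sigma> 2 = tqueue (flat_trans W T)" "\<sigma> 7 = bin p @ [6]" "\<sigma> 3 = fl W x" "\<sigma> 4 = []" "\<sigma> 5 = []" "\<sigma> 6 = []" "\<sigma> 8 = []"
  shows "exec cycle (6 * length (bin p @ [6]) + (12 * h + 22) * (Suc k * Suc W + 1) + length c * (4 * length (\<sigma> 2) + 2 * (Suc k * Suc W + 1)))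
    \<sigma> (\<sigma>(3 := fl W (sm x (int m) (effv k c))))"
proof -
  define y where "y = effv k c"
  define L where "L = Suc k * Suc W + 1"
  \<comment> \<open>The executed iteration is the last one for a decreasing cycle and the first one
    otherwise, so at most one of the two jumps is nontrivial.\<close>
  define a b where "a = (if wt c < 0 then m - 1 else 0)" and "b = (if wt c < 0 then 0 else m - 1)"
  define x1 where "x1 = sm x (int a) y"
  define x2 where "x2 = sm x1 1 y"
  define x3 where "x3 = sm x2 (int b) y"
  have ly: "length y = Suc k" "\<And>i. i \<le> k \<Longrightarrow> y ! i = eff c i" by (simp_all add: y_def)
  have lx: "length x1 = Suc k" "length x2 = Suc k" "length x3 = Suc k" using x(1) ly by (simp_all add: x1_def x2_def x3_def)
  have n1: "x1 ! i = x ! i + int a * y ! i" "x2 ! i = x1 ! i + y ! i" if "i \<le> k" for i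
    using that x(1) ly lx by (simp_all add: x1_def x2_def)
  have ab: "a + b = m - 1" "a < 2 ^ h" "b < 2 ^ h" using m by (auto simp: a_def b_def)
  have x3: "x3 = sm x (int m) (effv k c)"
  proof -
    have "int a + 1 + int b = int m" using ab(1) m(1) by simp
    then show ?thesis unfolding x3_def x2_def x1_def sm_sm y_def by simp
  qed
  have tc: "t \<in> set T" if "t \<in> set c" for t
  proof -
    have "vpath T p c q \<Longrightarrow> set c \<subseteq> set T" for p q by (induction c arbitrary: p) auto
    then show ?thesis using c(1) that by blast
  qed
  define Y where "Y = int (length c) * D"
  have yb: "\<bar>y ! i\<bar> \<le> Y" if "i \<le> k" for i using eff_bound[of c i D] tc D[OF _ that] ly(2)[OF that] by (simp add: Y_def)
  have Y0: "0 \<le> Y" using D0 by (simp add: Y_def)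
  have bd: "\<bar>x ! i\<bar> + (2 ^ h * Y + Y + D) < 2 ^ W" if "i \<le> k" for i
  proof -
    have "(2 ^ h + 1) * ((int (length c) + 1) * D) = 2 ^ h * Y + 2 ^ h * D + Y + D" by (simp add: Y_def algebra_simps)
    moreover have "0 \<le> 2 ^ h * D" using D0 by simp
    ultimately show ?thesis using x(2)[OF that] by linarith
  qed
  have Yh: "Y \<le> 2 ^ h * Y" using mult_right_mono[of 1 "2 ^ h" Y] Y0 by simp
  have mult: "int n * \<bar>y ! i\<bar> \<le> int n * Y" "int n * Y \<le> 2 ^ h * Y" "\<bar>int n * y ! i\<bar> = int n * \<bar>y ! i\<bar>" if "i \<le> k" "n \<le> 2 ^ h" for i n
  proof -
    show "int n * \<bar>y ! i\<bar> \<le> int n * Y" using yb[OF that(1)] by (simp add: mult_left_mono)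
    have "int n \<le> 2 ^ h" using that(2) by (metis of_nat_le_iff of_nat_numeral of_nat_power)
    then show "int n * Y \<le> 2 ^ h * Y" using Y0 by (rule mult_right_mono)
  qed (simp add: abs_mult)
  have hY: "2 ^ h * \<bar>y ! i\<bar> < 2 ^ W" if "i \<le> k" for i
  proof -
    have "2 ^ h * \<bar>y ! i\<bar> \<le> 2 ^ h * Y" using yb[OF that] by (simp add: mult_left_mono)
    then show ?thesis using bd[OF that] Y0 D0 by linarith
  qed
  have b0: "\<bar>x ! i\<bar> + int a * \<bar>y ! i\<bar> < 2 ^ W" if "i \<le> k" for i
    using bd[OF that] mult[OF that, of a] ab(2) Y0 D0 by linarith
  have b1: "\<bar>x1 ! i\<bar> + (Y + D) < 2 ^ W" if "i \<le> k" for i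
    using bd[OF that] mult[OF that, of a] ab(2) n1(1)[OF that] Y0 by linarith
  have b2: "\<bar>x2 ! i\<bar> + int b * \<bar>y ! i\<bar> < 2 ^ W" if "i \<le> k" for i
  proof -
    have "a = 0 \<or> b = 0" by (simp add: a_def b_def)
    then show ?thesis
    proof
      assume "a = 0"
      then show ?thesis using bd[OF that] mult[OF that, of b] ab(3) n1[OF that] yb[OF that] Y0 D0 by simp
    next
      assume "b = 0"
      then show ?thesis using b1[OF that] n1(2)[OF that] yb[OF that] D0 by simp
    qed
  qed
  let ?y = "fl W y" and ?p = "bin p @ [6]"
  have tb: "endw (set B) 6 ?p" using term_bin by simp
  define \<sigma>1 where "\<sigma>1 = \<sigma>(4 := ?y)"
  define \<sigma>2 where "\<sigma>2 = \<sigma>1(8 := ?p)"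
  define \<sigma>3 where "\<sigma>3 = \<sigma>2(3 := fl W x1)"
  define \<sigma>4 where "\<sigma>4 = \<sigma>3(5 := fl W x1)"
  define \<sigma>5 where "\<sigma>5 = \<sigma>4(7 := ?p, 3 := fl W x2)"
  define \<sigma>6 where "\<sigma>6 = \<sigma>5(5 := [])"
  define \<sigma>7 where "\<sigma>7 = \<sigma>6(8 := [])"
  define \<sigma>8 where "\<sigma>8 = \<sigma>7(3 := fl W x3)"
  note s = \<sigma>1_def \<sigma>2_def \<sigma>3_def \<sigma>4_def \<sigma>5_def \<sigma>6_def \<sigma>7_def \<sigma>8_def
  have lfl: "length (fl W y) = L" "length (fl W x1) = L" "length (fl W x) = L" by (simp_all add: length_fl ly lx x(1) L_def)
  have e1: "exec (guess V 5 4) L \<sigma> \<sigma>1"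
    using guess_complete[of V 5 ?y \<sigma> 4] \<sigma> by (simp add: set_V[simplified] isvec_fl s lfl)
  have e2: "exec (copy B 6 7 8) (3 * length ?p) \<sigma>1 \<sigma>2"
    using copy_complete[of B 6 \<sigma>1 7 8] \<sigma> tb by (simp add: s)
  have e3: "exec (Alt One (Seq (sign 4 4) jump)) ((6 * h + 6) * L) \<sigma>2 \<sigma>3"
    unfolding L_def \<sigma>3_def x1_def
    by (rule optional_jump_complete) (use \<sigma> x(1) ly ab b0 hY in \<open>auto simp: s a_def\<close>)
  have e4: "exec (copy V 5 3 5) (3 * L) \<sigma>3 \<sigma>4"
    using copy_complete[of V 5 \<sigma>3 3 5] \<sigma> by (simp add: set_V[simplified] isvec_fl s lfl)
  have e5: "exec (Star step) (length c * (4 * length (\<sigma>4 2) + 2 * length (\<sigma>4 3))) \<sigma>4 \<sigma>5"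
    unfolding \<sigma>5_def x2_def y_def
  proof (rule steps_complete[OF wf D c(1) _ lx(1)])
    show "fire (x1 ! 0) c"
    proof (cases "wt c < 0")
      case True
      then have "x1 ! 0 = x ! 0 + (int m - 1) * wt c" using n1(1)[of 0] ly(2)[of 0] m(1) by (simp add: a_def of_nat_diff)
      then show ?thesis using c(3) by simp
    next
      case False
      then show ?thesis using c(2) n1(1)[of 0] by (simp add: a_def)
    qed
    show "\<bar>x1 ! i\<bar> + (int (length c) + 1) * D < 2 ^ W" if "i \<le> k" for i
      using b1[OF that] by (simp add: Y_def algebra_simps)
  qed (use \<sigma> in \<open>simp_all add: s\<close>)
  have e6: "exec (chk 5 4 3) (5 * L) \<sigma>5 \<sigma>6"
  proof -
    have x2: "x2 = map2 (+) x1 y" by (simp add: x2_def sm_1)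
    have "exec (chk 5 4 3) (5 * length (fl W x1)) \<sigma>5 (\<sigma>5(5 := []))"
    proof (rule chk_complete)
      fix i assume i: "i \<in> set x1 \<union> set y \<union> set (map2 (+) x1 y)"
      have "\<bar>x1 ! j\<bar> < 2 ^ W" "\<bar>y ! j\<bar> < 2 ^ W" "\<bar>x2 ! j\<bar> < 2 ^ W" if "j \<le> k" for j
        using b1[OF that] n1(2)[OF that] yb[OF that] D0 Y0 by linarith+
      then show "inrange W i" using i lx(1,2) ly(1) inrange_nth[of x1 W i] inrange_nth[of y W i] inrange_nth[of x2 W i]
        unfolding x2[symmetric] by (metis UnE less_Suc_eq_le)
    qed (use lx ly x2 in \<open>simp_all add: s\<close>)
    then show ?thesis by (simp add: lfl \<sigma>6_def)
  qed
  have e7: "exec (same_keep B 6 7 8) (3 * length ?p) \<sigma>6 \<sigma>7"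
    using same_keep_complete[of B 6 \<sigma>6 7 8] tb by (simp add: s)
  have e8: "exec (Alt One (Seq (sign 4 3) jump)) ((6 * h + 6) * L) \<sigma>7 \<sigma>8"
    unfolding L_def \<sigma>8_def x3_def
    by (rule optional_jump_complete) (use \<sigma> lx ly ab b2 hY in \<open>auto simp: s b_def\<close>)
  have e9: "exec (clear V 5 4) L \<sigma>8 (\<sigma>8(4 := []))"
    using clear_complete[of V 5 \<sigma>8 4] by (simp add: set_V[simplified] isvec_fl s lfl)
  have fin: "\<sigma>8(4 := []) = \<sigma>(3 := fl W (sm x (int m) (effv k c)))"
    unfolding x3[symmetric] s using \<sigma>(2,4-7) by (auto simp: fun_eq_iff)
  have "\<sigma>4 2 = \<sigma> 2" "length (\<sigma>4 3) = L" by (simp_all add: s lfl)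
  then have cost: "L + (3 * length ?p + ((6 * h + 6) * L + (3 * L + (length c * (4 * length (\<sigma>4 2) + 2 * length (\<sigma>4 3)) + (5 * L + (3 * length ?p + ((6 * h + 6) * L + L)))))))
    = 6 * length ?p + (12 * h + 22) * L + length c * (4 * length (\<sigma> 2) + 2 * L)"
    by (simp add: algebra_simps)
  note exec_Seq[OF e1 exec_Seq[OF e2 exec_Seq[OF e3 exec_Seq[OF e4 exec_Seq[OF e5 exec_Seq[OF e6 exec_Seq[OF e7 exec_Seq[OF e8 e9]]]]]]]]
  from this[unfolded cost fin] show ?thesis unfolding cycle_def L_def .
qed

text \<open>An item with multiplicity 1 is executed step by step, any other one by
  \<open>cycle\<close>. An item changes a coordinate by at most
  \<open>(2 ^ h + 1) * ((int N + 1) * D)\<close>, and the width has to cover this amount for each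
  item that remains.\<close>

lemma items_complete:
  assumes wf: "vass_wf k T" and D0: "0 \<le> D" and D: "\<And>t i. t \<in> set T \<Longrightarrow> i \<le> k \<Longrightarrow> \<bar>vec t ! i\<bar> \<le> D"
    and b: "\<And>t. t \<in> set T \<Longrightarrow> length (bin (tgt t)) \<le> b" "length (bin p) \<le> b"
    and al: "apath T p al q" "avalid (x ! 0) al" "\<And>c m. (c, m) \<in> set al \<Longrightarrow> length c \<le> N \<and> m \<le> 2 ^ h"
    and x: "length x = Suc k" "\<And>i. i \<le> k \<Longrightarrow> \<bar>x ! i\<bar> + int (length al) * ((2 ^ h + 1) * ((int N + 1) * D)) < 2 ^ W"
    and \<sigma>: "\<sigma> 2 = tqueue (flat_trans W T)" "\<sigma> 7 = bin p @ [6]" "\<sigma> 3 = fl W x" "\<sigma> 4 = []" "\<sigma> 5 = []" "\<sigma> 6 = []" "\<sigma> 8 = []"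
  shows "exec (Star (Alt step cycle)) (length al * (6 * (b + 1) + (12 * h + 22) * (Suc k * Suc W + 1) + N * (4 * length (\<sigma> 2) + 2 * (Suc k * Suc W + 1))))
    \<sigma> (\<sigma>(7 := bin q @ [6], 3 := fl W (sm x 1 (map (aeff al) [0..<Suc k]))))"
  using b(2) al x \<sigma>
proof (induction al arbitrary: \<sigma> p x)
  case Nil
  have "sm x 1 (map (aeff []) [0..<Suc k]) = x" using Nil by (intro nth_equalityI) (auto simp del: upt_Suc)
  moreover have "bin q @ [6] = \<sigma> 7" "fl W x = \<sigma> 3" using Nil by simp_all
  ultimately have "\<sigma>(7 := bin q @ [6], 3 := fl W (sm x 1 (map (aeff []) [0..<Suc k]))) = \<sigma>"
    by (simp only: fun_upd_triv)
  then show ?case by (simp only: exec_Star0)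
next
  case (Cons cm al)
  obtain c m where cm: "cm = (c, m)" by (cases cm)
  obtain r where r: "vpath T p c r" "m = 1 \<or> r = p" "apath T r al q" using Cons.prems(2) cm by auto
  have v: "1 \<le> m" "fire (x ! 0) c" "fire (x ! 0 + (int m - 1) * wt c) c" "avalid (x ! 0 + int m * wt c) al"
    using Cons.prems(3) cm by auto
  have l: "length c \<le> N" "m \<le> 2 ^ h" using Cons.prems(4) cm by auto
  let ?L = "Suc k * Suc W + 1"
  let ?C = "6 * (b + 1) + (12 * h + 22) * ?L + N * (4 * length (\<sigma> 2) + 2 * ?L)"
  define E where "E = (2 ^ h + 1) * ((int N + 1) * D)"
  define x' where "x' = sm x (int m) (effv k c)"
  have lx': "length x' = Suc k" using Cons.prems(5) by (simp add: x'_def)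
  have nx': "x' ! i = x ! i + int m * eff c i" if "i \<le> k" for i using that Cons.prems(5) by (simp add: x'_def)
  have E0: "0 \<le> E" using D0 by (simp add: E_def)
  have bx: "\<bar>x ! i\<bar> + int (length al) * E + E < 2 ^ W" if "i \<le> k" for i
    using Cons.prems(6)[OF that] unfolding E_def[symmetric] by (simp add: algebra_simps)
  have alE: "0 \<le> int (length al) * E" using E0 by simp
  have NE: "(2 ^ h + 1) * ((int (length c) + 1) * D) \<le> E" unfolding E_def
    using D0 l(1) by (intro mult_left_mono mult_right_mono) auto
  have cT: "set c \<subseteq> set T" using r(1) by (induction c arbitrary: p) auto
  have mE: "\<bar>int m * eff c i\<bar> \<le> E" if "i \<le> k" for i
  proof -
    have "\<bar>eff c i\<bar> \<le> int (length c) * D" using eff_bound[of c i D] cT D[OF _ that] by blast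
    also have "\<dots> \<le> (int (length c) + 1) * D" using D0 by (simp add: algebra_simps)
    finally have e: "\<bar>eff c i\<bar> \<le> (int (length c) + 1) * D" .
    have "int m \<le> 2 ^ h" using l(2) by (metis of_nat_le_iff of_nat_numeral of_nat_power)
    then have "int m \<le> 2 ^ h + 1" by linarith
    then have "int m * \<bar>eff c i\<bar> \<le> (2 ^ h + 1) * ((int (length c) + 1) * D)" by (rule mult_mono[OF _ e]) simp_all
    then show ?thesis using NE by (simp add: abs_mult)
  qed
  let ?\<sigma> = "\<sigma>(7 := bin r @ [6], 3 := fl W x')"
  have 1: "exec (Star (Alt step cycle)) ?C \<sigma> ?\<sigma>"
  proof (cases "m = 1")
    case True
    have "exec (Star step) (length c * (4 * length (\<sigma> 2) + 2 * length (\<sigma> 3))) \<sigma> (\<sigma>(7 := bin r @ [6], 3 := fl W (sm x 1 (effv k c))))"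
    proof (rule steps_complete[OF wf D r(1) v(2) Cons.prems(5) _ Cons.prems(7-9)])
      show "\<bar>x ! i\<bar> + (int (length c) + 1) * D < 2 ^ W" if "i \<le> k" for i
      proof -
        have "1 * ((int (length c) + 1) * D) \<le> (2 ^ h + 1) * ((int (length c) + 1) * D)" using D0 by (intro mult_right_mono) auto
        then show ?thesis using NE bx[OF that] alE by linarith
      qed
    qed
    then have e: "exec (Star (Alt step cycle)) (length c * (4 * length (\<sigma> 2) + 2 * length (\<sigma> 3))) \<sigma> ?\<sigma>"
      unfolding x'_def True of_nat_1 by (rule exec_Star_Alt1)
    have "length (\<sigma> 3) = ?L" using Cons.prems(5,9) by (simp add: length_fl)
    then have "length c * (4 * length (\<sigma> 2) + 2 * length (\<sigma> 3)) \<le> N * (4 * length (\<sigma> 2) + 2 * ?L)"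
      using l(1) by (simp only: mult_le_mono1)
    then show ?thesis using exec_mono[OF e] by simp
  next
    case False
    then have rp: "r = p" using r(2) by simp
    have "exec cycle (6 * length (bin p @ [6]) + (12 * h + 22) * ?L + length c * (4 * length (\<sigma> 2) + 2 * ?L)) \<sigma> (\<sigma>(3 := fl W x'))"
      unfolding x'_def
    proof (rule cycle_complete[OF wf D0 D r(1)[unfolded rp] v(2,3,1) l(2) Cons.prems(5) _ Cons.prems(7-13)])
      show "\<bar>x ! i\<bar> + (2 ^ h + 1) * ((int (length c) + 1) * D) < 2 ^ W" if "i \<le> k" for i
        using NE bx[OF that] alE by linarith
    qed
    moreover have "\<sigma>(3 := fl W x') = ?\<sigma>" using Cons.prems(8) rp by (simp add: fun_eq_iff)
    ultimately have e: "exec (Star (Alt step cycle)) (6 * length (bin p @ [6]) + (12 * h + 22) * ?L + length c * (4 * length (\<sigma> 2) + 2 * ?L)) \<sigma> ?\<sigma>"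
      using exec_Star_1[OF exec_Alt2] by metis
    have "length c * (4 * length (\<sigma> 2) + 2 * ?L) \<le> N * (4 * length (\<sigma> 2) + 2 * ?L)" using l(1) by (simp only: mult_le_mono1)
    then show ?thesis using exec_mono[OF e] Cons.prems(1) by simp
  qed
  have br: "length (bin r) \<le> b"
  proof (cases "c = []")
    case True then show ?thesis using r(1) Cons.prems(1) by simp
  next
    case False
    then have "tgt (last c) = r" "last c \<in> set T" using vpath_ends[OF r(1)] cT by auto
    then show ?thesis using b(1) by blast
  qed
  have 2: "exec (Star (Alt step cycle)) (length al * (6 * (b + 1) + (12 * h + 22) * ?L + N * (4 * length (?\<sigma> 2) + 2 * ?L)))
    ?\<sigma> (?\<sigma>(7 := bin q @ [6], 3 := fl W (sm x' 1 (map (aeff al) [0..<Suc k]))))"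
  proof (rule Cons.IH[OF br r(3) _ _ lx'])
    show "avalid (x' ! 0) al" using v(4) nx'[of 0] by simp
    show "length c \<le> N \<and> m \<le> 2 ^ h" if "(c, m) \<in> set al" for c m by (rule Cons.prems(4)) (use that in simp)
    show "\<bar>x' ! i\<bar> + int (length al) * ((2 ^ h + 1) * ((int N + 1) * D)) < 2 ^ W" if "i \<le> k" for i
      unfolding E_def[symmetric] using bx[OF that] mE[OF that] nx'[OF that] by linarith
  qed (use Cons.prems(7-) in simp_all)
  have "sm x' 1 (map (aeff al) [0..<Suc k]) = sm x 1 (map (aeff (cm # al)) [0..<Suc k])"
    by (rule nth_equalityI) (use lx' Cons.prems(5) nx' in \<open>auto simp: cm nth_append less_Suc_eq\<close>)
  then have "?\<sigma>(7 := bin q @ [6], 3 := fl W (sm x' 1 (map (aeff al) [0..<Suc k]))) = \<sigma>(7 := bin q @ [6], 3 := fl W (sm x 1 (map (aeff (cm # al)) [0..<Suc k])))"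
    by (simp add: fun_eq_iff)
  moreover have "?\<sigma> 2 = \<sigma> 2" by simp
  moreover have "?C + length al * ?C = length (cm # al) * ?C" by simp
  ultimately show ?case using exec_Star_append[OF 1 2] by metis
qed

section \<open>Polynomial bounds\<close>

lemma reach_path:
  assumes "vass_reach T c d" "vass_wf k T" "length (snd c) = Suc k"
  shows "length (snd d) = Suc k \<and> (\<exists>\<pi>. vpath T (fst c) \<pi> (fst d) \<and> fire (snd c ! 0) \<pi> \<and> (\<forall>i \<le> k. snd d ! i = snd c ! i + eff \<pi> i))"
  using assms(1) unfolding vass_reach_def
proof (induction rule: rtranclp_induct)
  case base
  then show ?case using assms(3) by (intro conjI exI[of _ "[]"]) auto
next
  case (step d d')
  then obtain \<pi> where \<pi>: "length (snd d) = Suc k" "vpath T (fst c) \<pi> (fst d)" "fire (snd c ! 0) \<pi>" "\<And>i. i \<le> k \<Longrightarrow> snd d ! i = snd c ! i + eff \<pi> i" by blast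
  from step(2) obtain v where v: "(fst d, v, fst d') \<in> set T" "snd d' = map2 (+) (snd d) v" "0 \<le> snd d' ! 0"
    by (auto simp: vass_step_def)
  have lv: "length v = Suc k" using v(1) assms(2) by (auto simp: vass_wf_def)
  have n: "snd d' ! i = snd c ! i + eff (\<pi> @ [(fst d, v, fst d')]) i" if "i \<le> k" for i
    using v(2) lv \<pi>(1,4) that by simp
  show ?case
  proof (intro conjI exI[of _ "\<pi> @ [(fst d, v, fst d')]"])
    show "fire (snd c ! 0) (\<pi> @ [(fst d, v, fst d')])" using \<pi>(3) v(3) n[of 0] by (simp add: fire_append add.assoc)
  qed (use \<pi> v lv n in \<open>auto simp: vpath_append\<close>)
qed

section \<open>Sizes of an encoded instance\<close>

lemma less_two_power_length_bin: "i < 2 ^ length (bin i)"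
proof (induction i rule: less_induct)
  case (less i)
  show ?case
  proof (cases "i < 2")
    case True then show ?thesis by (subst bin.simps) auto
  next
    case False
    then have "i div 2 < 2 ^ length (bin (i div 2))" by (intro less) simp
    moreover have "length (bin i) = Suc (length (bin (i div 2)))" using False by (subst bin.simps) simp
    ultimately show ?thesis by simp
  qed
qed

lemma length_enc_int: "length (bin (nat \<bar>i\<bar>)) + 1 \<le> length (enc_int i)"
  by (simp add: enc_int_def)

lemma length_concat_ge: "x \<in> set xs \<Longrightarrow> length (f x) \<le> length (concat (map f xs))"
  by (induction xs) auto

lemma length_concat_ge_count: "(\<And>x. x \<in> set xs \<Longrightarrow> 1 \<le> length (f x)) \<Longrightarrow> length xs \<le> length (concat (map f xs))"
  by (induction xs) force+

lemma enc_vec_bounds: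
  shows "i \<in> set v \<Longrightarrow> length (bin (nat \<bar>i\<bar>)) \<le> length (enc_vec v)" and "length v \<le> length (enc_vec v)"
proof -
  show "length (bin (nat \<bar>i\<bar>)) \<le> length (enc_vec v)" if "i \<in> set v"
    using length_concat_ge[OF that, of enc_int] length_enc_int[of i] by (simp add: enc_vec_def)
  have "length v \<le> length (concat (map enc_int v))" by (rule length_concat_ge_count) (use length_enc_int le_add2 le_trans in blast)
  then show "length v \<le> length (enc_vec v)" by (simp add: enc_vec_def)
qed

text \<open>Each numeral is a part of the encoding, so its length is at most \<open>n\<close> and
  its value below \<open>2 ^ n\<close>. For \<open>k\<close> itself there is the stronger bound by
  \<open>n\<close>, as a configuration lists \<open>k + 1\<close> components.\<close>

lemma enc_instance_bounds:
  assumes n: "n = length (enc_instance k T s t)" and wf: "conf_wf k s"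
  shows "Suc k \<le> n" "length T \<le> n" "length (bin k) \<le> n" "length (bin (fst s)) \<le> n" "length (bin (fst t)) \<le> n"
    "tr \<in> set T \<Longrightarrow> length (bin (src tr)) \<le> n \<and> length (bin (tgt tr)) \<le> n"
    "tr \<in> set T \<Longrightarrow> i \<in> set (vec tr) \<Longrightarrow> \<bar>i\<bar> < 2 ^ n"
    "i \<in> set (snd s) \<union> set (snd t) \<Longrightarrow> \<bar>i\<bar> < 2 ^ n"
proof -
  have small: "\<bar>i\<bar> < 2 ^ n" if "length (bin (nat \<bar>i\<bar>)) \<le> n" for i :: int
  proof -
    have "nat \<bar>i\<bar> < 2 ^ n" using less_two_power_length_bin[of "nat \<bar>i\<bar>"] power_increasing[OF that, of "2 :: nat"] by linarith
    then have "int (nat \<bar>i\<bar>) < int (2 ^ n)" by (simp only: of_nat_less_iff)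
    then show ?thesis by simp
  qed
  have ns: "n = length (bin k) + length (concat (map enc_trans T)) + length (enc_conf s) + length (enc_conf t) + 3"
    by (simp add: n enc_instance_def)
  have c: "length (enc_conf c) = length (bin (fst c)) + length (enc_vec (snd c)) + 1" for c by (simp add: enc_conf_def)
  have "Suc k = length (snd s)" using wf by (simp add: conf_wf_def)
  then show "Suc k \<le> n" using enc_vec_bounds(2)[of "snd s"] ns c by simp
  show "length (bin k) \<le> n" "length (bin (fst s)) \<le> n" "length (bin (fst t)) \<le> n" using ns c by simp_all
  have "length T \<le> length (concat (map enc_trans T))" by (rule length_concat_ge_count) (simp add: enc_trans_def split: prod.splits)
  then show "length T \<le> n" using ns by simp
  have tr: "length (bin (src tr)) + length (bin (tgt tr)) + length (enc_vec (vec tr)) \<le> n" if "tr \<in> set T"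
    using length_concat_ge[OF that, of enc_trans] ns by (simp add: enc_trans_def split: prod.splits)
  then show "tr \<in> set T \<Longrightarrow> length (bin (src tr)) \<le> n \<and> length (bin (tgt tr)) \<le> n" by fastforce
  show "\<bar>i\<bar> < 2 ^ n" if "tr \<in> set T" "i \<in> set (vec tr)"
    using tr[OF that(1)] enc_vec_bounds(1)[OF that(2)] by (intro small) simp
  show "\<bar>i\<bar> < 2 ^ n" if "i \<in> set (snd s) \<union> set (snd t)"
  proof (rule small)
    from that show "length (bin (nat \<bar>i\<bar>)) \<le> n"
      using enc_vec_bounds(1)[of i "snd s"] enc_vec_bounds(1)[of i "snd t"] ns c[of s] c[of t] by auto
  qed
qed

text \<open>Since s + 1 is at most 2 m 2 ^ (s div (2 m)), the factor (s + 1) ^ m costs only half of the exponent s.\<close>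

lemma exponent_bound:
  fixes s m e :: nat
  assumes "2 ^ s \<le> (2 ^ e * (s + 1)) ^ m" "1 \<le> m"
  shows "s \<le> 2 * e * m + 4 * m * m"
proof -
  define q where "q = s div (2 * m)"
  have q: "2 * (q * m) \<le> s" unfolding q_def using div_times_less_eq_dividend[of s "2 * m"] by (simp add: algebra_simps)
  have "s < 2 * m * Suc q" unfolding q_def using assms(2) by (intro dividend_less_times_div[of "2 * m" s, THEN less_le_trans]) simp_all
  also have "\<dots> \<le> 2 ^ (2 * m) * 2 ^ q"
    using less_exp[of "2 * m"] Suc_leI[OF less_exp[of q]] by (intro mult_mono) (auto simp only: less_imp_le zero_le)
  finally have "s + 1 \<le> 2 ^ (2 * m + q)" by (simp add: power_add)
  then have "(2 ^ e * (s + 1)) ^ m \<le> (2 ^ e * 2 ^ (2 * m + q)) ^ m" by (intro power_mono mult_left_mono) simp_all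
  also have "\<dots> = 2 ^ ((e + (2 * m + q)) * m)" by (simp only: power_add[symmetric] power_mult[symmetric])
  finally have "2 ^ s \<le> (2 :: nat) ^ ((e + (2 * m + q)) * m)" using assms(1) by (rule order_trans[rotated])
  then have "s \<le> (e + (2 * m + q)) * m" by (simp only: power_increasing_iff)
  then show ?thesis using q by (simp add: algebra_simps)
qed

text \<open>There are at most \<open>28 * n\<^sup>2\<close> equations, and \<open>M\<close> is at
  most \<open>2 ^ (8 * n)\<close>. So \<open>exponent_bound\<close> applies with
  \<open>e = 9 * n\<close> and gives \<open>s\<close> at most 18 * 28 + 4 * 784 = 3640 times
  \<open>n ^ 4\<close>; one more unit of \<open>n ^ 4\<close> covers \<open>s + 1\<close>.\<close>

lemma parameter_bounds:
  fixes n N M k s m :: nat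
  assumes n: "1 \<le> n" "Suc k \<le> n" "N \<le> 3 * n"
    and M: "M = ((2 * N + 1) * N + N + 3) * 2 ^ n"
    and s: "2 ^ s \<le> (2 * (s * M) + 1) ^ (Suc k + ((2 * N + 1) * N + 2 * N))"
    and S: "S = 3641 * n ^ 4"
  shows "s + 1 \<le> S" "(2 * N + 1) * N \<le> S" "(s + 1) * (2 * (s + 1) * M) ^ (s + 1) \<le> 2 ^ (3 * S\<^sup>2)"
proof -
  have pw: "n ^ a \<le> n ^ b" if "a \<le> b" for a b using n(1) that by (rule power_increasing[rotated])
  have "(2 * N + 1) * N \<le> (7 * n) * (3 * n)" using n by (intro mult_mono) auto
  then have N2: "(2 * N + 1) * N \<le> 21 * n\<^sup>2" by (simp add: power2_eq_square)
  have nn: "n \<le> n\<^sup>2" "1 \<le> n\<^sup>2" using pw[of 1 2] pw[of 0 2] by simp_all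
  have n8: "n\<^sup>2 \<le> 2 ^ (2 * n)"
  proof -
    have "n\<^sup>2 \<le> (2 ^ n)\<^sup>2" using less_exp[of n] by (intro power_mono) simp_all
    then show ?thesis by (simp only: power_mult[symmetric] mult.commute)
  qed
  have "(2 * N + 1) * N + N + 3 \<le> 32 * n\<^sup>2" using N2 n nn by linarith
  also have "\<dots> \<le> 2 ^ 5 * 2 ^ (2 * n)" using n8 by simp
  finally have "M \<le> (2 ^ 5 * 2 ^ (2 * n)) * 2 ^ n" unfolding M by (rule mult_right_mono) simp
  also have "\<dots> = 2 ^ (5 + 2 * n + n)" by (simp only: power_add)
  also have "\<dots> \<le> 2 ^ (8 * n)" using n(1) by (intro power_increasing) simp_all
  finally have M8: "M \<le> 2 ^ (8 * n)" .
  define m where "m = Suc k + ((2 * N + 1) * N + 2 * N)"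
  have m: "m \<le> 28 * n\<^sup>2" "1 \<le> m" unfolding m_def using N2 n nn by linarith+
  have "2 * (s * M) + 1 \<le> 2 * (s * 2 ^ (8 * n)) + 1" using M8 by simp
  also have "\<dots> \<le> 2 ^ (9 * n) * (s + 1)"
  proof -
    have "2 * 2 ^ (8 * n) \<le> (2 :: nat) ^ (9 * n)" using n(1) power_increasing[of "Suc (8 * n)" "9 * n" "2 :: nat"] by simp
    then have "s * (2 * 2 ^ (8 * n)) \<le> s * 2 ^ (9 * n)" by (rule mult_left_mono) simp
    moreover have "(1 :: nat) \<le> 2 ^ (9 * n)" by simp
    moreover have "2 * (s * 2 ^ (8 * n)) = s * (2 * 2 ^ (8 * n))" "2 ^ (9 * n) * (s + 1) = s * 2 ^ (9 * n) + 2 ^ (9 * n)" by simp_all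
    ultimately show ?thesis by linarith
  qed
  finally have "(2 * (s * M) + 1) ^ m \<le> (2 ^ (9 * n) * (s + 1)) ^ m" by (rule power_mono) simp
  with s have "2 ^ s \<le> (2 ^ (9 * n) * (s + 1)) ^ m" unfolding m_def by (rule order_trans)
  from exponent_bound[OF this m(2)] have "s \<le> 18 * (n * m) + 4 * (m * m)" by (simp add: mult.assoc)
  moreover have "n * m \<le> 28 * n ^ 4"
  proof -
    have "n * m \<le> n * (28 * n\<^sup>2)" using m(1) by (rule mult_left_mono) simp
    also have "\<dots> = 28 * n ^ 3" by (simp add: power3_eq_cube power2_eq_square)
    finally show ?thesis using pw[of 3 4] by linarith
  qed
  moreover have "m * m \<le> (28 * n\<^sup>2) * (28 * n\<^sup>2)" using m(1) by (intro mult_mono) simp_all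
  then have "m * m \<le> 784 * n ^ 4" by (simp add: power4_eq_xxxx power2_eq_square)
  moreover have "1 \<le> n ^ 4" using pw[of 0 4] by simp
  ultimately show s1: "s + 1 \<le> S" unfolding S by linarith
  show "(2 * N + 1) * N \<le> S" using N2 pw[of 2 4] unfolding S by linarith
  have nS: "9 * n \<le> S" using pw[of 1 4] unfolding S by simp
  have sS: "s + 1 \<le> 2 ^ S" using s1 less_exp[of S] by linarith
  have "2 * (s + 1) * M \<le> 2 * 2 ^ S * 2 ^ (8 * n)" using sS M8 by (intro mult_mono) simp_all
  also have "\<dots> = 2 ^ (1 + S + 8 * n)" by (simp only: power_add power_one_right)
  also have "\<dots> \<le> 2 ^ (2 * S)" using nS n(1) by (intro power_increasing) simp_all
  finally have "(2 * (s + 1) * M) ^ (s + 1) \<le> (2 ^ (2 * S)) ^ (s + 1)" by (rule power_mono) simp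
  also have "\<dots> \<le> (2 ^ (2 * S)) ^ S" using s1 by (rule power_increasing) simp
  finally have "(s + 1) * (2 * (s + 1) * M) ^ (s + 1) \<le> 2 ^ S * (2 ^ (2 * S)) ^ S" using sS by (intro mult_mono) simp_all
  also have "\<dots> = 2 ^ (S + 2 * S * S)" by (simp only: power_mult[symmetric] power_add[symmetric])
  also have "\<dots> \<le> 2 ^ (3 * S\<^sup>2)"
  proof (rule power_increasing)
    have "S * 1 \<le> S * S" by (rule mult_left_mono) (use s1 in simp_all)
    then show "S + 2 * S * S \<le> 3 * S\<^sup>2" by (simp add: power2_eq_square)
  qed simp
  finally show "(s + 1) * (2 * (s + 1) * M) ^ (s + 1) \<le> 2 ^ (3 * S\<^sup>2)" .
qed

text \<open>Bits add up: \<open>S + 1\<close> for the number of items, \<open>h + 1\<close> for the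
  multiplicity, \<open>n + 2\<close> for the cycle length and \<open>n\<close> for an entry. The two
  further bits of \<open>W\<close> leave room for the start value.\<close>

lemma magnitude_bound:
  fixes n N S h W l :: nat
  assumes "1 \<le> n" "N \<le> 3 * n" "l \<le> 2 * S" "W = S + h + 2 * n + 6" "\<bar>i\<bar> < 2 ^ n"
  shows "\<bar>i\<bar> + int l * ((2 ^ h + 1) * ((int N + 1) * 2 ^ n)) < 2 ^ W"
proof -
  have "l \<le> 2 ^ (S + 1)" unfolding power_add power_one_right using assms(3) less_exp[of S] by linarith
  moreover have "2 ^ h + 1 \<le> (2 :: nat) ^ (h + 1)" by simp
  moreover have "(2 :: nat) ^ (n + 2) = 4 * 2 ^ n" by simp
  then have "N + 1 \<le> 2 ^ (n + 2)" using assms(1,2) less_exp[of n] by linarith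
  ultimately have "l * ((2 ^ h + 1) * ((N + 1) * 2 ^ n)) \<le> 2 ^ (S + 1) * (2 ^ (h + 1) * (2 ^ (n + 2) * 2 ^ n))"
    by (intro mult_mono) simp_all
  also have "\<dots> = 2 ^ (S + h + 2 * n + 4)" by (simp add: power_add[symmetric] del: power_Suc)
  finally have "int (l * ((2 ^ h + 1) * ((N + 1) * 2 ^ n))) \<le> int (2 ^ (S + h + 2 * n + 4))" by (simp only: of_nat_le_iff)
  then have "int l * ((2 ^ h + 1) * ((int N + 1) * 2 ^ n)) \<le> 2 ^ (S + h + 2 * n + 4)" by (simp add: algebra_simps)
  moreover have "(2 :: int) ^ n \<le> 2 ^ (S + h + 2 * n + 4)" by (intro power_increasing) simp_all
  moreover have "(2 :: int) ^ W = 4 * 2 ^ (S + h + 2 * n + 4)" unfolding assms(4) by (simp add: power_add)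
  ultimately show ?thesis using assms(5) by linarith
qed

text \<open>\<open>z\<close> bounds all parameters except the length \<open>lq\<close> of the
  transition queue, which is cubic. The leading term is the number of items times the cycle length
  times \<open>lq\<close>, whence the exponent 5. The coefficients add up to 7 + 57 + 6 + 106 + 2 +
  4 = 182, rounded up to 200.\<close>

lemma cost_bound:
  fixes z k lT lb W h b N la lq :: nat
  assumes "1 \<le> z" "Suc k \<le> z" "lT \<le> z" "lb \<le> z" "Suc W \<le> z" "h \<le> z" "b + 1 \<le> z" "N \<le> z" "la \<le> z" "lq \<le> 7 * z ^ 3"
  shows "(lb * (3 * k + 4) + (lT + 2) * (Suc k * (2 * W + 5) + 8 + 4 * b) + 6) +
    (la * (6 * (b + 1) + (12 * h + 22) * (Suc k * Suc W + 1) + N * (4 * lq + 2 * (Suc k * Suc W + 1))) +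
      (2 * (b + 1) + 2 * (Suc k * Suc W + 1))) \<le> 200 * z ^ 5"
proof -
  have pw: "z ^ a \<le> z ^ b" if "a \<le> b" for a b using assms(1) that by (rule power_increasing[rotated])
  have z: "1 \<le> z ^ 5" "z \<le> z ^ 5" "z ^ 2 \<le> z ^ 5" "z ^ 3 \<le> z ^ 5" "z ^ 4 \<le> z ^ 5" "z \<le> z ^ 2" "z \<le> z ^ 3" "z ^ 2 \<le> z ^ 3" "1 \<le> z ^ 2" "z \<le> z ^ 4" "z ^ 3 \<le> z ^ 4"
    using pw[of 0 5] pw[of 1 5] pw[of 2 5] pw[of 3 5] pw[of 4 5] pw[of 1 2] pw[of 1 3] pw[of 2 3] pw[of 0 2] pw[of 1 4] pw[of 3 4] by simp_all
  have m: "z * z = z ^ 2" "z * z ^ 2 = z ^ 3" "z * z ^ 3 = z ^ 4" "z * z ^ 4 = z ^ 5"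
    by (simp_all add: eval_nat_numeral)
  have "Suc k * Suc W \<le> z * z" using assms by (intro mult_mono) simp_all
  then have "Suc k * Suc W + 1 \<le> 2 * z ^ 2" using m z by linarith
  then obtain e where e: "Suc k * Suc W + 1 = e" and kW: "e \<le> 2 * z ^ 2" by blast
  obtain b1 where b1: "b + 1 = b1" "b1 \<le> z" using assms(7) by blast
  have "(12 * h + 22) * e \<le> (34 * z) * (2 * z ^ 2)" using assms kW by (intro mult_mono) linarith+
  then have 1: "(12 * h + 22) * e \<le> 68 * z ^ 3" using m(2) by simp
  have "N * (4 * lq + 2 * e) \<le> z * (32 * z ^ 3)" using assms kW z by (intro mult_mono) linarith+
  then have 2: "N * (4 * lq + 2 * e) \<le> 32 * z ^ 4" using m(3) by simp
  have "u \<le> 68 * z ^ 3 \<Longrightarrow> v \<le> 32 * z ^ 4 \<Longrightarrow> 6 * b1 + u + v \<le> 106 * z ^ 4" for u v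
    using b1(2) z by linarith
  from mult_mono[OF assms(9) this[OF 1 2]]
  have "la * (6 * b1 + (12 * h + 22) * e + N * (4 * lq + 2 * e)) \<le> z * (106 * z ^ 4)"
    by simp
  then have 3: "la * (6 * b1 + (12 * h + 22) * e + N * (4 * lq + 2 * e)) \<le> 106 * z ^ 5" using m(4) by simp
  have "lb * (3 * k + 4) \<le> z * (7 * z)" using assms by (intro mult_mono) linarith+
  then have 4: "lb * (3 * k + 4) \<le> 7 * z ^ 2" using m(1) by simp
  have "Suc k * (2 * W + 5) \<le> z * (7 * z)" using assms by (intro mult_mono) linarith+
  then have "Suc k * (2 * W + 5) \<le> 7 * z ^ 2" using m(1) by simp
  then have "(lT + 2) * (Suc k * (2 * W + 5) + 8 + 4 * b) \<le> (3 * z) * (19 * z ^ 2)" using assms z by (intro mult_mono) linarith+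
  then have 5: "(lT + 2) * (Suc k * (2 * W + 5) + 8 + 4 * b) \<le> 57 * z ^ 3" using m(2) by simp
  have "a4 \<le> 7 * z ^ 2 \<Longrightarrow> a5 \<le> 57 * z ^ 3 \<Longrightarrow> a3 \<le> 106 * z ^ 5 \<Longrightarrow> (a4 + a5 + 6) + (a3 + (2 * b1 + 2 * e)) \<le> 200 * z ^ 5" for a3 a4 a5
    using kW z b1(2) by linarith
  from this[OF 4 5 3] show ?thesis unfolding e b1(1) .
qed

lemma length_tqueue:
  assumes "vass_wf k T" "\<And>t. t \<in> set T \<Longrightarrow> length (bin (src t)) \<le> b \<and> length (bin (tgt t)) \<le> b"
  shows "length (tqueue (flat_trans W T)) \<le> length T * (2 * b + 3 + Suc k * Suc W) + 1"
proof -
  have "length (concat (map encT (flat_trans W T))) \<le> length T * (2 * b + 3 + Suc k * Suc W)"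
    using assms
  proof (induction T)
    case (Cons t T)
    obtain p v q where t: "t = (p, v, q)" by (cases t)
    have "length v = Suc k" using Cons.prems(1) t by (simp add: vass_wf_def)
    then have "length (encT (p, fl W v, q)) \<le> 2 * b + 3 + Suc k * Suc W" using Cons.prems(2)[of t] t by (simp add: encT_def length_fl)
    moreover have "length (concat (map encT (flat_trans W T))) \<le> length T * (2 * b + 3 + Suc k * Suc W)"
      using Cons.prems by (intro Cons.IH) (simp_all add: vass_wf_def)
    ultimately show ?case using t by simp
  qed simp
  then show ?thesis by (simp add: tqueue_def)
qed

text \<open>A small accelerated run is turned into an execution. The width \<open>W\<close> is
  guessed by the padding at loading time; it exceeds the number of bits of any multiplicity, which
  is quadratic in \<open>S\<close> and hence of order \<open>n ^ 8\<close>.\<close>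

lemma prog_complete:
  assumes "w \<in> REACH_1N"
  shows "\<exists>\<sigma>'. exec prog (200 * (10 ^ 8 * length w ^ 8) ^ 5) (init_store w) \<sigma>'"
proof -
  obtain k T s t where w: "w = enc_instance k T s t" and wf: "vass_wf k T" "conf_wf k s" "conf_wf k t" and reach: "vass_reach T s t"
    using assms unfolding REACH_1N_def by blast
  define n where "n = length w"
  note eb = enc_instance_bounds[OF n_def[unfolded w] wf(2)]
  have n1: "1 \<le> n" using eb(1) by simp
  have ls: "length (snd s) = Suc k" "length (snd t) = Suc k" "0 \<le> snd s ! 0" using wf(2,3) by (simp_all add: conf_wf_def)
  obtain \<pi> where \<pi>: "vpath T (fst s) \<pi> (fst t)" "fire (snd s ! 0) \<pi>" "\<And>i. i \<le> k \<Longrightarrow> snd t ! i = snd s ! i + eff \<pi> i"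
    using reach_path[OF reach wf(1) ls(1)] by blast
  \<comment> \<open>Only the start state and the ends of transitions can occur on a run; there are
    at most \<open>2 * length T + 1\<close> of them.\<close>
  define Q where "Q = insert (fst s) (src ` set T \<union> tgt ` set T)"
  define N where "N = card Q"
  have "N \<le> Suc (card (src ` set T \<union> tgt ` set T))" unfolding N_def Q_def by (rule card_insert_le_m1) simp_all
  also have "\<dots> \<le> Suc (card (src ` set T) + card (tgt ` set T))" by (simp add: card_Un_le)
  also have "\<dots> \<le> Suc (length T + length T)"
    using card_image_le[of "set T" src] card_image_le[of "set T" tgt] card_length[of T] by simp
  finally have N: "N \<le> 3 * n" using eb(2) n1 by simp
  have sb: "\<bar>snd s ! i\<bar> < 2 ^ n" "\<bar>snd t ! i\<bar> < 2 ^ n" if "i \<le> k" for i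
    using eb(8)[of "snd s ! i"] eb(8)[of "snd t ! i"] that ls by simp_all
  have vb: "\<bar>vec tr ! i\<bar> \<le> 2 ^ n" if "tr \<in> set T" "i \<le> k" for tr i
  proof -
    have "length (vec tr) = Suc k" using that(1) wf(1) by (auto simp: vass_wf_def)
    then show ?thesis using eb(7)[OF that(1), of "vec tr ! i"] that(2) by simp
  qed
  define M where "M = ((2 * N + 1) * N + N + 3) * 2 ^ n"
  have "\<exists>al c. apath T (fst s) al (fst t) \<and> avalid (snd s ! 0) al \<and> (\<forall>i \<le> k. aeff al i = eff \<pi> i) \<and>
    (\<forall>(c', m) \<in> set al. length c' \<le> N \<and> m \<le> (c + 1) * (2 * (c + 1) * M) ^ (c + 1)) \<and>
    length al \<le> (2 * N + 1) * N + c \<and> 2 ^ c \<le> (2 * (c * M) + 1) ^ (Suc k + ((2 * N + 1) * N + 2 * N))"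
  proof (rule accelerated_run[OF \<pi>(1,2) ls(3), where V = "2 ^ n" and Q = Q])
    show "snd s ! 0 \<le> 2 ^ n" using sb(1)[of 0] by simp
    show "\<bar>eff \<pi> i\<bar> \<le> 2 * 2 ^ n" if "i \<le> k" for i using sb[OF that] \<pi>(3)[OF that] by linarith
    show "int M = (int ((2 * N + 1) * N) + int N + 3) * 2 ^ n" by (simp add: M_def)
    show "tgt ` set T \<subseteq> Q" "src ` set T \<subseteq> Q" unfolding Q_def by blast+
  qed (use vb in \<open>simp_all add: Q_def N_def\<close>)
  then obtain al c where al: "apath T (fst s) al (fst t)" "avalid (snd s ! 0) al" "\<And>i. i \<le> k \<Longrightarrow> aeff al i = eff \<pi> i"
    "\<And>c' m. (c', m) \<in> set al \<Longrightarrow> length c' \<le> N \<and> m \<le> (c + 1) * (2 * (c + 1) * M) ^ (c + 1)"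
    "length al \<le> (2 * N + 1) * N + c" "2 ^ c \<le> (2 * (c * M) + 1) ^ (Suc k + ((2 * N + 1) * N + 2 * N))" by blast
  define S h W where "S = 3641 * n ^ 4" and "h = 3 * S\<^sup>2" and "W = S + h + 2 * n + 6"
  note pb = parameter_bounds[OF n1 eb(1) N M_def al(6) S_def]
  have lal: "length al \<le> 2 * S" using al(5) pb(1,2) by linarith
  have mh: "length c' \<le> N \<and> m \<le> 2 ^ h" if "(c', m) \<in> set al" for c' m
    using al(4)[OF that] pb(3) unfolding h_def by linarith
  have nW: "(2 :: int) ^ n \<le> 2 ^ W" unfolding W_def by (intro power_increasing) simp_all
  let ?\<sigma>1 = "loaded k (flat_trans W T) (fst s) (fl W (snd s)) (fst t) (fl W (snd t))"
  have load: "exec load (length (bin k) * (3 * k + 4) + (length T + 2) * (Suc k * (2 * W + 5) + 8 + 4 * n) + 6) (init_store w) ?\<sigma>1"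
    unfolding w
  proof (rule load_complete[OF _ _ _ wf])
    show "\<bar>i\<bar> < 2 ^ W" if "tr \<in> set T" "i \<in> set (vec tr)" for tr i using eb(7)[OF that] nW by linarith
    show "\<bar>i\<bar> < 2 ^ W" if "i \<in> set (snd s) \<union> set (snd t)" for i using eb(8)[OF that] nW by linarith
  qed (use eb in \<open>simp_all add: W_def\<close>)
  have r: "?\<sigma>1 2 = tqueue (flat_trans W T)" "?\<sigma>1 7 = bin (fst s) @ [6]" "?\<sigma>1 3 = fl W (snd s)" "?\<sigma>1 4 = []" "?\<sigma>1 5 = []" "?\<sigma>1 6 = []" "?\<sigma>1 8 = []"
    "?\<sigma>1 10 = bin (fst t) @ [6]" "?\<sigma>1 9 = fl W (snd t)" by (simp_all add: loaded_def)
  let ?\<sigma>2 = "?\<sigma>1(7 := bin (fst t) @ [6], 3 := fl W (snd t))"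
  have "exec (Star (Alt step cycle)) (length al * (6 * (n + 1) + (12 * h + 22) * (Suc k * Suc W + 1) + N * (4 * length (?\<sigma>1 2) + 2 * (Suc k * Suc W + 1))))
    ?\<sigma>1 (?\<sigma>1(7 := bin (fst t) @ [6], 3 := fl W (sm (snd s) 1 (map (aeff al) [0..<Suc k]))))"
  proof (rule items_complete[OF wf(1) _ vb _ _ al(1,2) mh ls(1) _ r(1-7)])
    show "\<bar>snd s ! i\<bar> + int (length al) * ((2 ^ h + 1) * ((int N + 1) * 2 ^ n)) < 2 ^ W" if "i \<le> k" for i
      by (rule magnitude_bound[OF n1 N lal W_def sb(1)[OF that]])
  qed (use eb in simp_all)
  moreover have "sm (snd s) 1 (map (aeff al) [0..<Suc k]) = snd t"
    by (rule nth_equalityI) (use ls al(3) \<pi>(3) in \<open>simp_all add: less_Suc_eq_le del: upt_Suc\<close>)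
  ultimately have loop: "exec (Star (Alt step cycle)) (length al * (6 * (n + 1) + (12 * h + 22) * (Suc k * Suc W + 1) + N * (4 * length (?\<sigma>1 2) + 2 * (Suc k * Suc W + 1)))) ?\<sigma>1 ?\<sigma>2"
    by (simp only:)
  have end1: "exec (same B 6 7 10) (2 * length (?\<sigma>2 7)) ?\<sigma>2 (?\<sigma>2(7 := [], 10 := []))"
    by (rule same_complete) (use term_bin r in simp_all)
  let ?\<sigma>3 = "?\<sigma>2(7 := [], 10 := [])"
  have end2: "exec (same V 5 3 9) (2 * length (?\<sigma>3 3)) ?\<sigma>3 (?\<sigma>3(3 := [], 9 := []))"
    by (rule same_complete) (use r in \<open>simp_all add: set_V[simplified] isvec_fl\<close>)
  note exec_Seq[OF load exec_Seq[OF loop exec_Seq[OF end1 end2]]]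
  then have ex: "exec prog ((length (bin k) * (3 * k + 4) + (length T + 2) * (Suc k * (2 * W + 5) + 8 + 4 * n) + 6) +
    (length al * (6 * (n + 1) + (12 * h + 22) * (Suc k * Suc W + 1) + N * (4 * length (?\<sigma>1 2) + 2 * (Suc k * Suc W + 1))) +
     (2 * length (?\<sigma>2 7) + 2 * length (?\<sigma>3 3)))) (init_store w) (?\<sigma>3(3 := [], 9 := []))"
    unfolding prog_def .
  \<comment> \<open>The leading coefficient of \<open>W\<close> is that of \<open>h\<close>, namely
    3 * 3641 * 3641 = 39770643; the factor \<open>10 ^ 8\<close> also covers the lower terms and all
    other parameters.\<close>
  define z where "z = 10 ^ 8 * n ^ 8"
  have pw: "n ^ a \<le> n ^ b" if "a \<le> b" for a b using n1 that by (rule power_increasing[rotated])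
  have n8: "1 \<le> n ^ 8" "n \<le> n ^ 8" "n ^ 4 \<le> n ^ 8" using pw[of 0 8] pw[of 1 8] pw[of 4 8] by simp_all
  have h: "h = 39770643 * n ^ 8" by (simp add: h_def S_def power_mult_distrib power_mult[symmetric])
  have z1: "1 \<le> z" "Suc k \<le> z" "length T \<le> z" "length (bin k) \<le> z" "Suc W \<le> z" "h \<le> z" "n + 1 \<le> z" "N \<le> z" "length al \<le> z"
    using n8 eb(1,2,3) N lal n1 unfolding z_def W_def S_def h by simp_all
  have lq: "length (?\<sigma>1 2) \<le> 7 * z ^ 3"
  proof -
    have zz: "z \<le> z\<^sup>2" "1 \<le> z ^ 3" "z * z\<^sup>2 = z ^ 3" using z1(1) power_increasing[of 1 2 z] power_increasing[of 0 3 z]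
      by (simp_all add: power2_eq_square power3_eq_cube)
    have "Suc k * Suc W \<le> z * z" using z1 by (intro mult_mono) simp_all
    then have "2 * n + 3 + Suc k * Suc W \<le> 6 * z\<^sup>2" using z1 zz unfolding power2_eq_square[symmetric] by linarith
    then have "length T * (2 * n + 3 + Suc k * Suc W) \<le> z * (6 * z\<^sup>2)" using z1 by (intro mult_mono) simp_all
    moreover have "length (?\<sigma>1 2) \<le> length T * (2 * n + 3 + Suc k * Suc W) + 1" unfolding r(1) by (rule length_tqueue[OF wf(1)]) (use eb in simp)
    ultimately show ?thesis using zz by simp
  qed
  have "2 * length (?\<sigma>2 7) + 2 * length (?\<sigma>3 3) \<le> 2 * (n + 1) + 2 * (Suc k * Suc W + 1)" using eb(5) ls(2) by (simp add: length_fl)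
  with cost_bound[OF z1 lq] exec_mono[OF ex] show ?thesis unfolding z_def n_def by (meson add_left_mono le_trans)
qed

section \<open>Register bounds of the program and the final theorem\<close>

lemma regs_ok_simps [simp]: "regs_ok K (Some (Pop r a)) \<longleftrightarrow> r \<le> K" "regs_ok K (Some (Push r a)) \<longleftrightarrow> 1 \<le> r \<and> r \<le> K"
  by (simp_all add: regs_ok_def)

lemma regs_adder: "(\<And>l a. a \<in> set (f l) \<Longrightarrow> regs_ok K (Some a)) \<Longrightarrow> regs_okp K (adder P f)"
  by (auto simp: adder_def component_def digits_def ones_def A_def)

lemma regs_Loop: "regs_okp K (Loop ws) \<longleftrightarrow> (\<forall>w \<in> set ws. \<forall>a \<in> set w. regs_ok K (Some a))"
  by (auto simp: Loop_def)

lemma regs_cps: "(\<And>s a. a \<in> set (F s) \<Longrightarrow> regs_ok K (Some a)) \<Longrightarrow> regs_okp K (cps S e F)"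
  by (auto simp: cps_def regs_Loop)

lemma regs_load: "regs_okp 10 load"
  by (simp add: load_def load_k_def dstep_def dbl_u_def load_trans_def load_conf_def load_vec_def load_int_def
      load_nat_def load_neg_def copy_bin_def Let_def regs_Loop)

lemma regs_passes: "1 \<le> r \<Longrightarrow> r \<le> 10 \<Longrightarrow> regs_okp 10 (clear S e r)" "1 \<le> r \<Longrightarrow> r \<le> 10 \<Longrightarrow> regs_okp 10 (guess S e r)"
  "1 \<le> r \<Longrightarrow> r \<le> 10 \<Longrightarrow> regs_okp 10 (sign r s)" "1 \<le> r \<Longrightarrow> r \<le> 10 \<Longrightarrow> regs_okp 10 (dbl r)"
  "1 \<le> r \<Longrightarrow> r \<le> 10 \<Longrightarrow> 1 \<le> r' \<Longrightarrow> r' \<le> 10 \<Longrightarrow> regs_okp 10 (copy S e r r')"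
  "1 \<le> r \<Longrightarrow> r \<le> 10 \<Longrightarrow> 1 \<le> r' \<Longrightarrow> r' \<le> 10 \<Longrightarrow> regs_okp 10 (same S e r r')"
  "1 \<le> r \<Longrightarrow> r \<le> 10 \<Longrightarrow> 1 \<le> r' \<Longrightarrow> r' \<le> 10 \<Longrightarrow> regs_okp 10 (same_keep S e r r')"
  "1 \<le> r \<Longrightarrow> r \<le> 10 \<Longrightarrow> 1 \<le> r' \<Longrightarrow> r' \<le> 10 \<Longrightarrow> regs_okp 10 (add r r')"
  unfolding clear_def guess_def sign_def dbl_def copy_def same_def same_keep_def add_def regs_okp.simps
  by (auto intro!: regs_cps regs_adder)

lemma regs_prog: "regs_okp 10 prog"
proof -
  have "regs_okp 10 skip" "regs_okp 10 read_src" "regs_okp 10 (chk 5 4 3)"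
    unfolding skip_def read_src_def chk_def by (auto intro!: regs_cps regs_adder)
  then show ?thesis
    by (simp add: prog_def step_def step_pass_def cycle_def jump_def read_tgt_def regs_load regs_passes regs_Loop)
qed

theorem theorem1:
  shows "in_NP REACH_1N"
proof (rule program_in_NP[where a = "200 * (10 ^ 8) ^ 5" and d = 40])
  show "regs_okp 10 prog" by (rule regs_prog)
  show "w \<in> REACH_1N" if "w \<in> lists input_alphabet" "exec prog n (init_store w) \<sigma>" for w n \<sigma>
    using prog_sound[OF that(2)] that(1) by (auto simp: input_alphabet_def)
  show "\<exists>\<sigma>'. exec prog (200 * (10 ^ 8) ^ 5 * (length w + 1) ^ 40) (init_store w) \<sigma>'" if "w \<in> REACH_1N" for w
  proof -
    \<comment> \<open>The exponent 40 is the degree 8 of the parameter bound times the degree 5 of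
      the cost.\<close>
    have "200 * (10 ^ 8 * length w ^ 8) ^ 5 = 200 * (10 ^ 8) ^ 5 * length w ^ 40"
      by (simp only: power_mult_distrib power_mult[symmetric] mult.assoc) simp
    also have "\<dots> \<le> 200 * (10 ^ 8) ^ 5 * (length w + 1) ^ 40" by (intro mult_left_mono power_mono) simp_all
    finally show ?thesis using prog_complete[OF that] exec_mono by blast
  qed
qed

end
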